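(* Let $\nu=\mu>0$ (Prandtl number $P=\nu/\mu=1$), $g>0$, $\Omega\in\mathbb{R}$, $\mathcal{N}\ge 0$, and consider the Cauchy problem for the viscous primitive equations $$\begin{cases}\partial_t u-\nu\Delta u+\Omega e_3\times u+(u\cdot\nabla)u+\nabla \pi=g\theta e_3,\\ \partial_t\theta-\mu\Delta\theta+(u\cdot\nabla)\theta=-\mathcal{N}^2u_3,\\ \mathrm{div}\,u=0,\\ u|_{t=0}=u_0,\quad \theta|_{t=0}=\theta_0\end{cases}\qquad\text{in }\mathbb{R}^3\times(0,\infty)$$ for $u=(u_1,u_2,u_3)$, the pressure $\pi$ and the scalar $\theta$, where $e_3=(0,0,1)$. Let $2<r\le\infty$. Then this problem is ill-posed in $[\dot{FB}^{-1}_{1,r}(\mathbb{R}^3)]^4$ in the sense that the solution map $(u_0,\theta_0)\mapsto(u,\theta)$ from $[\dot{FB}^{-1}_{1,r}(\mathbb{R}^3)]^4$ to $\big[C([0,T],\dot{FB}^{-1}_{1,r}(\mathbb{R}^3))\big]^4$, if it exists, is not continuous at $(u_0,\theta_0)=(0,0)$.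
   Context: Littlewood–Paley decomposition. Fix a radial $\psi\in\mathscr{S}(\mathbb{R}^3)$ with $\mathrm{supp}\,\hat\psi\subset\{\xi:\frac34\le|\xi|\le\frac83\}$ and $\sum_{j\in\mathbb{Z}}\hat\psi(2^{-j}\xi)=1$ for all $\xi\ne0$. Put $\psi_j(x)=2^{3j}\psi(2^jx)$ and $\Delta_jf=\psi_j*f$, $j\in\mathbb{Z}$. Let $\mathscr{S}'_h(\mathbb{R}^3)=\mathscr{S}'(\mathbb{R}^3)/\mathcal{P}[\mathbb{R}^3]$ (tempered distributions modulo polynomials). Fourier–Besov space. For $s\in\mathbb{R}$, $1\le p,r\le\infty$, $\dot{FB}^s_{p,r}(\mathbb{R}^3)$ is the set of $u\in\mathscr{S}'_h(\mathbb{R}^3)$ with $\|u\|_{\dot{FB}^s_{p,r}}:=\big\|\{2^{js}\|\widehat{\Delta_ju}\|_{L^p}\}_{j\in\mathbb{Z}}\big\|_{\ell^r(\mathbb{Z})}<\infty$. Norms of vector-valued functions are taken componentwise. Solution map. Here $T>0$, and the solution map assigns to initial data $(u_0,\theta_0)$ (with $\mathrm{div}\,u_0=0$, as forced by the constraint $\mathrm{div}\,u=0$) the solution $(u,\theta)$ on $[0,T]$ of the Cauchy problem with these data. Solutions are understood in the mild sense, i.e. as solutions of the Duhamel integral equation: with $w=(u_1,u_2,u_3,\theta)$, $w_0=(u_0,\theta_0)$, $$w(t)=S(t)w_0-\int_0^tS(t-\tau)\widetilde{\mathbb P}\,\mathcal{D}(w)(\tau)\,d\tau,\qquad \mathcal{D}(w)_k=\sum_{j=1}^3\partial_j(w_jw_k),\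 k=1,\dots,4,$$ where $\widetilde{\mathbb P}$ is the Fourier multiplier with $4\times4$ matrix symbol $P(\xi)$, $P_{jk}(\xi)=\delta_{jk}-\xi_j\xi_k/|\xi|^2$ for $1\le j,k\le3$ and $P_{jk}=\delta_{jk}$ otherwise, and $S(t)$ is the Fourier multiplier with symbol $e^{-\nu|\xi|^2t}\exp(-tP(\xi)\mathcal{B}'P(\xi))$, with $\mathcal{B}'(w_1,w_2,w_3,w_4)^{T}=(-\Omega w_2,\ \Omega w_1,\ -g w_4,\ \mathcal{N}^2w_3)^{T}$. *)

theory Defs
  imports "HOL-Analysis.Analysis" "HOL-Probability.Essential_Supremum"
begin

section \<open>Schwartz functions and tempered distributions on \<open>\<real>\<^sup>3\<close>\<close>

definition partial :: "3 \<Rightarrow> (real^3 \<Rightarrow> complex) \<Rightarrow> real^3 \<Rightarrow> complex" where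
  "partial i f x = frechet_derivative f (at x) (axis i 1)"

abbreviation partials :: "3 list \<Rightarrow> (real^3 \<Rightarrow> complex) \<Rightarrow> real^3 \<Rightarrow> complex" where
  "partials is f \<equiv> foldr partial is f"

definition smooth :: "(real^3 \<Rightarrow> complex) \<Rightarrow> bool" where
  "smooth f \<longleftrightarrow> (\<forall>is x. partials is f differentiable (at x))"

definition schwartz :: "(real^3 \<Rightarrow> complex) \<Rightarrow> bool" where
  "schwartz f \<longleftrightarrow> smooth f \<and>
     (\<forall>is n. \<exists>C. \<forall>x. (1 + norm x) ^ n * cmod (partials is f x) \<le> C)"

definition schwartz_norm :: "nat \<Rightarrow> (real^3 \<Rightarrow> complex) \<Rightarrow> real" where
  "schwartz_norm N f =
     (SUP (is, x) \<in> {is. length is \<le> N} \<times> UNIV. (1 + norm x) ^ N * cmod (partials is f x))"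

text \<open>Distributions are total functionals; only their values on Schwartz functions matter.\<close>

type_synonym functional = "(real^3 \<Rightarrow> complex) \<Rightarrow> complex"

definition tempered :: "functional \<Rightarrow> bool" where
  "tempered u \<longleftrightarrow>
     (\<forall>f g. schwartz f \<longrightarrow> schwartz g \<longrightarrow> u (\<lambda>x. f x + g x) = u f + u g) \<and>
     (\<forall>c f. schwartz f \<longrightarrow> u (\<lambda>x. c * f x) = c * u f) \<and>
     (\<exists>C N. \<forall>f. schwartz f \<longrightarrow> cmod (u f) \<le> C * schwartz_norm N f)"

definition polynomial_dist :: "functional \<Rightarrow> bool" where
  "polynomial_dist u \<longleftrightarrow> (\<exists>(A :: (3 \<Rightarrow> nat) set) (c :: (3 \<Rightarrow> nat) \<Rightarrow> complex). finite A \<and>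
     (\<forall>f. schwartz f \<longrightarrow>
        u f = (\<Sum>\<alpha>\<in>A. c \<alpha> * (LINT x|lborel. of_real (\<Prod>i\<in>UNIV. (x $ i) ^ \<alpha> i) * f x))))"

definition tempered_rel :: "functional \<Rightarrow> functional \<Rightarrow> bool" where
  "tempered_rel u v \<longleftrightarrow> tempered u \<and> tempered v \<and> polynomial_dist (\<lambda>f. u f - v f)"

lemma schwartz_norm_bdd:
  assumes "schwartz f"
  shows "bdd_above ((\<lambda>(is, x). (1 + norm x) ^ N * cmod (partials is f x)) `
           ({is. length is \<le> M} \<times> UNIV))"
proof -
  have fin: "finite {is :: 3 list. length is \<le> M}"
    using finite_lists_length_le[of "UNIV :: 3 set" M] by simp
  have "\<forall>is. \<exists>C. \<forall>x. (1 + norm x) ^ N * cmod (partials is f x) \<le> C"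
    using assms unfolding schwartz_def by blast
  then obtain C where C: "\<And>is x. (1 + norm x) ^ N * cmod (partials is f x) \<le> C is"
    by metis
  show ?thesis
  proof (rule bdd_aboveI)
    fix y
    assume "y \<in> (\<lambda>(is, x). (1 + norm x) ^ N * cmod (partials is f x)) `
      ({is. length is \<le> M} \<times> UNIV)"
    then obtain "is" x where y: "y = (1 + norm x) ^ N * cmod (partials is f x)"
      and l: "length is \<le> M"
      by auto
    have "C is \<le> Max (C ` {is. length is \<le> M})"
      using fin l by (intro Max_ge) auto
    then show "y \<le> Max (C ` {is. length is \<le> M})"
      using C[of x "is"] y by linarith
  qed
qed

lemma schwartz_norm_mono:
  assumes "schwartz f" "N \<le> M"
  shows "schwartz_norm N f \<le> schwartz_norm M f"
  unfolding schwartz_norm_def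
proof (rule cSUP_mono)
  show "{is :: 3 list. length is \<le> N} \<times> (UNIV :: (real^3) set) \<noteq> {}"
    by (auto intro: exI[of _ "[]"])
  show "bdd_above ((\<lambda>(is, x). (1 + norm x) ^ M * cmod (partials is f x)) `
          ({is. length is \<le> M} \<times> UNIV))"
    by (rule schwartz_norm_bdd[OF assms(1)])
next
  fix p assume p: "p \<in> {is :: 3 list. length is \<le> N} \<times> (UNIV :: (real^3) set)"
  obtain "is" x where ix: "p = (is, x)" by (cases p)
  have "(1 + norm x) ^ N \<le> (1 + norm x) ^ M"
    using assms(2) by (intro power_increasing) auto
  then have "(1 + norm x) ^ N * cmod (partials is f x) \<le> (1 + norm x) ^ M * cmod (partials is f x)"
    by (intro mult_right_mono) auto
  then show "\<exists>q\<in>{is. length is \<le> M} \<times> UNIV.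
       (case p of (is, x) \<Rightarrow> (1 + norm x) ^ N * cmod (partials is f x))
       \<le> (case q of (is, x) \<Rightarrow> (1 + norm x) ^ M * cmod (partials is f x))"
    using p ix assms(2) by (intro bexI[of _ p]) auto
qed

lemma schwartz_norm_nonneg:
  assumes "schwartz f"
  shows "0 \<le> schwartz_norm N f"
proof -
  have "(\<lambda>(is, x). (1 + norm x) ^ N * cmod (partials is f x)) ([], 0) \<le> schwartz_norm N f"
    unfolding schwartz_norm_def
    by (rule cSUP_upper[OF _ schwartz_norm_bdd[OF assms]]) auto
  then have "cmod (f 0) \<le> schwartz_norm N f"
    by simp
  then show ?thesis
    using norm_ge_zero[of "f 0"] by linarith
qed

lemma tempered_zero: "tempered (\<lambda>f. 0)"
  unfolding tempered_def by (auto intro!: exI[of _ 0])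

lemma tempered_uminus: "tempered u \<Longrightarrow> tempered (\<lambda>f. - u f)"
  unfolding tempered_def by auto

lemma tempered_add:
  assumes u: "tempered u" and v: "tempered v"
  shows "tempered (\<lambda>f. u f + v f)"
proof -
  obtain C N where C: "\<And>f. schwartz f \<Longrightarrow> cmod (u f) \<le> C * schwartz_norm N f"
    using u unfolding tempered_def by blast
  obtain D M where D: "\<And>f. schwartz f \<Longrightarrow> cmod (v f) \<le> D * schwartz_norm M f"
    using v unfolding tempered_def by blast
  have "cmod (u f + v f) \<le> (\<bar>C\<bar> + \<bar>D\<bar>) * schwartz_norm (max N M) f" if f: "schwartz f" for f
  proof -
    let ?s = "schwartz_norm (max N M) f"
    have "C * schwartz_norm N f \<le> \<bar>C\<bar> * ?s"
      using schwartz_norm_mono[OF f, of N "max N M"] schwartz_norm_nonneg[OF f, of N]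
      by (intro mult_mono) auto
    moreover have "D * schwartz_norm M f \<le> \<bar>D\<bar> * ?s"
      using schwartz_norm_mono[OF f, of M "max N M"] schwartz_norm_nonneg[OF f, of M]
      by (intro mult_mono) auto
    ultimately have "cmod (u f) + cmod (v f) \<le> (\<bar>C\<bar> + \<bar>D\<bar>) * ?s"
      using C[OF f] D[OF f] by (simp add: distrib_right)
    then show ?thesis
      using norm_triangle_ineq[of "u f" "v f"] by linarith
  qed
  then show ?thesis
    using u v unfolding tempered_def
    by (intro conjI allI impI exI[of _ "\<bar>C\<bar> + \<bar>D\<bar>"] exI[of _ "max N M"])
       (auto simp: algebra_simps)
qed

lemma polynomial_dist_zero: "polynomial_dist (\<lambda>f. 0)"
  unfolding polynomial_dist_def by (auto intro!: exI[of _ "{}"])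

lemma polynomial_dist_uminus:
  assumes "polynomial_dist u"
  shows "polynomial_dist (\<lambda>f. - u f)"
proof -
  obtain A c where A: "finite A"
    "\<forall>f. schwartz f \<longrightarrow>
        u f = (\<Sum>\<alpha>\<in>A. c \<alpha> * (LINT x|lborel. of_real (\<Prod>i\<in>UNIV. (x $ i) ^ \<alpha> i) * f x))"
    using assms unfolding polynomial_dist_def by blast
  show ?thesis
    unfolding polynomial_dist_def
    by (rule exI[of _ A], rule exI[of _ "\<lambda>\<alpha>. - c \<alpha>"]) (use A in \<open>auto simp: sum_negf\<close>)
qed

lemma polynomial_dist_add:
  assumes "polynomial_dist u" "polynomial_dist v"
  shows "polynomial_dist (\<lambda>f. u f + v f)"
proof -
  obtain A c where A: "finite A"
    "\<And>f. schwartz f \<Longrightarrow>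
        u f = (\<Sum>\<alpha>\<in>A. c \<alpha> * (LINT x|lborel. of_real (\<Prod>i\<in>UNIV. (x $ i) ^ \<alpha> i) * f x))"
    using assms(1) unfolding polynomial_dist_def by blast
  obtain B d where B: "finite B"
    "\<And>f. schwartz f \<Longrightarrow>
        v f = (\<Sum>\<alpha>\<in>B. d \<alpha> * (LINT x|lborel. of_real (\<Prod>i\<in>UNIV. (x $ i) ^ \<alpha> i) * f x))"
    using assms(2) unfolding polynomial_dist_def by blast
  define e where "e = (\<lambda>\<alpha>. (if \<alpha> \<in> A then c \<alpha> else 0) + (if \<alpha> \<in> B then d \<alpha> else 0))"
  have "u f + v f =
     (\<Sum>\<alpha>\<in>A \<union> B. e \<alpha> * (LINT x|lborel. of_real (\<Prod>i\<in>UNIV. (x $ i) ^ \<alpha> i) * f x))"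
    if f: "schwartz f" for f
  proof -
    let ?I = "\<lambda>\<alpha>::3 \<Rightarrow> nat. LINT x|lborel. of_real (\<Prod>i\<in>UNIV. (x $ i) ^ \<alpha> i) * f x"
    have "(\<Sum>\<alpha>\<in>A. c \<alpha> * ?I \<alpha>) = (\<Sum>\<alpha>\<in>A \<union> B. (if \<alpha> \<in> A then c \<alpha> else 0) * ?I \<alpha>)"
      using A(1) B(1) by (intro sum.mono_neutral_cong_left) auto
    moreover have "(\<Sum>\<alpha>\<in>B. d \<alpha> * ?I \<alpha>) = (\<Sum>\<alpha>\<in>A \<union> B. (if \<alpha> \<in> B then d \<alpha> else 0) * ?I \<alpha>)"
      using A(1) B(1) by (intro sum.mono_neutral_cong_left) auto
    ultimately show ?thesis
      using A(2)[OF f] B(2)[OF f] unfolding e_def by (simp add: sum.distrib distrib_right)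
  qed
  then show ?thesis
    unfolding polynomial_dist_def using A(1) B(1) by blast
qed

text \<open>The space \<open>S'\<^sub>h = S' / P\<close>.\<close>

quotient_type tempered_h = functional / partial: tempered_rel
proof (rule part_equivpI)
  show "\<exists>u. tempered_rel u u"
    by (rule exI[of _ "\<lambda>f. 0"])
       (simp add: tempered_rel_def tempered_zero polynomial_dist_zero)
  show "symp tempered_rel"
  proof (rule sympI)
    fix u v assume "tempered_rel u v"
    then show "tempered_rel v u"
      using polynomial_dist_uminus[of "\<lambda>f. u f - v f"] by (auto simp: tempered_rel_def)
  qed
  show "transp tempered_rel"
  proof (rule transpI)
    fix u v w assume "tempered_rel u v" "tempered_rel v w"
    then show "tempered_rel u w"
      using polynomial_dist_add[of "\<lambda>f. u f - v f" "\<lambda>f. v f - w f"] by (auto simp: tempered_rel_def)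
  qed
qed

instantiation tempered_h :: ab_group_add
begin

lift_definition zero_tempered_h :: tempered_h is "\<lambda>f. 0"
  by (simp add: tempered_rel_def tempered_zero polynomial_dist_zero)

lift_definition plus_tempered_h :: "tempered_h \<Rightarrow> tempered_h \<Rightarrow> tempered_h"
  is "\<lambda>u v f. u f + v f"
proof -
  fix u u' v v' :: functional
  assume "tempered_rel u u'" "tempered_rel v v'"
  then show "tempered_rel (\<lambda>f. u f + v f) (\<lambda>f. u' f + v' f)"
    using polynomial_dist_add[of "\<lambda>f. u f - u' f" "\<lambda>f. v f - v' f"]
    by (auto simp: tempered_rel_def tempered_add algebra_simps)
qed

lift_definition uminus_tempered_h :: "tempered_h \<Rightarrow> tempered_h" is "\<lambda>u f. - u f"
proof -
  fix u v :: functional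
  assume "tempered_rel u v"
  then show "tempered_rel (\<lambda>f. - u f) (\<lambda>f. - v f)"
    using polynomial_dist_uminus[of "\<lambda>f. u f - v f"]
    by (auto simp: tempered_rel_def tempered_uminus)
qed

definition minus_tempered_h :: "tempered_h \<Rightarrow> tempered_h \<Rightarrow> tempered_h" where
  "minus_tempered_h U V = U + (- V)"

instance
proof
  fix a b c :: tempered_h
  show "a + b + c = a + (b + c)"
    by transfer (simp add: tempered_rel_def tempered_add polynomial_dist_zero add.assoc)
  show "a + b = b + a"
    by transfer (simp add: tempered_rel_def tempered_add polynomial_dist_zero add.commute)
  show "0 + a = a"
    by transfer (simp add: tempered_rel_def)
  show "- a + a = 0"
    by transfer (simp add: tempered_rel_def tempered_zero polynomial_dist_zero)
  show "a - b = a + - b"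
    by (rule minus_tempered_h_def)
qed

end

section \<open>Fourier transform and Littlewood--Paley decomposition\<close>

definition fourier :: "(real^3 \<Rightarrow> complex) \<Rightarrow> real^3 \<Rightarrow> complex" where
  "fourier f \<xi> = (LINT x|lborel. cis (- (x \<bullet> \<xi>)) * f x)"

definition littlewood_paley :: "(real^3 \<Rightarrow> complex) \<Rightarrow> bool" where
  "littlewood_paley \<psi> \<longleftrightarrow> schwartz \<psi> \<and>
     (\<forall>x y. norm x = norm y \<longrightarrow> \<psi> x = \<psi> y) \<and>
     closure {\<xi>. fourier \<psi> \<xi> \<noteq> 0} \<subseteq> {\<xi>. 3/4 \<le> norm \<xi> \<and> norm \<xi> \<le> 8/3} \<and>
     (\<forall>\<xi>. \<xi> \<noteq> 0 \<longrightarrow> ((\<lambda>j::int. fourier \<psi> ((2 powi (- j)) *\<^sub>R \<xi>)) has_sum 1) UNIV)"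

definition dilate :: "(real^3 \<Rightarrow> complex) \<Rightarrow> int \<Rightarrow> real^3 \<Rightarrow> complex" where
  "dilate \<psi> j x = of_real (2 powi (3 * j)) * \<psi> ((2 powi j) *\<^sub>R x)"

text \<open>
  The function \<open>\<Delta>\<^sub>j U = \<psi>\<^sub>j * U\<close>. It does not depend on the representative of \<open>U\<close>, because all
  moments of \<open>\<psi>\<^sub>j\<close> vanish.
\<close>

definition lp_block :: "(real^3 \<Rightarrow> complex) \<Rightarrow> int \<Rightarrow> tempered_h \<Rightarrow> real^3 \<Rightarrow> complex" where
  "lp_block \<psi> j U x = rep_tempered_h U (\<lambda>y. dilate \<psi> j (x - y))"

text \<open>The Fourier transform of \<open>\<Delta>\<^sub>j U\<close> as a tempered distribution.\<close>

definition lp_block_hat :: "(real^3 \<Rightarrow> complex) \<Rightarrow> int \<Rightarrow> tempered_h \<Rightarrow> functional" where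
  "lp_block_hat \<psi> j U f = (LINT x|lborel. lp_block \<psi> j U x * fourier f x)"

section \<open>Fourier--Besov spaces\<close>

definition ennreal_pow :: "ennreal \<Rightarrow> real \<Rightarrow> ennreal" where
  "ennreal_pow x a = (if x = \<infinity> then \<infinity> else ennreal (enn2real x powr a))"

definition Lp_norm :: "'a measure \<Rightarrow> ennreal \<Rightarrow> ('a \<Rightarrow> ennreal) \<Rightarrow> ennreal" where
  "Lp_norm M p f = (if p = \<infinity> then esssup M f
     else ennreal_pow (\<integral>\<^sup>+x. ennreal_pow (f x) (enn2real p) \<partial>M) (1 / enn2real p))"

text \<open>
  The \<open>L\<^sup>p\<close> norm of a distribution: that of the (almost everywhere unique) function representing
  it, and \<open>\<infinity>\<close> if there is none.
\<close>

definition dist_Lp_norm :: "ennreal \<Rightarrow> functional \<Rightarrow> ennreal" where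
  "dist_Lp_norm p v =
     (INF h \<in> {h \<in> borel_measurable lborel. \<forall>f. schwartz f \<longrightarrow>
                 integrable lborel (\<lambda>\<xi>. h \<xi> * f \<xi>) \<and> v f = (LINT \<xi>|lborel. h \<xi> * f \<xi>)}.
        Lp_norm lborel p (\<lambda>\<xi>. ennreal (cmod (h \<xi>))))"

definition fb_norm ::
    "(real^3 \<Rightarrow> complex) \<Rightarrow> real \<Rightarrow> ennreal \<Rightarrow> ennreal \<Rightarrow> tempered_h \<Rightarrow> ennreal" where
  "fb_norm \<psi> s p r U =
     Lp_norm (count_space (UNIV :: int set)) r
       (\<lambda>j. ennreal (2 powr (of_int j * s)) * dist_Lp_norm p (lp_block_hat \<psi> j U))"

definition fb_space ::
    "(real^3 \<Rightarrow> complex) \<Rightarrow> real \<Rightarrow> ennreal \<Rightarrow> ennreal \<Rightarrow> tempered_h set" where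
  "fb_space \<psi> s p r = {U. fb_norm \<psi> s p r U < \<infinity>}"

definition fb_vec_norm ::
    "(real^3 \<Rightarrow> complex) \<Rightarrow> real \<Rightarrow> ennreal \<Rightarrow> ennreal \<Rightarrow> tempered_h^4 \<Rightarrow> ennreal" where
  "fb_vec_norm \<psi> s p r W = (\<Sum>k\<in>UNIV. fb_norm \<psi> s p r (W $ k))"

section \<open>Mild solutions\<close>

text \<open>
  An element \<open>U\<close> of \<open>S'\<^sub>h\<close> is determined by the restriction of its Fourier transform to
  \<open>\<real>\<^sup>3 - {0}\<close> (a tempered distribution is a polynomial iff its Fourier transform is supported at
  the origin). Identities in \<open>S'\<^sub>h\<close> are read by pairing the Fourier transform with test functions
  from \<open>C\<^sub>c\<^sup>\<infinity>(\<real>\<^sup>3 - {0})\<close>; a Fourier multiplier whose symbol is smooth off the origin acts on them by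
  multiplication.
\<close>

definition test_off_0 :: "(real^3 \<Rightarrow> complex) \<Rightarrow> bool" where
  "test_off_0 \<phi> \<longleftrightarrow> smooth \<phi> \<and>
     (\<exists>a b. 0 < a \<and> (\<forall>\<xi>. \<phi> \<xi> \<noteq> 0 \<longrightarrow> a \<le> norm \<xi> \<and> norm \<xi> \<le> b))"

definition hat_pair :: "tempered_h \<Rightarrow> (real^3 \<Rightarrow> complex) \<Rightarrow> complex" where
  "hat_pair U \<phi> = rep_tempered_h U (fourier \<phi>)"

text \<open>
  The product in \<open>S'\<^sub>h\<close>: \<open>Q = \<Sum>\<^sub>j\<^sub>,\<^sub>l \<Delta>\<^sub>j U \<Delta>\<^sub>l V\<close>, the double series being summed over the squares
  \<open>\<bar>j\<bar>, \<bar>l\<bar> \<le> n\<close>. The partial sums are products of smooth functions of polynomial growth.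
\<close>

definition lp_sum :: "(real^3 \<Rightarrow> complex) \<Rightarrow> nat \<Rightarrow> tempered_h \<Rightarrow> real^3 \<Rightarrow> complex" where
  "lp_sum \<psi> n U x = (\<Sum>j\<in>{- int n..int n}. lp_block \<psi> j U x)"

definition is_product ::
    "(real^3 \<Rightarrow> complex) \<Rightarrow> tempered_h \<Rightarrow> tempered_h \<Rightarrow> tempered_h \<Rightarrow> bool" where
  "is_product \<psi> U V Q \<longleftrightarrow> (\<forall>\<phi>. test_off_0 \<phi> \<longrightarrow>
     (\<lambda>n. LINT x|lborel. lp_sum \<psi> n U x * lp_sum \<psi> n V x * fourier \<phi> x)
       \<longlonglongrightarrow> hat_pair Q \<phi>)"

text \<open>
  The frequency padded by a fourth component \<open>0\<close>, so that the indices of \<open>\<xi>\<close> and of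
  \<open>w = (u\<^sub>1, u\<^sub>2, u\<^sub>3, \<theta>)\<close> have the same type.
\<close>

definition freq4 :: "real^3 \<Rightarrow> real^4" where
  "freq4 \<xi> = vector [\<xi> $ 1, \<xi> $ 2, \<xi> $ 3, 0]"

definition leray :: "real^3 \<Rightarrow> real^4^4" where
  "leray \<xi> = (\<chi> j k. (if j = k then 1 else 0) - freq4 \<xi> $ j * freq4 \<xi> $ k / (norm \<xi>)\<^sup>2)"

definition coupling :: "real \<Rightarrow> real \<Rightarrow> real \<Rightarrow> real^4^4" where
  "coupling g \<Omega> N = vector
     [vector [0, - \<Omega>, 0, 0],
      vector [\<Omega>, 0, 0, 0],
      vector [0, 0, 0, - g],
      vector [0, 0, N\<^sup>2, 0]]"

definition matrix_exp :: "real^4^4 \<Rightarrow> real^4^4" where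
  "matrix_exp A = (\<Sum>n. (1 / fact n) *\<^sub>R (((**) A) ^^ n) (mat 1))"

text \<open>
  The viscosity and the thermal diffusivity coincide (\<open>\<nu> = \<mu>\<close>), so one scalar heat factor serves
  all four components.
\<close>

definition semigroup_symbol ::
    "real \<Rightarrow> real \<Rightarrow> real \<Rightarrow> real \<Rightarrow> real \<Rightarrow> real^3 \<Rightarrow> real^4^4" where
  "semigroup_symbol \<nu> g \<Omega> N t \<xi> =
     exp (- \<nu> * (norm \<xi>)\<^sup>2 * t) *\<^sub>R
       matrix_exp ((- t) *\<^sub>R (leray \<xi> ** coupling g \<Omega> N ** leray \<xi>))"

definition divergence_free :: "tempered_h^4 \<Rightarrow> bool" where
  "divergence_free W \<longleftrightarrow> (\<forall>\<phi>. test_off_0 \<phi> \<longrightarrow>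
     (\<Sum>j\<in>{1, 2, 3}. hat_pair (W $ j) (\<lambda>\<xi>. \<i> * of_real (freq4 \<xi> $ j) * \<phi> \<xi>)) = 0)"

definition data_space :: "(real^3 \<Rightarrow> complex) \<Rightarrow> ennreal \<Rightarrow> (tempered_h^4) set" where
  "data_space \<psi> r = {W. (\<forall>k. W $ k \<in> fb_space \<psi> (-1) 1 r) \<and> divergence_free W}"

definition cont_path ::
    "(real^3 \<Rightarrow> complex) \<Rightarrow> ennreal \<Rightarrow> real \<Rightarrow> (real \<Rightarrow> tempered_h^4) \<Rightarrow> bool" where
  "cont_path \<psi> r T W \<longleftrightarrow>
     (\<forall>t\<in>{0..T}. (\<forall>k. W t $ k \<in> fb_space \<psi> (-1) 1 r) \<and>
        ((\<lambda>s. fb_vec_norm \<psi> (-1) 1 r (W s - W t)) \<longlongrightarrow> 0) (at t within {0..T}))"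

text \<open>
  The Duhamel equation on \<open>[0, T]\<close>; \<open>Q \<tau> $ j $ l\<close> is the product \<open>w\<^sub>j(\<tau>) w\<^sub>l(\<tau>)\<close>, and the time
  integral is a weak (Pettis) integral.
\<close>

definition mild_solution ::
    "(real^3 \<Rightarrow> complex) \<Rightarrow> real \<Rightarrow> real \<Rightarrow> real \<Rightarrow> real \<Rightarrow> real \<Rightarrow>
     tempered_h^4 \<Rightarrow> (real \<Rightarrow> tempered_h^4) \<Rightarrow> bool" where
  "mild_solution \<psi> \<nu> g \<Omega> N T W0 W \<longleftrightarrow> (\<exists>Q :: real \<Rightarrow> tempered_h^4^4.
     (AE \<tau> in lborel. \<tau> \<in> {0<..<T} \<longrightarrow>
        (\<forall>j\<in>{1, 2, 3}. \<forall>l. is_product \<psi> (W \<tau> $ j) (W \<tau> $ l) (Q \<tau> $ j $ l))) \<and>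
     (\<forall>t\<in>{0..T}. \<forall>k. \<forall>\<phi>. test_off_0 \<phi> \<longrightarrow>
        (let I = (\<lambda>\<tau>. \<Sum>l\<in>UNIV. \<Sum>j\<in>{1, 2, 3}. hat_pair (Q \<tau> $ j $ l)
                   (\<lambda>\<xi>. of_real ((semigroup_symbol \<nu> g \<Omega> N (t - \<tau>) \<xi> ** leray \<xi>) $ k $ l)
                         * (\<i> * of_real (freq4 \<xi> $ j)) * \<phi> \<xi>))
         in set_integrable lborel {0..t} I \<and>
            hat_pair (W t $ k) \<phi> =
              (\<Sum>l\<in>UNIV. hat_pair (W0 $ l)
                 (\<lambda>\<xi>. of_real (semigroup_symbol \<nu> g \<Omega> N t \<xi> $ k $ l) * \<phi> \<xi>))
              - (LINT \<tau>:{0..t}|lborel. I \<tau>))))"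

text \<open>
  \<open>\<Phi>\<close> sends every datum in \<open>D\<close> to \<^emph>\<open>the\<close> mild solution in \<open>C([0, T], FB\<^sup>-\<^sup>1\<^sub>1\<^sub>,\<^sub>r)\<close> with this datum.
\<close>

definition is_solution_map ::
    "(real^3 \<Rightarrow> complex) \<Rightarrow> ennreal \<Rightarrow> real \<Rightarrow> real \<Rightarrow> real \<Rightarrow> real \<Rightarrow> real \<Rightarrow>
     (tempered_h^4) set \<Rightarrow> (tempered_h^4 \<Rightarrow> real \<Rightarrow> tempered_h^4) \<Rightarrow> bool" where
  "is_solution_map \<psi> r \<nu> g \<Omega> N T D \<Phi> \<longleftrightarrow> (\<forall>W0\<in>D.
     cont_path \<psi> r T (\<Phi> W0) \<and> mild_solution \<psi> \<nu> g \<Omega> N T W0 (\<Phi> W0) \<and>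
     (\<forall>V. cont_path \<psi> r T V \<and> mild_solution \<psi> \<nu> g \<Omega> N T W0 V \<longrightarrow>
        (\<forall>t\<in>{0..T}. V t = \<Phi> W0 t)))"

end

theory Submission
  imports Defs "HOL-Probability.Probability"
begin

text \<open>
  The data are complex-valued, with Fourier transform supported in the half space \<open>\<xi>\<^sub>2 \<ge> 1\<close>. Convolutions
  raise the lower bound for \<open>\<xi>\<^sub>2\<close>, so every strip of frequencies sees only finitely many Picard iterates and
  the mild solution is explicit: on \<open>\<xi>\<^sub>2 < 3\<close> it is the free evolution minus one Duhamel integral.

  The data consist of \<open>n\<close> dyadic blocks of amplitude \<open>\<delta> / \<surd>n\<close>, all in the kernel of the Coriolis generator.
  Their norm in \<open>FB\<^sup>-\<^sup>1\<^sub>1\<^sub>,\<^sub>r\<close> is of order \<open>\<delta> n\<^sup>1\<^sup>/\<^sup>r / \<surd>n\<close>, which tends to \<open>0\<close> because \<open>r > 2\<close>. In the Duhamel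
  integral each block interacts with its mirror image and contributes the same positive amount \<open>\<delta>\<^sup>2 / n\<close> near the
  frequency \<open>(0, 9/4, 9/4)\<close>, so the solution at a fixed small time stays bounded below by a multiple of
  \<open>\<delta>\<^sup>2\<close>, independently of \<open>n\<close>. The norm of the free evolution in \<open>L\<^sup>2(0, T; FB\<^sup>0\<^sub>1\<^sub>,\<^sub>1)\<close> is of order \<open>\<delta>\<close>, so
  for small \<open>\<delta>\<close> the iterates are uniformly bounded there and the solution is a continuous path in
  \<open>FB\<^sup>-\<^sup>1\<^sub>1\<^sub>,\<^sub>r\<close>.
\<close>

section \<open>Smooth functions\<close>

lemma partial_eqI: "(f has_derivative f') (at x) \<Longrightarrow> partial i f x = f' (axis i 1)"
  unfolding partial_def using frechet_derivative_at by metis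

lemma partial_works:
  assumes "f differentiable (at x)"
  obtains f' where "(f has_derivative f') (at x)" "\<And>i. partial i f x = f' (axis i 1)"
  using assms partial_eqI unfolding differentiable_def by blast

lemma partial_add:
  assumes "f differentiable (at x)" "g differentiable (at x)"
  shows "partial i (\<lambda>x. f x + g x) x = partial i f x + partial i g x"
proof -
  obtain f' g' where *: "(f has_derivative f') (at x)" "partial i f x = f' (axis i 1)"
    "(g has_derivative g') (at x)" "partial i g x = g' (axis i 1)"
    using assms by (elim partial_works) blast
  show ?thesis
    using partial_eqI[OF has_derivative_add[OF *(1,3)]] *(2,4) by simp
qed

lemma partial_mult:
  assumes "f differentiable (at x)" "g differentiable (at x)"
  shows "partial i (\<lambda>x. f x * g x) x = partial i f x * g x + f x * partial i g x"
proof -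
  obtain f' g' where *: "(f has_derivative f') (at x)" "partial i f x = f' (axis i 1)"
    "(g has_derivative g') (at x)" "partial i g x = g' (axis i 1)"
    using assms by (elim partial_works) blast
  show ?thesis
    using partial_eqI[OF has_derivative_mult[OF *(1,3)]] *(2,4) by simp
qed

lemma partial_const [simp]: "partial i (\<lambda>x. c) = (\<lambda>x. 0)"
  by (rule ext, rule partial_eqI) (rule has_derivative_const)

lemma has_derivative_coord: "((\<lambda>x. complex_of_real (x $ i)) has_derivative (\<lambda>h. complex_of_real (h $ i))) (at (x :: real^3))"
  by (rule bounded_linear_imp_has_derivative)
    (intro bounded_linear_compose[OF bounded_linear_of_real] bounded_linear_vec_nth)

lemma partial_coord: "partial i (\<lambda>x. complex_of_real (x $ j)) = (\<lambda>x. if i = j then 1 else 0)"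
  by (rule ext, subst partial_eqI[OF has_derivative_coord]) (simp add: axis_def)

lemma partial_cong_open:
  assumes "open S" "x \<in> S" "\<And>y. y \<in> S \<Longrightarrow> f y = g y" "f differentiable (at x)"
  shows "g differentiable (at x)" "partial i g x = partial i f x"
proof -
  obtain f' where f': "(f has_derivative f') (at x)" "\<And>i. partial i f x = f' (axis i 1)"
    using partial_works[OF assms(4)] by blast
  then have "(g has_derivative f') (at x)"
    using has_derivative_transform_within_open[OF f'(1) assms(1,2)] assms(3) by blast
  then show "g differentiable (at x)" "partial i g x = partial i f x"
    using f' partial_eqI by (auto simp: differentiable_def)
qed

primrec smooth_upto :: "nat \<Rightarrow> (real^3) set \<Rightarrow> (real^3 \<Rightarrow> complex) \<Rightarrow> bool" where
  "smooth_upto 0 S f \<longleftrightarrow> (\<forall>x\<in>S. f differentiable (at x))"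
| "smooth_upto (Suc n) S f \<longleftrightarrow> (\<forall>x\<in>S. f differentiable (at x)) \<and> (\<forall>i. smooth_upto n S (partial i f))"

lemma smooth_upto_diff: "smooth_upto n S f \<Longrightarrow> x \<in> S \<Longrightarrow> f differentiable (at x)"
  by (cases n) auto

lemma smooth_upto_Suc: "smooth_upto (Suc n) S f \<Longrightarrow> smooth_upto n S f"
  by (induction n arbitrary: f) auto

lemma smooth_iff: "smooth f \<longleftrightarrow> (\<forall>n. smooth_upto n UNIV f)"
proof
  assume "smooth f"
  then have *: "\<forall>is x. partials is f differentiable (at x)"
    unfolding smooth_def by blast
  have "smooth_upto n UNIV f" for n
    using *
  proof (induction n arbitrary: f)
    case 0
    then show ?case by (auto dest: spec[of _ "[]"])
  next
    case (Suc n)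
    have "smooth_upto n UNIV (partial i f)" for i
    proof (rule Suc.IH, intro allI)
      fix "is" x show "partials is (partial i f) differentiable (at x)"
        using Suc.prems[rule_format, of "is @ [i]" x] by simp
    qed
    then show ?case
      using Suc.prems[rule_format, of "[]"] by simp
  qed
  then show "\<forall>n. smooth_upto n UNIV f" by blast
next
  assume *: "\<forall>n. smooth_upto n UNIV f"
  have "partials is f differentiable (at x)" for "is" x
    using *
  proof (induction "is" arbitrary: f rule: rev_induct)
    case Nil
    then have "smooth_upto 0 UNIV f" by blast
    then show ?case by simp
  next
    case (snoc i "is")
    then have "\<forall>n. smooth_upto n UNIV (partial i f)"
      by (meson smooth_upto.simps(2))
    then show ?case using snoc.IH by simp
  qed
  then show "smooth f" unfolding smooth_def by blast
qed

lemma smooth_upto_cong: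
  assumes "open S" "smooth_upto n S f" "\<And>x. x \<in> S \<Longrightarrow> f x = g x"
  shows "smooth_upto n S g"
  using assms(2,3)
proof (induction n arbitrary: f g)
  case 0
  then show ?case using partial_cong_open(1)[OF assms(1)] by (metis smooth_upto.simps(1))
next
  case (Suc n)
  have "smooth_upto n S (partial i g)" for i
    by (rule Suc.IH[of "partial i f"])
      (use Suc.prems partial_cong_open(2)[OF assms(1) _ Suc.prems(2)] in auto)
  moreover have "g differentiable (at x)" if "x \<in> S" for x
    using Suc.prems partial_cong_open(1)[OF assms(1) that Suc.prems(2)] that by auto
  ultimately show ?case by simp
qed

lemma smooth_upto_const: "smooth_upto n S (\<lambda>x. c)"
  by (induction n arbitrary: c) auto

lemma smooth_upto_coord: "smooth_upto n S (\<lambda>x. complex_of_real (x $ i))"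
proof -
  have "(\<lambda>x::real^3. complex_of_real (x $ i)) differentiable (at x)" for x
    using has_derivative_coord differentiable_def by blast
  then show ?thesis
    by (cases n) (auto simp: partial_coord intro: smooth_upto_const)
qed

lemma smooth_upto_add:
  assumes "open S" "smooth_upto n S f" "smooth_upto n S g"
  shows "smooth_upto n S (\<lambda>x. f x + g x)"
  using assms(2,3)
proof (induction n arbitrary: f g)
  case (Suc n)
  have "smooth_upto n S (partial i (\<lambda>x. f x + g x))" for i
    by (rule smooth_upto_cong[OF assms(1) Suc.IH[of "partial i f" "partial i g"]])
      (use Suc.prems in \<open>auto simp: partial_add\<close>)
  with Suc.prems show ?case by auto
qed auto

lemma smooth_upto_mult:
  assumes "open S" "smooth_upto n S f" "smooth_upto n S g"
  shows "smooth_upto n S (\<lambda>x. f x * g x)"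
  using assms(2,3)
proof (induction n arbitrary: f g)
  case (Suc n)
  have "smooth_upto n S (partial i (\<lambda>x. f x * g x))" for i
  proof (rule smooth_upto_cong[OF assms(1)])
    show "smooth_upto n S (\<lambda>x. partial i f x * g x + f x * partial i g x)"
      using Suc.prems Suc.prems[THEN smooth_upto_Suc]
      by (intro smooth_upto_add[OF assms(1)] Suc.IH) auto
  qed (use Suc.prems in \<open>auto simp: partial_mult\<close>)
  with Suc.prems show ?case by auto
qed auto

lemma smooth_upto_uminus: "open S \<Longrightarrow> smooth_upto n S f \<Longrightarrow> smooth_upto n S (\<lambda>x. - f x)"
  using smooth_upto_mult[OF _ smooth_upto_const[of n S "-1"]] by simp

lemma smooth_upto_diff_fun:
  "open S \<Longrightarrow> smooth_upto n S f \<Longrightarrow> smooth_upto n S g \<Longrightarrow> smooth_upto n S (\<lambda>x. f x - g x)"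
  using smooth_upto_add[OF _ _ smooth_upto_uminus] by fastforce

lemma smooth_upto_chain:
  assumes "open S" "smooth_upto n S h" and Q: "\<And>q. q \<in> Q \<Longrightarrow> \<exists>q'\<in>Q. \<forall>x\<in>S. (q has_field_derivative q' (h x)) (at (h x))"
    and "q \<in> Q"
  shows "smooth_upto n S (\<lambda>x. q (h x))"
proof -
  have *: "(\<lambda>x. q (h x)) differentiable (at x) \<and> partial i (\<lambda>x. q (h x)) x = q' (h x) * partial i h x"
    if dq: "(q has_field_derivative q' (h x)) (at (h x))" and dh: "h differentiable (at x)" for q q' x i
  proof -
    obtain h' where h': "(h has_derivative h') (at x)" "\<And>i. partial i h x = h' (axis i 1)"
      using partial_works[OF dh] by blast
    have "((\<lambda>x. q (h x)) has_derivative (\<lambda>y. h' y * q' (h x))) (at x)"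
      using has_derivative_compose[OF h'(1) dq[unfolded has_field_derivative_def]]
      by (simp add: mult.commute)
    then show ?thesis
      using partial_eqI h'(2) by (metis differentiable_def mult.commute)
  qed
  show ?thesis using assms(2,4)
  proof (induction n arbitrary: q)
    case 0
    obtain q' where q': "\<And>x. x \<in> S \<Longrightarrow> (q has_field_derivative q' (h x)) (at (h x))"
      using Q[OF 0(2)] by blast
    have "(\<lambda>x. q (h x)) differentiable (at x)" if "x \<in> S" for x
      using *[where q = q and q' = q' and x = x] q' 0(1) that by simp
    then show ?case by simp
  next
    case (Suc n)
    obtain q' where q': "q' \<in> Q" "\<And>x. x \<in> S \<Longrightarrow> (q has_field_derivative q' (h x)) (at (h x))"
      using Q[OF Suc.prems(2)] by blast
    have d: "\<And>x. x \<in> S \<Longrightarrow> h differentiable (at x)"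
      using Suc.prems by auto
    have **: "(\<lambda>x. q (h x)) differentiable (at x)" "partial i (\<lambda>x. q (h x)) x = q' (h x) * partial i h x" if "x \<in> S" for x i
      using *[where q = q and q' = q' and x = x] q' d that by simp_all
    have "smooth_upto n S (partial i (\<lambda>x. q (h x)))" for i
    proof (rule smooth_upto_cong[OF assms(1)])
      show "smooth_upto n S (\<lambda>x. q' (h x) * partial i h x)"
        using Suc.prems(1)
        by (intro smooth_upto_mult[OF assms(1) Suc.IH[OF smooth_upto_Suc[OF Suc.prems(1)] q'(1)]]) simp
    qed (use ** in simp)
    then show ?case using ** by simp
  qed
qed

lemma smooth_upto_powser:
  assumes "open S" "smooth_upto n S h" and "\<And>y::complex. summable (\<lambda>m. c m * y ^ m)"
  shows "smooth_upto n S (\<lambda>x. \<Sum>m. c m * h x ^ m)"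
proof (rule smooth_upto_chain[where Q = "{q. \<exists>c. (\<forall>y::complex. summable (\<lambda>m. c m * y ^ m)) \<and> q = (\<lambda>y. \<Sum>m. c m * y ^ m)}", OF assms(1,2)])
  fix q :: "complex \<Rightarrow> complex"
  assume "q \<in> {q. \<exists>c. (\<forall>y. summable (\<lambda>m. c m * y ^ m)) \<and> q = (\<lambda>y. \<Sum>m. c m * y ^ m)}"
  then obtain c where c: "\<And>y. summable (\<lambda>m. c m * y ^ m)" "q = (\<lambda>y. \<Sum>m. c m * y ^ m)"
    by auto
  then show "\<exists>q'\<in>{q. \<exists>c. (\<forall>y. summable (\<lambda>m. c m * y ^ m)) \<and> q = (\<lambda>y. \<Sum>m. c m * y ^ m)}.
       \<forall>x\<in>S. (q has_field_derivative q' (h x)) (at (h x))"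
    using termdiffs_strong_converges_everywhere[of c] termdiff_converges_all[of c]
    by (intro bexI[of _ "\<lambda>y. \<Sum>m. diffs c m * y ^ m"]) auto
qed (use assms(3) in auto)

lemma smooth_upto_exp:
  assumes "open S" "smooth_upto n S h"
  shows "smooth_upto n S (\<lambda>x. exp (h x))"
  by (rule smooth_upto_chain[where Q = "{exp}", OF assms]) (auto intro: DERIV_exp)

lemma smooth_upto_inverse:
  assumes "open S" "smooth_upto n S h" "\<And>x. x \<in> S \<Longrightarrow> h x \<noteq> 0"
  shows "smooth_upto n S (\<lambda>x. inverse (h x))"
proof -
  let ?Q = "range (\<lambda>(c, k) (y::complex). c * inverse y ^ k)"
  have "smooth_upto n S (\<lambda>x. (\<lambda>y. 1 * inverse y ^ 1) (h x))"
  proof (rule smooth_upto_chain[where Q = ?Q, OF assms(1,2)])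
    fix q assume "q \<in> ?Q"
    then obtain c k where q: "q = (\<lambda>y. c * inverse y ^ k)" by auto
    have "(q has_field_derivative (- of_nat k * c * inverse (h x) ^ Suc k)) (at (h x))" if "x \<in> S" for x
      unfolding q using assms(3)[OF that]
      by (auto intro!: derivative_eq_intros simp: power_Suc power2_eq_square field_simps)
        (cases k; simp add: field_simps)
    then show "\<exists>q'\<in>?Q. \<forall>x\<in>S. (q has_field_derivative q' (h x)) (at (h x))"
      by (intro bexI[of _ "\<lambda>y. (- of_nat k * c) * inverse y ^ Suc k"] ballI image_eqI[of _ _ "(- of_nat k * c, Suc k)"])
        (auto simp del: power_Suc)
  qed (auto intro!: image_eqI[of _ _ "(1, 1)"])
  then show ?thesis by simp
qed

lemma smooth_upto_cnj:
  assumes "smooth_upto n S f" "open S"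
  shows "smooth_upto n S (\<lambda>x. cnj (f x))"
  using assms(1)
proof (induction n arbitrary: f)
  case 0
  then show ?case
    unfolding smooth_upto.simps differentiable_def by (blast intro: has_derivative_cnj)
next
  case (Suc n)
  have *: "(\<lambda>x. cnj (f x)) differentiable (at x) \<and> partial i (\<lambda>x. cnj (f x)) x = cnj (partial i f x)" if "x \<in> S" for i x
  proof -
    have df: "f differentiable (at x)"
      using Suc.prems that by simp
    obtain h' where h': "(f has_derivative h') (at x)" "\<And>i. partial i f x = h' (axis i 1)"
      using partial_works[OF df] by blast
    then show ?thesis
      using has_derivative_cnj[OF h'(1)] partial_eqI[OF has_derivative_cnj[OF h'(1)]]
      unfolding differentiable_def by (metis h'(2))
  qed
  have "smooth_upto n S (partial i (\<lambda>x. cnj (f x)))" for i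
    by (rule smooth_upto_cong[OF assms(2) Suc.IH[of "partial i f"]]) (use Suc.prems * in auto)
  then show ?case using * by auto
qed

lemma smooth_upto_Un: "smooth_upto n S f \<Longrightarrow> smooth_upto n T f \<Longrightarrow> smooth_upto n (S \<union> T) f"
  by (induction n arbitrary: f) auto

lemma smooth_continuous: "smooth f \<Longrightarrow> continuous_on UNIV f"
  by (metis smooth_iff smooth_upto_diff UNIV_I differentiable_imp_continuous_within continuous_at_imp_continuous_on)

lemma smooth_partial: "smooth f \<Longrightarrow> smooth (partial i f)"
  by (meson smooth_iff smooth_upto.simps(2))

lemma smooth_differentiable: "smooth f \<Longrightarrow> f differentiable (at x)"
  using smooth_iff smooth_upto_diff by blast

lemma prod_Basis_eq: "(\<Prod>b\<in>(Basis :: (real^3) set). h b) = (\<Prod>i\<in>UNIV. h (axis i 1))"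
proof -
  have B: "(Basis :: (real^3) set) = range (\<lambda>i. axis i 1)"
    by (auto simp: Basis_vec_def)
  show ?thesis unfolding B
    by (subst prod.reindex) (auto simp: inj_on_def axis_eq_axis)
qed

lemma
  fixes f :: "3 \<Rightarrow> real \<Rightarrow> complex"
  assumes f: "\<And>i. integrable lborel (f i)"
  shows integrable_prod_coords: "integrable lborel (\<lambda>x::real^3. \<Prod>i\<in>UNIV. f i (x $ i))"
    and integral_prod_coords: "(LINT x|lborel. (\<Prod>i\<in>UNIV. f i ((x::real^3) $ i))) = (\<Prod>i\<in>UNIV. (LINT x|lborel. f i x))"
proof -
  interpret product_sigma_finite "\<lambda>b::real^3. lborel :: real measure" ..
  define F where "F b = f (THE i. b = axis i 1)" for b :: "real^3"
  have F: "F (axis i 1) = f i" for i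
    unfolding F_def by (simp add: axis_eq_axis)
  have intF: "integrable lborel (F b)" for b
    unfolding F_def by (rule f)
  have [measurable]: "f i \<in> borel_measurable borel" for i
    using borel_measurable_integrable[OF f[of i]] by simp
  have comp: "(\<Sum>b\<in>Basis. g b *\<^sub>R b) $ i = g (axis i 1)" for g :: "real^3 \<Rightarrow> real" and i
  proof -
    have "(\<Sum>b\<in>Basis. g b *\<^sub>R b) \<bullet> axis i 1 = g (axis i 1)"
      by (rule inner_sum_left_Basis) simp
    then show ?thesis by (simp add: inner_axis)
  qed
  have M: "(\<lambda>x::real^3. \<Prod>i\<in>UNIV. f i (x $ i)) \<in> borel_measurable borel"
    by measurable
  have T: "(\<lambda>f. \<Sum>b\<in>Basis. f b *\<^sub>R b) \<in> measurable (\<Pi>\<^sub>M b\<in>(Basis :: (real^3) set). lborel) borel"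
    by measurable
  have eq: "(\<Prod>i\<in>UNIV. f i ((\<Sum>b\<in>Basis. g b *\<^sub>R b) $ i)) = (\<Prod>b\<in>Basis. F b (g b))" for g :: "real^3 \<Rightarrow> real"
    by (simp only: comp prod_Basis_eq F)
  show "integrable lborel (\<lambda>x::real^3. \<Prod>i\<in>UNIV. f i (x $ i))"
    unfolding lborel_eq[where 'a = "real^3"]
    by (subst integrable_distr_eq[OF T M]) (simp only: eq product_integrable_prod[OF finite_Basis intF])
  have "(LINT x|lborel. (\<Prod>i\<in>UNIV. f i ((x::real^3) $ i))) = (\<Prod>b\<in>Basis. integral\<^sup>L lborel (F b))"
    unfolding lborel_eq[where 'a = "real^3"]
    by (subst integral_distr[OF T M]) (simp only: eq product_integral_prod[OF finite_Basis intF])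
  also have "\<dots> = (\<Prod>i\<in>UNIV. (LINT x|lborel. f i x))"
    by (simp add: prod_Basis_eq F)
  finally show "(LINT x|lborel. (\<Prod>i\<in>UNIV. f i ((x::real^3) $ i))) = (\<Prod>i\<in>UNIV. (LINT x|lborel. f i x))" .
qed

lemma
  fixes f :: "real^3 \<Rightarrow> 'b :: {banach, second_countable_topology}"
  assumes c: "c \<noteq> 0"
  shows integrable_affine_iff: "integrable lborel (\<lambda>x. f (c *\<^sub>R x + t)) \<longleftrightarrow> integrable lborel f"
    and integral_affine: "(LINT x|lborel. f (c *\<^sub>R x + t)) = inverse (\<bar>c\<bar> ^ 3) *\<^sub>R (LINT x|lborel. f x)"
proof -
  have *: "integrable lborel (\<lambda>x. f (c *\<^sub>R x + t))" if f: "integrable lborel f" and c: "c \<noteq> 0"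
    for f :: "real^3 \<Rightarrow> 'b" and c t
  proof -
    note [measurable] = borel_measurable_integrable[OF f]
    have "integrable (density (distr lborel borel (\<lambda>x. t + c *\<^sub>R x)) (\<lambda>_. ennreal (\<bar>c\<bar> ^ DIM(real^3)))) f"
      using f lborel_affine[OF c, of t] by simp
    then have "integrable lborel (\<lambda>x. \<bar>c\<bar> ^ 3 *\<^sub>R f (t + c *\<^sub>R x))"
      by (subst (asm) integrable_density) (auto simp: integrable_distr_eq)
    from integrable_scaleR_right[of "inverse (\<bar>c\<bar> ^ 3)", OF this]
    show ?thesis using c by (simp add: add.commute)
  qed
  show iff: "integrable lborel (\<lambda>x. f (c *\<^sub>R x + t)) \<longleftrightarrow> integrable lborel f"
  proof
    assume "integrable lborel (\<lambda>x. f (c *\<^sub>R x + t))"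
    from *[OF this, of "inverse c" "- inverse c *\<^sub>R t"] c
    show "integrable lborel f" by (simp add: algebra_simps)
  qed (use * c in blast)
  show "(LINT x|lborel. f (c *\<^sub>R x + t)) = inverse (\<bar>c\<bar> ^ 3) *\<^sub>R (LINT x|lborel. f x)"
  proof (cases "integrable lborel f")
    case f: True
    note [measurable] = borel_measurable_integrable[OF f]
    have "(LINT x|lborel. f x) = (LINT x|density (distr lborel borel (\<lambda>x. t + c *\<^sub>R x)) (\<lambda>_. ennreal (\<bar>c\<bar> ^ DIM(real^3))). f x)"
      using lborel_affine[OF c, of t] by simp
    also have "\<dots> = \<bar>c\<bar> ^ 3 *\<^sub>R (LINT x|lborel. f (t + c *\<^sub>R x))"
      by (subst integral_density) (auto simp: integral_distr)
    finally show ?thesis using c by (simp add: add.commute)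
  next
    case False
    then show ?thesis using iff by (simp add: not_integrable_integral_eq)
  qed
qed

lemma integrable_weight: "integrable lborel (\<lambda>x::real^3. inverse ((1 + norm x) ^ 6))"
proof -
  have c: "integrable lborel (\<lambda>t::real. inverse (1 + t\<^sup>2))"
    using integrable_inverse_1_plus_square by (simp add: set_integrable_def)
  then have "integrable lborel (\<lambda>t::real. complex_of_real (inverse (1 + t\<^sup>2)))"
    by (rule integrable_of_real)
  from integrable_prod_coords[of "\<lambda>_ t. complex_of_real (inverse (1 + t\<^sup>2))", OF this]
  have "integrable lborel (\<lambda>x::real^3. complex_of_real (\<Prod>i\<in>UNIV. inverse (1 + (x $ i)\<^sup>2)))"
    by simp
  then have I: "integrable lborel (\<lambda>x::real^3. \<Prod>i\<in>UNIV. inverse (1 + (x $ i)\<^sup>2))"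
    by (simp only: complex_of_real_integrable_eq)
  show ?thesis
  proof (rule Bochner_Integration.integrable_bound[OF I])
    show "AE x in lborel. norm (inverse ((1 + norm (x::real^3)) ^ 6)) \<le> norm (\<Prod>i\<in>UNIV. inverse (1 + (x $ i)\<^sup>2))"
    proof (rule AE_I2)
      fix x :: "real^3"
      have "(\<Prod>i\<in>(UNIV :: 3 set). (1 + (x $ i)\<^sup>2)) \<le> (\<Prod>i\<in>(UNIV :: 3 set). (1 + norm x)\<^sup>2)"
      proof (rule prod_mono, safe)
        fix i
        have "(x $ i)\<^sup>2 \<le> (norm x)\<^sup>2"
          using component_le_norm_cart[of x i] abs_le_square_iff by fastforce
        then show "1 + (x $ i)\<^sup>2 \<le> (1 + norm x)\<^sup>2"
          by (simp add: power2_sum add_increasing2)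
      qed simp
      also have "\<dots> = (1 + norm x) ^ 6"
        by (simp add: power_mult[symmetric])
      finally have le: "(\<Prod>i\<in>(UNIV :: 3 set). (1 + (x $ i)\<^sup>2)) \<le> (1 + norm x) ^ 6" .
      have "0 < (\<Prod>i\<in>(UNIV :: 3 set). (1 + (x $ i)\<^sup>2))"
        by (intro prod_pos) (auto intro: add_pos_nonneg)
      with le have "inverse ((1 + norm x) ^ 6) \<le> inverse (\<Prod>i\<in>(UNIV :: 3 set). (1 + (x $ i)\<^sup>2))"
        by (simp add: le_imp_inverse_le)
      moreover have "inverse (\<Prod>i\<in>(UNIV :: 3 set). (1 + (x $ i)\<^sup>2)) = (\<Prod>i\<in>UNIV. inverse (1 + (x $ i)\<^sup>2))"
        by (simp add: prod_inversef[symmetric] comp_def)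
      ultimately show "norm (inverse ((1 + norm x) ^ 6)) \<le> norm (\<Prod>i\<in>UNIV. inverse (1 + (x $ i)\<^sup>2))"
        by (simp add: abs_of_nonneg prod_nonneg)
    qed
  qed measurable
qed

definition rapid :: "(real^3 \<Rightarrow> complex) \<Rightarrow> bool" where
  "rapid f \<longleftrightarrow> (\<forall>x. f differentiable (at x)) \<and> (\<forall>n. \<exists>C. \<forall>x. (1 + norm x) ^ n * cmod (f x) \<le> C)"

primrec schwartz_upto :: "nat \<Rightarrow> (real^3 \<Rightarrow> complex) \<Rightarrow> bool" where
  "schwartz_upto 0 f \<longleftrightarrow> rapid f"
| "schwartz_upto (Suc n) f \<longleftrightarrow> rapid f \<and> (\<forall>i. schwartz_upto n (partial i f))"

lemma schwartz_alt: "schwartz f \<longleftrightarrow> (\<forall>is. rapid (partials is f))"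
  unfolding schwartz_def smooth_def rapid_def by blast

lemma schwartz_rapid: "schwartz f \<Longrightarrow> rapid f"
  using schwartz_alt[of f] by (metis foldr.simps(1) id_apply)

lemma schwartz_partial: "schwartz f \<Longrightarrow> schwartz (partial i f)"
  unfolding schwartz_alt
proof
  fix "is" assume "\<forall>is. rapid (partials is f)"
  then have "rapid (partials (is @ [i]) f)" by blast
  then show "rapid (partials is (partial i f))" by simp
qed

lemma schwartz_iff: "schwartz f \<longleftrightarrow> (\<forall>n. schwartz_upto n f)"
proof
  assume *: "schwartz f"
  have "schwartz_upto n f" for n
    using * by (induction n arbitrary: f) (auto simp: schwartz_rapid schwartz_partial)
  then show "\<forall>n. schwartz_upto n f" by blast
next
  assume *: "\<forall>n. schwartz_upto n f"
  have "rapid (partials is f)" for "is"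
    using *
  proof (induction "is" arbitrary: f rule: rev_induct)
    case Nil
    then have "schwartz_upto 0 f" by blast
    then show ?case by simp
  next
    case (snoc i "is")
    have "schwartz_upto n (partial i f)" for n
      using snoc.prems by (metis schwartz_upto.simps(2))
    then show ?case using snoc.IH by simp
  qed
  then show "schwartz f" unfolding schwartz_alt by blast
qed

lemma rapid_diff: "rapid f \<Longrightarrow> f differentiable (at x)"
  by (simp add: rapid_def)

lemma schwartz_diff: "schwartz f \<Longrightarrow> f differentiable (at x)"
  by (simp add: schwartz_rapid rapid_diff)

lemma rapid_boundE:
  assumes "rapid f" obtains C where "C \<ge> 0" "\<And>x. (1 + norm x) ^ n * cmod (f x) \<le> C"
proof -
  obtain C where C: "\<And>x. (1 + norm x) ^ n * cmod (f x) \<le> C"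
    using assms unfolding rapid_def by blast
  have "0 \<le> (1 + norm (0::real^3)) ^ n * cmod (f 0)" by simp
  also have "\<dots> \<le> C" by (rule C)
  finally show ?thesis using C that by blast
qed

lemma rapid_add:
  assumes "rapid f" "rapid g" shows "rapid (\<lambda>x. f x + g x)"
  unfolding rapid_def
proof (intro conjI allI)
  fix n
  obtain C where C: "\<And>x. (1 + norm x) ^ n * cmod (f x) \<le> C" using rapid_boundE[OF assms(1)] by metis
  obtain D where D: "\<And>x. (1 + norm x) ^ n * cmod (g x) \<le> D" using rapid_boundE[OF assms(2)] by metis
  have "(1 + norm x) ^ n * cmod (f x + g x) \<le> C + D" for x
  proof -
    have "(1 + norm x) ^ n * cmod (f x + g x) \<le> (1 + norm x) ^ n * (cmod (f x) + cmod (g x))"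
      by (intro mult_left_mono norm_triangle_ineq) simp
    then show ?thesis using C[of x] D[of x] by (simp add: distrib_left)
  qed
  then show "\<exists>C. \<forall>x. (1 + norm x) ^ n * cmod (f x + g x) \<le> C" by blast
qed (use assms in \<open>auto simp: rapid_def\<close>)

lemma rapid_coord_mult:
  assumes "rapid f" shows "rapid (\<lambda>x. complex_of_real (x $ i) * f x)"
  unfolding rapid_def
proof (intro conjI allI)
  fix n
  obtain C where C: "\<And>x. (1 + norm x) ^ Suc n * cmod (f x) \<le> C" using rapid_boundE[OF assms(1)] by metis
  have "(1 + norm x) ^ n * cmod (complex_of_real (x $ i) * f x) \<le> C" for x
  proof -
    have "(1 + norm x) ^ n * cmod (complex_of_real (x $ i) * f x) \<le> (1 + norm x) ^ n * ((1 + norm x) * cmod (f x))"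
      using component_le_norm_cart[of x i]
      by (intro mult_left_mono) (auto simp: norm_mult intro!: mult_right_mono)
    then show ?thesis using C[of x] by (simp add: mult_ac)
  qed
  then show "\<exists>C. \<forall>x. (1 + norm x) ^ n * cmod (complex_of_real (x $ i) * f x) \<le> C" by blast
next
  fix x
  have "(\<lambda>x::real^3. complex_of_real (x $ i)) differentiable (at x)"
    using has_derivative_coord differentiable_def by blast
  then show "(\<lambda>x. complex_of_real (x $ i) * f x) differentiable (at x)"
    using assms by (auto simp: rapid_def)
qed

lemma rapid_cmult:
  assumes "rapid f" shows "rapid (\<lambda>x. c * f x)"
  unfolding rapid_def
proof (intro conjI allI)
  fix n
  obtain C where C: "\<And>x. (1 + norm x) ^ n * cmod (f x) \<le> C" using rapid_boundE[OF assms(1)] by metis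
  have "(1 + norm x) ^ n * cmod (c * f x) \<le> cmod c * C" for x
    using mult_left_mono[OF C[of x], of "cmod c"] by (simp add: norm_mult mult_ac)
  then show "\<exists>C. \<forall>x. (1 + norm x) ^ n * cmod (c * f x) \<le> C" by blast
qed (use assms in \<open>auto simp: rapid_def\<close>)

lemma rapid_affine:
  assumes "rapid f" "c \<noteq> 0" shows "rapid (\<lambda>x. f (c *\<^sub>R x + b))"
  unfolding rapid_def
proof (intro conjI allI)
  fix n
  obtain C where C: "\<And>x. (1 + norm x) ^ n * cmod (f x) \<le> C" using rapid_boundE[OF assms(1)] by metis
  define K where "K = 1 + (1 + norm b) / \<bar>c\<bar>"
  have K: "1 + norm x \<le> K * (1 + norm (c *\<^sub>R x + b))" for x
  proof -
    have "\<bar>c\<bar> * norm x = norm ((c *\<^sub>R x + b) - b)" by simp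
    also have "\<dots> \<le> norm (c *\<^sub>R x + b) + norm b" by (rule norm_triangle_ineq4)
    finally have "norm x \<le> (norm (c *\<^sub>R x + b) + norm b) / \<bar>c\<bar>"
      using assms(2) by (simp add: pos_le_divide_eq mult.commute)
    also have "\<dots> \<le> ((1 + norm b) / \<bar>c\<bar>) * (1 + norm (c *\<^sub>R x + b))"
      unfolding times_divide_eq_left by (intro divide_right_mono) (auto simp: algebra_simps)
    finally have "1 + norm x \<le> (1 + norm (c *\<^sub>R x + b)) + (1 + norm b) / \<bar>c\<bar> * (1 + norm (c *\<^sub>R x + b))"
      using norm_ge_zero[of "c *\<^sub>R x + b"] by linarith
    then show ?thesis unfolding K_def by (simp only: distrib_right mult_1_left)
  qed
  have K0: "0 \<le> K" unfolding K_def by (intro add_nonneg_nonneg divide_nonneg_nonneg) auto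
  have "(1 + norm x) ^ n * cmod (f (c *\<^sub>R x + b)) \<le> K ^ n * C" for x
  proof -
    have "(1 + norm x) ^ n \<le> (K * (1 + norm (c *\<^sub>R x + b))) ^ n"
      by (intro power_mono K) simp
    then have "(1 + norm x) ^ n * cmod (f (c *\<^sub>R x + b)) \<le> (K * (1 + norm (c *\<^sub>R x + b))) ^ n * cmod (f (c *\<^sub>R x + b))"
      by (intro mult_right_mono) auto
    also have "\<dots> \<le> K ^ n * C"
      using mult_left_mono[OF C[of "c *\<^sub>R x + b"], of "K ^ n"] K0 by (simp add: power_mult_distrib mult_ac)
    finally show ?thesis .
  qed
  then show "\<exists>C. \<forall>x. (1 + norm x) ^ n * cmod (f (c *\<^sub>R x + b)) \<le> C" by blast
next
  fix x
  have "f differentiable (at (c *\<^sub>R x + b))" using assms rapid_diff by blast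
  moreover have "(\<lambda>x. c *\<^sub>R x + b) differentiable (at x)"
    by (auto intro!: derivative_intros)
  ultimately show "(\<lambda>x. f (c *\<^sub>R x + b)) differentiable (at x)"
    using differentiable_chain_at[of "\<lambda>x. c *\<^sub>R x + b" x f] by (simp add: comp_def)
qed

lemma partial_affine:
  assumes "f differentiable (at (c *\<^sub>R x + b))"
  shows "partial i (\<lambda>x. f (c *\<^sub>R x + b)) x = of_real c * partial i f (c *\<^sub>R x + b)"
proof -
  obtain h' where h': "(f has_derivative h') (at (c *\<^sub>R x + b))" "\<And>i. partial i f (c *\<^sub>R x + b) = h' (axis i 1)"
    using partial_works[OF assms] by blast
  have "((\<lambda>x. f (c *\<^sub>R x + b)) has_derivative (\<lambda>y. h' (c *\<^sub>R y))) (at x)"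
    using h'(1) by (intro has_derivative_compose[where g = f and f = "\<lambda>x. c *\<^sub>R x + b"]) (auto intro!: derivative_eq_intros)
  moreover have "h' (c *\<^sub>R axis i 1) = of_real c * h' (axis i 1)"
    using linear_cmul[OF has_derivative_linear[OF h'(1)]] by (simp add: scaleR_conv_of_real)
  ultimately show ?thesis
    using partial_eqI h'(2) by metis
qed

lemma schwartz_cmult:
  assumes "schwartz f" shows "schwartz (\<lambda>x. c * f x)"
proof -
  have "schwartz_upto n (\<lambda>x. c * f x)" for n
    using assms
  proof (induction n arbitrary: f)
    case (Suc n)
    have "partial i (\<lambda>x. c * f x) = (\<lambda>x. c * partial i f x)" for i
      using Suc.prems by (subst partial_mult[OF _ schwartz_diff, THEN ext]) auto
    then show ?case using Suc by (simp add: rapid_cmult schwartz_rapid schwartz_partial)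
  qed (simp add: rapid_cmult schwartz_rapid)
  then show ?thesis by (simp add: schwartz_iff)
qed

lemma schwartz_coord_mult:
  assumes "schwartz f" shows "schwartz (\<lambda>x. complex_of_real (x $ i) * f x)"
proof -
  have "schwartz_upto n (\<lambda>x. complex_of_real (x $ i) * f x)" for n
    using assms
  proof (induction n arbitrary: f)
    case (Suc n)
    have *: "partial j (\<lambda>x. complex_of_real (x $ i) * f x)
        = (\<lambda>x. (if j = i then 1 else 0) * f x + complex_of_real (x $ i) * partial j f x)" for j
    proof
      fix x
      have "(\<lambda>x::real^3. complex_of_real (x $ i)) differentiable (at x)"
        using has_derivative_coord differentiable_def by blast
      then show "partial j (\<lambda>x. complex_of_real (x $ i) * f x) x
        = (if j = i then 1 else 0) * f x + complex_of_real (x $ i) * partial j f x"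
        using Suc.prems by (simp add: partial_mult schwartz_diff partial_coord)
    qed
    have add: "schwartz_upto n g \<Longrightarrow> schwartz_upto n h \<Longrightarrow> schwartz_upto n (\<lambda>x. g x + h x)" for g h n
    proof (induction n arbitrary: g h)
      case (Suc n)
      have "partial i (\<lambda>x. g x + h x) = (\<lambda>x. partial i g x + partial i h x)" for i
        using Suc.prems by (intro ext partial_add) (auto intro: rapid_diff)
      with Suc show ?case by (simp add: rapid_add)
    qed (simp add: rapid_add)
    have "schwartz_upto n (partial j (\<lambda>x. complex_of_real (x $ i) * f x))" for j
      unfolding *
      using schwartz_cmult[OF Suc.prems] Suc.IH[OF schwartz_partial[OF Suc.prems]]
      by (intro add) (auto simp: schwartz_iff)
    then show ?case using Suc by (simp add: rapid_coord_mult schwartz_rapid)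
  qed (simp add: rapid_coord_mult schwartz_rapid)
  then show ?thesis by (simp add: schwartz_iff)
qed

lemma schwartz_affine:
  assumes "schwartz f" "c \<noteq> 0" shows "schwartz (\<lambda>x. f (c *\<^sub>R x + b))"
proof -
  have "schwartz_upto n (\<lambda>x. d * f (c *\<^sub>R x + b))" for n d
    using assms
  proof (induction n arbitrary: f d)
    case (Suc n)
    have "partial i (\<lambda>x. d * f (c *\<^sub>R x + b)) = (\<lambda>x. (d * of_real c) * partial i f (c *\<^sub>R x + b))" for i
    proof
      fix x
      have "(\<lambda>x. f (c *\<^sub>R x + b)) differentiable (at x)"
        using rapid_diff[OF rapid_affine[OF schwartz_rapid[OF Suc.prems(1)] Suc.prems(2)]] .
      then show "partial i (\<lambda>x. d * f (c *\<^sub>R x + b)) x = (d * of_real c) * partial i f (c *\<^sub>R x + b)"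
        using Suc.prems by (simp add: partial_mult partial_affine schwartz_diff)
    qed
    then show ?case using Suc schwartz_partial[OF Suc.prems(1)]
      by (simp add: rapid_cmult rapid_affine schwartz_rapid)
  qed (simp add: rapid_affine rapid_cmult schwartz_rapid)
  from this[of _ 1] show ?thesis by (simp add: schwartz_iff)
qed

lemma schwartz_compact_support:
  assumes f: "smooth f" and supp: "\<And>x. f x \<noteq> 0 \<Longrightarrow> norm x \<le> b"
  shows "schwartz f"
proof -
  have rapid: "rapid f" if f: "smooth f" and supp: "\<And>x. f x \<noteq> 0 \<Longrightarrow> norm x \<le> b" for f
    unfolding rapid_def
  proof (intro conjI allI)
    fix n
    have "compact ((\<lambda>x. (1 + norm x) ^ n * cmod (f x)) ` cball 0 b)"
      by (intro compact_continuous_image continuous_intros continuous_on_subset[OF smooth_continuous[OF f]]) auto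
    then have "bdd_above ((\<lambda>x. (1 + norm x) ^ n * cmod (f x)) ` cball 0 b)"
      by (intro bounded_imp_bdd_above compact_imp_bounded)
    then obtain C where C: "\<And>x. x \<in> cball 0 b \<Longrightarrow> (1 + norm x) ^ n * cmod (f x) \<le> C"
      unfolding bdd_above_def by (meson imageI)
    have "(1 + norm x) ^ n * cmod (f x) \<le> max C 0" for x
      using C[of x] supp[of x] by (cases "f x = 0") auto
    then show "\<exists>C. \<forall>x. (1 + norm x) ^ n * cmod (f x) \<le> C" by blast
  qed (use f smooth_differentiable in blast)
  have "schwartz_upto n f" for n
    using f supp
  proof (induction n arbitrary: f)
    case (Suc n)
    have "norm x \<le> b" if "partial i f x \<noteq> 0" for i x
    proof (rule ccontr)
      assume "\<not> norm x \<le> b"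
      then have x: "x \<in> - cball 0 b" by simp
      have "partial i f x = partial i (\<lambda>x. 0) x"
        by (rule partial_cong_open(2)[OF _ x]) (use Suc.prems(2) in auto)
      then show False using that by simp
    qed
    then show ?case using Suc.IH[OF smooth_partial[OF Suc.prems(1)]] rapid[OF Suc.prems] by simp
  qed (simp add: rapid)
  then show ?thesis by (simp add: schwartz_iff)
qed

lemma rapid_continuous: "rapid f \<Longrightarrow> continuous_on UNIV f"
  by (simp add: rapid_def differentiable_imp_continuous_within continuous_at_imp_continuous_on)

lemma rapid_measurable [measurable_dest]: "rapid f \<Longrightarrow> f \<in> borel_measurable borel"
  by (simp add: rapid_continuous borel_measurable_continuous_onI)

lemma weight_integrable:
  fixes f :: "real^3 \<Rightarrow> 'b::{banach, second_countable_topology}"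
  assumes "f \<in> borel_measurable borel" "\<And>x. norm (f x) \<le> C * inverse ((1 + norm x) ^ 6)"
  shows "integrable lborel f" "(LINT x|lborel. norm (f x)) \<le> C * (LINT x|lborel. inverse ((1 + norm (x::real^3)) ^ 6))"
proof -
  have I: "integrable lborel (\<lambda>x::real^3. C * inverse ((1 + norm x) ^ 6))"
    using integrable_weight by simp
  show f: "integrable lborel f"
    using assms(2) abs_ge_self order_trans
    by (intro Bochner_Integration.integrable_bound[OF I] AE_I2) (use assms(1) in \<open>auto, fastforce\<close>)
  show "(LINT x|lborel. norm (f x)) \<le> C * (LINT x|lborel. inverse ((1 + norm (x::real^3)) ^ 6))"
    using integral_mono[OF integrable_norm[OF f] I assms(2)] by simp
qed

lemma rapid_weight:
  assumes "rapid f" obtains C where "C \<ge> 0" "\<And>x. cmod (f x) * (1 + norm x) ^ n \<le> C * inverse ((1 + norm x) ^ 6)"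
proof -
  obtain C where C: "C \<ge> 0" "\<And>x. (1 + norm x) ^ (n + 6) * cmod (f x) \<le> C" using rapid_boundE[OF assms] by metis
  have "cmod (f x) * (1 + norm x) ^ n \<le> C * inverse ((1 + norm x) ^ 6)" for x
  proof -
    have p: "0 < (1 + norm x) ^ 6" by (intro zero_less_power add_pos_nonneg) auto
    have "cmod (f x) * (1 + norm x) ^ n * (1 + norm x) ^ 6 \<le> C"
      using C(2)[of x] by (simp add: power_add mult_ac)
    with p show ?thesis
      by (metis divide_inverse pos_le_divide_eq)
  qed
  with C show ?thesis using that by blast
qed

lemma rapid_integrable_power:
  assumes "rapid f" shows "integrable lborel (\<lambda>x. cmod (f x) * (1 + norm x) ^ n)"
proof -
  obtain C where "\<And>x. cmod (f x) * (1 + norm x) ^ n \<le> C * inverse ((1 + norm x) ^ 6)"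
    using rapid_weight[OF assms] by metis
  then show ?thesis
    using assms by (intro weight_integrable(1)[of _ C]) auto
qed

lemma rapid_integrable: "rapid f \<Longrightarrow> integrable lborel f"
  using rapid_integrable_power[of f 0] rapid_measurable[of f] by (simp add: integrable_norm_iff)

section \<open>The Fourier transform on Schwartz functions\<close>

lemma integrable_cis_mult:
  assumes "integrable lborel f" "g \<in> borel_measurable lborel"
  shows "integrable lborel (\<lambda>x. cis (g x) * f x)"
proof -
  note [measurable] = borel_measurable_integrable[OF assms(1)] assms(2)
  have [measurable]: "(\<lambda>x. cis (g x)) \<in> borel_measurable lborel"
    unfolding cis_conv_exp by measurable
  show ?thesis
    by (rule Bochner_Integration.integrable_bound[OF assms(1)]) (auto simp: norm_mult)
qed

lemma fourier_bound:
  assumes "integrable lborel f"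
  shows "cmod (fourier f \<xi>) \<le> (LINT x|lborel. cmod (f x))"
  unfolding fourier_def using integral_norm_bound[of lborel "\<lambda>x. cis (- (x \<bullet> \<xi>)) * f x"]
  by (simp add: norm_mult)

lemma cis_taylor: "cmod (cis t - 1 - \<i> * of_real t) \<le> t\<^sup>2"
proof -
  have "cmod (cis t - 1 - \<i> * of_real t) \<le> t\<^sup>2 / 2"
    using iexp_approx1[of t 1] by (simp add: cis_conv_exp diff_diff_eq power2_eq_square)
  then show ?thesis using zero_le_power2[of t] by linarith
qed

lemma fourier_has_derivative:
  assumes f: "rapid f"
  shows "(fourier f has_derivative (\<lambda>h. LINT x|lborel. cis (- (x \<bullet> \<xi>)) * (- \<i> * of_real (x \<bullet> h) * f x))) (at \<xi>)"
proof -
  let ?D = "\<lambda>h x. cis (- (x \<bullet> \<xi>)) * (- \<i> * of_real (x \<bullet> h) * f x)"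
  let ?M = "\<lambda>n. LINT x|lborel. cmod (f x) * (1 + norm x) ^ n"
  note [measurable] = rapid_measurable[OF f]
  have If: "integrable lborel f" by (rule rapid_integrable[OF f])
  have [measurable]: "(\<lambda>x. cis (- (x \<bullet> \<xi>))) \<in> borel_measurable lborel" for \<xi> :: "real^3"
    unfolding cis_conv_exp by measurable
  have bd1: "cmod (?D h x) \<le> norm h * (cmod (f x) * (1 + norm x) ^ 1)" for h x
  proof -
    have "\<bar>x \<bullet> h\<bar> \<le> (1 + norm x) * norm h"
      using Cauchy_Schwarz_ineq2[of x h] by (simp add: algebra_simps add_increasing)
    then show ?thesis
      using mult_right_mono[of "\<bar>x \<bullet> h\<bar>" "(1 + norm x) * norm h" "cmod (f x)"] by (simp add: norm_mult mult_ac)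
  qed
  have ID: "integrable lborel (?D h)" for h
    by (rule Bochner_Integration.integrable_bound[OF integrable_mult_right[OF rapid_integrable_power[OF f, of 1], of "norm h"]])
      (use bd1 in \<open>auto simp: abs_mult\<close>)
  have bl: "bounded_linear (\<lambda>h. LINT x|lborel. ?D h x)"
  proof (rule bounded_linear_intro[where K = "?M 1"])
    fix h k :: "real^3"
    show "(LINT x|lborel. ?D (h + k) x) = (LINT x|lborel. ?D h x) + (LINT x|lborel. ?D k x)"
      by (subst Bochner_Integration.integral_add[OF ID ID, symmetric]) (simp add: inner_add_right algebra_simps)
  next
    fix r :: real and h :: "real^3"
    show "(LINT x|lborel. ?D (r *\<^sub>R h) x) = r *\<^sub>R (LINT x|lborel. ?D h x)"
    proof -
      have "?D (r *\<^sub>R h) x = r *\<^sub>R ?D h x" for x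
        by (simp add: scaleR_conv_of_real[where 'a = complex] mult_ac)
      then show ?thesis by (simp only: integral_scaleR_right)
    qed
  next
    fix h :: "real^3"
    have "norm (LINT x|lborel. ?D h x) \<le> (LINT x|lborel. norm (?D h x))"
      by (rule integral_norm_bound)
    also have "\<dots> \<le> (LINT x|lborel. norm h * (cmod (f x) * (1 + norm x) ^ 1))"
      by (rule integral_mono[OF integrable_norm[OF ID] integrable_mult_right[OF rapid_integrable_power[OF f]] bd1])
    finally show "norm (LINT x|lborel. ?D h x) \<le> norm h * ?M 1" by simp
  qed
  have est: "norm (fourier f (\<xi> + h) - fourier f \<xi> - (LINT x|lborel. ?D h x)) / norm h \<le> norm h * ?M 2" for h
  proof -
    let ?E = "\<lambda>x. cis (- (x \<bullet> (\<xi> + h))) * f x - cis (- (x \<bullet> \<xi>)) * f x - ?D h x"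
    have I: "integrable lborel (\<lambda>x. cis (- (x \<bullet> \<xi>)) * f x)" for \<xi>
      by (rule integrable_cis_mult[OF If]) simp
    have E: "cmod (?E x) \<le> (norm h)\<^sup>2 * (cmod (f x) * (1 + norm x) ^ 2)" for x
    proof -
      have e: "?E x = cis (- (x \<bullet> \<xi>)) * (cis (- (x \<bullet> h)) - 1 - \<i> * of_real (- (x \<bullet> h))) * f x"
        by (simp add: inner_add_right algebra_simps cis_mult)
      have "(x \<bullet> h)\<^sup>2 \<le> (norm h * (1 + norm x))\<^sup>2"
      proof (rule power2_le_iff_abs_le[THEN iffD2])
        show "\<bar>x \<bullet> h\<bar> \<le> norm h * (1 + norm x)"
          using Cauchy_Schwarz_ineq2[of x h] by (simp add: algebra_simps add_increasing)
      qed simp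
      then have "cmod (cis (- (x \<bullet> h)) - 1 - \<i> * of_real (- (x \<bullet> h))) \<le> (norm h * (1 + norm x))\<^sup>2"
        using cis_taylor[of "- (x \<bullet> h)"] by simp
      from mult_right_mono[OF this, of "cmod (f x)"]
      show ?thesis unfolding e by (simp add: norm_mult power_mult_distrib mult_ac)
    qed
    have IE: "integrable lborel ?E"
      by (rule Bochner_Integration.integrable_diff[OF Bochner_Integration.integrable_diff[OF I I] ID])
    have "fourier f (\<xi> + h) - fourier f \<xi> - (LINT x|lborel. ?D h x) = (LINT x|lborel. ?E x)"
      unfolding fourier_def
      using Bochner_Integration.integral_diff[OF Bochner_Integration.integrable_diff[OF I[of "\<xi> + h"] I[of \<xi>]] ID[of h]]
        Bochner_Integration.integral_diff[OF I[of "\<xi> + h"] I[of \<xi>]] by simp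
    then have "norm (fourier f (\<xi> + h) - fourier f \<xi> - (LINT x|lborel. ?D h x)) \<le> (LINT x|lborel. norm (?E x))"
      using integral_norm_bound[of lborel ?E] by (simp only:)
    moreover have "(LINT x|lborel. norm (?E x)) \<le> (LINT x|lborel. (norm h)\<^sup>2 * (cmod (f x) * (1 + norm x) ^ 2))"
      by (rule integral_mono[OF integrable_norm[OF IE] integrable_mult_right[OF rapid_integrable_power[OF f]] E])
    moreover have "(LINT x|lborel. (norm h)\<^sup>2 * (cmod (f x) * (1 + norm x) ^ 2)) = norm h * ?M 2 * norm h"
      by (simp only: integral_mult_right_zero power2_eq_square mult_ac)
    ultimately have "norm (fourier f (\<xi> + h) - fourier f \<xi> - (LINT x|lborel. ?D h x)) \<le> norm h * ?M 2 * norm h"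
      by linarith
    then show ?thesis by (cases "h = 0") (simp_all add: pos_divide_le_eq)
  qed
  have "(\<lambda>h. norm (fourier f (\<xi> + h) - fourier f \<xi> - (LINT x|lborel. ?D h x)) / norm h) \<midarrow>0\<rightarrow> 0"
  proof (rule Lim_null_comparison)
    show "\<forall>\<^sub>F h in at 0. norm (norm (fourier f (\<xi> + h) - fourier f \<xi> - (LINT x|lborel. ?D h x)) / norm h) \<le> norm h * ?M 2"
      using est by (intro always_eventually) simp
    show "((\<lambda>h::real^3. norm h * ?M 2) \<longlongrightarrow> 0) (at 0)"
      by (intro tendsto_mult_left_zero tendsto_norm_zero tendsto_ident_at)
  qed
  with bl show ?thesis by (simp add: has_derivative_at)
qed

lemma partial_fourier:
  assumes "rapid f"
  shows "partial i (fourier f) = fourier (\<lambda>x. - \<i> * (complex_of_real (x $ i) * f x))"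
  by (rule ext, rule partial_eqI[OF fourier_has_derivative[OF assms], THEN trans])
    (simp add: fourier_def inner_axis mult_ac)

lemma fourier_differentiable: "rapid f \<Longrightarrow> fourier f differentiable (at \<xi>)"
  using fourier_has_derivative differentiable_def by blast

lemma integral_partial_zero:
  assumes g: "\<And>x. g differentiable (at x)" "integrable lborel g"
    and bd: "\<And>x. cmod (partial i g x) \<le> C * inverse ((1 + norm x) ^ 6)"
  shows "(LINT x|lborel. partial i g x) = 0"
proof -
  let ?e = "axis i 1 :: real^3"
  define s where "s n = inverse (real (Suc n))" for n
  have s: "0 < s n" "s n \<le> 1" for n by (auto simp: s_def divide_simps)
  have s0: "s \<longlonglongrightarrow> 0" unfolding s_def by (rule LIMSEQ_inverse_real_of_nat)
  define q where "q n x = (g (x + s n *\<^sub>R ?e) - g x) /\<^sub>R s n" for n x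
  have shift: "integrable lborel (\<lambda>x. g (x + t))" "(LINT x|lborel. g (x + t)) = (LINT x|lborel. g x)" for t
    using g(2) integrable_affine_iff[of 1 g t] integral_affine[of 1 g t] by auto
  have q0: "(LINT x|lborel. q n x) = 0" for n
    unfolding q_def using shift g(2) by simp
  have mg [measurable]: "g \<in> borel_measurable borel"
    using borel_measurable_integrable[OF g(2)] by simp
  have lim: "(\<lambda>n. q n x) \<longlonglongrightarrow> partial i g x" for x
  proof -
    obtain g' where g': "(g has_derivative g') (at x)" "\<And>i. partial i g x = g' (axis i 1)"
      using partial_works[OF g(1)] by blast
    have "((\<lambda>t. g (x + t *\<^sub>R ?e)) has_derivative (\<lambda>t. g' (t *\<^sub>R ?e))) (at (0::real))"
      using g'(1) by (intro has_derivative_compose[where g = g and f = "\<lambda>t. x + t *\<^sub>R ?e"]) (auto intro!: derivative_eq_intros)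
    then have "(\<lambda>h. norm (g (x + h *\<^sub>R ?e) - g x - g' (h *\<^sub>R ?e)) / norm h) \<midarrow>0\<rightarrow> 0"
      by (simp add: has_derivative_at)
    then have "(\<lambda>n. norm (g (x + s n *\<^sub>R ?e) - g x - g' (s n *\<^sub>R ?e)) / norm (s n)) \<longlonglongrightarrow> 0"
      using s s0 by (subst (asm) LIMSEQ_SEQ_conv[symmetric]) (auto simp: less_imp_neq[symmetric])
    moreover have "norm (g (x + s n *\<^sub>R ?e) - g x - g' (s n *\<^sub>R ?e)) / norm (s n) = norm (q n x - partial i g x)" for n
    proof -
      have "g (x + s n *\<^sub>R ?e) - g x - g' (s n *\<^sub>R ?e) = s n *\<^sub>R (q n x - partial i g x)"
        using linear_cmul[OF has_derivative_linear[OF g'(1)]] g'(2) s(1)[of n]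
        by (simp add: q_def scaleR_diff_right)
      then show ?thesis using s(1)[of n] by simp
    qed
    ultimately have "(\<lambda>n. norm (q n x - partial i g x)) \<longlonglongrightarrow> 0" by simp
    then show ?thesis using LIM_zero_cancel tendsto_norm_zero_iff by blast
  qed
  have bound: "norm (q n x) \<le> 64 * C * inverse ((1 + norm x) ^ 6)" for n x
  proof -
    have C0: "0 \<le> C"
      using order_trans[OF norm_ge_zero bd[of 0]] by simp
    have b: "norm (partial i g (x + t *\<^sub>R ?e)) \<le> 64 * C * inverse ((1 + norm x) ^ 6)" if t: "0 \<le> t" "t \<le> 1" for t
    proof -
      have "norm x = norm ((x + t *\<^sub>R ?e) - t *\<^sub>R ?e)" by simp
      also have "\<dots> \<le> norm (x + t *\<^sub>R ?e) + norm (t *\<^sub>R ?e)" by (rule norm_triangle_ineq4)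
      also have "\<dots> \<le> norm (x + t *\<^sub>R ?e) + 1" using t by simp
      finally have le0: "norm x \<le> norm (x + t *\<^sub>R ?e) + 1" .
      have le: "1 + norm x \<le> 2 * (1 + norm (x + t *\<^sub>R ?e))"
      proof -
        have "1 + a \<le> 2 * (1 + b)" if "a \<le> b + 1" "0 \<le> b" for a b :: real
          using that by simp
        from this[OF le0 norm_ge_zero] show ?thesis .
      qed
      have p: "0 < 1 + norm y" for y :: "real^3" by (simp add: add_pos_nonneg)
      have "(1 + norm x) ^ 6 \<le> 64 * (1 + norm (x + t *\<^sub>R ?e)) ^ 6"
        using power_mono[OF le, of 6] by (simp only: power_mult_distrib) simp
      then have "inverse ((1 + norm (x + t *\<^sub>R ?e)) ^ 6) \<le> 64 * inverse ((1 + norm x) ^ 6)"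
        using p[of x] p[of "x + t *\<^sub>R ?e"] by (simp add: divide_simps)
      from mult_left_mono[OF this C0]
      show ?thesis using bd[of "x + t *\<^sub>R ?e"] by (simp add: mult_ac)
    qed
    have "norm (g (x + s n *\<^sub>R ?e) - g (x + 0 *\<^sub>R ?e)) \<le> (64 * C * inverse ((1 + norm x) ^ 6)) * norm (s n - 0)"
    proof (rule differentiable_bound[where S = "{0..s n}" and f' = "\<lambda>t r. r *\<^sub>R partial i g (x + t *\<^sub>R ?e)" and f = "\<lambda>t. g (x + t *\<^sub>R ?e)"])
      fix t assume t: "t \<in> {0..s n}"
      obtain g' where g': "(g has_derivative g') (at (x + t *\<^sub>R ?e))" "\<And>i. partial i g (x + t *\<^sub>R ?e) = g' (axis i 1)"
        using partial_works[OF g(1)] by blast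
      have "((\<lambda>t. g (x + t *\<^sub>R ?e)) has_derivative (\<lambda>r. g' (r *\<^sub>R ?e))) (at t)"
        using g'(1) by (intro has_derivative_compose[where g = g and f = "\<lambda>t. x + t *\<^sub>R ?e"]) (auto intro!: derivative_eq_intros)
      then show "((\<lambda>t. g (x + t *\<^sub>R ?e)) has_derivative (\<lambda>r. r *\<^sub>R partial i g (x + t *\<^sub>R ?e))) (at t within {0..s n})"
        using linear_cmul[OF has_derivative_linear[OF g'(1)]] g'(2) by (simp add: has_derivative_at_withinI)
      have "norm (partial i g (x + t *\<^sub>R ?e)) \<le> 64 * C * inverse ((1 + norm x) ^ 6)"
        using b t s(2)[of n] by auto
      then show "onorm (\<lambda>r. r *\<^sub>R partial i g (x + t *\<^sub>R ?e)) \<le> 64 * C * inverse ((1 + norm x) ^ 6)"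
        by (intro onorm_le) (auto simp: mult.commute intro!: mult_left_mono)
    qed (use s[of n] in auto)
    then have *: "inverse (s n) * norm (g (x + s n *\<^sub>R ?e) - g x) \<le> inverse (s n) * (64 * C * inverse ((1 + norm x) ^ 6) * s n)"
      using s(1)[of n] by (intro mult_left_mono) auto
    have "inverse (s n) * (a * s n) = a" for a
      using s(1)[of n] by simp
    with * show ?thesis
      unfolding q_def norm_scaleR using s(1)[of n] by (simp only:) (simp add: abs_of_pos)
  qed
  have qm: "q n \<in> borel_measurable lborel" for n
    unfolding q_def by measurable
  have pm: "partial i g \<in> borel_measurable lborel"
    by (rule borel_measurable_LIMSEQ_metric[OF qm lim])
  have "(\<lambda>n. LINT x|lborel. q n x) \<longlonglongrightarrow> (LINT x|lborel. partial i g x)"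
    by (rule integral_dominated_convergence[where w = "\<lambda>x. 64 * C * inverse ((1 + norm x) ^ 6)"])
      (use qm pm lim bound integrable_weight in auto)
  then show ?thesis
    by (simp add: q0 LIMSEQ_const_iff)
qed

lemma has_derivative_cis_inner: "((\<lambda>x. cis (- (x \<bullet> \<xi>))) has_derivative (\<lambda>h. - \<i> * of_real (h \<bullet> \<xi>) * cis (- (x \<bullet> \<xi>)))) (at x)"
proof -
  have 1: "((\<lambda>x. - (x \<bullet> \<xi>)) has_derivative (\<lambda>h. - (h \<bullet> \<xi>))) (at x)"
    by (auto intro!: derivative_eq_intros)
  have 2: "(cis has_derivative (\<lambda>t. t *\<^sub>R (\<i> * cis (- (x \<bullet> \<xi>))))) (at (- (x \<bullet> \<xi>)))"
  proof -
    have 3: "((\<lambda>t. \<i> * complex_of_real t) has_derivative (\<lambda>t. \<i> * complex_of_real t)) (at (- (x \<bullet> \<xi>)))"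
      by (auto intro!: derivative_eq_intros)
    show ?thesis
      using has_derivative_compose[OF 3 DERIV_exp[unfolded has_field_derivative_def]]
      unfolding cis_conv_exp by (simp add: scaleR_conv_of_real mult_ac)
  qed
  show ?thesis
    using has_derivative_compose[OF 1 2] by (simp add: scaleR_conv_of_real mult_ac)
qed

lemma fourier_partial:
  assumes f: "rapid f" and f': "rapid (partial i f)"
  shows "fourier (partial i f) \<xi> = \<i> * of_real (\<xi> $ i) * fourier f \<xi>"
proof -
  let ?g = "\<lambda>x. cis (- (x \<bullet> \<xi>)) * f x"
  have cd: "(\<lambda>x. cis (- (x \<bullet> \<xi>))) differentiable (at x)" for x
    using has_derivative_cis_inner differentiable_def by blast
  have pg: "partial i ?g x = cis (- (x \<bullet> \<xi>)) * partial i f x - \<i> * of_real (\<xi> $ i) * (cis (- (x \<bullet> \<xi>)) * f x)" for x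
    by (subst partial_mult[OF cd rapid_diff[OF f]], subst partial_eqI[OF has_derivative_cis_inner])
      (simp add: inner_commute inner_axis algebra_simps)
  obtain C where C: "\<And>x. cmod (f x) * (1 + norm x) ^ 0 \<le> C * inverse ((1 + norm x) ^ 6)"
    using rapid_weight[OF f] by metis
  obtain D where D: "\<And>x. cmod (partial i f x) * (1 + norm x) ^ 0 \<le> D * inverse ((1 + norm x) ^ 6)"
    using rapid_weight[OF f'] by metis
  have I: "integrable lborel (\<lambda>x. cis (- (x \<bullet> \<xi>)) * f x)"
    "integrable lborel (\<lambda>x. cis (- (x \<bullet> \<xi>)) * partial i f x)"
    by (rule integrable_cis_mult[OF rapid_integrable]; simp add: f f')+
  have "(LINT x|lborel. partial i ?g x) = 0"
  proof (rule integral_partial_zero[where C = "D + \<bar>\<xi> $ i\<bar> * C"])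
    fix x
    show "?g differentiable (at x)"
      using cd rapid_diff[OF f] by auto
    have "cmod (partial i ?g x) \<le> cmod (partial i f x) + \<bar>\<xi> $ i\<bar> * cmod (f x)"
      unfolding pg by (rule norm_triangle_ineq4[THEN order_trans]) (simp add: norm_mult)
    also have "\<dots> \<le> D * inverse ((1 + norm x) ^ 6) + \<bar>\<xi> $ i\<bar> * (C * inverse ((1 + norm x) ^ 6))"
      using C[of x] D[of x] by (intro add_mono mult_left_mono) auto
    finally show "cmod (partial i ?g x) \<le> (D + \<bar>\<xi> $ i\<bar> * C) * inverse ((1 + norm x) ^ 6)"
      by (simp add: algebra_simps)
  qed (rule I)
  then show ?thesis
    unfolding pg fourier_def using I by simp
qed

lemma fourier_decay:
  assumes "schwartz f"
  shows "\<exists>C. \<forall>\<xi>. (1 + norm \<xi>) ^ n * cmod (fourier f \<xi>) \<le> C"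
  using assms
proof (induction n arbitrary: f)
  case 0
  then show ?case using fourier_bound[OF rapid_integrable[OF schwartz_rapid]] by auto
next
  case (Suc n)
  obtain C where C: "\<And>\<xi>. (1 + norm \<xi>) ^ n * cmod (fourier f \<xi>) \<le> C"
    using Suc.IH[OF Suc.prems] by blast
  have "\<forall>i. \<exists>C. \<forall>\<xi>. (1 + norm \<xi>) ^ n * cmod (fourier (partial i f) \<xi>) \<le> C"
    using Suc.IH[OF schwartz_partial[OF Suc.prems]] by blast
  then obtain D where D: "\<And>i \<xi>. (1 + norm \<xi>) ^ n * cmod (fourier (partial i f) \<xi>) \<le> D i"
    by metis
  have "(1 + norm \<xi>) ^ Suc n * cmod (fourier f \<xi>) \<le> C + (\<Sum>i\<in>UNIV. D i)" for \<xi>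
  proof -
    have "(1 + norm \<xi>) * cmod (fourier f \<xi>) \<le> (1 + (\<Sum>i\<in>UNIV. \<bar>\<xi> $ i\<bar>)) * cmod (fourier f \<xi>)"
      using norm_le_l1_cart[of \<xi>] by (intro mult_right_mono) auto
    also have "\<dots> = cmod (fourier f \<xi>) + (\<Sum>i\<in>UNIV. cmod (fourier (partial i f) \<xi>))"
      by (simp add: fourier_partial schwartz_rapid schwartz_partial Suc.prems norm_mult sum_distrib_right distrib_right)
    finally have "(1 + norm \<xi>) ^ n * ((1 + norm \<xi>) * cmod (fourier f \<xi>)) \<le>
      (1 + norm \<xi>) ^ n * (cmod (fourier f \<xi>) + (\<Sum>i\<in>UNIV. cmod (fourier (partial i f) \<xi>)))"
      by (intro mult_left_mono) auto
    also have "\<dots> \<le> C + (\<Sum>i\<in>UNIV. D i)"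
      using C[of \<xi>] sum_mono[of UNIV _ D, OF D[of \<xi>]] by (simp add: distrib_left sum_distrib_left)
    finally show ?thesis by (simp add: mult_ac)
  qed
  then show ?case by blast
qed

lemma fourier_rapid: "schwartz f \<Longrightarrow> rapid (fourier f)"
  unfolding rapid_def using fourier_decay fourier_differentiable[OF schwartz_rapid] by blast

lemma fourier_schwartz:
  assumes "schwartz f" shows "schwartz (fourier f)"
proof -
  have "schwartz_upto n (fourier f)" for n
    using assms
  proof (induction n arbitrary: f)
    case (Suc n)
    have "schwartz_upto n (partial i (fourier f))" for i
      using Suc.IH[OF schwartz_cmult[OF schwartz_coord_mult[OF Suc.prems]]]
      unfolding partial_fourier[OF schwartz_rapid[OF Suc.prems]] .
    then show ?case by (simp add: fourier_rapid Suc.prems)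
  qed (simp add: fourier_rapid)
  then show ?thesis by (simp add: schwartz_iff)
qed

lemma fourier_weighted_bound:
  obtains K where "K \<ge> 0" "\<And>f \<xi>. schwartz f \<Longrightarrow> (1 + norm \<xi>) * cmod (fourier f \<xi>) \<le> K * schwartz_norm 6 f"
proof
  let ?W = "LINT x|lborel. inverse ((1 + norm (x::real^3)) ^ 6)"
  have W0: "0 \<le> ?W" by (intro Bochner_Integration.integral_nonneg) simp
  show "0 \<le> 4 * ?W" using W0 by simp
  fix f \<xi> assume f: "schwartz f"
  have le: "(LINT x|lborel. cmod (partials is f x)) \<le> schwartz_norm 6 f * ?W" if l: "length is \<le> 6" for "is"
  proof (rule weight_integrable(2))
    show "partials is f \<in> borel_measurable borel"
      using f unfolding schwartz_alt by (auto intro: rapid_measurable)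
    fix x
    have "(\<lambda>(is, x). (1 + norm x) ^ 6 * cmod (partials is f x)) (is, x) \<le> schwartz_norm 6 f"
      unfolding schwartz_norm_def by (rule cSUP_upper[OF _ schwartz_norm_bdd[OF f]]) (use l in auto)
    moreover have "0 < (1 + norm x) ^ 6" by (intro zero_less_power add_pos_nonneg) auto
    ultimately show "norm (partials is f x) \<le> schwartz_norm 6 f * inverse ((1 + norm x) ^ 6)"
      by (simp add: divide_inverse[symmetric] pos_le_divide_eq mult.commute)
  qed
  have "(1 + norm \<xi>) * cmod (fourier f \<xi>) \<le> (1 + (\<Sum>i\<in>UNIV. \<bar>\<xi> $ i\<bar>)) * cmod (fourier f \<xi>)"
    using norm_le_l1_cart[of \<xi>] by (intro mult_right_mono) auto
  also have "\<dots> = cmod (fourier f \<xi>) + (\<Sum>i\<in>UNIV. cmod (fourier (partial i f) \<xi>))"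
    by (simp add: fourier_partial schwartz_rapid schwartz_partial f norm_mult sum_distrib_right distrib_right)
  also have "\<dots> \<le> schwartz_norm 6 f * ?W + (\<Sum>i\<in>(UNIV::3 set). schwartz_norm 6 f * ?W)"
  proof (intro add_mono sum_mono)
    show "cmod (fourier f \<xi>) \<le> schwartz_norm 6 f * ?W"
      using le[of "[]"] fourier_bound[OF rapid_integrable[OF schwartz_rapid[OF f]], of \<xi>] by simp
    show "cmod (fourier (partial i f) \<xi>) \<le> schwartz_norm 6 f * ?W" for i
      using le[of "[i]"] fourier_bound[OF rapid_integrable[OF schwartz_rapid[OF schwartz_partial[OF f]]], of i \<xi>] by simp
  qed
  also have "\<dots> = 4 * ?W * schwartz_norm 6 f" by simp
  finally show "(1 + norm \<xi>) * cmod (fourier f \<xi>) \<le> 4 * ?W * schwartz_norm 6 f" .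
qed

lemma integral_cis_gauss:
  assumes e: "e > 0"
  shows "integrable lborel (\<lambda>x::real. cis (- (x * t)) * of_real (exp (- (e * x)\<^sup>2 / 2)))"
    and "(LINT x|lborel. cis (- (x * t)) * of_real (exp (- (e * x)\<^sup>2 / 2)))
      = of_real (sqrt (2 * pi) / e * exp (- (t / e)\<^sup>2 / 2))"
proof -
  let ?g = "\<lambda>s x. cis (- (x * s)) * complex_of_real (exp (- x\<^sup>2 / 2))"
  have m: "(\<lambda>x. iexp (s * x)) \<in> borel_measurable lborel" for s :: real
    by measurable
  have eq: "?g s x = of_real (sqrt (2 * pi)) * (std_normal_density x *\<^sub>R iexp (- s * x))" for s x
    by (simp add: std_normal_density_def cis_conv_exp scaleR_conv_of_real mult_ac)
  have I: "integrable lborel (\<lambda>x. std_normal_density x *\<^sub>R iexp (- s * x))" for s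
    by (rule Bochner_Integration.integrable_bound[of lborel std_normal_density])
      (auto simp: integrable_normal_density norm_mult)
  have "(LINT x|lborel. std_normal_density x *\<^sub>R iexp (- s * x)) = of_real (exp (- s\<^sup>2 / 2))" for s
    using fun_cong[OF char_std_normal_distribution, of "- s"] m[of "- s"]
    by (simp add: char_def integral_density)
  then have B: "(LINT x|lborel. ?g s x) = of_real (sqrt (2 * pi)) * of_real (exp (- s\<^sup>2 / 2))" for s
    by (simp only: eq integral_mult_right_zero)
  have Ig: "integrable lborel (?g s)" for s
    unfolding eq by (rule integrable_mult_right[OF I])
  have sub: "?g (t / e) (0 + e * x) = cis (- (x * t)) * of_real (exp (- (e * x)\<^sup>2 / 2))" for x
    using e by simp
  show "integrable lborel (\<lambda>x::real. cis (- (x * t)) * of_real (exp (- (e * x)\<^sup>2 / 2)))"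
    using lborel_integrable_real_affine[OF Ig[of "t / e"], of e 0] e unfolding sub by simp
  show "(LINT x|lborel. cis (- (x * t)) * of_real (exp (- (e * x)\<^sup>2 / 2)))
      = of_real (sqrt (2 * pi) / e * exp (- (t / e)\<^sup>2 / 2))"
    using lborel_integral_real_affine[of e "?g (t / e)" 0] e B[of "t / e"] unfolding sub
    by (simp add: scaleR_conv_of_real field_simps)
qed

definition gauss :: "real \<Rightarrow> real^3 \<Rightarrow> complex" where
  "gauss e x = of_real (exp (- (e * norm x)\<^sup>2 / 2))"

lemma norm_sq_3: "(norm (x::real^3))\<^sup>2 = (x $ 1)\<^sup>2 + (x $ 2)\<^sup>2 + (x $ 3)\<^sup>2"
  by (simp only: power2_norm_eq_inner inner_vec_def sum_3) (simp add: power2_eq_square)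

lemma gauss_prod: "gauss e x = (\<Prod>i\<in>UNIV. of_real (exp (- (e * x $ i)\<^sup>2 / 2)))"
proof -
  have "- (e * norm x)\<^sup>2 / 2 = - (e * x $ 1)\<^sup>2 / 2 + (- (e * x $ 2)\<^sup>2 / 2 + - (e * x $ 3)\<^sup>2 / 2)"
    by (simp only: power_mult_distrib norm_sq_3) (simp add: field_simps)
  then show ?thesis
    unfolding gauss_def by (simp only: exp_add UNIV_3) simp
qed

lemma cis_inner_prod: "cis (- (x \<bullet> \<xi>)) = (\<Prod>i\<in>UNIV. cis (- (x $ i * \<xi> $ i)))" for x :: "real^3"
proof -
  have "- (x \<bullet> \<xi>) = - (x $ 1 * \<xi> $ 1) + (- (x $ 2 * \<xi> $ 2) + - (x $ 3 * \<xi> $ 3))"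
    by (simp add: inner_vec_def sum_3)
  then show ?thesis
    by (simp only: cis_mult[symmetric] UNIV_3) simp
qed

lemma
  assumes "e > 0"
  shows gauss_integrable: "integrable lborel (gauss e)"
    and fourier_gauss: "fourier (gauss e) \<xi> = of_real ((sqrt (2 * pi) / e) ^ 3) * gauss (1 / e) \<xi>"
proof -
  have eq: "cis (- (x \<bullet> \<xi>)) * gauss e x = (\<Prod>i\<in>UNIV. (cis (- (x $ i * \<xi> $ i)) * of_real (exp (- (e * x $ i)\<^sup>2 / 2))))" for x \<xi>
    by (simp only: gauss_prod cis_inner_prod prod.distrib)
  have "integrable lborel (\<lambda>x::real^3. \<Prod>i\<in>UNIV. (cis (- (x $ i * 0 $ i)) * of_real (exp (- (e * x $ i)\<^sup>2 / 2))))"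
    by (rule integrable_prod_coords[of "\<lambda>i x. cis (- (x * (0::real^3) $ i)) * of_real (exp (- (e * x)\<^sup>2 / 2))"])
      (rule integral_cis_gauss(1)[OF assms])
  then show "integrable lborel (gauss e)"
    unfolding eq[of _ 0, symmetric] by simp
  have "fourier (gauss e) \<xi> = (\<Prod>i\<in>UNIV. of_real (sqrt (2 * pi) / e * exp (- (\<xi> $ i / e)\<^sup>2 / 2)))"
    unfolding fourier_def eq
    by (subst integral_prod_coords[of "\<lambda>i x. cis (- (x * \<xi> $ i)) * of_real (exp (- (e * x)\<^sup>2 / 2))"])
      (simp_all only: integral_cis_gauss[OF assms])
  also have "\<dots> = of_real ((sqrt (2 * pi) / e) ^ 3) * gauss (1 / e) \<xi>"
    unfolding gauss_prod of_real_mult prod.distrib by simp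
  finally show "fourier (gauss e) \<xi> = of_real ((sqrt (2 * pi) / e) ^ 3) * gauss (1 / e) \<xi>" .
qed

lemma integrable_pair_mult:
  fixes f g :: "real^3 \<Rightarrow> complex"
  assumes f: "integrable lborel f" and g: "integrable lborel g"
  shows "integrable (lborel \<Otimes>\<^sub>M lborel) (\<lambda>(x, y). f x * g y)"
proof (rule lborel_pair.Fubini_integrable)
  note [measurable] = borel_measurable_integrable[OF f] borel_measurable_integrable[OF g]
  show "(\<lambda>(x, y). f x * g y) \<in> borel_measurable (lborel \<Otimes>\<^sub>M lborel)"
    by measurable
  show "integrable lborel (\<lambda>x. LINT y|lborel. norm (case (x, y) of (x, y) \<Rightarrow> f x * g y))"
    using f by (simp add: norm_mult)
  show "AE x in lborel. integrable lborel (\<lambda>y. case (x, y) of (x, y) \<Rightarrow> f x * g y)"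
    using g by simp
qed

lemma integrable_pair_cis:
  fixes f g :: "real^3 \<Rightarrow> complex"
  assumes f: "integrable lborel f" and g: "integrable lborel g"
  shows "integrable (lborel \<Otimes>\<^sub>M lborel) (\<lambda>(x, y). cis (- (x \<bullet> y)) * (f x * g y))"
proof (rule Bochner_Integration.integrable_bound[OF integrable_pair_mult[OF f g]])
  note [measurable] = borel_measurable_integrable[OF f] borel_measurable_integrable[OF g]
  show "(\<lambda>(x, y). cis (- (x \<bullet> y)) * (f x * g y)) \<in> borel_measurable (lborel \<Otimes>\<^sub>M lborel)"
    unfolding cis_conv_exp by measurable
qed (auto simp: norm_mult)

lemma fourier_swap:
  assumes f: "integrable lborel f" and g: "integrable lborel g"
  shows "(LINT x|lborel. fourier f x * g x) = (LINT y|lborel. f y * fourier g y)"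
proof -
  have "(LINT x|lborel. fourier f x * g x) = (LINT x|lborel. (LINT y|lborel. cis (- (y \<bullet> x)) * (f y * g x)))"
    unfolding fourier_def by (subst integral_mult_left_zero[symmetric]) (simp only: mult.assoc)
  also have "\<dots> = (LINT y|lborel. (LINT x|lborel. cis (- (y \<bullet> x)) * (f y * g x)))"
    using integrable_pair_cis[OF f g] by (rule lborel_pair.Fubini_integral)
  also have "\<dots> = (LINT y|lborel. f y * fourier g y)"
    unfolding fourier_def
    by (subst integral_mult_right_zero[symmetric]) (simp only: mult.assoc mult.left_commute inner_commute)
  finally show ?thesis .
qed

lemma fourier_measurable [measurable]:
  assumes "f \<in> borel_measurable lborel" shows "fourier f \<in> borel_measurable borel"
proof -
  note [measurable] = assms
  show ?thesis unfolding fourier_def cis_conv_exp by measurable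
qed

lemma gauss_le_1: "cmod (gauss e x) \<le> 1"
  by (simp add: gauss_def)

lemma inversion_0:
  assumes f: "schwartz f"
  shows "(LINT x|lborel. fourier f x) = of_real ((2 * pi) ^ 3) * f 0"
proof -
  define s where "s n = inverse (real (Suc n))" for n
  have s: "0 < s n" for n by (auto simp: s_def)
  have s0: "s \<longlonglongrightarrow> 0" unfolding s_def by (rule LIMSEQ_inverse_real_of_nat)
  have If: "integrable lborel f" and I': "integrable lborel (fourier f)"
    using f fourier_schwartz[OF f] by (auto intro: rapid_integrable schwartz_rapid)
  have c: "isCont f 0"
    using rapid_continuous[OF schwartz_rapid[OF f]] by (simp add: continuous_on_eq_continuous_at)
  obtain C where C: "\<And>x. cmod (f x) \<le> C"
    using rapid_boundE[OF schwartz_rapid[OF f], of 0] by auto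
  note [measurable] = borel_measurable_integrable[OF If] borel_measurable_integrable[OF I']
  have [measurable]: "gauss e \<in> borel_measurable borel" for e
    unfolding gauss_def by measurable
  have key: "(LINT x|lborel. fourier f x * gauss (s n) x) = of_real (sqrt (2 * pi) ^ 3) * (LINT z|lborel. f (s n *\<^sub>R z) * gauss 1 z)" for n
  proof -
    let ?h = "\<lambda>y. f y * gauss (1 / s n) y"
    have g1: "gauss (1 / s n) (s n *\<^sub>R z + 0) = gauss 1 z" for z
      using s[of n] by (simp add: gauss_def)
    have "(LINT z|lborel. f (s n *\<^sub>R z) * gauss 1 z) = inverse (s n ^ 3) *\<^sub>R (LINT y|lborel. ?h y)"
      using integral_affine[of "s n" ?h 0] s[of n] unfolding g1 by simp
    moreover have "(LINT x|lborel. fourier f x * gauss (s n) x) = of_real ((sqrt (2 * pi) / s n) ^ 3) * (LINT y|lborel. ?h y)"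
      by (subst fourier_swap[OF If gauss_integrable[OF s]], subst fourier_gauss[OF s],
          subst integral_mult_right_zero[symmetric]) (simp only: mult.left_commute)
    ultimately show ?thesis
      by (simp only: scaleR_conv_of_real power_divide divide_inverse of_real_mult of_real_inverse mult.assoc
          power_mult_distrib power_inverse of_real_power)
  qed
  have gl: "(\<lambda>n. gauss (s n) x) \<longlonglongrightarrow> 1" for x
  proof -
    have "(\<lambda>n. of_real (exp (- (s n * norm x)\<^sup>2 / 2))) \<longlonglongrightarrow> complex_of_real (exp (- (0 * norm x)\<^sup>2 / 2))"
      by (intro tendsto_intros s0) auto
    then show ?thesis by (simp add: gauss_def)
  qed
  have "(\<lambda>n. LINT x|lborel. fourier f x * gauss (s n) x) \<longlonglongrightarrow> (LINT x|lborel. fourier f x)"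
  proof (rule integral_dominated_convergence[where w = "\<lambda>x. cmod (fourier f x)"])
    show "AE x in lborel. (\<lambda>n. fourier f x * gauss (s n) x) \<longlonglongrightarrow> fourier f x"
      using tendsto_mult[OF tendsto_const gl] by (auto intro: AE_I2)
    show "AE x in lborel. norm (fourier f x * gauss (s n) x) \<le> cmod (fourier f x)" for n
      using mult_left_mono[OF gauss_le_1, of "cmod (fourier f _)"] by (auto simp: norm_mult)
  qed (use I' in auto)
  moreover have "(\<lambda>n. LINT x|lborel. f (s n *\<^sub>R x) * gauss 1 x) \<longlonglongrightarrow> (LINT x|lborel. f 0 * gauss 1 x)"
  proof (rule integral_dominated_convergence[where w = "\<lambda>x. C * cmod (gauss 1 x)"])
    have "(\<lambda>n. s n *\<^sub>R x) \<longlonglongrightarrow> 0 *\<^sub>R x" for x :: "real^3"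
      by (intro tendsto_intros s0)
    then have "(\<lambda>n. f (s n *\<^sub>R x)) \<longlonglongrightarrow> f 0" for x
      by (intro isCont_tendsto_compose[OF c]) simp
    then show "AE x in lborel. (\<lambda>n. f (s n *\<^sub>R x) * gauss 1 x) \<longlonglongrightarrow> f 0 * gauss 1 x"
      by (intro AE_I2 tendsto_mult tendsto_const)
    show "AE x in lborel. norm (f (s n *\<^sub>R x) * gauss 1 x) \<le> C * cmod (gauss 1 x)" for n
      by (auto simp: norm_mult intro!: mult_right_mono C)
  qed (use gauss_integrable[of 1] in auto)
  ultimately have "(LINT x|lborel. fourier f x) = of_real (sqrt (2 * pi) ^ 3) * (LINT x|lborel. f 0 * gauss 1 x)"
    using tendsto_mult[OF tendsto_const] LIMSEQ_unique unfolding key by blast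
  moreover have "(LINT x|lborel. gauss 1 x) = of_real (sqrt (2 * pi) ^ 3)"
    using fourier_gauss[of 1 0] unfolding fourier_def by (simp add: gauss_def)
  moreover have "sqrt (2 * pi) ^ 3 * sqrt (2 * pi) ^ 3 = (2 * pi) ^ 3"
    by (simp add: power_mult_distrib[symmetric])
  ultimately show ?thesis
    by (simp add: mult.left_commute[of _ "f 0"] of_real_mult[symmetric] mult.commute del: of_real_mult of_real_power)
qed

lemma fourier_fourier:
  assumes f: "schwartz f"
  shows "fourier (fourier f) x = of_real ((2 * pi) ^ 3) * f (- x)"
proof -
  have "fourier (\<lambda>y. f (y - x)) \<xi> = cis (- (\<xi> \<bullet> x)) * fourier f \<xi>" for \<xi>
  proof -
    have "cis (- ((y + x) \<bullet> \<xi>)) * f y = cis (- (\<xi> \<bullet> x)) * (cis (- (y \<bullet> \<xi>)) * f y)" for y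
      by (simp add: inner_add_left cis_mult inner_commute[of x] algebra_simps)
    then have "(LINT y|lborel. cis (- ((y + x) \<bullet> \<xi>)) * f y) = cis (- (\<xi> \<bullet> x)) * fourier f \<xi>"
      by (simp only: fourier_def integral_mult_right_zero)
    then show ?thesis
      using integral_affine[of 1 "\<lambda>y. cis (- ((y + x) \<bullet> \<xi>)) * f y" "- x"] by (simp add: fourier_def)
  qed
  then have "fourier (fourier f) x = (LINT \<xi>|lborel. fourier (\<lambda>y. f (y - x)) \<xi>)"
    unfolding fourier_def[of "fourier f"] by simp
  also have "\<dots> = of_real ((2 * pi) ^ 3) * f (- x)"
    using inversion_0[OF schwartz_affine[OF f, of 1 "- x"]] by simp
  finally show ?thesis .
qed

definition ifourier :: "(real^3 \<Rightarrow> complex) \<Rightarrow> real^3 \<Rightarrow> complex" where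
  "ifourier f \<xi> = fourier f (- \<xi>) / of_real ((2 * pi) ^ 3)"

lemma ifourier_fourier: "schwartz f \<Longrightarrow> ifourier (fourier f) = f"
  by (simp add: ifourier_def fourier_fourier fun_eq_iff)

lemma ifourier_measurable [measurable]:
  assumes "f \<in> borel_measurable lborel" shows "ifourier f \<in> borel_measurable borel"
proof -
  note [measurable] = assms
  show ?thesis unfolding ifourier_def by measurable
qed

lemma ifourier_swap:
  assumes f: "integrable lborel f" and g: "integrable lborel g"
  shows "(LINT x|lborel. ifourier f x * g x) = (LINT y|lborel. f y * ifourier g y)"
proof -
  have g': "integrable lborel (\<lambda>x. g (- x))"
    using integrable_affine_iff[of "-1" g 0] g by simp
  have *: "fourier (\<lambda>x. g (- x)) y = fourier g (- y)" for y
    unfolding fourier_def using integral_affine[of "-1" "\<lambda>x. cis (x \<bullet> y) * g x" 0] by simp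
  have "(LINT x|lborel. fourier f (- x) * g x) = (LINT x|lborel. fourier f x * g (- x))"
    using integral_affine[of "-1" "\<lambda>x. fourier f x * g (- x)" 0] by simp
  also have "\<dots> = (LINT y|lborel. f y * fourier g (- y))"
    by (subst fourier_swap[OF f g']) (simp add: *)
  finally show ?thesis by (simp add: ifourier_def)
qed

lemma moment_zero:
  assumes g: "schwartz g" and z: "\<And>\<xi>. norm \<xi> < e \<Longrightarrow> fourier g \<xi> = 0" and e: "e > 0"
  shows "(LINT x|lborel. of_real (\<Prod>i\<in>UNIV. (x $ i) ^ \<alpha> i) * g x) = 0"
proof -
  define P where "P g \<longleftrightarrow> schwartz g \<and> (\<forall>\<xi>. norm \<xi> < e \<longrightarrow> fourier g \<xi> = 0)" for g
  have step: "P (\<lambda>x. of_real (x $ i) * g x)" if "P g" for g i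
  proof -
    have g: "schwartz g" and z: "\<And>\<xi>. norm \<xi> < e \<Longrightarrow> fourier g \<xi> = 0" using that by (auto simp: P_def)
    have "fourier (\<lambda>x. of_real (x $ i) * g x) \<xi> = 0" if "norm \<xi> < e" for \<xi>
    proof -
      have "partial i (\<lambda>_. 0) \<xi> = partial i (fourier g) \<xi>"
        by (rule partial_cong_open(2)[of "ball 0 e", symmetric, THEN sym]) (use that z fourier_differentiable[OF schwartz_rapid[OF g]] in auto)
      then have "fourier (\<lambda>x. - \<i> * (of_real (x $ i) * g x)) \<xi> = 0"
        by (simp add: partial_fourier[OF schwartz_rapid[OF g]])
      moreover have "fourier (\<lambda>x. - \<i> * (of_real (x $ i) * g x)) \<xi> = - \<i> * fourier (\<lambda>x. of_real (x $ i) * g x) \<xi>"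
        unfolding fourier_def by (simp only: mult.left_commute[of _ "- \<i>"] integral_mult_right_zero)
      ultimately show ?thesis by simp
    qed
    then show ?thesis using schwartz_coord_mult[OF g] by (simp add: P_def)
  qed
  have pow: "P (\<lambda>x. of_real ((x $ i) ^ k) * g x)" if "P g" for g i k
  proof (induction k)
    case (Suc k)
    from step[OF this, of i] show ?case by (simp add: mult_ac)
  qed (use that in simp)
  have "P g" using g z by (simp add: P_def)
  from pow[OF pow[OF pow[OF this]], of 1 "\<alpha> 1" 2 "\<alpha> 2" 3 "\<alpha> 3"]
  have "P (\<lambda>x. of_real ((x $ 1) ^ \<alpha> 1) * (of_real ((x $ 2) ^ \<alpha> 2) * (of_real ((x $ 3) ^ \<alpha> 3) * g x)))" .
  then have A: "fourier (\<lambda>x. of_real ((x $ 1) ^ \<alpha> 1) * (of_real ((x $ 2) ^ \<alpha> 2) * (of_real ((x $ 3) ^ \<alpha> 3) * g x))) 0 = 0"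
    using e by (simp add: P_def)
  have B: "of_real (\<Prod>i\<in>UNIV. (x $ i) ^ \<alpha> i) * g x =
    of_real ((x $ 1) ^ \<alpha> 1) * (of_real ((x $ 2) ^ \<alpha> 2) * (of_real ((x $ 3) ^ \<alpha> 3) * g x))" for x
    by (simp only: UNIV_3) (simp add: mult.assoc)
  show ?thesis unfolding B using A by (simp only: fourier_def) simp
qed

section \<open>Elements of \<open>S'\<^sub>h\<close> given by their Fourier transform\<close>

definition admissible :: "(real^3 \<Rightarrow> complex) \<Rightarrow> bool" where
  "admissible F \<longleftrightarrow> F \<in> borel_measurable lborel \<and> integrable lborel (\<lambda>\<xi>. cmod (F \<xi>) / (1 + norm \<xi>))"

definition freq_functional :: "(real^3 \<Rightarrow> complex) \<Rightarrow> functional" where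
  "freq_functional F f = (LINT \<xi>|lborel. F \<xi> * ifourier f \<xi>)"

text \<open>The element of \<open>S'\<^sub>h\<close> with Fourier transform \<open>F\<close>.\<close>

definition freq_dist :: "(real^3 \<Rightarrow> complex) \<Rightarrow> tempered_h" where
  "freq_dist F = abs_tempered_h (freq_functional F)"

lemma one_plus_norm_pos [simp]: "0 < 1 + norm x" "1 + norm x \<noteq> 0"
  using norm_ge_zero[of x] by (linarith)+

lemma admissible_measurable: "admissible F \<Longrightarrow> F \<in> borel_measurable borel"
  by (simp add: admissible_def)

lemma admissible_mult:
  assumes F: "admissible F" and k: "k \<in> borel_measurable borel" "\<And>\<xi>. (1 + norm \<xi>) * cmod (k \<xi>) \<le> K"
  shows "integrable lborel (\<lambda>\<xi>. F \<xi> * k \<xi>)"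
    and "cmod (LINT \<xi>|lborel. F \<xi> * k \<xi>) \<le> K * (LINT \<xi>|lborel. cmod (F \<xi>) / (1 + norm \<xi>))"
proof -
  note [measurable] = admissible_measurable[OF F] k(1)
  have I: "integrable lborel (\<lambda>\<xi>. K * (cmod (F \<xi>) / (1 + norm \<xi>)))"
    by (rule integrable_mult_right) (use F in \<open>simp add: admissible_def\<close>)
  have b: "cmod (F \<xi> * k \<xi>) \<le> K * (cmod (F \<xi>) / (1 + norm \<xi>))" for \<xi>
    using mult_left_mono[OF k(2)[of \<xi>], of "cmod (F \<xi>) / (1 + norm \<xi>)"]
    by (simp add: norm_mult mult_ac)
  show i: "integrable lborel (\<lambda>\<xi>. F \<xi> * k \<xi>)"
    by (rule Bochner_Integration.integrable_bound[OF I]) (auto intro!: AE_I2 order_trans[OF b] divide_right_mono)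
  have "cmod (LINT \<xi>|lborel. F \<xi> * k \<xi>) \<le> (LINT \<xi>|lborel. cmod (F \<xi> * k \<xi>))"
    by (rule integral_norm_bound)
  also have "\<dots> \<le> (LINT \<xi>|lborel. K * (cmod (F \<xi>) / (1 + norm \<xi>)))"
    by (rule integral_mono[OF integrable_norm[OF i] I b])
  finally show "cmod (LINT \<xi>|lborel. F \<xi> * k \<xi>) \<le> K * (LINT \<xi>|lborel. cmod (F \<xi>) / (1 + norm \<xi>))"
    by (simp only: integral_mult_right_zero)
qed

lemma schwartz_measurable: "schwartz f \<Longrightarrow> f \<in> borel_measurable borel"
  by (simp add: schwartz_rapid rapid_measurable)

lemma schwartz_integrable: "schwartz f \<Longrightarrow> integrable lborel f"
  by (simp add: schwartz_rapid rapid_integrable)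

lemma ifourier_schwartz: assumes "schwartz f" shows "schwartz (ifourier f)"
proof -
  have "ifourier f = (\<lambda>x. inverse (of_real ((2 * pi) ^ 3)) * fourier f ((-1) *\<^sub>R x + 0))"
    by (rule ext) (simp only: ifourier_def divide_inverse scaleR_minus_left scaleR_one add_0_right mult.commute)
  then show ?thesis
    using schwartz_cmult[OF schwartz_affine[OF fourier_schwartz[OF assms], of "-1" 0]] by (simp only:)
qed

lemma admissible_schwartz_mult:
  assumes F: "admissible F" and k: "schwartz k"
  shows "integrable lborel (\<lambda>\<xi>. F \<xi> * k \<xi>)"
proof -
  obtain C where C: "\<And>x. (1 + norm x) ^ 1 * cmod (k x) \<le> C"
    using rapid_boundE[OF schwartz_rapid[OF k]] by metis
  show ?thesis
    by (rule admissible_mult(1)[OF F schwartz_measurable[OF k], of C]) (use C in simp)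
qed

lemma tempered_freq:
  assumes F: "admissible F"
  shows "tempered (freq_functional F)"
proof -
  obtain K where K: "K \<ge> 0" "\<And>f \<xi>. schwartz f \<Longrightarrow> (1 + norm \<xi>) * cmod (fourier f \<xi>) \<le> K * schwartz_norm 6 f"
    using fourier_weighted_bound by blast
  let ?A = "LINT \<xi>|lborel. cmod (F \<xi>) / (1 + norm \<xi>)"
  show ?thesis
    unfolding tempered_def
  proof (intro conjI allI impI)
    fix f g assume f: "schwartz f" and g: "schwartz g"
    have "fourier (\<lambda>x. f x + g x) \<xi> = fourier f \<xi> + fourier g \<xi>" for \<xi>
      unfolding fourier_def distrib_left
      by (intro Bochner_Integration.integral_add integrable_cis_mult schwartz_integrable f g) auto
    then have "ifourier (\<lambda>x. f x + g x) \<xi> = ifourier f \<xi> + ifourier g \<xi>" for \<xi>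
      by (simp add: ifourier_def add_divide_distrib)
    then show "freq_functional F (\<lambda>x. f x + g x) = freq_functional F f + freq_functional F g"
      unfolding freq_functional_def
      by (simp only: distrib_left Bochner_Integration.integral_add[OF
        admissible_schwartz_mult[OF F ifourier_schwartz[OF f]] admissible_schwartz_mult[OF F ifourier_schwartz[OF g]]])
  next
    fix c f assume f: "schwartz f"
    have "fourier (\<lambda>x. c * f x) \<xi> = c * fourier f \<xi>" for \<xi>
      unfolding fourier_def by (simp only: mult.left_commute[of _ c] integral_mult_right_zero)
    then have "ifourier (\<lambda>x. c * f x) \<xi> = c * ifourier f \<xi>" for \<xi>
      by (simp add: ifourier_def)
    then show "freq_functional F (\<lambda>x. c * f x) = c * freq_functional F f"
      unfolding freq_functional_def by (simp only: mult.left_commute[of _ c] integral_mult_right_zero)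
  next
    have "cmod (freq_functional F f) \<le> (K * ?A) * schwartz_norm 6 f" if f: "schwartz f" for f
    proof -
      have "(1 + norm \<xi>) * cmod (ifourier f \<xi>) \<le> K * schwartz_norm 6 f" for \<xi>
      proof -
        have "cmod (ifourier f \<xi>) \<le> cmod (fourier f (- \<xi>))"
        proof -
          have "1 \<le> (2 * pi) ^ 3" using pi_gt3 by (intro one_le_power) simp
          then have "cmod (fourier f (- \<xi>)) / (2 * pi) ^ 3 \<le> cmod (fourier f (- \<xi>)) / 1"
            by (intro divide_left_mono) auto
          then show ?thesis by (simp add: ifourier_def norm_divide norm_power norm_mult)
        qed
        then have "(1 + norm \<xi>) * cmod (ifourier f \<xi>) \<le> (1 + norm (- \<xi>)) * cmod (fourier f (- \<xi>))"
          by (simp add: mult_left_mono)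
        then show ?thesis using K(2)[OF f, of "- \<xi>"] by linarith
      qed
      from admissible_mult(2)[OF F schwartz_measurable[OF ifourier_schwartz[OF f]] this]
      show ?thesis by (simp add: freq_functional_def mult_ac)
    qed
    then show "\<exists>C N. \<forall>f. schwartz f \<longrightarrow> cmod (freq_functional F f) \<le> C * schwartz_norm N f"
      by blast
  qed
qed

lemma rep_freq_dist:
  assumes F: "admissible F" and f: "schwartz f" and z: "\<And>\<xi>. norm \<xi> < e \<Longrightarrow> fourier f \<xi> = 0" and e: "e > 0"
  shows "rep_tempered_h (freq_dist F) f = freq_functional F f"
proof -
  have "tempered_rel (freq_functional F) (freq_functional F)"
    using tempered_freq[OF F] by (simp add: tempered_rel_def polynomial_dist_zero)
  then have "tempered_rel (rep_tempered_h (freq_dist F)) (freq_functional F)"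
    unfolding freq_dist_def by (rule Quotient3_rep_abs[OF Quotient3_tempered_h])
  then have "polynomial_dist (\<lambda>f. rep_tempered_h (freq_dist F) f - freq_functional F f)"
    by (simp add: tempered_rel_def)
  then obtain A c where "\<And>f. schwartz f \<Longrightarrow> rep_tempered_h (freq_dist F) f - freq_functional F f
      = (\<Sum>\<alpha>\<in>A. c \<alpha> * (LINT x|lborel. of_real (\<Prod>i\<in>UNIV. (x $ i) ^ \<alpha> i) * f x))"
    unfolding polynomial_dist_def by blast
  from this[OF f] show ?thesis
    using moment_zero[OF f z e] by simp
qed

lemma test_off_0_schwartz:
  assumes "test_off_0 \<phi>" shows "schwartz \<phi>"
  using assms schwartz_compact_support unfolding test_off_0_def by blast

lemma hat_pair_freq_dist:
  assumes F: "admissible F" and \<phi>: "test_off_0 \<phi>"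
  shows "hat_pair (freq_dist F) \<phi> = (LINT \<xi>|lborel. F \<xi> * \<phi> \<xi>)"
proof -
  have s: "schwartz \<phi>" by (rule test_off_0_schwartz[OF \<phi>])
  obtain a where a: "0 < a" "\<And>\<xi>. \<phi> \<xi> \<noteq> 0 \<Longrightarrow> a \<le> norm \<xi>"
    using \<phi> unfolding test_off_0_def by blast
  have "rep_tempered_h (freq_dist F) (fourier \<phi>) = freq_functional F (fourier \<phi>)"
    by (rule rep_freq_dist[OF F fourier_schwartz[OF s] _ a(1)])
      (use a(2) in \<open>force simp: fourier_fourier[OF s]\<close>)
  then show ?thesis
    by (simp add: hat_pair_def freq_functional_def ifourier_fourier[OF s])
qed

lemma freq_dist_zero: "freq_dist (\<lambda>_. 0) = 0"
proof -
  have "freq_functional (\<lambda>_. 0) = (\<lambda>f. 0)" by (simp add: freq_functional_def fun_eq_iff)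
  then show ?thesis unfolding freq_dist_def zero_tempered_h_def by simp
qed

lemma admissible_zero [simp]: "admissible (\<lambda>_. 0)"
  by (simp add: admissible_def)

lemma admissible_diff:
  assumes F: "admissible F" and G: "admissible G" shows "admissible (\<lambda>\<xi>. F \<xi> - G \<xi>)"
proof -
  note [measurable] = admissible_measurable[OF F] admissible_measurable[OF G]
  have I: "integrable lborel (\<lambda>\<xi>. cmod (F \<xi>) / (1 + norm \<xi>) + cmod (G \<xi>) / (1 + norm \<xi>))"
    using F G by (auto simp: admissible_def)
  have "integrable lborel (\<lambda>\<xi>. cmod (F \<xi> - G \<xi>) / (1 + norm \<xi>))"
    by (rule Bochner_Integration.integrable_bound[OF I])
      (auto intro!: AE_I2 simp: add_divide_distrib[symmetric] divide_right_mono norm_triangle_ineq4)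
  then show ?thesis by (simp add: admissible_def)
qed

lemma freq_dist_diff:
  assumes F: "admissible F" and G: "admissible G"
  shows "freq_dist F - freq_dist G = freq_dist (\<lambda>\<xi>. F \<xi> - G \<xi>)"
proof -
  have rF: "tempered_rel (freq_functional F) (freq_functional F)" if "admissible F" for F
    using tempered_freq[OF that] by (simp add: tempered_rel_def polynomial_dist_zero)
  have "freq_dist (\<lambda>\<xi>. F \<xi> - G \<xi>) = abs_tempered_h (\<lambda>f. freq_functional F f + - freq_functional G f)"
    unfolding freq_dist_def
    apply (rule Quotient3_rel_abs[OF Quotient3_tempered_h])
    unfolding tempered_rel_def
  proof (intro conjI tempered_freq admissible_diff F G tempered_add tempered_uminus)
    show "polynomial_dist (\<lambda>f. freq_functional (\<lambda>\<xi>. F \<xi> - G \<xi>) f - (freq_functional F f + - freq_functional G f))"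
      unfolding polynomial_dist_def
    proof (intro exI[of _ "{}"] exI conjI allI impI)
      fix f assume f: "schwartz f"
      note s = ifourier_schwartz[OF f]
      show "freq_functional (\<lambda>\<xi>. F \<xi> - G \<xi>) f - (freq_functional F f + - freq_functional G f)
        = (\<Sum>\<alpha>\<in>{}. 0 * (LINT x|lborel. of_real (\<Prod>i\<in>UNIV. (x $ i) ^ \<alpha> i) * f x))"
        using Bochner_Integration.integral_diff[OF admissible_schwartz_mult[OF F s] admissible_schwartz_mult[OF G s]]
        by (simp add: freq_functional_def left_diff_distrib)
    qed simp
  qed
  also have "\<dots> = freq_dist F + (- freq_dist G)"
  proof -
    have "tempered_rel (\<lambda>f. - freq_functional G f) (\<lambda>f. - freq_functional G f)"
      using tempered_uminus[OF tempered_freq[OF G]] by (simp add: tempered_rel_def polynomial_dist_zero)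
    then show ?thesis
      by (simp only: freq_dist_def plus_tempered_h.abs_eq[OF rF[OF F]] uminus_tempered_h.abs_eq[OF rF[OF G]])
  qed
  finally show ?thesis by (simp only: minus_tempered_h_def)
qed

definition lp_hat :: "(real^3 \<Rightarrow> complex) \<Rightarrow> int \<Rightarrow> real^3 \<Rightarrow> complex" where
  "lp_hat \<psi> j \<xi> = fourier \<psi> ((2 powi (- j)) *\<^sub>R \<xi>)"

context
  fixes \<psi> assumes lp: "littlewood_paley \<psi>"
begin

lemma psi_schwartz: "schwartz \<psi>" using lp by (simp add: littlewood_paley_def)

lemma psi_hat_supp: "fourier \<psi> \<xi> \<noteq> 0 \<Longrightarrow> 3/4 \<le> norm \<xi> \<and> norm \<xi> \<le> 8/3"
  using lp closure_subset[of "{\<xi>. fourier \<psi> \<xi> \<noteq> 0}"] unfolding littlewood_paley_def by blast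

lemma psi_hat_even: "fourier \<psi> (- \<xi>) = fourier \<psi> \<xi>"
proof -
  have "\<psi> (- x) = \<psi> x" for x using lp unfolding littlewood_paley_def by (metis norm_minus_cancel)
  then show ?thesis
    unfolding fourier_def using integral_affine[of "-1" "\<lambda>x. cis (- (x \<bullet> \<xi>)) * \<psi> x" 0] by simp
qed

lemma lp_hat_even: "lp_hat \<psi> j (- \<xi>) = lp_hat \<psi> j \<xi>"
  using psi_hat_even by (simp add: lp_hat_def)

lemma lp_hat_schwartz: "schwartz (lp_hat \<psi> j)"
  using schwartz_affine[OF fourier_schwartz[OF psi_schwartz], of "2 powi (- j)" 0]
  by (simp add: lp_hat_def[abs_def])

lemma lp_hat_measurable [measurable]: "lp_hat \<psi> j \<in> borel_measurable borel"
  by (rule schwartz_measurable[OF lp_hat_schwartz])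

lemma lp_hat_supp: "lp_hat \<psi> j \<xi> \<noteq> 0 \<Longrightarrow> 3/4 * 2 powi j \<le> norm \<xi> \<and> norm \<xi> \<le> 8/3 * 2 powi j"
  using psi_hat_supp[of "2 powi (- j) *\<^sub>R \<xi>"]
  by (simp add: lp_hat_def power_int_minus field_simps)

lemma fourier_translated_block:
  "fourier (\<lambda>y. dilate \<psi> j (x - y)) \<xi> = cis (- (x \<bullet> \<xi>)) * lp_hat \<psi> j \<xi>"
proof -
  let ?c = "(2::real) powi j"
  have c: "?c > 0" by simp
  define h where "h u = cis (- ((x - (1 / ?c) *\<^sub>R u) \<bullet> \<xi>)) * \<psi> u" for u
  have "cis (- (y \<bullet> \<xi>)) * dilate \<psi> j (x - y) = of_real (?c ^ 3) * h ((- ?c) *\<^sub>R y + ?c *\<^sub>R x)" for y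
    using c by (simp add: h_def dilate_def algebra_simps power_int_mult[symmetric] power_int_power' mult.commute[of 3])
  then have "fourier (\<lambda>y. dilate \<psi> j (x - y)) \<xi> = of_real (?c ^ 3) * (inverse (\<bar>- ?c\<bar> ^ 3) *\<^sub>R (LINT u|lborel. h u))"
    unfolding fourier_def using c by (subst integral_affine[symmetric, of "- ?c" h "?c *\<^sub>R x"]) auto
  also have "\<dots> = (LINT u|lborel. h u)"
    using c by (simp add: scaleR_conv_of_real)
  also have "\<dots> = cis (- (x \<bullet> \<xi>)) * fourier \<psi> (- ((1 / ?c) *\<^sub>R \<xi>))"
    unfolding fourier_def
    by (subst integral_mult_right_zero[symmetric]) (simp add: h_def[abs_def] inner_diff_left cis_mult mult.assoc[symmetric])
  finally show ?thesis
    by (simp add: psi_hat_even lp_hat_def power_int_minus divide_inverse)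
qed

lemma lp_block_freq_dist:
  assumes F: "admissible F"
  shows "lp_block \<psi> j (freq_dist F) x = ifourier (\<lambda>\<xi>. F \<xi> * lp_hat \<psi> j \<xi>) x"
proof -
  let ?f = "\<lambda>y. dilate \<psi> j (x - y)"
  have f: "schwartz ?f"
  proof -
    have "?f = (\<lambda>y. of_real (2 powi (3 * j)) * \<psi> ((- (2 powi j)) *\<^sub>R y + (2 powi j) *\<^sub>R x))"
      by (simp add: dilate_def fun_eq_iff algebra_simps)
    then show ?thesis
      using schwartz_cmult[OF schwartz_affine[OF psi_schwartz, of "- (2 powi j)" "(2 powi j) *\<^sub>R x"]] by simp
  qed
  have "rep_tempered_h (freq_dist F) ?f = freq_functional F ?f"
  proof (rule rep_freq_dist[OF F f])
    show "0 < 3/4 * (2::real) powi j" by simp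
    show "fourier ?f \<xi> = 0" if "norm \<xi> < 3/4 * 2 powi j" for \<xi>
      using that lp_hat_supp[of j \<xi>] by (auto simp: fourier_translated_block)
  qed
  also have "\<dots> = ifourier (\<lambda>\<xi>. F \<xi> * lp_hat \<psi> j \<xi>) x"
    unfolding freq_functional_def ifourier_def fourier_translated_block
    by (simp add: fourier_def lp_hat_even inner_commute mult_ac)
  finally show ?thesis by (simp add: lp_block_def)
qed

lemma lp_block_hat_freq_dist:
  assumes F: "admissible F" and f: "schwartz f"
  shows "lp_block_hat \<psi> j (freq_dist F) f = (LINT \<xi>|lborel. (F \<xi> * lp_hat \<psi> j \<xi>) * f \<xi>)"
  unfolding lp_block_hat_def lp_block_freq_dist[OF F]
  using ifourier_swap[OF admissible_schwartz_mult[OF F lp_hat_schwartz] schwartz_integrable[OF fourier_schwartz[OF f]]]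
  by (simp add: ifourier_fourier[OF f])

definition lp_hat_sum :: "nat \<Rightarrow> real^3 \<Rightarrow> complex" where
  "lp_hat_sum n \<xi> = (\<Sum>j\<in>{- int n..int n}. lp_hat \<psi> j \<xi>)"

lemma lp_sum_freq_dist:
  assumes F: "admissible F"
  shows "lp_sum \<psi> n (freq_dist F) x = ifourier (\<lambda>\<xi>. F \<xi> * lp_hat_sum n \<xi>) x"
proof -
  have "lp_sum \<psi> n (freq_dist F) x = (\<Sum>j\<in>{- int n..int n}. fourier (\<lambda>\<xi>. F \<xi> * lp_hat \<psi> j \<xi>) (- x)) / of_real ((2 * pi) ^ 3)"
    by (simp only: lp_sum_def lp_block_freq_dist[OF F] ifourier_def sum_divide_distrib)
  also have "(\<Sum>j\<in>{- int n..int n}. fourier (\<lambda>\<xi>. F \<xi> * lp_hat \<psi> j \<xi>) (- x)) = fourier (\<lambda>\<xi>. F \<xi> * lp_hat_sum n \<xi>) (- x)"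
    unfolding fourier_def lp_hat_sum_def sum_distrib_left
    by (rule Bochner_Integration.integral_sum[symmetric])
      (intro integrable_cis_mult admissible_schwartz_mult[OF F lp_hat_schwartz], simp)
  finally show ?thesis by (simp add: ifourier_def)
qed

lemma lp_hat_card: 
  shows "finite {j. lp_hat \<psi> j \<xi> \<noteq> 0}" "card {j. lp_hat \<psi> j \<xi> \<noteq> 0} \<le> 3"
proof -
  let ?S = "{j. lp_hat \<psi> j \<xi> \<noteq> 0}"
  have d: "j \<le> i + 1" if "i \<in> ?S" "j \<in> ?S" for i j
  proof (rule ccontr)
    assume "\<not> j \<le> i + 1"
    then have "(2::real) powi (i + 2) \<le> 2 powi j" by (intro power_int_increasing) auto
    then have "4 * (2::real) powi i \<le> 2 powi j" by (simp add: power_int_add)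
    moreover have "3/4 * 2 powi j \<le> norm \<xi>" "norm \<xi> \<le> 8/3 * 2 powi i"
      using that lp_hat_supp by auto
    moreover have "0 < (2::real) powi i" by simp
    ultimately show False by linarith
  qed
  have "finite ?S \<and> card ?S \<le> 3"
  proof (cases "?S = {}")
    case False
    then obtain i where "i \<in> ?S" by blast
    then have "?S \<subseteq> {i - 1..i + 1}" using d by fastforce
    then show ?thesis using card_mono[of "{i - 1..i + 1}" ?S] finite_subset by auto
  next
    case True
    then show ?thesis by (simp only: True) simp
  qed
  then show "finite ?S" "card ?S \<le> 3" by auto
qed

definition psi_bound :: real where "psi_bound = (LINT x|lborel. cmod (\<psi> x))"

lemma lp_hat_le: "cmod (lp_hat \<psi> j \<xi>) \<le> psi_bound"
  unfolding lp_hat_def psi_bound_def by (rule fourier_bound[OF schwartz_integrable[OF psi_schwartz]])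

lemma psi_bound_nonneg: "0 \<le> psi_bound"
  using order_trans[OF norm_ge_zero lp_hat_le] .

lemma lp_hat_sum_bound: "cmod (lp_hat_sum n \<xi>) \<le> 3 * psi_bound"
proof -
  let ?S = "{j. lp_hat \<psi> j \<xi> \<noteq> 0}"
  have "cmod (lp_hat_sum n \<xi>) = cmod (\<Sum>j\<in>{- int n..int n} \<inter> ?S. lp_hat \<psi> j \<xi>)"
    unfolding lp_hat_sum_def by (intro arg_cong[where f = cmod] sum.mono_neutral_right) auto
  also have "\<dots> \<le> (\<Sum>j\<in>{- int n..int n} \<inter> ?S. psi_bound)"
    by (intro sum_norm_le lp_hat_le)
  also have "\<dots> \<le> 3 * psi_bound"
  proof -
    have "card ({- int n..int n} \<inter> ?S) \<le> 3"
      using card_mono[OF lp_hat_card(1), of "{- int n..int n} \<inter> ?S"] lp_hat_card(2)[of \<xi>] by force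
    then have "real (card ({- int n..int n} \<inter> ?S)) \<le> 3" by simp
    then show ?thesis using psi_bound_nonneg by (simp add: mult_right_mono)
  qed
  finally show ?thesis .
qed

lemma lp_hat_has_sum: "\<xi> \<noteq> 0 \<Longrightarrow> ((\<lambda>j. lp_hat \<psi> j \<xi>) has_sum 1) UNIV"
  using lp by (simp add: littlewood_paley_def lp_hat_def)

lemma lp_hat_sum_tendsto:
  assumes "\<xi> \<noteq> 0" shows "(\<lambda>n. lp_hat_sum n \<xi>) \<longlonglongrightarrow> 1"
proof -
  have "(sum (\<lambda>j. lp_hat \<psi> j \<xi>) \<longlongrightarrow> 1) (finite_subsets_at_top UNIV)"
    using lp_hat_has_sum[OF assms] by (simp add: has_sum_def)
  moreover have "filterlim (\<lambda>n. {- int n..int n}) (finite_subsets_at_top UNIV) sequentially"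
    unfolding filterlim_finite_subsets_at_top
  proof (intro allI impI)
    fix X :: "int set" assume "finite X \<and> X \<subseteq> UNIV"
    then have fX: "finite X" by simp
    define m where "m = Max (insert 0 ((\<lambda>j. nat \<bar>j\<bar>) ` X))"
    have m: "nat \<bar>j\<bar> \<le> m" if "j \<in> X" for j
      unfolding m_def using fX that by (intro Max_ge) auto
    have "finite {- int n..int n} \<and> X \<subseteq> {- int n..int n} \<and> {- int n..int n} \<subseteq> UNIV" if "m \<le> n" for n
      using m that by fastforce
    then show "\<forall>\<^sub>F n in sequentially. finite {- int n..int n} \<and> X \<subseteq> {- int n..int n} \<and> {- int n..int n} \<subseteq> UNIV"
      using eventually_sequentially by blast
  qed
  ultimately have "((\<lambda>n. sum (\<lambda>j. lp_hat \<psi> j \<xi>) {- int n..int n}) \<longlongrightarrow> 1) sequentially"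
    by (rule filterlim_compose)
  then show ?thesis by (simp add: lp_hat_sum_def[abs_def])
qed

lemma lp_hat_sum_measurable [measurable]: "lp_hat_sum n \<in> borel_measurable borel"
  unfolding lp_hat_sum_def[abs_def] by measurable

end

definition conv :: "(real^3 \<Rightarrow> complex) \<Rightarrow> (real^3 \<Rightarrow> complex) \<Rightarrow> real^3 \<Rightarrow> complex" where
  "conv F G \<zeta> = (LINT \<eta>|lborel. F (\<zeta> - \<eta>) * G \<eta>) / of_real ((2 * pi) ^ 3)"

lemma integrable_admissible:
  assumes "integrable lborel F" shows "admissible F"
proof -
  note [measurable] = borel_measurable_integrable[OF assms]
  have "integrable lborel (\<lambda>\<xi>. cmod (F \<xi>) / (1 + norm \<xi>))"
    by (rule Bochner_Integration.integrable_bound[OF assms])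
      (auto intro!: AE_I2 simp: divide_le_eq mult_le_cancel_left1)
  then show ?thesis by (simp add: admissible_def)
qed

lemma integrable_bounded_mult:
  fixes F k :: "'a \<Rightarrow> complex"
  assumes "integrable M F" "k \<in> borel_measurable M" "\<And>x. cmod (k x) \<le> B"
  shows "integrable M (\<lambda>x. F x * k x)"
proof (rule Bochner_Integration.integrable_bound[where f = "\<lambda>x. B * cmod (F x)"])
  show "AE x in M. norm (F x * k x) \<le> norm (B * cmod (F x))"
  proof (rule AE_I2)
    fix x
    have "norm (F x * k x) \<le> B * cmod (F x)"
      using mult_left_mono[OF assms(3)[of x], of "cmod (F x)"] by (simp add: norm_mult mult.commute)
    then show "norm (F x * k x) \<le> norm (B * cmod (F x))" by simp
  qed
qed (use assms in auto)

lemma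
  assumes F: "integrable lborel F" and G: "integrable lborel G"
  shows integrable_conv_pair: "integrable (lborel \<Otimes>\<^sub>M lborel) (\<lambda>(\<eta>, \<zeta>). F (\<zeta> - \<eta>) * G \<eta>)"
    and conv_integrable: "integrable lborel (conv F G)"
    and conv_pairing: "\<And>k B. k \<in> borel_measurable lborel \<Longrightarrow> (\<And>x. cmod (k x) \<le> B) \<Longrightarrow>
      (LINT \<zeta>|lborel. conv F G \<zeta> * k \<zeta>)
        = (LINT \<eta>|lborel. G \<eta> * (LINT \<xi>|lborel. F \<xi> * k (\<xi> + \<eta>))) / of_real ((2 * pi) ^ 3)"
proof -
  note [measurable] = borel_measurable_integrable[OF F] borel_measurable_integrable[OF G]
  have sh: "integrable lborel (\<lambda>\<zeta>. F (\<zeta> - \<eta>))" "(LINT \<zeta>|lborel. cmod (F (\<zeta> - \<eta>))) = (LINT \<zeta>|lborel. cmod (F \<zeta>))" for \<eta>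
    using integrable_affine_iff[of 1 F "- \<eta>"] F integral_affine[of 1 "\<lambda>x. cmod (F x)" "- \<eta>"] by auto
  show I: "integrable (lborel \<Otimes>\<^sub>M lborel) (\<lambda>(\<eta>, \<zeta>). F (\<zeta> - \<eta>) * G \<eta>)"
  proof (rule lborel_pair.Fubini_integrable)
    show "(\<lambda>(\<eta>, \<zeta>). F (\<zeta> - \<eta>) * G \<eta>) \<in> borel_measurable (lborel \<Otimes>\<^sub>M lborel)"
      by measurable
    show "integrable lborel (\<lambda>\<eta>. LINT \<zeta>|lborel. norm (case (\<eta>, \<zeta>) of (\<eta>, \<zeta>) \<Rightarrow> F (\<zeta> - \<eta>) * G \<eta>))"
      using G by (simp add: norm_mult sh)
    show "AE \<eta> in lborel. integrable lborel (\<lambda>\<zeta>. case (\<eta>, \<zeta>) of (\<eta>, \<zeta>) \<Rightarrow> F (\<zeta> - \<eta>) * G \<eta>)"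
      using sh by simp
  qed
  show "integrable lborel (conv F G)"
    unfolding conv_def[abs_def]
    using lborel_pair.integrable_snd[OF I] by simp
  fix k :: "real^3 \<Rightarrow> complex" and B
  assume k[measurable]: "k \<in> borel_measurable lborel" and B: "\<And>x. cmod (k x) \<le> B"
  have "integrable (lborel \<Otimes>\<^sub>M lborel) (\<lambda>x. (case x of (\<eta>, \<zeta>) \<Rightarrow> F (\<zeta> - \<eta>) * G \<eta>) * (case x of (\<eta>, \<zeta>) \<Rightarrow> k \<zeta>))"
    by (rule integrable_bounded_mult[OF I, where B = B]) (auto simp: B)
  then have Ik: "integrable (lborel \<Otimes>\<^sub>M lborel) (\<lambda>(\<eta>, \<zeta>). F (\<zeta> - \<eta>) * G \<eta> * k \<zeta>)"
    by (simp add: case_prod_unfold)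
  have "(LINT \<zeta>|lborel. (LINT \<eta>|lborel. F (\<zeta> - \<eta>) * G \<eta> * k \<zeta>)) = (LINT \<eta>|lborel. (LINT \<zeta>|lborel. F (\<zeta> - \<eta>) * G \<eta> * k \<zeta>))"
    using lborel_pair.Fubini_integral[OF Ik] .
  also have "\<dots> = (LINT \<eta>|lborel. G \<eta> * (LINT \<xi>|lborel. F \<xi> * k (\<xi> + \<eta>)))"
  proof (rule Bochner_Integration.integral_cong[OF refl])
    fix \<eta>
    have "(LINT \<zeta>|lborel. F (\<zeta> - \<eta>) * k \<zeta>) = (LINT \<xi>|lborel. F \<xi> * k (\<xi> + \<eta>))"
      using integral_affine[of 1 "\<lambda>\<xi>. F \<xi> * k (\<xi> + \<eta>)" "- \<eta>"] by simp
    moreover have "(LINT \<zeta>|lborel. F (\<zeta> - \<eta>) * G \<eta> * k \<zeta>) = G \<eta> * (LINT \<zeta>|lborel. F (\<zeta> - \<eta>) * k \<zeta>)"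
      by (subst integral_mult_right_zero[symmetric]) (simp only: mult_ac)
    ultimately show "(LINT \<zeta>|lborel. F (\<zeta> - \<eta>) * G \<eta> * k \<zeta>) = G \<eta> * (LINT \<xi>|lborel. F \<xi> * k (\<xi> + \<eta>))"
      by simp
  qed
  finally show "(LINT \<zeta>|lborel. conv F G \<zeta> * k \<zeta>)
        = (LINT \<eta>|lborel. G \<eta> * (LINT \<xi>|lborel. F \<xi> * k (\<xi> + \<eta>))) / of_real ((2 * pi) ^ 3)"
    unfolding conv_def by simp
qed

lemma ifourier_bounded:
  assumes "integrable lborel F" shows "\<exists>B. \<forall>x. cmod (ifourier F x) \<le> B"
proof -
  have "cmod (ifourier F x) \<le> (LINT x|lborel. cmod (F x)) / (2 * pi) ^ 3" for x
    using divide_right_mono[OF fourier_bound[OF assms, of "- x"], of "(2 * pi) ^ 3"]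
    by (simp add: ifourier_def norm_divide norm_power norm_mult)
  then show ?thesis by blast
qed

lemma ifourier_product_pairing:
  assumes F: "integrable lborel F" and G: "integrable lborel G" and \<phi>: "schwartz \<phi>"
  shows "(LINT x|lborel. ifourier F x * ifourier G x * fourier \<phi> x)
    = (LINT \<eta>|lborel. G \<eta> * (LINT \<xi>|lborel. F \<xi> * \<phi> (\<xi> + \<eta>))) / of_real ((2 * pi) ^ 3)"
proof -
  note [measurable] = borel_measurable_integrable[OF F] borel_measurable_integrable[OF G]
  have I\<phi>: "integrable lborel (fourier \<phi>)" by (rule schwartz_integrable[OF fourier_schwartz[OF \<phi>]])
  obtain B where B: "\<And>x. cmod (ifourier F x) \<le> B" using ifourier_bounded[OF F] by blast
  have I1: "integrable lborel (\<lambda>x. fourier \<phi> x * ifourier F x)"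
    by (rule integrable_bounded_mult[OF I\<phi> _ B]) measurable
  have inner: "ifourier (\<lambda>x. fourier \<phi> x * ifourier F x) \<eta> = (LINT \<xi>|lborel. F \<xi> * \<phi> (\<xi> + \<eta>)) / of_real ((2 * pi) ^ 3)" for \<eta>
  proof -
    let ?k = "\<lambda>x. cis (x \<bullet> \<eta>) * fourier \<phi> x"
    have Ik: "integrable lborel ?k" by (rule integrable_cis_mult[OF I\<phi>]) simp
    have k: "ifourier ?k \<xi> = \<phi> (\<xi> + \<eta>)" for \<xi>
    proof -
      have "fourier ?k (- \<xi>) = fourier (fourier \<phi>) (- (\<xi> + \<eta>))"
        unfolding fourier_def[of ?k] fourier_def[of "fourier \<phi>"]
        by (simp add: inner_add_right inner_diff_right mult.assoc[symmetric] cis_mult add.commute)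
      then show ?thesis by (simp add: ifourier_def fourier_fourier[OF \<phi>] add.commute)
    qed
    have "fourier (\<lambda>x. fourier \<phi> x * ifourier F x) (- \<eta>) = (LINT x|lborel. ifourier F x * ?k x)"
      unfolding fourier_def[of "\<lambda>x. fourier \<phi> x * ifourier F x"] by (simp add: mult_ac)
    also have "\<dots> = (LINT \<xi>|lborel. F \<xi> * \<phi> (\<xi> + \<eta>))"
      by (subst ifourier_swap[OF F Ik]) (simp only: k)
    finally show ?thesis by (simp add: ifourier_def)
  qed
  have "(LINT x|lborel. ifourier F x * ifourier G x * fourier \<phi> x) = (LINT x|lborel. ifourier G x * (fourier \<phi> x * ifourier F x))"
    by (simp only: mult_ac)
  also have "\<dots> = (LINT \<eta>|lborel. G \<eta> * ((LINT \<xi>|lborel. F \<xi> * \<phi> (\<xi> + \<eta>)) / of_real ((2 * pi) ^ 3)))"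
    by (subst ifourier_swap[OF G I1]) (simp only: inner)
  finally show ?thesis by simp
qed

lemma is_product_conv:
  assumes lp: "littlewood_paley \<psi>" and F: "integrable lborel F" and G: "integrable lborel G"
  shows "is_product \<psi> (freq_dist F) (freq_dist G) (freq_dist (conv F G))"
  unfolding is_product_def
proof (intro allI impI)
  fix \<phi> assume t: "test_off_0 \<phi>"
  note \<phi> = test_off_0_schwartz[OF t]
  note aF = integrable_admissible[OF F] and aG = integrable_admissible[OF G]
  note [measurable] = borel_measurable_integrable[OF F] borel_measurable_integrable[OF G] schwartz_measurable[OF \<phi>]
  obtain B where B: "B \<ge> 0" "\<And>x. cmod (\<phi> x) \<le> B"
    using rapid_boundE[OF schwartz_rapid[OF \<phi>], of 0] by auto
  let ?\<chi> = "lp_hat_sum \<psi>" and ?M = "3 * psi_bound \<psi>"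
  have [measurable]: "?\<chi> n \<in> borel_measurable borel" for n by (rule lp_hat_sum_measurable[OF lp])
  note \<chi>b = lp_hat_sum_bound[OF lp]
  have M0: "0 \<le> ?M" using psi_bound_nonneg[OF lp] by simp
  have IF: "integrable lborel (\<lambda>\<xi>. F \<xi> * ?\<chi> n \<xi>)" and IG: "integrable lborel (\<lambda>\<xi>. G \<xi> * ?\<chi> n \<xi>)" for n
    by (rule integrable_bounded_mult[OF F _ \<chi>b]; measurable) (rule integrable_bounded_mult[OF G _ \<chi>b]; measurable)
  have nz: "AE \<xi>::real^3 in lborel. \<xi> \<noteq> 0"
    by (rule AE_lborel_singleton)
  let ?A = "\<lambda>n \<eta>. LINT \<xi>|lborel. (F \<xi> * ?\<chi> n \<xi>) * \<phi> (\<xi> + \<eta>)"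
  let ?L = "\<lambda>\<eta>. LINT \<xi>|lborel. F \<xi> * \<phi> (\<xi> + \<eta>)"
  have Fb: "cmod ((F \<xi> * ?\<chi> n \<xi>) * \<phi> (\<xi> + \<eta>)) \<le> ?M * B * cmod (F \<xi>)" for n \<xi> \<eta>
  proof -
    have "cmod (?\<chi> n \<xi>) * cmod (\<phi> (\<xi> + \<eta>)) \<le> ?M * B"
      by (intro mult_mono \<chi>b B M0) auto
    from mult_left_mono[OF this, of "cmod (F \<xi>)"] show ?thesis by (simp add: norm_mult mult_ac)
  qed
  have limA: "(\<lambda>n. ?A n \<eta>) \<longlonglongrightarrow> ?L \<eta>" for \<eta>
  proof (rule integral_dominated_convergence[where w = "\<lambda>\<xi>. ?M * B * cmod (F \<xi>)"])
    show "AE \<xi> in lborel. (\<lambda>n. (F \<xi> * ?\<chi> n \<xi>) * \<phi> (\<xi> + \<eta>)) \<longlonglongrightarrow> F \<xi> * \<phi> (\<xi> + \<eta>)"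
      using nz
    proof eventually_elim
      case (elim \<xi>)
      have "(\<lambda>n. (F \<xi> * ?\<chi> n \<xi>) * \<phi> (\<xi> + \<eta>)) \<longlonglongrightarrow> (F \<xi> * 1) * \<phi> (\<xi> + \<eta>)"
        by (intro tendsto_mult tendsto_const lp_hat_sum_tendsto[OF lp elim])
      then show ?case by simp
    qed
  qed (use F Fb in auto)
  have IA: "integrable lborel (\<lambda>\<xi>. (F \<xi> * ?\<chi> n \<xi>) * \<phi> (\<xi> + \<eta>))" for n \<eta>
    by (rule integrable_bounded_mult[OF IF _ B(2)]) measurable
  have Ab: "cmod (?A n \<eta>) \<le> ?M * B * (LINT \<xi>|lborel. cmod (F \<xi>))" for n \<eta>
  proof -
    have "cmod (?A n \<eta>) \<le> (LINT \<xi>|lborel. cmod ((F \<xi> * ?\<chi> n \<xi>) * \<phi> (\<xi> + \<eta>)))"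
      by (rule integral_norm_bound)
    also have "\<dots> \<le> (LINT \<xi>|lborel. ?M * B * cmod (F \<xi>))"
      using F by (intro integral_mono[OF integrable_norm[OF IA] _ Fb]) auto
    finally show ?thesis by simp
  qed
  let ?K = "?M * (?M * B * (LINT \<xi>|lborel. cmod (F \<xi>)))"
  have lim: "(\<lambda>n. LINT \<eta>|lborel. (G \<eta> * ?\<chi> n \<eta>) * ?A n \<eta>) \<longlonglongrightarrow> (LINT \<eta>|lborel. G \<eta> * ?L \<eta>)"
  proof (rule integral_dominated_convergence[where w = "\<lambda>\<eta>. ?K * cmod (G \<eta>)"])
    show "AE \<eta> in lborel. (\<lambda>n. (G \<eta> * ?\<chi> n \<eta>) * ?A n \<eta>) \<longlonglongrightarrow> G \<eta> * ?L \<eta>"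
      using nz
    proof eventually_elim
      case (elim \<eta>)
      have "(\<lambda>n. (G \<eta> * ?\<chi> n \<eta>) * ?A n \<eta>) \<longlonglongrightarrow> (G \<eta> * 1) * ?L \<eta>"
        by (intro tendsto_mult tendsto_const lp_hat_sum_tendsto[OF lp elim] limA)
      then show ?case by simp
    qed
    show "AE \<eta> in lborel. norm ((G \<eta> * ?\<chi> n \<eta>) * ?A n \<eta>) \<le> ?K * cmod (G \<eta>)" for n
    proof (rule AE_I2)
      fix \<eta>
      have "cmod (?\<chi> n \<eta>) * cmod (?A n \<eta>) \<le> ?K"
        by (intro mult_mono \<chi>b Ab M0) auto
      from mult_left_mono[OF this, of "cmod (G \<eta>)"]
      show "norm ((G \<eta> * ?\<chi> n \<eta>) * ?A n \<eta>) \<le> ?K * cmod (G \<eta>)" by (simp add: norm_mult mult_ac)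
    qed
  qed (use G in \<open>auto\<close>)
  have "hat_pair (freq_dist (conv F G)) \<phi> = (LINT \<eta>|lborel. G \<eta> * ?L \<eta>) / of_real ((2 * pi) ^ 3)"
    unfolding hat_pair_freq_dist[OF integrable_admissible[OF conv_integrable[OF F G]] t]
    by (rule conv_pairing[OF F G _ B(2)]) measurable
  moreover have "(LINT x|lborel. lp_sum \<psi> n (freq_dist F) x * lp_sum \<psi> n (freq_dist G) x * fourier \<phi> x)
      = (LINT \<eta>|lborel. (G \<eta> * ?\<chi> n \<eta>) * ?A n \<eta>) / of_real ((2 * pi) ^ 3)" for n
    unfolding lp_sum_freq_dist[OF lp aF] lp_sum_freq_dist[OF lp aG]
    by (rule ifourier_product_pairing[OF IF IG \<phi>])
  ultimately show "(\<lambda>n. LINT x|lborel. lp_sum \<psi> n (freq_dist F) x * lp_sum \<psi> n (freq_dist G) x * fourier \<phi> x)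
       \<longlonglongrightarrow> hat_pair (freq_dist (conv F G)) \<phi>"
    using tendsto_divide[OF lim tendsto_const] by simp
qed

lemma ennreal_pow_mono: "x \<le> y \<Longrightarrow> 0 \<le> a \<Longrightarrow> ennreal_pow x a \<le> ennreal_pow y a"
  unfolding ennreal_pow_def
  by (auto simp: top_unique less_top[symmetric] intro!: ennreal_leI powr_mono2 enn2real_mono)

lemma ennreal_pow_inverse: "a > 0 \<Longrightarrow> ennreal_pow (ennreal_pow x a) (1 / a) = x"
  unfolding ennreal_pow_def by (auto simp: powr_powr less_top[symmetric])

lemma Lp_norm_1: "Lp_norm M 1 f = (\<integral>\<^sup>+x. f x \<partial>M)"
proof -
  have "ennreal_pow x 1 = x" for x
    unfolding ennreal_pow_def by (auto simp: less_top[symmetric])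
  then show ?thesis by (simp add: Lp_norm_def)
qed

lemma Lp_norm_count_ge:
  assumes r: "0 < r"
  shows "f j \<le> Lp_norm (count_space UNIV) r f"
proof (cases "r = \<infinity>")
  case True
  then show ?thesis using esssup_AE[of f "count_space UNIV"] by (simp add: Lp_norm_def AE_count_space)
next
  case False
  then have r0: "enn2real r > 0" using r by (simp add: enn2real_positive_iff less_top)
  have "ennreal_pow (f j) (enn2real r) = (\<integral>\<^sup>+x. ennreal_pow (f x) (enn2real r) * indicator {j} x \<partial>count_space UNIV)"
    by (simp add: nn_integral_indicator_singleton)
  also have "\<dots> \<le> (\<integral>\<^sup>+x. ennreal_pow (f x) (enn2real r) \<partial>count_space UNIV)"
    by (intro nn_integral_mono) (auto simp: indicator_def)
  finally have "ennreal_pow (ennreal_pow (f j) (enn2real r)) (1 / enn2real r) \<le> Lp_norm (count_space UNIV) r f"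
    unfolding Lp_norm_def using False r0 by (simp add: ennreal_pow_mono)
  then show ?thesis using r0 by (simp add: ennreal_pow_inverse)
qed

lemma Lp_norm_count_le_finite:
  assumes r: "0 < r" and M: "\<And>j. f j \<le> ennreal M" "M \<ge> 0" and S: "finite S" "\<And>j. j \<notin> S \<Longrightarrow> f j = 0"
  shows "Lp_norm (count_space UNIV) r f \<le> ennreal (M * (if r = \<infinity> then 1 else real (card S) powr (1 / enn2real r)))"
proof (cases "r = \<infinity>")
  case True
  then show ?thesis using M by (simp add: Lp_norm_def) (rule esssup_I; simp)
next
  case False
  then have r0: "enn2real r > 0" using r by (simp add: enn2real_positive_iff less_top)
  let ?r = "enn2real r"
  have "(\<integral>\<^sup>+x. ennreal_pow (f x) ?r \<partial>count_space UNIV) = (\<integral>\<^sup>+x. ennreal_pow (f x) ?r \<partial>count_space S)"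
    by (rule nn_integral_count_space_eq) (use S r0 in \<open>auto simp: ennreal_pow_def\<close>)
  also have "\<dots> \<le> (\<integral>\<^sup>+x. ennreal (M powr ?r) \<partial>count_space S)"
  proof (rule nn_integral_mono)
    fix x
    show "ennreal_pow (f x) ?r \<le> ennreal (M powr ?r)"
      using ennreal_pow_mono[OF M(1)[of x], of ?r] r0 M(2) by (simp add: ennreal_pow_def)
  qed
  also have "\<dots> = ennreal (real (card S) * M powr ?r)"
    using S(1) by (simp add: nn_integral_const emeasure_count_space ennreal_mult ennreal_of_nat_eq_real_of_nat mult.commute)
  finally have "Lp_norm (count_space UNIV) r f \<le> ennreal_pow (ennreal (real (card S) * M powr ?r)) (1 / ?r)"
    unfolding Lp_norm_def using False r0 by (simp add: ennreal_pow_mono)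
  also have "\<dots> = ennreal (M * real (card S) powr (1 / ?r))"
    using r0 M(2) by (simp add: ennreal_pow_def powr_mult powr_powr mult.commute)
  finally show ?thesis using False by simp
qed

lemma Lp_norm_count_le_sum:
  assumes r: "1 \<le> r"
  shows "Lp_norm (count_space UNIV) r f \<le> (\<integral>\<^sup>+j. f j \<partial>count_space UNIV)"
proof -
  let ?s = "\<integral>\<^sup>+j. f j \<partial>count_space UNIV"
  have le: "f j \<le> ?s" for j
  proof -
    have "f j = (\<integral>\<^sup>+x. f x * indicator {j} x \<partial>count_space UNIV)"
      by (simp add: nn_integral_indicator_singleton)
    also have "\<dots> \<le> ?s" by (intro nn_integral_mono) (auto simp: indicator_def)
    finally show ?thesis .
  qed
  consider "?s = \<infinity>" | "r = \<infinity>" | "?s < \<infinity>" "r \<noteq> \<infinity>" by (metis less_top infinity_ennreal_def)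
  then show ?thesis
  proof cases
    case 2
    then show ?thesis using le by (simp add: Lp_norm_def) (rule esssup_I; simp)
  next
    case 3
    let ?r = "enn2real r"
    have r1: "1 \<le> ?r" using enn2real_mono[OF r] 3 by (simp add: less_top)
    define \<sigma> where "\<sigma> = enn2real ?s"
    have \<sigma>: "?s = ennreal \<sigma>" "0 \<le> \<sigma>" using 3 by (auto simp: \<sigma>_def)
    have "ennreal_pow (f x) ?r \<le> f x * ennreal (\<sigma> powr (?r - 1))" for x
    proof -
      have fx: "f x < \<infinity>" "enn2real (f x) \<le> \<sigma>" using le[of x] 3 enn2real_mono[OF le[of x]] by (auto simp: \<sigma>_def intro: le_less_trans)
      have "enn2real (f x) powr ?r = enn2real (f x) * enn2real (f x) powr (?r - 1)"
        by (simp add: powr_mult_base)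
      also have "\<dots> \<le> enn2real (f x) * \<sigma> powr (?r - 1)"
        using fx r1 by (intro mult_left_mono powr_mono2) auto
      finally have "ennreal (enn2real (f x) powr ?r) \<le> ennreal (enn2real (f x) * \<sigma> powr (?r - 1))"
        by (rule ennreal_leI)
      then show ?thesis using fx by (simp add: ennreal_pow_def ennreal_mult)
    qed
    then have "(\<integral>\<^sup>+x. ennreal_pow (f x) ?r \<partial>count_space UNIV) \<le> (\<integral>\<^sup>+x. f x * ennreal (\<sigma> powr (?r - 1)) \<partial>count_space UNIV)"
      by (intro nn_integral_mono)
    also have "\<dots> = ?s * ennreal (\<sigma> powr (?r - 1))"
      by (rule nn_integral_multc) simp
    also have "\<dots> = ennreal (\<sigma> powr ?r)"
      unfolding \<sigma>(1) using \<sigma>(2) by (simp add: ennreal_mult[symmetric] powr_mult_base)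
    finally have "Lp_norm (count_space UNIV) r f \<le> ennreal_pow (ennreal (\<sigma> powr ?r)) (1 / ?r)"
      unfolding Lp_norm_def using 3 r1 by (simp add: ennreal_pow_mono)
    also have "\<dots> = ?s" using r1 \<sigma> by (simp add: ennreal_pow_def powr_powr)
    finally show ?thesis .
  qed simp
qed

lemma block_norm_le:
  assumes lp: "littlewood_paley \<psi>" and F: "admissible F"
  shows "dist_Lp_norm 1 (lp_block_hat \<psi> j (freq_dist F)) \<le> (\<integral>\<^sup>+\<xi>. ennreal (cmod (F \<xi> * lp_hat \<psi> j \<xi>)) \<partial>lborel)"
  unfolding dist_Lp_norm_def Lp_norm_1
proof (rule INF_lower, safe)
  note [measurable] = admissible_measurable[OF F] lp_hat_measurable[OF lp]
  show "(\<lambda>\<xi>. F \<xi> * lp_hat \<psi> j \<xi>) \<in> borel_measurable lborel" by measurable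
  fix f assume f: "schwartz f"
  obtain B where B: "\<And>x. cmod (f x) \<le> B"
    using rapid_boundE[OF schwartz_rapid[OF f], of 0] by auto
  show "integrable lborel (\<lambda>\<xi>. F \<xi> * lp_hat \<psi> j \<xi> * f \<xi>)"
    by (rule integrable_bounded_mult[OF admissible_schwartz_mult[OF F lp_hat_schwartz[OF lp]] _ B])
      (simp add: schwartz_measurable[OF f])
  show "lp_block_hat \<psi> j (freq_dist F) f = (LINT \<xi>|lborel. F \<xi> * lp_hat \<psi> j \<xi> * f \<xi>)"
    by (rule lp_block_hat_freq_dist[OF lp F f])
qed

lemma block_norm_ge:
  assumes f: "schwartz f" and B: "\<And>x. cmod (f x) \<le> B" "B > 0"
  shows "ennreal (cmod (v f)) \<le> ennreal B * dist_Lp_norm 1 v"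
proof -
  have "ennreal (cmod (v f)) / ennreal B \<le> dist_Lp_norm 1 v"
    unfolding dist_Lp_norm_def Lp_norm_1
  proof (rule INF_greatest, clarify)
    fix h assume h [measurable]: "h \<in> borel_measurable lborel"
      and hf: "\<forall>f. schwartz f \<longrightarrow> integrable lborel (\<lambda>\<xi>. h \<xi> * f \<xi>) \<and> v f = (LINT \<xi>|lborel. h \<xi> * f \<xi>)"
    have i: "integrable lborel (\<lambda>\<xi>. h \<xi> * f \<xi>)" and v: "v f = (LINT \<xi>|lborel. h \<xi> * f \<xi>)"
      using hf f by auto
    have "ennreal (cmod (v f)) \<le> ennreal (LINT \<xi>|lborel. norm (h \<xi> * f \<xi>))"
      unfolding v by (intro ennreal_leI integral_norm_bound)
    also have "\<dots> = (\<integral>\<^sup>+\<xi>. ennreal (norm (h \<xi> * f \<xi>)) \<partial>lborel)"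
      using i by (intro nn_integral_eq_integral[symmetric]) auto
    also have "\<dots> \<le> (\<integral>\<^sup>+\<xi>. ennreal B * ennreal (cmod (h \<xi>)) \<partial>lborel)"
    proof (rule nn_integral_mono)
      fix \<xi>
      have "norm (h \<xi> * f \<xi>) \<le> B * cmod (h \<xi>)"
        using mult_right_mono[OF B(1)[of \<xi>], of "cmod (h \<xi>)"] by (simp add: norm_mult mult.commute)
      then show "ennreal (norm (h \<xi> * f \<xi>)) \<le> ennreal B * ennreal (cmod (h \<xi>))"
        using B(2) by (simp add: ennreal_mult[symmetric] ennreal_leI)
    qed
    also have "\<dots> = (\<integral>\<^sup>+\<xi>. ennreal (cmod (h \<xi>)) \<partial>lborel) * ennreal B"
      by (subst nn_integral_cmult) (auto simp: mult.commute)
    finally show "ennreal (cmod (v f)) / ennreal B \<le> (\<integral>\<^sup>+\<xi>. ennreal (cmod (h \<xi>)) \<partial>lborel)"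
      using B(2) by (intro divide_le_posI_ennreal) (auto simp: mult.commute)
  qed
  then have "ennreal B * (ennreal (cmod (v f)) / ennreal B) \<le> ennreal B * dist_Lp_norm 1 v"
    by (rule mult_left_mono) simp
  moreover have "ennreal B * (ennreal (cmod (v f)) / ennreal B) = ennreal (cmod (v f))"
    using B(2) by (simp add: divide_ennreal ennreal_mult[symmetric])
  ultimately show ?thesis by simp
qed

lemma powr_minus_1_int: "2 powr (of_int j * (-1)) = (2::real) powi (- j)"
  by (simp add: powr_real_of_int' [symmetric] powr_minus power_int_minus)

lemma fb_norm_pairing:
  assumes lp: "littlewood_paley \<psi>" and F: "admissible F" and f: "schwartz f"
    and B: "\<And>x. cmod (f x) \<le> B" "B > 0" and r: "0 < r"
  shows "ennreal (cmod (LINT \<xi>|lborel. F \<xi> * lp_hat \<psi> j \<xi> * f \<xi>))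
    \<le> ennreal (B * 2 powi j) * fb_norm \<psi> (-1) 1 r (freq_dist F)"
proof -
  let ?d = "dist_Lp_norm 1 (lp_block_hat \<psi> j (freq_dist F))"
  have "ennreal (2 powi (- j)) * ?d \<le> fb_norm \<psi> (-1) 1 r (freq_dist F)"
    using Lp_norm_count_ge[OF r, of "\<lambda>j. ennreal (2 powr (of_int j * (-1))) * dist_Lp_norm 1 (lp_block_hat \<psi> j (freq_dist F))" j]
    unfolding fb_norm_def powr_minus_1_int .
  then have "ennreal (B * 2 powi j) * (ennreal (2 powi (- j)) * ?d) \<le> ennreal (B * 2 powi j) * fb_norm \<psi> (-1) 1 r (freq_dist F)"
    by (rule mult_left_mono) simp
  moreover have "ennreal (B * 2 powi j) * (ennreal (2 powi (- j)) * ?d) = ennreal B * ?d"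
  proof -
    have "ennreal (B * 2 powi j) * ennreal (2 powi (- j)) = ennreal (B * 2 powi j * 2 powi (- j))"
      using B(2) by (subst ennreal_mult) auto
    also have "B * 2 powi j * 2 powi (- j) = B"
      by (simp add: power_int_minus)
    finally show ?thesis by (simp only: mult.assoc[symmetric])
  qed
  ultimately show ?thesis
    using block_norm_ge[OF f B, of "lp_block_hat \<psi> j (freq_dist F)"] lp_block_hat_freq_dist[OF lp F f, of j]
    by simp
qed

lemma fb_norm_le_weighted:
  assumes lp: "littlewood_paley \<psi>" and F: "admissible F" and r: "1 \<le> r"
  shows "fb_norm \<psi> (-1) 1 r (freq_dist F) \<le> (\<integral>\<^sup>+\<xi>. ennreal (8 * psi_bound \<psi> * (cmod (F \<xi>) / norm \<xi>)) \<partial>lborel)"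
proof -
  note [measurable] = admissible_measurable[OF F] lp_hat_measurable[OF lp]
  let ?c = "\<lambda>j. (2::real) powi (- j)"
  have "fb_norm \<psi> (-1) 1 r (freq_dist F) \<le> (\<integral>\<^sup>+j. ennreal (?c j) * dist_Lp_norm 1 (lp_block_hat \<psi> j (freq_dist F)) \<partial>count_space UNIV)"
    unfolding fb_norm_def powr_minus_1_int by (rule Lp_norm_count_le_sum[OF r])
  also have "\<dots> \<le> (\<integral>\<^sup>+j. (\<integral>\<^sup>+\<xi>. ennreal (?c j) * ennreal (cmod (F \<xi> * lp_hat \<psi> j \<xi>)) \<partial>lborel) \<partial>count_space UNIV)"
    by (intro nn_integral_mono, subst nn_integral_cmult) (auto intro!: mult_left_mono block_norm_le[OF lp F])
  also have "\<dots> = (\<integral>\<^sup>+\<xi>. (\<integral>\<^sup>+j. ennreal (?c j) * ennreal (cmod (F \<xi> * lp_hat \<psi> j \<xi>)) \<partial>count_space UNIV) \<partial>lborel)"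
    by (rule nn_integral_count_space_nn_integral[symmetric]) auto
  also have "\<dots> \<le> (\<integral>\<^sup>+\<xi>. ennreal (8 * psi_bound \<psi> * (cmod (F \<xi>) / norm \<xi>)) \<partial>lborel)"
  proof (rule nn_integral_mono_AE)
    have "AE \<xi>::real^3 in lborel. \<xi> \<noteq> 0" by (rule AE_lborel_singleton)
    then show "AE \<xi> in lborel. (\<integral>\<^sup>+j. ennreal (?c j) * ennreal (cmod (F \<xi> * lp_hat \<psi> j \<xi>)) \<partial>count_space UNIV)
      \<le> ennreal (8 * psi_bound \<psi> * (cmod (F \<xi>) / norm \<xi>))"
    proof eventually_elim
      case (elim \<xi>)
      let ?S = "{j. lp_hat \<psi> j \<xi> \<noteq> 0}"
      have n0: "norm \<xi> > 0" using elim by simp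
      have "(\<integral>\<^sup>+j. ennreal (?c j) * ennreal (cmod (F \<xi> * lp_hat \<psi> j \<xi>)) \<partial>count_space UNIV)
        = (\<integral>\<^sup>+j. ennreal (?c j * cmod (F \<xi> * lp_hat \<psi> j \<xi>)) \<partial>count_space ?S)"
        by (subst nn_integral_count_space_eq[of UNIV ?S]) (auto simp: ennreal_mult)
      also have "\<dots> = ennreal (\<Sum>j\<in>?S. ?c j * cmod (F \<xi> * lp_hat \<psi> j \<xi>))"
        using lp_hat_card(1)[OF lp] by (simp add: nn_integral_count_space_finite)
      also have "\<dots> \<le> ennreal (\<Sum>j\<in>?S. 8/3 * psi_bound \<psi> * (cmod (F \<xi>) / norm \<xi>))"
      proof (intro ennreal_leI sum_mono)
        fix j assume "j \<in> ?S"
        then have "norm \<xi> \<le> 8/3 * 2 powi j" using lp_hat_supp[OF lp] by blast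
        then have "?c j \<le> 8/3 / norm \<xi>"
          using n0 by (simp add: power_int_minus field_simps)
        then have "?c j * cmod (F \<xi> * lp_hat \<psi> j \<xi>) \<le> (8/3 / norm \<xi>) * (cmod (F \<xi>) * psi_bound \<psi>)"
          by (intro mult_mono) (auto simp: norm_mult intro!: mult_left_mono lp_hat_le[OF lp])
        then show "?c j * cmod (F \<xi> * lp_hat \<psi> j \<xi>) \<le> 8/3 * psi_bound \<psi> * (cmod (F \<xi>) / norm \<xi>)"
          by (simp add: mult_ac)
      qed
      also have "\<dots> \<le> ennreal (8 * psi_bound \<psi> * (cmod (F \<xi>) / norm \<xi>))"
      proof (rule ennreal_leI)
        let ?y = "8/3 * psi_bound \<psi> * (cmod (F \<xi>) / norm \<xi>)"
        have "real (card ?S) * ?y \<le> 3 * ?y"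
          using lp_hat_card(2)[OF lp, of \<xi>] psi_bound_nonneg[OF lp] by (intro mult_right_mono) auto
        then show "(\<Sum>j\<in>?S. ?y) \<le> 8 * psi_bound \<psi> * (cmod (F \<xi>) / norm \<xi>)" by simp
      qed
      finally show ?case .
    qed
  qed
  finally show ?thesis .
qed

lemma fb_norm_zero: "littlewood_paley \<psi> \<Longrightarrow> 1 \<le> r \<Longrightarrow> fb_norm \<psi> (-1) 1 r 0 = 0"
  using fb_norm_le_weighted[of \<psi> "\<lambda>_. 0" r] by (simp add: freq_dist_zero)

section \<open>The Coriolis symbol\<close>

definition smooth_off_0 :: "(real^3 \<Rightarrow> complex) \<Rightarrow> bool" where
  "smooth_off_0 f \<longleftrightarrow> (\<forall>n. smooth_upto n (- {0}) f)"

lemma open_off_0: "open (- {0 :: real^3})"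
  by (simp add: open_Compl)

lemma smooth_off_0_const [intro, simp]: "smooth_off_0 (\<lambda>_. c)"
  unfolding smooth_off_0_def using smooth_upto_const by blast

lemma smooth_off_0_coord [intro, simp]: "smooth_off_0 (\<lambda>x. complex_of_real (x $ i))"
  unfolding smooth_off_0_def using smooth_upto_coord by blast

lemma smooth_off_0_add [intro]: "smooth_off_0 f \<Longrightarrow> smooth_off_0 g \<Longrightarrow> smooth_off_0 (\<lambda>x. f x + g x)"
  unfolding smooth_off_0_def using smooth_upto_add[OF open_off_0] by blast

lemma smooth_off_0_diff [intro]: "smooth_off_0 f \<Longrightarrow> smooth_off_0 g \<Longrightarrow> smooth_off_0 (\<lambda>x. f x - g x)"
  unfolding smooth_off_0_def using smooth_upto_diff_fun[OF open_off_0] by blast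

lemma smooth_off_0_mult [intro]: "smooth_off_0 f \<Longrightarrow> smooth_off_0 g \<Longrightarrow> smooth_off_0 (\<lambda>x. f x * g x)"
  unfolding smooth_off_0_def using smooth_upto_mult[OF open_off_0] by blast

lemma smooth_off_0_exp [intro]: "smooth_off_0 f \<Longrightarrow> smooth_off_0 (\<lambda>x. exp (f x))"
  unfolding smooth_off_0_def using smooth_upto_exp[OF open_off_0] by blast

lemma smooth_off_0_powser:
  "smooth_off_0 f \<Longrightarrow> (\<And>y::complex. summable (\<lambda>m. b m * y ^ m)) \<Longrightarrow> smooth_off_0 (\<lambda>x. \<Sum>m. b m * f x ^ m)"
  unfolding smooth_off_0_def by (intro allI smooth_upto_powser[OF open_off_0]) blast+

lemma smooth_off_0_inverse:
  "smooth_off_0 f \<Longrightarrow> (\<And>x. x \<noteq> 0 \<Longrightarrow> f x \<noteq> 0) \<Longrightarrow> smooth_off_0 (\<lambda>x. inverse (f x))"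
  unfolding smooth_off_0_def by (intro allI smooth_upto_inverse[OF open_off_0]) auto

lemma smooth_off_0_cong: "smooth_off_0 f \<Longrightarrow> (\<And>x. x \<noteq> 0 \<Longrightarrow> f x = g x) \<Longrightarrow> smooth_off_0 g"
  unfolding smooth_off_0_def using smooth_upto_cong[OF open_off_0] by (metis ComplD singletonI)

lemma test_off_0_mult:
  assumes m: "smooth_off_0 m" and \<phi>: "test_off_0 \<phi>"
  shows "test_off_0 (\<lambda>\<xi>. m \<xi> * \<phi> \<xi>)"
proof -
  obtain a b where ab: "0 < a" "\<And>\<xi>. \<phi> \<xi> \<noteq> 0 \<Longrightarrow> a \<le> norm \<xi> \<and> norm \<xi> \<le> b"
    using \<phi> unfolding test_off_0_def by blast
  have "smooth_upto n UNIV (\<lambda>\<xi>. m \<xi> * \<phi> \<xi>)" for n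
  proof -
    have "smooth_off_0 \<phi>"
    proof -
      have *: "smooth_upto n UNIV f \<Longrightarrow> smooth_upto n (- {0}) f" for n f
        by (induction n arbitrary: f) auto
      then show ?thesis using \<phi> by (auto simp: smooth_off_0_def test_off_0_def smooth_iff)
    qed
    then have 1: "smooth_upto n (- {0}) (\<lambda>\<xi>. m \<xi> * \<phi> \<xi>)"
      using smooth_off_0_mult[OF m] by (simp add: smooth_off_0_def)
    have 2: "smooth_upto n (ball 0 a) (\<lambda>\<xi>. m \<xi> * \<phi> \<xi>)"
      by (rule smooth_upto_cong[OF open_ball smooth_upto_const[of n "ball 0 a" 0]]) (use ab(2) in force)
    have "- {0} \<union> ball 0 a = (UNIV :: (real^3) set)" using ab(1) by auto
    then show ?thesis using smooth_upto_Un[OF 1 2] by simp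
  qed
  moreover have "\<exists>a b. 0 < a \<and> (\<forall>\<xi>. m \<xi> * \<phi> \<xi> \<noteq> 0 \<longrightarrow> a \<le> norm \<xi> \<and> norm \<xi> \<le> b)"
    by (rule exI[of _ a], rule exI[of _ b]) (use ab in auto)
  ultimately show ?thesis
    unfolding test_off_0_def smooth_iff by blast
qed

lemma vector_4: "(vector [a, b, c, d] :: ('a::zero)^4) $ 1 = a" "(vector [a, b, c, d] :: 'a^4) $ 2 = b"
  "(vector [a, b, c, d] :: 'a^4) $ 3 = c" "(vector [a, b, c, d] :: 'a^4) $ 4 = d"
  unfolding vector_def by auto

lemma freq4_simps [simp]: "freq4 \<xi> $ 1 = \<xi> $ 1" "freq4 \<xi> $ 2 = \<xi> $ 2" "freq4 \<xi> $ 3 = \<xi> $ 3" "freq4 \<xi> $ 4 = 0"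
  by (simp_all add: freq4_def vector_4)

lemma freq4_le: "\<bar>freq4 \<xi> $ j\<bar> \<le> norm \<xi>"
  using component_le_norm_cart[of \<xi>] by (cases j rule: exhaust_4[THEN disjE]) auto

lemma smooth_off_0_freq4 [intro, simp]: "smooth_off_0 (\<lambda>\<xi>. complex_of_real (freq4 \<xi> $ j))"
  using exhaust_4[of j] by auto

lemma smooth_off_0_leray: "smooth_off_0 (\<lambda>\<xi>. complex_of_real (leray \<xi> $ j $ k))"
proof (rule smooth_off_0_cong)
  let ?n = "\<lambda>\<xi>::real^3. complex_of_real (\<xi> $ 1) * complex_of_real (\<xi> $ 1) + complex_of_real (\<xi> $ 2) * complex_of_real (\<xi> $ 2)
      + complex_of_real (\<xi> $ 3) * complex_of_real (\<xi> $ 3)"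
  have n: "?n \<xi> = complex_of_real ((norm \<xi>)\<^sup>2)" for \<xi>
    by (simp only: norm_sq_3) (simp add: power2_eq_square)
  show "smooth_off_0 (\<lambda>\<xi>. (if j = k then 1 else 0) - complex_of_real (freq4 \<xi> $ j) * complex_of_real (freq4 \<xi> $ k) * inverse (?n \<xi>))"
    by (intro smooth_off_0_diff smooth_off_0_mult smooth_off_0_inverse smooth_off_0_const smooth_off_0_freq4 smooth_off_0_add smooth_off_0_coord)
      (simp only: n, simp)
  show "(if j = k then 1 else 0) - complex_of_real (freq4 \<xi> $ j) * complex_of_real (freq4 \<xi> $ k) * inverse (?n \<xi>)
    = complex_of_real (leray \<xi> $ j $ k)" for \<xi>
    unfolding n by (simp add: leray_def divide_inverse)
qed

text \<open>\<open>sinc (x\<^sup>2) = sin x / x\<close> and \<open>cosc (x\<^sup>2) = (1 - cos x) / x\<^sup>2\<close>.\<close>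

definition sinc :: "real \<Rightarrow> real" where "sinc y = (\<Sum>m. ((- 1) ^ m / fact (2 * m + 1)) * y ^ m)"
definition cosc :: "real \<Rightarrow> real" where "cosc y = (\<Sum>m. ((- 1) ^ m / fact (2 * m + 2)) * y ^ m)"

lemma summable_fact_bound:
  fixes y :: "'a :: {real_normed_field, banach}"
  assumes "\<And>m. norm (b m :: 'a) \<le> 1 / fact m"
  shows "summable (\<lambda>m. norm (b m * y ^ m))" "(\<Sum>m. norm (b m * y ^ m)) \<le> exp (norm y)"
proof -
  have S: "(\<lambda>m. norm y ^ m / fact m) sums exp (norm y)"
    using exp_converges[of "norm y"] by (simp add: divide_inverse mult.commute)
  have le: "norm (b m * y ^ m) \<le> norm y ^ m / fact m" for m
    using mult_right_mono[OF assms[of m], of "norm y ^ m"] by (simp add: norm_mult norm_power)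
  show s: "summable (\<lambda>m. norm (b m * y ^ m))"
    by (rule summable_comparison_test'[OF sums_summable[OF S], of 0]) (use le in simp)
  show "(\<Sum>m. norm (b m * y ^ m)) \<le> exp (norm y)"
    using suminf_le[OF le s sums_summable[OF S]] sums_unique[OF S] by simp
qed

lemma coeff_bounds:
  "norm ((- 1) ^ m / fact (2 * m + 1) :: 'a :: real_normed_field) \<le> 1 / fact m"
  "norm ((- 1) ^ m / fact (2 * m + 2) :: 'a :: real_normed_field) \<le> 1 / fact m"
proof -
  have "(fact m :: real) \<le> fact (2 * m + 1)" "(fact m :: real) \<le> fact (2 * m + 2)"
    by (intro fact_mono; simp)+
  then show "norm ((- 1) ^ m / fact (2 * m + 1) :: 'a) \<le> 1 / fact m"
    "norm ((- 1) ^ m / fact (2 * m + 2) :: 'a) \<le> 1 / fact m"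
    by (simp_all only: norm_divide norm_power norm_minus_cancel norm_one power_one norm_fact, auto intro!: divide_left_mono)
qed

lemmas sinc_summable = summable_fact_bound(1)[OF coeff_bounds(1)]
lemmas cosc_summable = summable_fact_bound(1)[OF coeff_bounds(2)]

lemma sinc_bound: "\<bar>sinc y\<bar> \<le> exp \<bar>y\<bar>" and cosc_bound: "\<bar>cosc y\<bar> \<le> exp \<bar>y\<bar>"
  using summable_norm[OF sinc_summable[of y]] summable_fact_bound(2)[OF coeff_bounds(1), of y]
    summable_norm[OF cosc_summable[of y]] summable_fact_bound(2)[OF coeff_bounds(2), of y]
  by (simp_all add: sinc_def cosc_def)

lemma sinc_complex: "complex_of_real (sinc y) = (\<Sum>m. ((- 1) ^ m / fact (2 * m + 1)) * complex_of_real y ^ m)"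
  and cosc_complex: "complex_of_real (cosc y) = (\<Sum>m. ((- 1) ^ m / fact (2 * m + 2)) * complex_of_real y ^ m)"
  unfolding sinc_def cosc_def
  using suminf_of_real[OF summable_norm_cancel[OF sinc_summable[of y]], where 'a = complex]
    suminf_of_real[OF summable_norm_cancel[OF cosc_summable[of y]], where 'a = complex]
  by simp_all

lemma measurable_sinc [measurable]: "sinc \<in> borel_measurable borel"
  unfolding sinc_def[abs_def] by measurable

lemma measurable_cosc [measurable]: "cosc \<in> borel_measurable borel"
  unfolding cosc_def[abs_def] by measurable

lemma sums_odd_part: "(\<lambda>n. if odd n then (- y) ^ ((n - 1) div 2) / fact n else 0) sums sinc (y :: real)"
proof -
  have "(\<lambda>m. ((- 1) ^ m / fact (2 * m + 1)) * y ^ m) sums sinc y"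
    unfolding sinc_def using summable_sums[OF summable_norm_cancel[OF sinc_summable[of y]]] .
  from sums_if'[OF this]
  show ?thesis
  proof (rule sums_cong[THEN iffD1, rotated])
    fix n show "(if even n then 0 else (- 1) ^ ((n - 1) div 2) / fact (2 * ((n - 1) div 2) + 1) * y ^ ((n - 1) div 2))
      = (if odd n then (- y) ^ ((n - 1) div 2) / fact n else 0)"
      by (auto elim!: oddE simp: power_minus[of y])
  qed
qed

lemma sums_even_part: "(\<lambda>n. if even n \<and> n \<noteq> 0 then (- y) ^ ((n - 2) div 2) / fact n else 0) sums cosc (y :: real)"
proof -
  have "(\<lambda>m. ((- 1) ^ m / fact (2 * m + 2)) * y ^ m) sums cosc y"
    unfolding cosc_def using summable_sums[OF summable_norm_cancel[OF cosc_summable[of y]]] .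
  from sums_if'[OF this]
  have "(\<lambda>n. if even (Suc n) \<and> Suc n \<noteq> 0 then (- y) ^ ((Suc n - 2) div 2) / fact (Suc n) else 0) sums cosc y"
  proof (rule sums_cong[THEN iffD1, rotated])
    fix n show "(if even n then 0 else (- 1) ^ ((n - 1) div 2) / fact (2 * ((n - 1) div 2) + 2) * y ^ ((n - 1) div 2))
      = (if even (Suc n) \<and> Suc n \<noteq> 0 then (- y) ^ ((Suc n - 2) div 2) / fact (Suc n) else 0)"
      by (auto elim!: oddE simp: power_minus[of y])
  qed
  then show ?thesis by (subst (asm) sums_Suc_iff) simp
qed

lemma matrix_exp_cubic:
  assumes M: "M ** M ** M = (- y) *\<^sub>R M"
  shows "matrix_exp M = mat 1 + sinc y *\<^sub>R M + cosc y *\<^sub>R (M ** M)"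
proof -
  let ?pw = "\<lambda>n. (((**) M) ^^ n) (mat 1)"
  have sm: "M ** (a *\<^sub>R X) = a *\<^sub>R (M ** X)" for a X
    by (simp add: matrix_scalar_ac scalar_mult_eq_scaleR[symmetric] matrix_matrix_mult_def vec_eq_iff sum_distrib_left mult_ac)
  have pw: "?pw (Suc (2 * m)) = ((- y) ^ m) *\<^sub>R M \<and> ?pw (Suc (Suc (2 * m))) = ((- y) ^ m) *\<^sub>R (M ** M)" for m
  proof (induction m)
    case (Suc m)
    have "2 * Suc m = Suc (Suc (2 * m))" by simp
    then have "?pw (Suc (2 * Suc m)) = M ** ?pw (Suc (Suc (2 * m)))" by simp
    also have "\<dots> = M ** (((- y) ^ m) *\<^sub>R (M ** M))" by (simp only: Suc.IH)
    also have "\<dots> = ((- y) ^ m) *\<^sub>R (M ** M ** M)" by (simp only: sm matrix_mul_assoc)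
    finally have 1: "?pw (Suc (2 * Suc m)) = ((- y) ^ Suc m) *\<^sub>R M" by (simp add: M mult.commute)
    have "?pw (Suc (Suc (2 * Suc m))) = M ** ?pw (Suc (2 * Suc m))" by (simp only: funpow.simps comp_def)
    with 1 show ?case by (simp only: sm)
  qed (simp add: matrix_mul_rid)
  have t: "(1 / fact n) *\<^sub>R ?pw n = (if n = 0 then 1 else 0) *\<^sub>R mat 1
     + (if odd n then (- y) ^ ((n - 1) div 2) / fact n else 0) *\<^sub>R M
     + (if even n \<and> n \<noteq> 0 then (- y) ^ ((n - 2) div 2) / fact n else 0) *\<^sub>R (M ** M)" for n
  proof -
    consider "n = 0" | m where "n = Suc (2 * m)" | m where "n = Suc (Suc (2 * m))"
    proof (cases "odd n")
      case True then show ?thesis using that by (auto elim!: oddE)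
    next
      case False
      then obtain k where "n = 2 * k" by (auto elim!: evenE)
      then show ?thesis using that by (cases k) auto
    qed
    then show ?thesis
    proof cases
      case (2 m)
      then show ?thesis using pw[of m] by (simp only: 2) simp
    next
      case (3 m)
      then show ?thesis using pw[of m] by (simp only: 3) simp
    qed simp
  qed
  have "(\<lambda>n. (1 / fact n) *\<^sub>R ?pw n) sums (1 *\<^sub>R mat 1 + sinc y *\<^sub>R M + cosc y *\<^sub>R (M ** M))"
    unfolding t
    by (intro sums_add sums_scaleR_left sums_odd_part sums_even_part) (use sums_If_finite[of "\<lambda>n. n = 0" "\<lambda>_. 1::real"] in simp)
  then show ?thesis unfolding matrix_exp_def by (simp add: sums_iff)
qed

definition proj_matrix :: "real \<Rightarrow> real \<Rightarrow> real \<Rightarrow> real^4^4" where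
  "proj_matrix a b c = vector
     [vector [1 - a * a, - (a * b), - (a * c), 0],
      vector [- (a * b), 1 - b * b, - (b * c), 0],
      vector [- (a * c), - (b * c), 1 - c * c, 0],
      vector [0, 0, 0, 1]]"

definition gen_matrix :: "real \<Rightarrow> real \<Rightarrow> real \<Rightarrow> real \<Rightarrow> real \<Rightarrow> real \<Rightarrow> real^4^4" where
  "gen_matrix g \<Omega> N a b c = vector
     [vector [0, - \<Omega> * (c * c), \<Omega> * (b * c), g * (a * c)],
      vector [\<Omega> * (c * c), 0, - \<Omega> * (a * c), g * (b * c)],
      vector [- \<Omega> * (b * c), \<Omega> * (a * c), 0, - g * (a * a + b * b)],
      vector [- (N * N * (a * c)), - (N * N * (b * c)), N * N * (a * a + b * b), 0]]"

lemma matrix_mult_4: "((X::real^4^4) ** Y) $ i $ j = X $ i $ 1 * Y $ 1 $ j + X $ i $ 2 * Y $ 2 $ j + X $ i $ 3 * Y $ 3 $ j + X $ i $ 4 * Y $ 4 $ j"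
  by (simp add: matrix_matrix_mult_def sum_4)

lemma proj_coupling_proj:
  assumes "a * a + b * b + c * c = 1"
  shows "proj_matrix a b c ** coupling g \<Omega> N ** proj_matrix a b c = gen_matrix g \<Omega> N a b c"
proof -
  have cc: "c * c = 1 - a * a - b * b" using assms by simp
  show ?thesis
    unfolding vec_eq_iff forall_4 matrix_mult_4 proj_matrix_def coupling_def gen_matrix_def vector_4
    by (simp add: power2_eq_square cc) (simp add: algebra_simps)
qed

lemma gen_matrix_cubic:
  "gen_matrix g \<Omega> N a b c ** gen_matrix g \<Omega> N a b c ** gen_matrix g \<Omega> N a b c
    = (- ((a * a + b * b + c * c) * (\<Omega> * \<Omega> * (c * c) + g * (N * N) * (a * a + b * b)))) *\<^sub>R gen_matrix g \<Omega> N a b c"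
  unfolding vec_eq_iff forall_4 matrix_mult_4 gen_matrix_def vector_4 vector_scaleR_component
  by (intro conjI; simp; algebra)

lemma leray_eq_proj:
  "leray \<xi> = proj_matrix (\<xi> $ 1 / norm \<xi>) (\<xi> $ 2 / norm \<xi>) (\<xi> $ 3 / norm \<xi>)"
  unfolding vec_eq_iff forall_4 proj_matrix_def vector_4
  by (simp add: leray_def power2_eq_square)

lemma unit_direction:
  assumes "\<xi> \<noteq> (0::real^3)"
  shows "\<xi> $ 1 / norm \<xi> * (\<xi> $ 1 / norm \<xi>) + \<xi> $ 2 / norm \<xi> * (\<xi> $ 2 / norm \<xi>) + \<xi> $ 3 / norm \<xi> * (\<xi> $ 3 / norm \<xi>) = 1"
proof -
  have "(\<xi> $ 1)\<^sup>2 / (norm \<xi>)\<^sup>2 + (\<xi> $ 2)\<^sup>2 / (norm \<xi>)\<^sup>2 + (\<xi> $ 3)\<^sup>2 / (norm \<xi>)\<^sup>2 = 1"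
    using assms by (simp only: add_divide_distrib[symmetric] norm_sq_3[symmetric]) simp
  then show ?thesis by (simp add: power2_eq_square)
qed

definition freq_sq :: "real \<Rightarrow> real \<Rightarrow> real \<Rightarrow> real^3 \<Rightarrow> real" where
  "freq_sq g \<Omega> N \<xi> = (\<Omega>\<^sup>2 * (\<xi> $ 3)\<^sup>2 + g * N\<^sup>2 * ((\<xi> $ 1)\<^sup>2 + (\<xi> $ 2)\<^sup>2)) / (norm \<xi>)\<^sup>2"

definition generator :: "real \<Rightarrow> real \<Rightarrow> real \<Rightarrow> real^3 \<Rightarrow> real^4^4" where
  "generator g \<Omega> N \<xi> = leray \<xi> ** coupling g \<Omega> N ** leray \<xi>"

lemma generator_cubic:
  assumes "\<xi> \<noteq> 0"
  shows "generator g \<Omega> N \<xi> ** generator g \<Omega> N \<xi> ** generator g \<Omega> N \<xi> = (- freq_sq g \<Omega> N \<xi>) *\<^sub>R generator g \<Omega> N \<xi>"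
proof -
  have "\<Omega> * \<Omega> * (\<xi> $ 3 / norm \<xi> * (\<xi> $ 3 / norm \<xi>))
     + g * (N * N) * (\<xi> $ 1 / norm \<xi> * (\<xi> $ 1 / norm \<xi>) + \<xi> $ 2 / norm \<xi> * (\<xi> $ 2 / norm \<xi>)) = freq_sq g \<Omega> N \<xi>"
    by (simp add: freq_sq_def power2_eq_square add_divide_distrib[symmetric] distrib_left)
  then show ?thesis
    unfolding generator_def leray_eq_proj proj_coupling_proj[OF unit_direction[OF assms]] gen_matrix_cubic unit_direction[OF assms]
    by simp
qed

text \<open>As \<open>A ** A ** A = - freq_sq *\<^sub>R A\<close> for the generator \<open>A\<close>, this is \<open>exp (- t A)\<close>.\<close>

definition coriolis_symbol :: "real \<Rightarrow> real \<Rightarrow> real \<Rightarrow> real \<Rightarrow> real^3 \<Rightarrow> real^4^4" where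
  "coriolis_symbol g \<Omega> N t \<xi> = mat 1 - (t * sinc (t\<^sup>2 * freq_sq g \<Omega> N \<xi>)) *\<^sub>R generator g \<Omega> N \<xi>
     + (t\<^sup>2 * cosc (t\<^sup>2 * freq_sq g \<Omega> N \<xi>)) *\<^sub>R (generator g \<Omega> N \<xi> ** generator g \<Omega> N \<xi>)"

lemma scaleR_matrix_mult:
  fixes X Y :: "real^4^4"
  shows "(a *\<^sub>R X) ** Y = a *\<^sub>R (X ** Y)" "X ** (a *\<^sub>R Y) = a *\<^sub>R (X ** Y)"
  by (simp_all add: vec_eq_iff matrix_mult_4 algebra_simps)

lemma semigroup_symbol_eq:
  assumes "\<xi> \<noteq> 0"
  shows "semigroup_symbol \<nu> g \<Omega> N t \<xi> = exp (- \<nu> * (norm \<xi>)\<^sup>2 * t) *\<^sub>R coriolis_symbol g \<Omega> N t \<xi>"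
proof -
  let ?A = "generator g \<Omega> N \<xi>"
  let ?M = "(- t) *\<^sub>R ?A"
  have "?M ** ?M ** ?M = (- t * - t * - t) *\<^sub>R (?A ** ?A ** ?A)"
    by (simp only: scaleR_matrix_mult scaleR_scaleR mult_ac)
  also have "\<dots> = (- (t\<^sup>2 * freq_sq g \<Omega> N \<xi>)) *\<^sub>R ?M"
    by (simp add: generator_cubic[OF assms] power2_eq_square)
  finally have "matrix_exp ?M = mat 1 + sinc (t\<^sup>2 * freq_sq g \<Omega> N \<xi>) *\<^sub>R ?M + cosc (t\<^sup>2 * freq_sq g \<Omega> N \<xi>) *\<^sub>R (?M ** ?M)"
    by (rule matrix_exp_cubic)
  also have "?M ** ?M = t\<^sup>2 *\<^sub>R (?A ** ?A)"
    by (simp only: scaleR_matrix_mult scaleR_scaleR) (simp add: power2_eq_square)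
  finally show ?thesis
    unfolding semigroup_symbol_def generator_def[symmetric] coriolis_symbol_def by (simp add: mult.commute)
qed

definition duhamel_symbol :: "real \<Rightarrow> real \<Rightarrow> real \<Rightarrow> real \<Rightarrow> real^3 \<Rightarrow> real^4^4" where
  "duhamel_symbol g \<Omega> N t \<xi> = coriolis_symbol g \<Omega> N t \<xi> ** leray \<xi>"

lemma smooth_off_0_matrix_mult:
  fixes X Y :: "real^3 \<Rightarrow> real^4^4"
  assumes "\<And>i j. smooth_off_0 (\<lambda>\<xi>. complex_of_real (X \<xi> $ i $ j))" "\<And>i j. smooth_off_0 (\<lambda>\<xi>. complex_of_real (Y \<xi> $ i $ j))"
  shows "smooth_off_0 (\<lambda>\<xi>. complex_of_real ((X \<xi> ** Y \<xi> :: real^4^4) $ i $ j))"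
  unfolding matrix_mult_4 of_real_add of_real_mult
  by (intro smooth_off_0_add smooth_off_0_mult assms)

lemma smooth_off_0_generator: "smooth_off_0 (\<lambda>\<xi>. complex_of_real (generator g \<Omega> N \<xi> $ i $ j))"
  unfolding generator_def
  by (intro smooth_off_0_matrix_mult smooth_off_0_leray) simp

lemma smooth_off_0_freq_sq: "smooth_off_0 (\<lambda>\<xi>. complex_of_real (freq_sq g \<Omega> N \<xi>))"
proof (rule smooth_off_0_cong)
  let ?x = "\<lambda>i (\<xi>::real^3). complex_of_real (\<xi> $ i)"
  let ?n = "\<lambda>\<xi>. ?x 1 \<xi> * ?x 1 \<xi> + ?x 2 \<xi> * ?x 2 \<xi> + ?x 3 \<xi> * ?x 3 \<xi>"
  have n: "?n \<xi> = complex_of_real ((norm \<xi>)\<^sup>2)" for \<xi>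
    by (simp only: norm_sq_3) (simp add: power2_eq_square)
  show "smooth_off_0 (\<lambda>\<xi>. (of_real (\<Omega>\<^sup>2) * (?x 3 \<xi> * ?x 3 \<xi>) + of_real (g * N\<^sup>2) * (?x 1 \<xi> * ?x 1 \<xi> + ?x 2 \<xi> * ?x 2 \<xi>)) * inverse (?n \<xi>))"
    by (intro smooth_off_0_mult smooth_off_0_inverse smooth_off_0_const smooth_off_0_add smooth_off_0_coord)
      (simp only: n, simp)
  show "(of_real (\<Omega>\<^sup>2) * (?x 3 \<xi> * ?x 3 \<xi>) + of_real (g * N\<^sup>2) * (?x 1 \<xi> * ?x 1 \<xi> + ?x 2 \<xi> * ?x 2 \<xi>)) * inverse (?n \<xi>)
    = complex_of_real (freq_sq g \<Omega> N \<xi>)" for \<xi>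
    unfolding n by (simp add: freq_sq_def divide_inverse power2_eq_square)
qed

lemma smooth_off_0_coriolis: "smooth_off_0 (\<lambda>\<xi>. complex_of_real (coriolis_symbol g \<Omega> N t \<xi> $ i $ j))"
proof -
  have y: "smooth_off_0 (\<lambda>\<xi>. complex_of_real (t\<^sup>2 * freq_sq g \<Omega> N \<xi>))"
    using smooth_off_0_mult[OF smooth_off_0_const[of "of_real (t\<^sup>2)"] smooth_off_0_freq_sq[of g \<Omega> N]] by simp
  have s: "smooth_off_0 (\<lambda>\<xi>. complex_of_real (sinc (t\<^sup>2 * freq_sq g \<Omega> N \<xi>)))"
    unfolding sinc_complex by (rule smooth_off_0_powser[OF y]) (rule summable_norm_cancel[OF sinc_summable])
  have c: "smooth_off_0 (\<lambda>\<xi>. complex_of_real (cosc (t\<^sup>2 * freq_sq g \<Omega> N \<xi>)))"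
    unfolding cosc_complex by (rule smooth_off_0_powser[OF y]) (rule summable_norm_cancel[OF cosc_summable])
  show ?thesis
    unfolding coriolis_symbol_def vector_add_component vector_minus_component vector_scaleR_component of_real_add of_real_diff real_scaleR_def of_real_mult
    by (intro smooth_off_0_add smooth_off_0_diff smooth_off_0_mult smooth_off_0_matrix_mult smooth_off_0_generator s c smooth_off_0_const)
qed

lemma smooth_off_0_heat: "smooth_off_0 (\<lambda>\<xi>. complex_of_real (exp (- \<nu> * (norm \<xi>)\<^sup>2 * t)))"
proof -
  let ?x = "\<lambda>i (\<xi>::real^3). complex_of_real (\<xi> $ i)"
  have e: "complex_of_real (exp (- \<nu> * (norm \<xi>)\<^sup>2 * t)) = exp (of_real (- \<nu> * t) * (?x 1 \<xi> * ?x 1 \<xi> + ?x 2 \<xi> * ?x 2 \<xi> + ?x 3 \<xi> * ?x 3 \<xi>))" for \<xi>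
    by (simp only: norm_sq_3 exp_of_real[symmetric]) (simp add: power2_eq_square algebra_simps)
  show ?thesis
    unfolding e by (intro smooth_off_0_exp smooth_off_0_mult smooth_off_0_add smooth_off_0_const smooth_off_0_coord)
qed

lemma smooth_off_0_semigroup: "smooth_off_0 (\<lambda>\<xi>. complex_of_real (semigroup_symbol \<nu> g \<Omega> N t \<xi> $ i $ j))"
  by (rule smooth_off_0_cong[OF smooth_off_0_mult[OF smooth_off_0_heat[of \<nu> t] smooth_off_0_coriolis[of g \<Omega> N t i j]]])
    (simp add: semigroup_symbol_eq)

lemma smooth_off_0_semigroup_leray: "smooth_off_0 (\<lambda>\<xi>. complex_of_real ((semigroup_symbol \<nu> g \<Omega> N t \<xi> ** leray \<xi>) $ i $ j))"
  by (intro smooth_off_0_matrix_mult smooth_off_0_semigroup smooth_off_0_leray)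

lemma matrix_mult_entry_bound:
  fixes X Y :: "real^4^4"
  assumes "\<And>i j. \<bar>X $ i $ j\<bar> \<le> a" "\<And>i j. \<bar>Y $ i $ j\<bar> \<le> b"
  shows "\<bar>(X ** Y) $ i $ j\<bar> \<le> 4 * a * b"
proof -
  have *: "\<bar>X $ i $ k * Y $ k $ j\<bar> \<le> a * b" for k
    unfolding abs_mult using assms(1)[of i k] order_trans[OF abs_ge_zero assms(1)[of i k]]
    by (intro mult_mono assms) auto
  then show ?thesis
    unfolding matrix_mult_4
    using *[of 1] *[of 2] *[of 3] *[of 4] abs_triangle_ineq[of "X $ i $ 1 * Y $ 1 $ j + X $ i $ 2 * Y $ 2 $ j + X $ i $ 3 * Y $ 3 $ j" "X $ i $ 4 * Y $ 4 $ j"]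
      abs_triangle_ineq[of "X $ i $ 1 * Y $ 1 $ j + X $ i $ 2 * Y $ 2 $ j" "X $ i $ 3 * Y $ 3 $ j"]
      abs_triangle_ineq[of "X $ i $ 1 * Y $ 1 $ j" "X $ i $ 2 * Y $ 2 $ j"]
    by linarith
qed

lemma leray_entry_bound: "\<bar>leray \<xi> $ i $ j\<bar> \<le> 2"
proof (cases "\<xi> = 0")
  case False
  have "\<bar>freq4 \<xi> $ i * freq4 \<xi> $ j\<bar> \<le> norm \<xi> * norm \<xi>"
    unfolding abs_mult by (intro mult_mono freq4_le) auto
  then have "\<bar>freq4 \<xi> $ i * freq4 \<xi> $ j / (norm \<xi>)\<^sup>2\<bar> \<le> 1"
    using False by (simp add: power2_eq_square divide_le_eq)
  moreover have "\<bar>leray \<xi> $ i $ j\<bar> \<le> \<bar>if i = j then 1 else 0\<bar> + \<bar>freq4 \<xi> $ i * freq4 \<xi> $ j / (norm \<xi>)\<^sup>2\<bar>"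
    unfolding leray_def by (simp only: vec_lambda_beta abs_triangle_ineq4)
  ultimately show ?thesis by (auto split: if_splits)
qed (simp add: leray_def)

lemma freq_sq_bounds:
  assumes "g \<ge> 0"
  shows "0 \<le> freq_sq g \<Omega> N \<xi>" "freq_sq g \<Omega> N \<xi> \<le> \<Omega>\<^sup>2 + g * N\<^sup>2"
proof -
  show "0 \<le> freq_sq g \<Omega> N \<xi>" using assms by (simp add: freq_sq_def)
  show "freq_sq g \<Omega> N \<xi> \<le> \<Omega>\<^sup>2 + g * N\<^sup>2"
  proof (cases "\<xi> = 0")
    case False
    have "\<Omega>\<^sup>2 * (\<xi> $ 3)\<^sup>2 + g * N\<^sup>2 * ((\<xi> $ 1)\<^sup>2 + (\<xi> $ 2)\<^sup>2) \<le> \<Omega>\<^sup>2 * (norm \<xi>)\<^sup>2 + g * N\<^sup>2 * (norm \<xi>)\<^sup>2"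
      using assms by (intro add_mono mult_left_mono) (auto simp: norm_sq_3)
    then show ?thesis using False by (simp add: freq_sq_def divide_le_eq distrib_right)
  qed (use assms in \<open>simp add: freq_sq_def\<close>)
qed

lemma coriolis_near_identity:
  assumes g: "g \<ge> 0"
  obtains K where "K \<ge> 0" "\<And>t \<xi> i j. 0 \<le> t \<Longrightarrow> t \<le> T \<Longrightarrow> \<bar>duhamel_symbol g \<Omega> N t \<xi> $ i $ j - leray \<xi> $ i $ j\<bar> \<le> K * t"
proof -
  define \<beta> where "\<beta> = Max (range (\<lambda>(i, j). \<bar>coupling g \<Omega> N $ i $ j\<bar>))"
  have \<beta>: "\<bar>coupling g \<Omega> N $ i $ j\<bar> \<le> \<beta>" for i j
    unfolding \<beta>_def by (rule Max_ge) (auto intro: range_eqI[of _ _ "(i, j)"])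
  have \<beta>0: "0 \<le> \<beta>" using order_trans[OF abs_ge_zero \<beta>] .
  define a where "a = 4 * (4 * 2 * \<beta>) * 2"
  have A: "\<bar>generator g \<Omega> N \<xi> $ i $ j\<bar> \<le> a" for \<xi> i j
    unfolding generator_def a_def by (intro matrix_mult_entry_bound leray_entry_bound \<beta>)
  have a0: "0 \<le> a" using \<beta>0 by (simp add: a_def)
  define E where "E = exp (\<bar>T\<bar>\<^sup>2 * (\<Omega>\<^sup>2 + g * N\<^sup>2))"
  have E1: "1 \<le> E" unfolding E_def using g by simp
  define K where "K = 4 * (E * a + \<bar>T\<bar> * E * (4 * a * a)) * 2"
  have "\<bar>duhamel_symbol g \<Omega> N t \<xi> $ i $ j - leray \<xi> $ i $ j\<bar> \<le> K * t" if t: "0 \<le> t" "t \<le> T" for t \<xi> i j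
  proof -
    let ?y = "t\<^sup>2 * freq_sq g \<Omega> N \<xi>" and ?A = "generator g \<Omega> N \<xi>"
    have "\<bar>?y\<bar> \<le> \<bar>T\<bar>\<^sup>2 * (\<Omega>\<^sup>2 + g * N\<^sup>2)"
      unfolding abs_mult using freq_sq_bounds[OF g, of \<Omega> N \<xi>] t by (intro mult_mono) (auto intro: power_mono)
    then have y: "exp \<bar>?y\<bar> \<le> E" by (simp add: E_def)
    have S: "\<bar>sinc ?y\<bar> \<le> E" and C: "\<bar>cosc ?y\<bar> \<le> E" using sinc_bound[of ?y] cosc_bound[of ?y] y by linarith+
    let ?D = "(- (t * sinc ?y)) *\<^sub>R ?A + (t\<^sup>2 * cosc ?y) *\<^sub>R (?A ** ?A)"
    have D: "\<bar>?D $ i $ j\<bar> \<le> t * (E * a + \<bar>T\<bar> * E * (4 * a * a))" for i j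
    proof -
      have "\<bar>(t * sinc ?y) * ?A $ i $ j\<bar> \<le> t * (E * a)"
        unfolding abs_mult mult.assoc using t a0 E1 by (intro mult_mono S A) auto
      moreover have "\<bar>(t\<^sup>2 * cosc ?y) * (?A ** ?A) $ i $ j\<bar> \<le> t * (\<bar>T\<bar> * E * (4 * a * a))"
      proof -
        have "\<bar>(t\<^sup>2 * cosc ?y) * (?A ** ?A) $ i $ j\<bar> = t * ((\<bar>t\<bar> * \<bar>cosc ?y\<bar>) * \<bar>(?A ** ?A) $ i $ j\<bar>)"
          using t by (simp add: abs_mult power2_eq_square)
        also have "\<dots> \<le> t * ((\<bar>T\<bar> * E) * (4 * a * a))"
          using t a0 E1 by (intro mult_left_mono mult_mono C matrix_mult_entry_bound A) auto
        finally show ?thesis by simp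
      qed
      moreover have "\<bar>?D $ i $ j\<bar> \<le> \<bar>(t * sinc ?y) * ?A $ i $ j\<bar> + \<bar>(t\<^sup>2 * cosc ?y) * (?A ** ?A) $ i $ j\<bar>"
        by simp
      ultimately show ?thesis by (simp add: distrib_left)
    qed
    have "duhamel_symbol g \<Omega> N t \<xi> = leray \<xi> + ?D ** leray \<xi>"
    proof -
      have "coriolis_symbol g \<Omega> N t \<xi> = mat 1 + ?D" by (simp add: coriolis_symbol_def)
      moreover have "(X + Y) ** Z = X ** Z + Y ** Z" for X Y Z :: "real^4^4"
        by (simp add: vec_eq_iff matrix_mult_4 algebra_simps)
      ultimately show ?thesis by (simp only: duhamel_symbol_def matrix_mul_lid)
    qed
    then have "\<bar>duhamel_symbol g \<Omega> N t \<xi> $ i $ j - leray \<xi> $ i $ j\<bar> = \<bar>(?D ** leray \<xi>) $ i $ j\<bar>" by simp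
    also have "\<dots> \<le> 4 * (t * (E * a + \<bar>T\<bar> * E * (4 * a * a))) * 2"
      by (intro matrix_mult_entry_bound D leray_entry_bound)
    finally show ?thesis by (simp add: K_def mult_ac)
  qed
  moreover have "0 \<le> K" unfolding K_def using a0 E1 by simp
  ultimately show ?thesis using that by blast
qed

lemma measurable_matrix_mult:
  fixes X Y :: "'a \<Rightarrow> real^4^4"
  assumes "\<And>i j. (\<lambda>x. X x $ i $ j) \<in> borel_measurable M" "\<And>i j. (\<lambda>x. Y x $ i $ j) \<in> borel_measurable M"
  shows "(\<lambda>x. (X x ** Y x :: real^4^4) $ i $ j) \<in> borel_measurable M"
  unfolding matrix_mult_4 using assms by measurable

lemma measurable_freq4 [measurable]: "(\<lambda>\<xi>. freq4 \<xi> $ j) \<in> borel_measurable borel"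
  using exhaust_4[of j] by auto

lemma measurable_leray [measurable]: "(\<lambda>\<xi>. leray \<xi> $ i $ j) \<in> borel_measurable borel"
  unfolding leray_def by simp

lemma measurable_duhamel_symbol [measurable]:
  assumes [measurable]: "h \<in> borel_measurable M" "k \<in> borel_measurable M"
  shows "(\<lambda>x. duhamel_symbol g \<Omega> N (h x) (k x) $ i $ j) \<in> borel_measurable M"
proof -
  have [measurable]: "(\<lambda>x. generator g \<Omega> N (k x) $ i $ j) \<in> borel_measurable M" for i j
    unfolding generator_def
    by (intro measurable_matrix_mult) (simp_all add: measurable_compose[OF assms(2) measurable_leray])
  have [measurable]: "(\<lambda>x. (generator g \<Omega> N (k x) ** generator g \<Omega> N (k x)) $ i $ j) \<in> borel_measurable M" for i j
    by (intro measurable_matrix_mult) measurable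
  have [measurable]: "(\<lambda>x. freq_sq g \<Omega> N (k x)) \<in> borel_measurable M"
    by (rule measurable_compose[OF assms(2)]) (simp add: freq_sq_def[abs_def])
  have "(\<lambda>x. coriolis_symbol g \<Omega> N (h x) (k x) $ i $ j) \<in> borel_measurable M" for i j
    unfolding coriolis_symbol_def vector_add_component vector_minus_component vector_scaleR_component
    by measurable
  then show ?thesis
    unfolding duhamel_symbol_def
    by (intro measurable_matrix_mult) (simp_all add: measurable_compose[OF assms(2) measurable_leray])
qed

lemma generator_geostrophic:
  assumes g: "g \<noteq> 0" and xi: "\<xi> \<noteq> 0"
  shows "generator g \<Omega> N \<xi> *v vector [\<xi> $ 2, - \<xi> $ 1, 0, - (\<Omega> * \<xi> $ 3 / g)] = 0"
  unfolding generator_def leray_eq_proj proj_coupling_proj[OF unit_direction[OF xi]]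
  unfolding vec_eq_iff forall_4 matrix_vector_mult_def gen_matrix_def vector_4 sum_4
  using g xi by (simp add: vector_4 field_simps)

section \<open>Convolution of measurable fields\<close>

type_synonym field4 = "4 \<Rightarrow> real \<Rightarrow> real^3 \<Rightarrow> complex"

definition joint_measurable :: "field4 \<Rightarrow> bool" where
  "joint_measurable w \<longleftrightarrow> (\<forall>k. (\<lambda>p. w k (fst p) (snd p)) \<in> borel_measurable (borel \<Otimes>\<^sub>M borel))"

lemma joint_measurableD:
  assumes w: "joint_measurable w" and f: "f \<in> borel_measurable M" and g: "g \<in> borel_measurable M"
  shows "(\<lambda>x. w k (f x) (g x)) \<in> borel_measurable M"
  using measurable_compose[OF measurable_Pair[OF f g], of "\<lambda>p. w k (fst p) (snd p)"] w
  by (simp add: joint_measurable_def)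

definition mag :: "field4 \<Rightarrow> real \<Rightarrow> real^3 \<Rightarrow> ennreal" where
  "mag w t \<xi> = (\<Sum>k\<in>UNIV. ennreal (cmod (w k t \<xi>)))"

lemma mag_measurable:
  assumes w: "joint_measurable w" and f: "f \<in> borel_measurable M" and g: "g \<in> borel_measurable M"
  shows "(\<lambda>x. mag w (f x) (g x)) \<in> borel_measurable M"
proof -
  note [measurable] = joint_measurableD[OF w f g]
  show ?thesis unfolding mag_def by measurable
qed

lemma cmod_le_mag: "ennreal (cmod (w k t \<xi>)) \<le> mag w t \<xi>"
  unfolding mag_def by (rule member_le_sum) auto

definition quad :: "field4 \<Rightarrow> real \<Rightarrow> real^3 \<Rightarrow> ennreal" where
  "quad w t \<xi> = (\<integral>\<^sup>+\<eta>. mag w t (\<xi> - \<eta>) * mag w t \<eta> \<partial>lborel)"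

lemma quad_measurable:
  assumes w: "joint_measurable w" and f: "f \<in> borel_measurable M" and g: "g \<in> borel_measurable M"
  shows "(\<lambda>x. quad w (f x) (g x)) \<in> borel_measurable M"
proof -
  note [measurable] = mag_measurable[OF w] f g
  show ?thesis unfolding quad_def by measurable
qed

lemma nn_integral_translate:
  fixes f :: "real^3 \<Rightarrow> ennreal"
  assumes [measurable]: "f \<in> borel_measurable borel"
  shows "(\<integral>\<^sup>+\<xi>. f (\<xi> - \<eta>) \<partial>lborel) = (\<integral>\<^sup>+\<xi>. f \<xi> \<partial>lborel)"
proof -
  have "(\<integral>\<^sup>+\<xi>. f \<xi> \<partial>lborel) = (\<integral>\<^sup>+\<xi>. f \<xi> \<partial>distr lborel borel (\<lambda>x. - \<eta> + x))"
    by (subst lborel_distr_plus) simp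
  also have "\<dots> = (\<integral>\<^sup>+\<xi>. f (\<xi> - \<eta>) \<partial>lborel)"
    by (subst nn_integral_distr) auto
  finally show ?thesis by simp
qed

lemma nn_integral_quad:
  assumes w: "joint_measurable w"
  shows "(\<integral>\<^sup>+\<xi>. quad w t \<xi> \<partial>lborel) = (\<integral>\<^sup>+\<xi>. mag w t \<xi> \<partial>lborel)\<^sup>2"
proof -
  note [measurable] = mag_measurable[OF w]
  have "(\<integral>\<^sup>+\<xi>. quad w t \<xi> \<partial>lborel) = (\<integral>\<^sup>+\<eta>. (\<integral>\<^sup>+\<xi>. mag w t (\<xi> - \<eta>) * mag w t \<eta> \<partial>lborel) \<partial>lborel)"
    unfolding quad_def by (rule lborel_pair.Fubini') measurable
  also have "\<dots> = (\<integral>\<^sup>+\<eta>. (\<integral>\<^sup>+\<xi>. mag w t \<xi> \<partial>lborel) * mag w t \<eta> \<partial>lborel)"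
    by (simp add: nn_integral_multc nn_integral_translate)
  also have "\<dots> = (\<integral>\<^sup>+\<xi>. mag w t \<xi> \<partial>lborel)\<^sup>2"
    by (simp add: nn_integral_cmult power2_eq_square)
  finally show ?thesis .
qed

lemma conv_bound:
  assumes w: "joint_measurable w"
  shows "(\<Sum>l\<in>UNIV. \<Sum>j\<in>{1,2,3}. ennreal (cmod (conv (w j t) (w l t) \<xi>))) \<le> quad w t \<xi>"
proof -
  note [measurable] = joint_measurableD[OF w] mag_measurable[OF w]
  have 1: "ennreal (cmod (conv (w j t) (w l t) \<xi>)) \<le> (\<integral>\<^sup>+\<eta>. ennreal (cmod (w j t (\<xi> - \<eta>))) * ennreal (cmod (w l t \<eta>)) \<partial>lborel)" for j l
  proof -
    let ?I = "LINT \<eta>|lborel. w j t (\<xi> - \<eta>) * w l t \<eta>"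
    have "cmod (conv (w j t) (w l t) \<xi>) \<le> cmod ?I"
    proof -
      have "1 \<le> (2 * pi) ^ 3" using pi_gt3 by (intro one_le_power) simp
      then have "cmod ?I / (2 * pi) ^ 3 \<le> cmod ?I / 1"
        by (intro divide_left_mono) auto
      then show ?thesis by (simp add: conv_def norm_divide norm_power norm_mult)
    qed
    then have "ennreal (cmod (conv (w j t) (w l t) \<xi>)) \<le> ennreal (cmod ?I)" by (rule ennreal_leI)
    also have "\<dots> \<le> (\<integral>\<^sup>+\<eta>. ennreal (cmod (w j t (\<xi> - \<eta>) * w l t \<eta>)) \<partial>lborel)"
    proof (cases "integrable lborel (\<lambda>\<eta>. w j t (\<xi> - \<eta>) * w l t \<eta>)")
      case True
      then show ?thesis by (rule integral_norm_bound_ennreal)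
    next
      case False
      then show ?thesis by (simp add: not_integrable_integral_eq)
    qed
    also have "\<dots> = (\<integral>\<^sup>+\<eta>. ennreal (cmod (w j t (\<xi> - \<eta>))) * ennreal (cmod (w l t \<eta>)) \<partial>lborel)"
      by (simp add: norm_mult ennreal_mult)
    finally show ?thesis .
  qed
  have "(\<Sum>l\<in>UNIV. \<Sum>j\<in>{1,2,3}. ennreal (cmod (conv (w j t) (w l t) \<xi>)))
    \<le> (\<Sum>l\<in>UNIV. \<Sum>j\<in>UNIV. (\<integral>\<^sup>+\<eta>. ennreal (cmod (w j t (\<xi> - \<eta>))) * ennreal (cmod (w l t \<eta>)) \<partial>lborel))"
    by (intro sum_mono order_trans[OF sum_mono[OF 1] sum_mono2]) auto
  also have "\<dots> = (\<integral>\<^sup>+\<eta>. (\<Sum>l\<in>UNIV. \<Sum>j\<in>UNIV. ennreal (cmod (w j t (\<xi> - \<eta>))) * ennreal (cmod (w l t \<eta>))) \<partial>lborel)"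
    by (subst nn_integral_sum; (subst nn_integral_sum)?; measurable)
  also have "\<dots> = quad w t \<xi>"
    unfolding quad_def mag_def by (simp only: sum_distrib_left sum_distrib_right)
  finally show ?thesis .
qed

definition half_space_supp :: "field4 \<Rightarrow> bool" where
  "half_space_supp w \<longleftrightarrow> (\<forall>k t \<xi>. \<xi> $ 2 < 1 \<longrightarrow> w k t \<xi> = 0)"

lemma conv_half_space:
  assumes "half_space_supp w" "\<xi> $ 2 < 2"
  shows "conv (w j t) (w l t) \<xi> = 0"
proof -
  have *: "w j t (\<xi> - \<eta>) * w l t \<eta> = 0" for \<eta>
    using assms by (cases "\<eta> $ 2 < 1") (auto simp: half_space_supp_def)
  show ?thesis unfolding conv_def * by simp
qed

lemma conv_strip_cong:
  assumes "half_space_supp v" "half_space_supp w" and eq: "\<And>k t \<eta>. \<eta> $ 2 \<le> \<xi> $ 2 - 1 \<Longrightarrow> v k t \<eta> = w k t \<eta>"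
  shows "conv (v j t) (v l t) \<xi> = conv (w j t) (w l t) \<xi>"
proof -
  have "v j t (\<xi> - \<eta>) * v l t \<eta> = w j t (\<xi> - \<eta>) * w l t \<eta>" for \<eta>
  proof (cases "\<eta> $ 2 < 1 \<or> (\<xi> - \<eta>) $ 2 < 1")
    case True
    then show ?thesis using assms(1,2) by (auto simp: half_space_supp_def)
  next
    case False
    then show ?thesis using eq[of \<eta>] eq[of "\<xi> - \<eta>"] by simp
  qed
  then show ?thesis by (simp add: conv_def)
qed

lemma ennreal_power2_add_le: "((x::ennreal) + y)\<^sup>2 \<le> 2 * x\<^sup>2 + 2 * y\<^sup>2"
proof (cases "x = \<top> \<or> y = \<top>")
  case True
  then show ?thesis by (auto simp: power2_eq_square ennreal_top_mult ennreal_mult_top)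
next
  case False
  then obtain a b where ab: "x = ennreal a" "y = ennreal b" "0 \<le> a" "0 \<le> b"
    by (metis enn2real_nonneg ennreal_enn2real less_top)
  have "(a + b)\<^sup>2 \<le> 2 * a\<^sup>2 + 2 * b\<^sup>2"
    using zero_le_power2[of "a - b"] by (simp add: power2_eq_square algebra_simps)
  then have "ennreal ((a + b)\<^sup>2) \<le> ennreal (2 * a\<^sup>2 + 2 * b\<^sup>2)" by (rule ennreal_leI)
  also have "ennreal (2 * a\<^sup>2 + 2 * b\<^sup>2) = 2 * ennreal (a\<^sup>2) + 2 * ennreal (b\<^sup>2)"
    by (subst ennreal_plus) (simp_all add: ennreal_mult')
  finally show ?thesis
    using ab by (simp add: ennreal_plus[symmetric] ennreal_power del: ennreal_plus)
qed

lemma heat_kernel_L2: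
  assumes "\<nu> > 0"
  shows "(\<integral>\<^sup>+t. ennreal ((r * exp (- \<nu> * r\<^sup>2 * (t - \<tau>)))\<^sup>2) * indicator {\<tau>..} t \<partial>lborel) \<le> ennreal (1 / (2 * \<nu>))"
proof (cases "r = 0")
  case False
  let ?c = "2 * \<nu> * r\<^sup>2"
  have c: "?c > 0" using assms False by simp
  let ?F = "\<lambda>t. - (1 / (2 * \<nu>)) * exp (- ?c * (t - \<tau>))"
  have "(\<integral>\<^sup>+t. ennreal ((r * exp (- \<nu> * r\<^sup>2 * (t - \<tau>)))\<^sup>2) * indicator {\<tau>..} t \<partial>lborel) = ennreal (0 - ?F \<tau>)"
  proof (rule nn_integral_FTC_atLeast[where F = ?F])
    show "(\<lambda>t. (r * exp (- \<nu> * r\<^sup>2 * (t - \<tau>)))\<^sup>2) \<in> borel_measurable borel" by measurable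
    fix t assume "\<tau> \<le> t"
    have "(r * exp (- \<nu> * r\<^sup>2 * (t - \<tau>)))\<^sup>2 = r\<^sup>2 * exp (- ?c * (t - \<tau>))"
      by (simp add: power_mult_distrib exp_double[symmetric] mult_ac)
    moreover have "(?F has_real_derivative (- (1 / (2 * \<nu>)) * (exp (- ?c * (t - \<tau>)) * (- ?c)))) (at t)"
      by (auto intro!: derivative_eq_intros)
    moreover have "- (1 / (2 * \<nu>)) * (exp (- ?c * (t - \<tau>)) * (- ?c)) = r\<^sup>2 * exp (- ?c * (t - \<tau>))"
      using assms by (simp add: field_simps)
    ultimately show "(?F has_real_derivative (r * exp (- \<nu> * r\<^sup>2 * (t - \<tau>)))\<^sup>2) (at t)" by simp
    show "0 \<le> (r * exp (- \<nu> * r\<^sup>2 * (t - \<tau>)))\<^sup>2" by simp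
  next
    have "((\<lambda>t. exp (- (?c * (t - \<tau>)))) \<longlongrightarrow> 0) at_top"
    proof (rule filterlim_compose[OF exp_at_bot])
      have "filterlim (\<lambda>t. ?c * (t - \<tau>)) at_top at_top"
        using c by (intro filterlim_tendsto_pos_mult_at_top[OF tendsto_const c])
          (simp add: filterlim_at_top_add_at_top[of "\<lambda>t. t" _ ] filterlim_tendsto_add_at_top[of "\<lambda>_. - \<tau>" "- \<tau>" _ "\<lambda>t. t", simplified] filterlim_ident)
      then show "filterlim (\<lambda>t. - (?c * (t - \<tau>))) at_bot at_top"
        by (simp add: filterlim_uminus_at_top)
    qed
    from tendsto_mult_right_zero[OF this, of "- (1 / (2 * \<nu>))"]
    show "(?F \<longlongrightarrow> 0) at_top" by simp
  qed
  then show ?thesis by simp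
qed simp

section \<open>Picard iteration on half-space data\<close>

definition heat :: "real \<Rightarrow> real \<Rightarrow> real^3 \<Rightarrow> real" where
  "heat \<nu> s \<xi> = exp (- \<nu> * (norm \<xi>)\<^sup>2 * s)"

lemma heat_pos [simp]: "0 < heat \<nu> s \<xi>" and heat_nonneg [simp]: "0 \<le> heat \<nu> s \<xi>"
  by (simp_all add: heat_def)

lemma heat_le_1: "\<nu> \<ge> 0 \<Longrightarrow> s \<ge> 0 \<Longrightarrow> heat \<nu> s \<xi> \<le> 1"
  by (simp add: heat_def)

lemma heat_measurable [measurable]:
  assumes [measurable]: "f \<in> borel_measurable M" "g \<in> borel_measurable M"
  shows "(\<lambda>x. heat \<nu> (f x) (g x)) \<in> borel_measurable M"
  unfolding heat_def by measurable

lemma weighted_Cauchy_Schwarz: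
  assumes [measurable]: "k \<in> borel_measurable M" "q \<in> borel_measurable M"
  shows "(\<integral>\<^sup>+x. k x * q x \<partial>M)\<^sup>2 \<le> (\<integral>\<^sup>+x. (k x)\<^sup>2 * q x \<partial>M) * (\<integral>\<^sup>+x. q x \<partial>M)"
proof -
  have "(\<integral>\<^sup>+x. k x * 1 \<partial>density M q)\<^sup>2 \<le> (\<integral>\<^sup>+x. (k x)\<^sup>2 \<partial>density M q) * (\<integral>\<^sup>+x. 1\<^sup>2 \<partial>density M q)"
    by (rule Cauchy_Schwarz_nn_integral) auto
  moreover have "(\<integral>\<^sup>+x. 1\<^sup>2 \<partial>density M q) = (\<integral>\<^sup>+x. q x \<partial>M)"
    by (subst nn_integral_density) auto
  ultimately show ?thesis
    by (simp add: nn_integral_density mult.commute del: nn_integral_const)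
qed

locale picard =
  fixes \<nu> T C0 :: real and E :: "real \<Rightarrow> real^3 \<Rightarrow> 4 \<Rightarrow> 4 \<Rightarrow> real" and d :: "4 \<Rightarrow> real^3 \<Rightarrow> complex"
  assumes nu: "\<nu> > 0" and T: "T > 0" and C0: "C0 > 0"
    and E_joint: "\<And>k l. (\<lambda>p. E (fst p) (snd p) k l) \<in> borel_measurable (borel \<Otimes>\<^sub>M borel)"
    and E_bound: "\<And>s \<xi> k l. 0 \<le> s \<Longrightarrow> s \<le> T \<Longrightarrow> \<bar>E s \<xi> k l\<bar> \<le> C0"
    and E_cont: "\<And>\<xi> k l. continuous_on UNIV (\<lambda>s. E s \<xi> k l)"
    and d_meas [measurable]: "\<And>k. d k \<in> borel_measurable borel"
    and d_supp: "\<And>k \<xi>. \<xi> $ 2 < 1 \<Longrightarrow> d k \<xi> = 0"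
    and d_int: "\<And>k. integrable lborel (d k)"
begin

definition duh_kernel :: "field4 \<Rightarrow> 4 \<Rightarrow> real \<Rightarrow> real^3 \<Rightarrow> real \<Rightarrow> complex" where
  "duh_kernel w k t \<xi> \<tau> = (\<Sum>l\<in>UNIV. \<Sum>j\<in>{1,2,3}.
     of_real (heat \<nu> (t - \<tau>) \<xi> * E (t - \<tau>) \<xi> k l) * (\<i> * of_real (freq4 \<xi> $ j)) * conv (w j \<tau>) (w l \<tau>) \<xi>)"

definition duh :: "field4 \<Rightarrow> field4" where
  "duh w k t \<xi> = (LINT \<tau>|lborel. indicator {0..t} \<tau> *\<^sub>R duh_kernel w k t \<xi> \<tau>)"

definition free :: "field4" where "free k t \<xi> = of_real (heat \<nu> t \<xi>) * d k \<xi>"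

definition step :: "field4 \<Rightarrow> field4" where "step w k t \<xi> = free k t \<xi> - duh w k t \<xi>"

primrec iter :: "nat \<Rightarrow> field4" where
  "iter 0 = (\<lambda>k t \<xi>. 0)"
| "iter (Suc m) = step (iter m)"

text \<open>
  A product of fields supported in \<open>\<xi>\<^sub>2 \<ge> 1\<close> is supported in \<open>\<xi>\<^sub>2 \<ge> 2\<close>, so the Picard iterates are
  stationary on each strip \<open>\<xi>\<^sub>2 < m + 1\<close> from the \<open>m\<close>-th on. Gluing them gives an exact solution without
  any contraction argument; smallness enters only through the size of the iterates.
\<close>

definition sol :: "field4" where "sol k t \<xi> = iter (nat \<lfloor>\<xi> $ 2\<rfloor>) k t \<xi>"

definition beta :: "field4 \<Rightarrow> real \<Rightarrow> real^3 \<Rightarrow> ennreal" where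
  "beta w t \<xi> = (\<integral>\<^sup>+\<tau>. ennreal (norm \<xi> * heat \<nu> (t - \<tau>) \<xi>) * quad w \<tau> \<xi> * indicator {0..t} \<tau> \<partial>lborel)"

text \<open>The square of the norm of \<open>L\<^sup>2(0, T; FB\<^sup>0\<^sub>1\<^sub>,\<^sub>1)\<close>.\<close>

definition Xnorm :: "field4 \<Rightarrow> ennreal" where
  "Xnorm w = (\<integral>\<^sup>+t. (\<integral>\<^sup>+\<xi>. mag w t \<xi> \<partial>lborel)\<^sup>2 * indicator {0..T} t \<partial>lborel)"

definition quad_total :: "field4 \<Rightarrow> real^3 \<Rightarrow> ennreal" where
  "quad_total w \<xi> = (\<integral>\<^sup>+\<tau>. quad w \<tau> \<xi> * indicator {0..T} \<tau> \<partial>lborel)"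

lemma E_meas:
  assumes "f \<in> borel_measurable M" "g \<in> borel_measurable M"
  shows "(\<lambda>x. E (f x) (g x) k l) \<in> borel_measurable M"
  using measurable_compose[OF measurable_Pair[OF assms] E_joint[of k l]] by simp

lemma conv_measurable:
  assumes w: "joint_measurable w" and [measurable]: "f \<in> borel_measurable M" "g \<in> borel_measurable M"
  shows "(\<lambda>x. conv (w j (f x)) (w l (f x)) (g x)) \<in> borel_measurable M"
proof -
  note [measurable] = joint_measurableD[OF w]
  show ?thesis unfolding conv_def by measurable
qed

lemma duh_kernel_measurable:
  assumes w: "joint_measurable w" and [measurable]: "f \<in> borel_measurable M" "g \<in> borel_measurable M" "h \<in> borel_measurable M"
  shows "(\<lambda>x. duh_kernel w k (f x) (g x) (h x)) \<in> borel_measurable M"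
proof -
  note [measurable] = conv_measurable[OF w] E_meas
  have [measurable]: "(\<lambda>x. freq4 (g x) $ j) \<in> borel_measurable M" for j
    by (rule measurable_compose[OF _ measurable_freq4]) measurable
  show ?thesis unfolding duh_kernel_def by measurable
qed

lemma duh_joint_measurable:
  assumes w: "joint_measurable w" shows "joint_measurable (duh w)"
proof -
  note [measurable] = duh_kernel_measurable[OF w]
  show ?thesis unfolding joint_measurable_def duh_def indicator_def atLeastAtMost_iff by measurable
qed

lemma free_joint_measurable: "joint_measurable free"
  unfolding joint_measurable_def free_def by measurable

lemma step_joint_measurable:
  assumes w: "joint_measurable w" shows "joint_measurable (step w)"
  using duh_joint_measurable[OF w] free_joint_measurable
  unfolding joint_measurable_def step_def by (intro allI borel_measurable_diff) blast+

lemma iter_joint_measurable: "joint_measurable (iter m)"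
  by (induction m) (auto simp: step_joint_measurable joint_measurable_def[of "\<lambda>k t \<xi>. 0"])

lemma duh_kernel_half_space: "half_space_supp w \<Longrightarrow> \<xi> $ 2 < 2 \<Longrightarrow> duh_kernel w k t \<xi> \<tau> = 0"
  unfolding duh_kernel_def by (simp only: conv_half_space mult_zero_right sum.neutral_const)

lemma duh_half_space: "half_space_supp w \<Longrightarrow> \<xi> $ 2 < 2 \<Longrightarrow> duh w k t \<xi> = 0"
  unfolding duh_def by (simp add: duh_kernel_half_space)

lemma step_half_space: "half_space_supp w \<Longrightarrow> half_space_supp (step w)"
  by (simp add: half_space_supp_def[of "step w"] step_def free_def d_supp duh_half_space)

lemma iter_half_space: "half_space_supp (iter m)"
  by (induction m) (auto simp: step_half_space half_space_supp_def[of "\<lambda>k t \<xi>. 0"])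

lemma step_strip_cong:
  assumes "half_space_supp v" "half_space_supp w" "\<And>k t \<eta>. \<eta> $ 2 \<le> \<xi> $ 2 - 1 \<Longrightarrow> v k t \<eta> = w k t \<eta>"
  shows "step v k t \<xi> = step w k t \<xi>"
proof -
  have e: "conv (v j t) (v l t) \<xi> = conv (w j t) (w l t) \<xi>" for j l t
    by (rule conv_strip_cong[OF assms(1,2)]) (rule assms(3))
  show ?thesis unfolding step_def duh_def duh_kernel_def e by (rule refl)
qed

lemma iter_stable_Suc: "\<xi> $ 2 < real m + 1 \<Longrightarrow> iter (Suc m) k t \<xi> = iter m k t \<xi>"
proof (induction m arbitrary: k t \<xi>)
  case 0
  then show ?case using iter_half_space[of 1] by (simp add: half_space_supp_def)
next
  case (Suc m)
  have "step (iter (Suc m)) k t \<xi> = step (iter m) k t \<xi>"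
    by (rule step_strip_cong[OF iter_half_space iter_half_space]) (use Suc in auto)
  then show ?case by simp
qed

lemma iter_sol:
  assumes "\<xi> $ 2 < real m + 1" shows "iter m k t \<xi> = sol k t \<xi>"
proof -
  let ?n = "nat \<lfloor>\<xi> $ 2\<rfloor>"
  have n: "\<xi> $ 2 < real ?n + 1" by linarith
  have "?n \<le> m" using assms by linarith
  then have "iter m k t \<xi> = iter ?n k t \<xi>"
  proof (induction m rule: dec_induct)
    case (step i)
    have "\<xi> $ 2 < real i + 1" using n step(1) by linarith
    then show ?case using iter_stable_Suc step by metis
  qed simp
  then show ?thesis by (simp add: sol_def)
qed

lemma sol_half_space: "half_space_supp sol"
  using iter_half_space by (simp add: half_space_supp_def sol_def)

lemma sol_fixed_point: "sol k t \<xi> = step sol k t \<xi>"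
proof -
  let ?n = "nat \<lfloor>\<xi> $ 2\<rfloor>"
  have n: "\<xi> $ 2 < real ?n + 1" by linarith
  have "sol k t \<xi> = step (iter ?n) k t \<xi>"
    using iter_sol[of \<xi> "Suc ?n" k t] n by simp
  also have "\<dots> = step sol k t \<xi>"
    by (rule step_strip_cong[OF iter_half_space sol_half_space]) (use n iter_sol in auto)
  finally show ?thesis .
qed

lemma sol_strip_2: "\<xi> $ 2 < 2 \<Longrightarrow> sol k t \<xi> = free k t \<xi>"
  by (subst sol_fixed_point) (simp add: step_def duh_half_space[OF sol_half_space])

lemma sol_strip_3:
  assumes "\<xi> $ 2 < 3" shows "sol k t \<xi> = step free k t \<xi>"
proof -
  have "half_space_supp free" by (simp add: half_space_supp_def free_def d_supp)
  then show ?thesis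
    by (subst sol_fixed_point) (rule step_strip_cong[OF sol_half_space], use assms sol_strip_2 in auto)
qed

lemma sol_joint_measurable: "joint_measurable sol"
  unfolding joint_measurable_def
proof
  fix k
  have "(\<lambda>p. sol k (fst p) (snd p)) = (\<lambda>p. (\<lambda>n. iter n k (fst p) (snd p)) (nat \<lfloor>snd p $ 2\<rfloor>))"
    by (simp add: sol_def)
  also have "\<dots> \<in> borel_measurable (borel \<Otimes>\<^sub>M borel)"
  proof (rule measurable_compose_countable[where f = "\<lambda>n p. iter n k (fst p) (snd p)" and g = "\<lambda>p. nat \<lfloor>snd p $ 2\<rfloor>"])
    show "(\<lambda>p. iter n k (fst p) (snd p)) \<in> borel_measurable (borel \<Otimes>\<^sub>M borel)" for n
      using iter_joint_measurable[of n] by (simp add: joint_measurable_def)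
    have "(\<lambda>p::real \<times> (real^3). snd p $ 2) \<in> borel_measurable (borel \<Otimes>\<^sub>M borel)"
      by (rule measurable_compose[OF measurable_snd]) simp
    then have "(\<lambda>p::real \<times> (real^3). \<lfloor>snd p $ 2\<rfloor>) \<in> measurable (borel \<Otimes>\<^sub>M borel) (count_space UNIV)"
      by (rule measurable_compose[OF _ measurable_real_floor])
    then show "(\<lambda>p::real \<times> (real^3). nat \<lfloor>snd p $ 2\<rfloor>) \<in> measurable (borel \<Otimes>\<^sub>M borel) (count_space UNIV)"
      by (rule measurable_compose) simp
  qed
  finally show "(\<lambda>p. sol k (fst p) (snd p)) \<in> borel_measurable (borel \<Otimes>\<^sub>M borel)" .
qed

lemma duh_kernel_bound:
  assumes w: "joint_measurable w" and t: "t \<le> T" "\<tau> \<in> {0..t}"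
  shows "ennreal (cmod (duh_kernel w k t \<xi> \<tau>)) \<le> ennreal (C0 * (norm \<xi> * heat \<nu> (t - \<tau>) \<xi>)) * quad w \<tau> \<xi>"
proof -
  let ?c = "C0 * (norm \<xi> * heat \<nu> (t - \<tau>) \<xi>)"
  have b: "cmod (of_real (heat \<nu> (t - \<tau>) \<xi> * E (t - \<tau>) \<xi> k l) * (\<i> * of_real (freq4 \<xi> $ j)) * z) \<le> ?c * cmod z" for l j z
  proof -
    have "\<bar>E (t - \<tau>) \<xi> k l\<bar> * \<bar>freq4 \<xi> $ j\<bar> \<le> C0 * norm \<xi>"
      using t C0 by (intro mult_mono E_bound freq4_le) auto
    from mult_left_mono[OF this, of "heat \<nu> (t - \<tau>) \<xi> * cmod z"]
    show ?thesis by (simp add: norm_mult abs_mult mult_ac)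
  qed
  have "cmod (duh_kernel w k t \<xi> \<tau>) \<le> (\<Sum>l\<in>UNIV. \<Sum>j\<in>{1,2,3}. ?c * cmod (conv (w j \<tau>) (w l \<tau>) \<xi>))"
    unfolding duh_kernel_def by (intro sum_norm_le b)
  then have "ennreal (cmod (duh_kernel w k t \<xi> \<tau>)) \<le> ennreal (?c * (\<Sum>l\<in>UNIV. \<Sum>j\<in>{1,2,3}. cmod (conv (w j \<tau>) (w l \<tau>) \<xi>)))"
    by (intro ennreal_leI) (simp only: sum_distrib_left)
  also have "\<dots> = ennreal ?c * (\<Sum>l\<in>UNIV. \<Sum>j\<in>{1,2,3}. ennreal (cmod (conv (w j \<tau>) (w l \<tau>) \<xi>)))"
    using C0 by (subst ennreal_mult) (auto simp only: sum_ennreal[symmetric] sum_nonneg norm_ge_zero, auto intro!: sum_nonneg mult_nonneg_nonneg)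
  also have "\<dots> \<le> ennreal ?c * quad w \<tau> \<xi>"
    by (intro mult_left_mono conv_bound w) simp
  finally show ?thesis .
qed

lemma duh_le_beta:
  assumes w: "joint_measurable w" and t: "t \<le> T"
  shows "ennreal (cmod (duh w k t \<xi>)) \<le> ennreal C0 * beta w t \<xi>"
proof -
  note [measurable] = quad_measurable[OF w]
  have "ennreal (cmod (duh w k t \<xi>)) \<le> (\<integral>\<^sup>+\<tau>. ennreal (cmod (indicator {0..t} \<tau> *\<^sub>R duh_kernel w k t \<xi> \<tau>)) \<partial>lborel)"
  proof (cases "integrable lborel (\<lambda>\<tau>. indicator {0..t} \<tau> *\<^sub>R duh_kernel w k t \<xi> \<tau>)")
    case True
    then show ?thesis unfolding duh_def by (rule integral_norm_bound_ennreal)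
  qed (simp add: duh_def not_integrable_integral_eq)
  also have "\<dots> \<le> (\<integral>\<^sup>+\<tau>. ennreal C0 * (ennreal (norm \<xi> * heat \<nu> (t - \<tau>) \<xi>) * quad w \<tau> \<xi> * indicator {0..t} \<tau>) \<partial>lborel)"
    using duh_kernel_bound[OF w t] C0
    by (intro nn_integral_mono) (auto simp: indicator_def ennreal_mult[symmetric] mult.assoc[symmetric])
  also have "\<dots> = ennreal C0 * beta w t \<xi>"
    unfolding beta_def by (rule nn_integral_cmult) measurable
  finally show ?thesis .
qed

lemma mag_duh: "joint_measurable w \<Longrightarrow> t \<le> T \<Longrightarrow> mag (duh w) t \<xi> \<le> ennreal (4 * C0) * beta w t \<xi>"
proof -
  assume "joint_measurable w" "t \<le> T"
  then have "mag (duh w) t \<xi> \<le> (\<Sum>k\<in>(UNIV::4 set). ennreal C0 * beta w t \<xi>)"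
    unfolding mag_def by (intro sum_mono duh_le_beta)
  also have "\<dots> = ennreal (4 * C0) * beta w t \<xi>"
    using C0 by (simp add: ennreal_mult mult.assoc)
  finally show ?thesis .
qed

lemma beta_measurable:
  assumes w: "joint_measurable w" and [measurable]: "f \<in> borel_measurable M" "g \<in> borel_measurable M"
  shows "(\<lambda>x. beta w (f x) (g x)) \<in> borel_measurable M"
proof -
  note [measurable] = quad_measurable[OF w]
  show ?thesis unfolding beta_def indicator_def atLeastAtMost_iff by measurable
qed

lemma quad_total_integral:
  assumes w: "joint_measurable w"
  shows "(\<integral>\<^sup>+\<xi>. quad_total w \<xi> \<partial>lborel) = Xnorm w"
proof -
  note [measurable] = quad_measurable[OF w]
  have "(\<integral>\<^sup>+\<xi>. quad_total w \<xi> \<partial>lborel) = (\<integral>\<^sup>+\<tau>. (\<integral>\<^sup>+\<xi>. quad w \<tau> \<xi> * indicator {0..T} \<tau> \<partial>lborel) \<partial>lborel)"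
    unfolding quad_total_def by (rule lborel_pair.Fubini') measurable
  also have "\<dots> = Xnorm w"
    unfolding Xnorm_def by (simp add: nn_integral_multc nn_integral_quad[OF w])
  finally show ?thesis .
qed

lemma beta_L2:
  assumes w: "joint_measurable w"
  shows "(\<integral>\<^sup>+t. (\<integral>\<^sup>+\<xi>. beta w t \<xi> \<partial>lborel)\<^sup>2 * indicator {0..T} t \<partial>lborel) \<le> ennreal (1 / (2 * \<nu>)) * (Xnorm w)\<^sup>2"
proof -
  note [measurable] = quad_measurable[OF w] beta_measurable[OF w]
  let ?k = "\<lambda>t \<xi> \<tau>. ennreal (norm \<xi> * heat \<nu> (t - \<tau>) \<xi>) * indicator {0..t} \<tau>"
  let ?q = "\<lambda>(\<xi>, \<tau>). quad w \<tau> \<xi> * indicator {0..T} \<tau>"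
  have qX: "(\<integral>\<^sup>+p. ?q p \<partial>(lborel \<Otimes>\<^sub>M lborel)) = Xnorm w"
    unfolding quad_total_integral[OF w, symmetric] quad_total_def
    by (subst lborel.nn_integral_fst[symmetric]) (auto simp: case_prod_unfold)
  have 1: "(\<integral>\<^sup>+\<xi>. beta w t \<xi> \<partial>lborel)\<^sup>2 \<le> (\<integral>\<^sup>+\<xi>. (\<integral>\<^sup>+\<tau>. (?k t \<xi> \<tau>)\<^sup>2 * (quad w \<tau> \<xi> * indicator {0..T} \<tau>) \<partial>lborel) \<partial>lborel) * Xnorm w"
    if t: "t \<in> {0..T}" for t
  proof -
    have "(\<integral>\<^sup>+\<xi>. beta w t \<xi> \<partial>lborel) = (\<integral>\<^sup>+\<xi>. (\<integral>\<^sup>+\<tau>. ?k t \<xi> \<tau> * (quad w \<tau> \<xi> * indicator {0..T} \<tau>) \<partial>lborel) \<partial>lborel)"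
      unfolding beta_def using t by (intro nn_integral_cong) (auto simp: indicator_def)
    also have "\<dots> = (\<integral>\<^sup>+p. (\<lambda>(\<xi>, \<tau>). ?k t \<xi> \<tau>) p * ?q p \<partial>(lborel \<Otimes>\<^sub>M lborel))"
      by (subst lborel.nn_integral_fst[symmetric]) (auto simp: case_prod_unfold indicator_def)
    finally have "(\<integral>\<^sup>+\<xi>. beta w t \<xi> \<partial>lborel)\<^sup>2 \<le> (\<integral>\<^sup>+p. ((\<lambda>(\<xi>, \<tau>). ?k t \<xi> \<tau>) p)\<^sup>2 * ?q p \<partial>(lborel \<Otimes>\<^sub>M lborel)) * (\<integral>\<^sup>+p. ?q p \<partial>(lborel \<Otimes>\<^sub>M lborel))"
      by (simp only:) (rule weighted_Cauchy_Schwarz; simp add: case_prod_unfold indicator_def)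
    also have "(\<integral>\<^sup>+p. ((\<lambda>(\<xi>, \<tau>). ?k t \<xi> \<tau>) p)\<^sup>2 * ?q p \<partial>(lborel \<Otimes>\<^sub>M lborel))
       = (\<integral>\<^sup>+\<xi>. (\<integral>\<^sup>+\<tau>. (?k t \<xi> \<tau>)\<^sup>2 * (quad w \<tau> \<xi> * indicator {0..T} \<tau>) \<partial>lborel) \<partial>lborel)"
      by (subst lborel.nn_integral_fst[symmetric]) (auto simp: case_prod_unfold indicator_def)
    finally show ?thesis unfolding qX .
  qed
  have "(\<integral>\<^sup>+t. (\<integral>\<^sup>+\<xi>. beta w t \<xi> \<partial>lborel)\<^sup>2 * indicator {0..T} t \<partial>lborel)
    \<le> (\<integral>\<^sup>+t. (\<integral>\<^sup>+\<xi>. (\<integral>\<^sup>+\<tau>. (?k t \<xi> \<tau>)\<^sup>2 * (quad w \<tau> \<xi> * indicator {0..T} \<tau>) \<partial>lborel) \<partial>lborel) * Xnorm w \<partial>lborel)"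
    using 1 by (intro nn_integral_mono) (auto simp: indicator_def)
  also have "\<dots> = (\<integral>\<^sup>+t. (\<integral>\<^sup>+\<xi>. (\<integral>\<^sup>+\<tau>. (?k t \<xi> \<tau>)\<^sup>2 * (quad w \<tau> \<xi> * indicator {0..T} \<tau>) \<partial>lborel) \<partial>lborel) \<partial>lborel) * Xnorm w"
    by (rule nn_integral_multc) (simp add: indicator_def)
  also have "(\<integral>\<^sup>+t. (\<integral>\<^sup>+\<xi>. (\<integral>\<^sup>+\<tau>. (?k t \<xi> \<tau>)\<^sup>2 * (quad w \<tau> \<xi> * indicator {0..T} \<tau>) \<partial>lborel) \<partial>lborel) \<partial>lborel)
     = (\<integral>\<^sup>+\<xi>. (\<integral>\<^sup>+t. (\<integral>\<^sup>+\<tau>. (?k t \<xi> \<tau>)\<^sup>2 * (quad w \<tau> \<xi> * indicator {0..T} \<tau>) \<partial>lborel) \<partial>lborel) \<partial>lborel)"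
    by (rule lborel_pair.Fubini') (simp add: indicator_def case_prod_unfold)
  also have "\<dots> = (\<integral>\<^sup>+\<xi>. (\<integral>\<^sup>+\<tau>. (\<integral>\<^sup>+t. (?k t \<xi> \<tau>)\<^sup>2 * (quad w \<tau> \<xi> * indicator {0..T} \<tau>) \<partial>lborel) \<partial>lborel) \<partial>lborel)"
    by (intro nn_integral_cong lborel_pair.Fubini') (simp add: indicator_def case_prod_unfold)
  also have "\<dots> \<le> (\<integral>\<^sup>+\<xi>. (\<integral>\<^sup>+\<tau>. ennreal (1 / (2 * \<nu>)) * (quad w \<tau> \<xi> * indicator {0..T} \<tau>) \<partial>lborel) \<partial>lborel)"
  proof (intro nn_integral_mono)
    fix \<xi> :: "real^3" and \<tau> :: real
    have "(\<integral>\<^sup>+t. (?k t \<xi> \<tau>)\<^sup>2 \<partial>lborel) \<le> (\<integral>\<^sup>+t. ennreal ((norm \<xi> * exp (- \<nu> * (norm \<xi>)\<^sup>2 * (t - \<tau>)))\<^sup>2) * indicator {\<tau>..} t \<partial>lborel)"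
      by (intro nn_integral_mono) (auto simp: indicator_def heat_def ennreal_power)
    also have "\<dots> \<le> ennreal (1 / (2 * \<nu>))" by (rule heat_kernel_L2[OF nu])
    finally have "(\<integral>\<^sup>+t. (?k t \<xi> \<tau>)\<^sup>2 \<partial>lborel) * (quad w \<tau> \<xi> * indicator {0..T} \<tau>) \<le> ennreal (1 / (2 * \<nu>)) * (quad w \<tau> \<xi> * indicator {0..T} \<tau>)"
      by (rule mult_right_mono) simp
    then show "(\<integral>\<^sup>+t. (?k t \<xi> \<tau>)\<^sup>2 * (quad w \<tau> \<xi> * indicator {0..T} \<tau>) \<partial>lborel) \<le> ennreal (1 / (2 * \<nu>)) * (quad w \<tau> \<xi> * indicator {0..T} \<tau>)"
      by (subst nn_integral_multc) (auto simp: indicator_def)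
  qed
  also have "\<dots> = ennreal (1 / (2 * \<nu>)) * (\<integral>\<^sup>+\<xi>. quad_total w \<xi> \<partial>lborel)"
    unfolding quad_total_def by (simp add: nn_integral_cmult)
  finally show ?thesis
    by (simp add: quad_total_integral[OF w] power2_eq_square mult_right_mono mult.assoc)
qed

end

context picard
begin

lemma mag_step:
  assumes w: "joint_measurable w" and t: "t \<le> T"
  shows "mag (step w) t \<xi> \<le> mag free t \<xi> + ennreal (4 * C0) * beta w t \<xi>"
proof -
  have "mag (step w) t \<xi> \<le> (\<Sum>k\<in>UNIV. ennreal (cmod (free k t \<xi>)) + ennreal (cmod (duh w k t \<xi>)))"
    unfolding mag_def step_def
    by (intro sum_mono) (simp add: ennreal_plus[symmetric] norm_triangle_ineq4 ennreal_leI del: ennreal_plus)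
  also have "\<dots> = mag free t \<xi> + mag (duh w) t \<xi>"
    by (simp add: mag_def sum.distrib)
  finally show ?thesis using mag_duh[OF w t] add_left_mono order_trans by blast
qed

lemma Xnorm_step:
  assumes w: "joint_measurable w"
  shows "Xnorm (step w) \<le> 2 * Xnorm free + 2 * (ennreal ((4 * C0)\<^sup>2 / (2 * \<nu>)) * (Xnorm w)\<^sup>2)"
proof -
  note [measurable] = mag_measurable[OF free_joint_measurable] beta_measurable[OF w]
  let ?c = "ennreal (4 * C0)"
  have "Xnorm (step w) \<le> (\<integral>\<^sup>+t. (2 * ((\<integral>\<^sup>+\<xi>. mag free t \<xi> \<partial>lborel)\<^sup>2 * indicator {0..T} t)
      + 2 * (?c\<^sup>2 * ((\<integral>\<^sup>+\<xi>. beta w t \<xi> \<partial>lborel)\<^sup>2 * indicator {0..T} t))) \<partial>lborel)"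
    unfolding Xnorm_def
  proof (rule nn_integral_mono)
    fix t
    show "(\<integral>\<^sup>+\<xi>. mag (step w) t \<xi> \<partial>lborel)\<^sup>2 * indicator {0..T} t \<le> 2 * ((\<integral>\<^sup>+\<xi>. mag free t \<xi> \<partial>lborel)\<^sup>2 * indicator {0..T} t)
      + 2 * (?c\<^sup>2 * ((\<integral>\<^sup>+\<xi>. beta w t \<xi> \<partial>lborel)\<^sup>2 * indicator {0..T} t))"
    proof (cases "t \<in> {0..T}")
      case True
      then have t: "t \<le> T" by simp
      have "(\<integral>\<^sup>+\<xi>. mag (step w) t \<xi> \<partial>lborel) \<le> (\<integral>\<^sup>+\<xi>. mag free t \<xi> + ?c * beta w t \<xi> \<partial>lborel)"
        by (intro nn_integral_mono mag_step[OF w t])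
      also have "\<dots> = (\<integral>\<^sup>+\<xi>. mag free t \<xi> \<partial>lborel) + ?c * (\<integral>\<^sup>+\<xi>. beta w t \<xi> \<partial>lborel)"
        by (simp add: nn_integral_add nn_integral_cmult)
      finally have "(\<integral>\<^sup>+\<xi>. mag (step w) t \<xi> \<partial>lborel)\<^sup>2 \<le> ((\<integral>\<^sup>+\<xi>. mag free t \<xi> \<partial>lborel) + ?c * (\<integral>\<^sup>+\<xi>. beta w t \<xi> \<partial>lborel))\<^sup>2"
        by (rule power_mono) simp
      also have "\<dots> \<le> 2 * (\<integral>\<^sup>+\<xi>. mag free t \<xi> \<partial>lborel)\<^sup>2 + 2 * (?c * (\<integral>\<^sup>+\<xi>. beta w t \<xi> \<partial>lborel))\<^sup>2"
        by (rule ennreal_power2_add_le)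
      finally show ?thesis using True by (simp add: power_mult_distrib)
    qed simp
  qed
  also have "\<dots> = 2 * Xnorm free + 2 * (?c\<^sup>2 * (\<integral>\<^sup>+t. (\<integral>\<^sup>+\<xi>. beta w t \<xi> \<partial>lborel)\<^sup>2 * indicator {0..T} t \<partial>lborel))"
    unfolding Xnorm_def by (simp add: nn_integral_add nn_integral_cmult)
  also have "\<dots> \<le> 2 * Xnorm free + 2 * (?c\<^sup>2 * (ennreal (1 / (2 * \<nu>)) * (Xnorm w)\<^sup>2))"
    by (intro add_left_mono mult_left_mono beta_L2[OF w]) auto
  also have "?c\<^sup>2 * (ennreal (1 / (2 * \<nu>)) * (Xnorm w)\<^sup>2) = ennreal ((4 * C0)\<^sup>2 / (2 * \<nu>)) * (Xnorm w)\<^sup>2"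
  proof -
    have "?c\<^sup>2 * ennreal (1 / (2 * \<nu>)) = ennreal ((4 * C0)\<^sup>2 / (2 * \<nu>))"
      using C0 nu by (simp add: ennreal_power ennreal_mult[symmetric])
    then show ?thesis by (simp only: mult.assoc[symmetric])
  qed
  finally show ?thesis .
qed

lemma Xnorm_iter:
  assumes \<delta>: "Xnorm free \<le> ennreal \<delta>" "0 \<le> \<delta>" and small: "16 * ((4 * C0)\<^sup>2 / (2 * \<nu>)) * \<delta> \<le> 1"
  shows "Xnorm (iter m) \<le> ennreal (4 * \<delta>)"
proof (induction m)
  case 0
  then show ?case by (simp add: Xnorm_def mag_def)
next
  case (Suc m)
  let ?C = "(4 * C0)\<^sup>2 / (2 * \<nu>)"
  have "Xnorm (iter (Suc m)) \<le> 2 * Xnorm free + 2 * (ennreal ?C * (Xnorm (iter m))\<^sup>2)"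
    using Xnorm_step[OF iter_joint_measurable] by simp
  also have "\<dots> \<le> 2 * ennreal \<delta> + 2 * (ennreal ?C * (ennreal (4 * \<delta>))\<^sup>2)"
    by (intro add_mono mult_left_mono \<delta>(1) power_mono Suc) auto
  also have "\<dots> = ennreal (2 * \<delta> + 2 * (?C * (4 * \<delta>)\<^sup>2))"
  proof -
    have e: "2 * ennreal x = ennreal (2 * x)" if "0 \<le> x" for x
      using that by (subst ennreal_mult) auto
    have C: "0 \<le> ?C" using nu by simp
    have "ennreal ?C * (ennreal (4 * \<delta>))\<^sup>2 = ennreal (?C * (4 * \<delta>)\<^sup>2)"
      using C \<delta>(2) by (simp only: ennreal_power ennreal_mult[symmetric] zero_le_power2 mult_nonneg_nonneg zero_le_numeral)
    then show ?thesis
      using C \<delta>(2) by (simp only: e mult_nonneg_nonneg zero_le_power2) (rule ennreal_plus[symmetric]; intro mult_nonneg_nonneg C; simp add: \<delta>(2))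
  qed
  also have "\<dots> \<le> ennreal (4 * \<delta>)"
  proof (rule ennreal_leI)
    have "2 * (?C * (4 * \<delta>)\<^sup>2) = 2 * \<delta> * (16 * ?C * \<delta>)" by (simp add: power2_eq_square)
    also have "\<dots> \<le> 2 * \<delta> * 1" using small \<delta>(2) by (intro mult_left_mono) auto
    finally show "2 * \<delta> + 2 * (?C * (4 * \<delta>)\<^sup>2) \<le> 4 * \<delta>" by simp
  qed
  finally show ?case .
qed

lemma Xnorm_sol:
  assumes R: "\<And>m. Xnorm (iter m) \<le> R"
  shows "Xnorm sol \<le> R"
proof -
  note [measurable] = mag_measurable[OF sol_joint_measurable]
  define g where "g m t = (\<integral>\<^sup>+\<xi>. mag sol t \<xi> * indicator {\<xi>. \<xi> $ 2 < real m + 1} \<xi> \<partial>lborel)" for m t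
  have S[measurable]: "{\<xi>::real^3. \<xi> $ 2 < real m + 1} \<in> sets borel" for m
    by (rule borel_open) (simp add: open_halfspace_component_lt_cart)
  have gm [measurable]: "g m \<in> borel_measurable lborel" for m
    unfolding g_def by measurable
  have inc: "incseq (\<lambda>m. g m t)" for t
    unfolding g_def by (intro incseq_SucI nn_integral_mono mult_left_mono) (auto simp: indicator_def)
  have lim: "(\<lambda>m. g m t) \<longlonglongrightarrow> (\<integral>\<^sup>+\<xi>. mag sol t \<xi> \<partial>lborel)" for t
  proof -
    have "(\<integral>\<^sup>+\<xi>. mag sol t \<xi> \<partial>lborel) = (\<integral>\<^sup>+\<xi>. (SUP m. mag sol t \<xi> * indicator {\<xi>. \<xi> $ 2 < real m + 1} \<xi>) \<partial>lborel)"
    proof (rule nn_integral_cong)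
      fix \<xi> :: "real^3"
      have "mag sol t \<xi> * indicator {\<xi>. \<xi> $ 2 < real m + 1} \<xi> \<le> mag sol t \<xi>" for m
        by (simp add: indicator_def)
      moreover have "mag sol t \<xi> = mag sol t \<xi> * indicator {\<eta>. \<eta> $ 2 < real (nat \<lfloor>\<xi> $ 2\<rfloor>) + 1} \<xi>"
      proof -
        have "\<xi> $ 2 < real (nat \<lfloor>\<xi> $ 2\<rfloor>) + 1" by linarith
        then show ?thesis by simp
      qed
      moreover have "mag sol t \<xi> * indicator {\<eta>. \<eta> $ 2 < real (nat \<lfloor>\<xi> $ 2\<rfloor>) + 1} \<xi>
          \<le> (SUP m. mag sol t \<xi> * indicator {\<xi>. \<xi> $ 2 < real m + 1} \<xi>)"
        by (rule SUP_upper[where f = "\<lambda>m. mag sol t \<xi> * indicator {\<xi>. \<xi> $ 2 < real m + 1} \<xi>", OF UNIV_I])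
      ultimately show "mag sol t \<xi> = (SUP m. mag sol t \<xi> * indicator {\<xi>. \<xi> $ 2 < real m + 1} \<xi>)"
        by (intro antisym SUP_least) simp_all
    qed
    also have "\<dots> = (SUP m. g m t)"
      unfolding g_def
      by (rule nn_integral_monotone_convergence_SUP)
        (auto intro!: incseq_SucI simp: le_fun_def indicator_def)
    finally show ?thesis using LIMSEQ_SUP[OF inc[of t]] by simp
  qed
  have "(\<lambda>m. (g m t)\<^sup>2) \<longlonglongrightarrow> (\<integral>\<^sup>+\<xi>. mag sol t \<xi> \<partial>lborel)\<^sup>2" for t
    unfolding power2_eq_square by (rule tendsto_mult_ennreal[OF lim lim]) auto
  then have lim2: "liminf (\<lambda>m. (g m t)\<^sup>2 * indicator {0..T} t) = (\<integral>\<^sup>+\<xi>. mag sol t \<xi> \<partial>lborel)\<^sup>2 * indicator {0..T} t" for t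
    by (intro lim_imp_Liminf) (auto simp: indicator_def)
  have "Xnorm sol = (\<integral>\<^sup>+t. liminf (\<lambda>m. (g m t)\<^sup>2 * indicator {0..T} t) \<partial>lborel)"
    unfolding Xnorm_def lim2 ..
  also have "\<dots> \<le> liminf (\<lambda>m. \<integral>\<^sup>+t. (g m t)\<^sup>2 * indicator {0..T} t \<partial>lborel)"
    by (rule nn_integral_liminf) measurable
  also have "\<dots> \<le> R"
  proof -
    have "(\<integral>\<^sup>+t. (g m t)\<^sup>2 * indicator {0..T} t \<partial>lborel) \<le> Xnorm (iter m)" for m
      unfolding Xnorm_def g_def
      by (intro nn_integral_mono mult_right_mono power_mono)
        (auto simp: indicator_def mag_def iter_sol)
    then have "(\<integral>\<^sup>+t. (g m t)\<^sup>2 * indicator {0..T} t \<partial>lborel) \<le> R" for m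
      using R order_trans by blast
    then have "liminf (\<lambda>m. \<integral>\<^sup>+t. (g m t)\<^sup>2 * indicator {0..T} t \<partial>lborel) \<le> liminf (\<lambda>m::nat. R)"
      by (intro Liminf_mono) auto
    then show ?thesis by (simp add: Liminf_const)
  qed
  finally show ?thesis .
qed

lemma beta_le_quad_total:
  assumes w: "joint_measurable w" and t: "t \<le> T"
  shows "beta w t \<xi> \<le> ennreal (norm \<xi>) * (\<integral>\<^sup>+\<tau>. quad w \<tau> \<xi> * indicator {0..T} \<tau> \<partial>lborel)"
proof -
  note [measurable] = quad_measurable[OF w]
  have "beta w t \<xi> \<le> (\<integral>\<^sup>+\<tau>. ennreal (norm \<xi>) * (quad w \<tau> \<xi> * indicator {0..T} \<tau>) \<partial>lborel)"
    unfolding beta_def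
  proof (rule nn_integral_mono)
    fix \<tau>
    show "ennreal (norm \<xi> * heat \<nu> (t - \<tau>) \<xi>) * quad w \<tau> \<xi> * indicator {0..t} \<tau> \<le> ennreal (norm \<xi>) * (quad w \<tau> \<xi> * indicator {0..T} \<tau>)"
    proof (cases "\<tau> \<in> {0..t}")
      case True
      have "norm \<xi> * heat \<nu> (t - \<tau>) \<xi> \<le> norm \<xi> * 1"
        using heat_le_1[of \<nu> "t - \<tau>" \<xi>] nu True by (intro mult_left_mono) auto
      then have "ennreal (norm \<xi> * heat \<nu> (t - \<tau>) \<xi>) \<le> ennreal (norm \<xi>)" by (intro ennreal_leI) simp
      then show ?thesis using True t by (simp add: mult_right_mono)
    qed simp
  qed
  also have "\<dots> = ennreal (norm \<xi>) * (\<integral>\<^sup>+\<tau>. quad w \<tau> \<xi> * indicator {0..T} \<tau> \<partial>lborel)"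
    by (rule nn_integral_cmult) measurable
  finally show ?thesis .
qed

lemma sol_bound:
  assumes t: "t \<in> {0..T}" and fin: "quad_total sol \<xi> < \<infinity>"
  shows "cmod (sol k t \<xi>) \<le> cmod (d k \<xi>) + C0 * (norm \<xi> * enn2real (quad_total sol \<xi>))"
proof -
  have "cmod (free k t \<xi>) \<le> cmod (d k \<xi>)"
    using mult_right_mono[OF heat_le_1[of \<nu> t \<xi>], of "cmod (d k \<xi>)"] t nu by (simp add: free_def norm_mult)
  moreover have "cmod (duh sol k t \<xi>) \<le> C0 * (norm \<xi> * enn2real (quad_total sol \<xi>))"
  proof -
    have "ennreal (cmod (duh sol k t \<xi>)) \<le> ennreal C0 * (ennreal (norm \<xi>) * quad_total sol \<xi>)"
    proof (rule order_trans)
      show "ennreal (cmod (duh sol k t \<xi>)) \<le> ennreal C0 * beta sol t \<xi>"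
        by (rule duh_le_beta[OF sol_joint_measurable]) (use t in simp)
      show "ennreal C0 * beta sol t \<xi> \<le> ennreal C0 * (ennreal (norm \<xi>) * quad_total sol \<xi>)"
        unfolding quad_total_def
        by (rule mult_left_mono[OF beta_le_quad_total[OF sol_joint_measurable]]) (use t in auto)
    qed
    also have "\<dots> = ennreal C0 * (ennreal (norm \<xi>) * ennreal (enn2real (quad_total sol \<xi>)))"
      using fin by simp
    also have "\<dots> = ennreal (C0 * (norm \<xi> * enn2real (quad_total sol \<xi>)))"
      using C0 by (simp add: ennreal_mult)
    finally show ?thesis using C0 by (subst (asm) ennreal_le_iff) auto
  qed
  moreover have "cmod (sol k t \<xi>) \<le> cmod (free k t \<xi>) + cmod (duh sol k t \<xi>)"
    by (subst sol_fixed_point) (simp add: step_def norm_triangle_ineq4)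
  ultimately show ?thesis by linarith
qed

lemma duh_kernel_continuous: "continuous_on UNIV (\<lambda>t. duh_kernel w k t \<xi> \<tau>)"
proof -
  have "continuous_on UNIV (\<lambda>t. E (t - \<tau>) \<xi> k l)" for k l
    by (rule continuous_on_compose2[OF E_cont]) (auto intro!: continuous_intros)
  then show ?thesis unfolding duh_kernel_def heat_def by (intro continuous_intros)
qed

lemma duh_tendsto:
  assumes w: "joint_measurable w" and fin: "quad_total w \<xi> < \<infinity>"
    and s: "\<And>n. s n \<in> {0..T}" "s \<longlonglongrightarrow> t" "t \<in> {0..T}"
  shows "(\<lambda>n. duh w k (s n) \<xi>) \<longlonglongrightarrow> duh w k t \<xi>"
proof -
  note [measurable] = quad_measurable[OF w] duh_kernel_measurable[OF w]
  have qf: "AE \<tau> in lborel. quad w \<tau> \<xi> * indicator {0..T} \<tau> < \<infinity>"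
  proof -
    have "AE \<tau> in lborel. quad w \<tau> \<xi> * indicator {0..T} \<tau> \<noteq> \<infinity>"
      by (rule nn_integral_PInf_AE) (use fin in \<open>auto simp: quad_total_def\<close>)
    then show ?thesis by eventually_elim (simp add: less_top)
  qed
  let ?W = "\<lambda>\<tau>. C0 * (norm \<xi> * enn2real (quad w \<tau> \<xi> * indicator {0..T} \<tau>))"
  have I: "integrable lborel ?W"
  proof -
    have "integrable lborel (\<lambda>\<tau>. enn2real (quad w \<tau> \<xi> * indicator {0..T} \<tau>))"
    proof (rule integrableI_nonneg)
      have "(\<integral>\<^sup>+\<tau>. ennreal (enn2real (quad w \<tau> \<xi> * indicator {0..T} \<tau>)) \<partial>lborel) = quad_total w \<xi>"
        unfolding quad_total_def by (rule nn_integral_cong_AE) (use qf in eventually_elim, auto)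
      then show "(\<integral>\<^sup>+\<tau>. ennreal (enn2real (quad w \<tau> \<xi> * indicator {0..T} \<tau>)) \<partial>lborel) < \<infinity>"
        using fin by simp
    qed auto
    then show ?thesis by simp
  qed
  have bound: "AE \<tau> in lborel. norm (indicator {0..u} \<tau> *\<^sub>R duh_kernel w k u \<xi> \<tau>) \<le> ?W \<tau>" if u: "u \<in> {0..T}" for u
    using qf
  proof eventually_elim
    case (elim \<tau>)
    show ?case
    proof (cases "\<tau> \<in> {0..u}")
      case True
      then have q: "quad w \<tau> \<xi> < \<infinity>" and \<tau>: "\<tau> \<in> {0..T}" using elim u by (auto simp: less_top)
      have "ennreal (cmod (duh_kernel w k u \<xi> \<tau>)) \<le> ennreal (C0 * (norm \<xi> * heat \<nu> (u - \<tau>) \<xi>)) * quad w \<tau> \<xi>"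
        using duh_kernel_bound[OF w, of u \<tau> k \<xi>] u True by auto
      also have "\<dots> \<le> ennreal (C0 * (norm \<xi> * 1)) * quad w \<tau> \<xi>"
        using C0 nu True by (intro mult_right_mono ennreal_leI mult_left_mono heat_le_1) auto
      also have "\<dots> = ennreal (C0 * norm \<xi>) * ennreal (enn2real (quad w \<tau> \<xi>))" using q by simp
      also have "\<dots> = ennreal (C0 * norm \<xi> * enn2real (quad w \<tau> \<xi>))"
        using C0 by (subst ennreal_mult) auto
      finally have "cmod (duh_kernel w k u \<xi> \<tau>) \<le> C0 * norm \<xi> * enn2real (quad w \<tau> \<xi>)"
        using C0 by (subst (asm) ennreal_le_iff) auto
      then show ?thesis using True \<tau> by (simp add: mult.assoc)
    qed (use C0 in simp)
  qed
  show ?thesis unfolding duh_def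
  proof (rule integral_dominated_convergence[where w = ?W])
    have "AE \<tau> in lborel. \<tau> \<noteq> t" by (rule AE_lborel_singleton)
    then show "AE \<tau> in lborel. (\<lambda>n. indicator {0..s n} \<tau> *\<^sub>R duh_kernel w k (s n) \<xi> \<tau>) \<longlonglongrightarrow> indicator {0..t} \<tau> *\<^sub>R duh_kernel w k t \<xi> \<tau>"
    proof eventually_elim
      case (elim \<tau>)
      have k: "(\<lambda>n. duh_kernel w k (s n) \<xi> \<tau>) \<longlonglongrightarrow> duh_kernel w k t \<xi> \<tau>"
        using continuous_on_tendsto_compose[OF duh_kernel_continuous s(2)] by simp
      have "\<forall>\<^sub>F n in sequentially. indicator {0..s n} \<tau> = (indicator {0..t} \<tau> :: real)"
      proof (cases "\<tau> < t")
        case True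
        show ?thesis using order_tendstoD(1)[OF s(2) True] by eventually_elim (use True in \<open>auto simp: indicator_def\<close>)
      next
        case False
        then have "t < \<tau>" using elim by simp
        show ?thesis using order_tendstoD(2)[OF s(2) \<open>t < \<tau>\<close>] by eventually_elim (use \<open>t < \<tau>\<close> in \<open>auto simp: indicator_def\<close>)
      qed
      then have "(\<lambda>n. indicator {0..s n} \<tau> :: real) \<longlonglongrightarrow> indicator {0..t} \<tau>"
        by (rule tendsto_eventually)
      then show ?case using k by (rule tendsto_scaleR)
    qed
    show "AE \<tau> in lborel. norm (indicator {0..s n} \<tau> *\<^sub>R duh_kernel w k (s n) \<xi> \<tau>) \<le> ?W \<tau>" for n
      by (rule bound[OF s(1)])
  qed (use I in auto)
qed

lemma sol_tendsto:
  assumes fin: "quad_total sol \<xi> < \<infinity>" and s: "\<And>n. s n \<in> {0..T}" "s \<longlonglongrightarrow> t" "t \<in> {0..T}"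
  shows "(\<lambda>n. sol k (s n) \<xi>) \<longlonglongrightarrow> sol k t \<xi>"
  unfolding sol_fixed_point[of k] step_def free_def heat_def
  by (intro tendsto_intros s duh_tendsto[OF sol_joint_measurable fin])

context
  assumes finX: "Xnorm sol < \<infinity>"
begin

lemma AE_quad_total: "AE \<xi> in lborel. quad_total sol \<xi> < \<infinity>"
proof -
  note [measurable] = quad_measurable[OF sol_joint_measurable]
  have "quad_total sol \<in> borel_measurable lborel" unfolding quad_total_def by measurable
  then show ?thesis
    using nn_integral_PInf_AE[of "quad_total sol" lborel] finX quad_total_integral[OF sol_joint_measurable]
    by (auto simp: less_top)
qed

definition dominator :: "4 \<Rightarrow> real^3 \<Rightarrow> real" where
  "dominator k \<xi> = cmod (d k \<xi>) + C0 * enn2real (quad_total sol \<xi>)"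

lemma dominator_integrable: "integrable lborel (dominator k)"
proof -
  note [measurable] = quad_measurable[OF sol_joint_measurable]
  have m: "quad_total sol \<in> borel_measurable lborel" unfolding quad_total_def by measurable
  have "integrable lborel (\<lambda>\<xi>. enn2real (quad_total sol \<xi>))"
  proof (rule integrableI_nonneg)
    have "(\<integral>\<^sup>+\<xi>. ennreal (enn2real (quad_total sol \<xi>)) \<partial>lborel) = (\<integral>\<^sup>+\<xi>. quad_total sol \<xi> \<partial>lborel)"
      by (rule nn_integral_cong_AE) (use AE_quad_total in eventually_elim, auto)
    then show "(\<integral>\<^sup>+\<xi>. ennreal (enn2real (quad_total sol \<xi>)) \<partial>lborel) < \<infinity>"
      using finX quad_total_integral[OF sol_joint_measurable] by simp
  qed (use m in auto)
  then show ?thesis unfolding dominator_def using d_int by (intro Bochner_Integration.integrable_add) auto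
qed

lemma sol_le_dominator:
  assumes t: "t \<in> {0..T}" and fin: "quad_total sol \<xi> < \<infinity>"
  shows "cmod (sol k t \<xi>) \<le> norm \<xi> * dominator k \<xi>"
proof (cases "\<xi> $ 2 < 1")
  case True
  then show ?thesis using sol_half_space C0 by (simp add: half_space_supp_def dominator_def)
next
  case False
  then have "1 \<le> norm \<xi>" using component_le_norm_cart[of \<xi> 2] by linarith
  then have "1 * cmod (d k \<xi>) \<le> norm \<xi> * cmod (d k \<xi>)" by (intro mult_right_mono) auto
  then show ?thesis using sol_bound[OF t fin, of k] by (simp add: dominator_def algebra_simps)
qed

lemma sol_measurable: "sol k t \<in> borel_measurable borel"
  using joint_measurableD[OF sol_joint_measurable, of "\<lambda>_. t" borel "\<lambda>\<xi>. \<xi>" k] by simp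

lemma sol_admissible:
  assumes t: "t \<in> {0..T}" shows "admissible (sol k t)"
proof -
  note [measurable] = sol_measurable
  have "integrable lborel (\<lambda>\<xi>. cmod (sol k t \<xi>) / (1 + norm \<xi>))"
  proof (rule Bochner_Integration.integrable_bound[OF dominator_integrable[of k]])
    show "AE \<xi> in lborel. norm (cmod (sol k t \<xi>) / (1 + norm \<xi>)) \<le> norm (dominator k \<xi>)"
      using AE_quad_total
    proof eventually_elim
      case (elim \<xi>)
      have "0 \<le> dominator k \<xi>" using C0 by (simp add: dominator_def)
      then have "cmod (sol k t \<xi>) \<le> (1 + norm \<xi>) * dominator k \<xi>"
        using sol_le_dominator[OF t elim, of k] by (simp add: distrib_right)
      then show ?case using \<open>0 \<le> dominator k \<xi>\<close> by (simp add: divide_le_eq mult.commute)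
    qed
  qed measurable
  then show ?thesis by (simp add: admissible_def sol_measurable)
qed

lemma sol_cont_path:
  assumes lp: "littlewood_paley \<psi>" and r: "1 \<le> r"
  shows "cont_path \<psi> r T (\<lambda>t. \<chi> k. freq_dist (sol k t))"
  unfolding cont_path_def
proof (intro ballI conjI allI)
  note [measurable] = sol_measurable
  let ?c = "8 * psi_bound \<psi>"
  have c0: "0 \<le> ?c" using psi_bound_nonneg[OF lp] by simp
  fix t assume t: "t \<in> {0..T}"
  have wb: "AE \<xi> in lborel. cmod (sol k t \<xi>) / norm \<xi> \<le> dominator k \<xi>" if "t \<in> {0..T}" for k t
    using AE_quad_total
  proof eventually_elim
    case (elim \<xi>)
    have "0 \<le> dominator k \<xi>" using C0 by (simp add: dominator_def)
    then show ?case using sol_le_dominator[OF that elim, of k]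
      by (cases "\<xi> = 0") (simp_all add: divide_le_eq mult.commute)
  qed
  show "(\<chi> k. freq_dist (sol k t)) $ k \<in> fb_space \<psi> (-1) 1 r" for k
  proof -
    have "fb_norm \<psi> (-1) 1 r (freq_dist (sol k t)) \<le> (\<integral>\<^sup>+\<xi>. ennreal (?c * (cmod (sol k t \<xi>) / norm \<xi>)) \<partial>lborel)"
      by (rule fb_norm_le_weighted[OF lp sol_admissible[OF t] r])
    also have "\<dots> \<le> (\<integral>\<^sup>+\<xi>. ennreal (?c * dominator k \<xi>) \<partial>lborel)"
      by (rule nn_integral_mono_AE) (use wb[OF t, of k] in eventually_elim, intro ennreal_leI mult_left_mono c0)
    also have "\<dots> < \<infinity>"
    proof -
      have "0 \<le> dominator k \<xi>" for \<xi> using C0 by (simp add: dominator_def)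
      then show ?thesis
        using c0 by (subst nn_integral_eq_integral) (auto intro!: integrable_mult_right dominator_integrable)
    qed
    finally show ?thesis by (simp add: fb_space_def)
  qed
  show "((\<lambda>s. fb_vec_norm \<psi> (-1) 1 r ((\<chi> k. freq_dist (sol k s)) - (\<chi> k. freq_dist (sol k t)))) \<longlongrightarrow> 0) (at t within {0..T})"
    unfolding tendsto_at_iff_sequentially
  proof (intro allI impI)
    fix s :: "nat \<Rightarrow> real" assume s0: "\<forall>i. s i \<in> {0..T} - {t}" "s \<longlonglongrightarrow> t"
    then have s: "\<And>n. s n \<in> {0..T}" by blast
    have comp: "((\<chi> k. freq_dist (sol k u)) - (\<chi> k. freq_dist (sol k t))) $ k = freq_dist (\<lambda>\<xi>. sol k u \<xi> - sol k t \<xi>)"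
      if "u \<in> {0..T}" for u k
      using freq_dist_diff[OF sol_admissible[OF that] sol_admissible[OF t]] by simp
    have b: "fb_norm \<psi> (-1) 1 r (freq_dist (\<lambda>\<xi>. sol k (s n) \<xi> - sol k t \<xi>)) \<le> (\<integral>\<^sup>+\<xi>. ennreal (?c * (cmod (sol k (s n) \<xi> - sol k t \<xi>) / norm \<xi>)) \<partial>lborel)" for k n
      by (rule fb_norm_le_weighted[OF lp admissible_diff[OF sol_admissible[OF s] sol_admissible[OF t]] r])
    have lim: "(\<lambda>n. \<integral>\<^sup>+\<xi>. ennreal (?c * (cmod (sol k (s n) \<xi> - sol k t \<xi>) / norm \<xi>)) \<partial>lborel) \<longlonglongrightarrow> (\<integral>\<^sup>+\<xi>. 0 \<partial>(lborel :: (real^3) measure))" for k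
    proof (rule nn_integral_dominated_convergence[where w = "\<lambda>\<xi>. ennreal (?c * (2 * dominator k \<xi>))"])
      show "AE \<xi> in lborel. ennreal (?c * (cmod (sol k (s n) \<xi> - sol k t \<xi>) / norm \<xi>)) \<le> ennreal (?c * (2 * dominator k \<xi>))" for n
        using wb[OF s[of n], where k = k] wb[OF t, where k = k]
      proof eventually_elim
        case (elim \<xi>)
        have "cmod (sol k (s n) \<xi> - sol k t \<xi>) / norm \<xi> \<le> cmod (sol k (s n) \<xi>) / norm \<xi> + cmod (sol k t \<xi>) / norm \<xi>"
          by (simp add: add_divide_distrib[symmetric] divide_right_mono norm_triangle_ineq4)
        then show ?case using elim by (intro ennreal_leI mult_left_mono c0) auto
      qed
      have "0 \<le> dominator k \<xi>" for \<xi> using C0 by (simp add: dominator_def)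
      then show "(\<integral>\<^sup>+\<xi>. ennreal (?c * (2 * dominator k \<xi>)) \<partial>lborel) < \<infinity>"
        using c0 by (subst nn_integral_eq_integral) (auto intro!: integrable_mult_right dominator_integrable)
      show "AE \<xi> in lborel. (\<lambda>n. ennreal (?c * (cmod (sol k (s n) \<xi> - sol k t \<xi>) / norm \<xi>))) \<longlonglongrightarrow> 0"
        using AE_quad_total
      proof eventually_elim
        case (elim \<xi>)
        have "(\<lambda>n. ?c * (cmod (sol k (s n) \<xi> - sol k t \<xi>) / norm \<xi>)) \<longlonglongrightarrow> ?c * (cmod (sol k t \<xi> - sol k t \<xi>) / norm \<xi>)"
        proof (cases "\<xi> = 0")
          case False
          then show ?thesis
            by (intro tendsto_mult tendsto_divide tendsto_norm tendsto_diff tendsto_const sol_tendsto[OF elim s s0(2) t]) simp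
        qed simp
        then have "(\<lambda>n. ?c * (cmod (sol k (s n) \<xi> - sol k t \<xi>) / norm \<xi>)) \<longlonglongrightarrow> 0" by simp
        from tendsto_ennrealI[OF this] show ?case by simp
      qed
      have [measurable]: "dominator k \<in> borel_measurable borel"
        using borel_measurable_integrable[OF dominator_integrable[of k]] by simp
      show "(\<lambda>\<xi>. ennreal (?c * (2 * dominator k \<xi>))) \<in> borel_measurable lborel" by measurable
    qed measurable
    have L0: "(\<lambda>n. \<Sum>k\<in>UNIV. \<integral>\<^sup>+\<xi>. ennreal (?c * (cmod (sol k (s n) \<xi> - sol k t \<xi>) / norm \<xi>)) \<partial>lborel) \<longlonglongrightarrow> (\<Sum>k\<in>(UNIV::4 set). 0)"
      by (intro tendsto_sum) (use lim in simp)
    then have L: "(\<lambda>n. \<Sum>k\<in>UNIV. \<integral>\<^sup>+\<xi>. ennreal (?c * (cmod (sol k (s n) \<xi> - sol k t \<xi>) / norm \<xi>)) \<partial>lborel) \<longlonglongrightarrow> 0"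
      by (simp only: sum.neutral_const)
    have U: "fb_vec_norm \<psi> (-1) 1 r ((\<chi> k. freq_dist (sol k (s n))) - (\<chi> k. freq_dist (sol k t)))
      \<le> (\<Sum>k\<in>UNIV. \<integral>\<^sup>+\<xi>. ennreal (?c * (cmod (sol k (s n) \<xi> - sol k t \<xi>) / norm \<xi>)) \<partial>lborel)" for n
      unfolding fb_vec_norm_def comp[OF s] by (intro sum_mono b)
    show "((\<lambda>s. fb_vec_norm \<psi> (-1) 1 r ((\<chi> k. freq_dist (sol k s)) - (\<chi> k. freq_dist (sol k t)))) \<circ> s) \<longlonglongrightarrow> 0"
      unfolding comp_def 
      by (rule tendsto_sandwich[OF _ _ tendsto_const L]; intro always_eventually allI; (rule U | rule zero_le))
  qed
qed

end

end

section \<open>The mild equation\<close>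

lemma AE_nonzero: "AE \<xi>::real^3 in lborel. \<xi> \<noteq> 0"
  by (rule AE_lborel_singleton)

context picard
begin

context
  fixes \<psi> g \<Omega> N
  assumes finX: "Xnorm sol < \<infinity>" and lp: "littlewood_paley \<psi>"
    and E_eq: "\<And>s \<xi> k l. E s \<xi> k l = duhamel_symbol g \<Omega> N s \<xi> $ k $ l"
    and d_fixed: "\<And>t \<xi> k. \<xi> \<noteq> 0 \<Longrightarrow> (\<Sum>l\<in>UNIV. of_real (coriolis_symbol g \<Omega> N t \<xi> $ k $ l) * d l \<xi>) = d k \<xi>"
begin

definition good :: "real set" where
  "good = {\<tau>. (\<integral>\<^sup>+\<xi>. mag sol \<tau> \<xi> \<partial>lborel) < \<infinity>}"

lemma good_measurable [measurable]: "good \<in> sets borel"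
proof -
  note [measurable] = mag_measurable[OF sol_joint_measurable]
  have "(\<lambda>\<tau>. \<integral>\<^sup>+\<xi>. mag sol \<tau> \<xi> \<partial>lborel) \<in> borel_measurable borel" by measurable
  then show ?thesis unfolding good_def by measurable
qed

lemma AE_good: "AE \<tau> in lborel. \<tau> \<in> {0..T} \<longrightarrow> \<tau> \<in> good"
proof -
  note [measurable] = mag_measurable[OF sol_joint_measurable]
  have "AE \<tau> in lborel. (\<integral>\<^sup>+\<xi>. mag sol \<tau> \<xi> \<partial>lborel)\<^sup>2 * indicator {0..T} \<tau> \<noteq> \<infinity>"
    by (rule nn_integral_PInf_AE) (use finX in \<open>auto simp: Xnorm_def\<close>)
  then show ?thesis
  proof eventually_elim
    case (elim \<tau>)
    then show ?case
      by (auto simp: good_def less_top[symmetric] power2_eq_square)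
  qed
qed

lemma good_integrable:
  assumes "\<tau> \<in> good" shows "integrable lborel (sol k \<tau>)"
proof (rule integrableI_bounded)
  show "sol k \<tau> \<in> borel_measurable lborel" using sol_measurable[OF finX] by simp
  have "(\<integral>\<^sup>+\<xi>. ennreal (norm (sol k \<tau> \<xi>)) \<partial>lborel) \<le> (\<integral>\<^sup>+\<xi>. mag sol \<tau> \<xi> \<partial>lborel)"
    by (intro nn_integral_mono cmod_le_mag)
  then show "(\<integral>\<^sup>+\<xi>. ennreal (norm (sol k \<tau> \<xi>)) \<partial>lborel) < \<infinity>"
    using assms by (auto simp: good_def intro: le_less_trans)
qed

text \<open>The convolution is a junk value at the (null set of) times at which \<open>sol\<close> is not integrable.\<close>

definition QF :: "real \<Rightarrow> 4 \<Rightarrow> 4 \<Rightarrow> real^3 \<Rightarrow> complex" where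
  "QF \<tau> j l \<xi> = (if \<tau> \<in> good then conv (sol j \<tau>) (sol l \<tau>) \<xi> else 0)"

lemma QF_integrable: "integrable lborel (QF \<tau> j l)"
  unfolding QF_def[abs_def] using conv_integrable[OF good_integrable good_integrable, of \<tau> \<tau> j l] by (cases "\<tau> \<in> good") simp_all

lemma test_bound:
  assumes "test_off_0 \<phi>" obtains B where "B \<ge> 0" "\<And>\<xi>. norm \<xi> * cmod (\<phi> \<xi>) \<le> B"
proof -
  obtain B where B: "B \<ge> 0" "\<And>\<xi>. (1 + norm \<xi>) ^ 1 * cmod (\<phi> \<xi>) \<le> B"
    using rapid_boundE[OF schwartz_rapid[OF test_off_0_schwartz[OF assms]]] by metis
  then show ?thesis using that[of B] by (smt (verit) distrib_right mult_cancel_right1 norm_ge_zero power_one_right)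
qed

lemma duhamel_pairing:
  fixes k :: 4
  assumes t: "t \<in> {0..T}" and \<phi>: "test_off_0 \<phi>"
  defines "I \<equiv> (\<lambda>\<tau>. \<Sum>l\<in>UNIV. \<Sum>j\<in>{1, 2, 3}. hat_pair (freq_dist (QF \<tau> j l))
                   (\<lambda>\<xi>. of_real ((semigroup_symbol \<nu> g \<Omega> N (t - \<tau>) \<xi> ** leray \<xi>) $ k $ l)
                         * (\<i> * of_real (freq4 \<xi> $ j)) * \<phi> \<xi>))"
  shows "set_integrable lborel {0..t} I"
    and "(LINT \<tau>:{0..t}|lborel. I \<tau>) = (LINT \<xi>|lborel. duh sol k t \<xi> * \<phi> \<xi>)"
proof -
  note s\<phi> = test_off_0_schwartz[OF \<phi>]
  obtain B where B: "B \<ge> 0" "\<And>\<xi>. norm \<xi> * cmod (\<phi> \<xi>) \<le> B" using test_bound[OF \<phi>] by metis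
  note [measurable] = quad_measurable[OF sol_joint_measurable] duh_kernel_measurable[OF sol_joint_measurable] schwartz_measurable[OF s\<phi>]
  let ?K = "\<lambda>\<tau> \<xi>. (indicator {0..t} \<tau> * indicator good \<tau>) *\<^sub>R (duh_kernel sol k t \<xi> \<tau> * \<phi> \<xi>)"
  have IK: "integrable (lborel \<Otimes>\<^sub>M lborel) (\<lambda>(\<tau>, \<xi>). ?K \<tau> \<xi>)"
  proof (rule integrableI_bounded)
    show "(\<lambda>(\<tau>, \<xi>). ?K \<tau> \<xi>) \<in> borel_measurable (lborel \<Otimes>\<^sub>M lborel)"
      unfolding case_prod_unfold by measurable
    have "ennreal (norm (?K \<tau> \<xi>)) \<le> ennreal (C0 * B) * (quad sol \<tau> \<xi> * indicator {0..T} \<tau>)" for \<tau> \<xi>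
    proof (cases "\<tau> \<in> {0..t}")
      case True
      have "ennreal (norm (?K \<tau> \<xi>)) \<le> ennreal (cmod (\<phi> \<xi>)) * ennreal (cmod (duh_kernel sol k t \<xi> \<tau>))"
        by (auto simp: norm_mult ennreal_mult[symmetric] mult.commute indicator_def intro!: ennreal_leI)
      also have "\<dots> \<le> ennreal (cmod (\<phi> \<xi>)) * (ennreal (C0 * (norm \<xi> * heat \<nu> (t - \<tau>) \<xi>)) * quad sol \<tau> \<xi>)"
        by (rule mult_left_mono[OF duh_kernel_bound[OF sol_joint_measurable]]) (use t True in auto)
      also have "\<dots> = ennreal (cmod (\<phi> \<xi>) * (C0 * (norm \<xi> * heat \<nu> (t - \<tau>) \<xi>))) * quad sol \<tau> \<xi>"
        using C0 by (subst (2) ennreal_mult) (auto simp: mult.assoc)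
      also have "\<dots> \<le> ennreal (C0 * B) * quad sol \<tau> \<xi>"
      proof (intro mult_right_mono ennreal_leI)
        have "heat \<nu> (t - \<tau>) \<xi> \<le> 1" using heat_le_1[of \<nu> "t - \<tau>" \<xi>] nu True by simp
        then have "(norm \<xi> * cmod (\<phi> \<xi>)) * heat \<nu> (t - \<tau>) \<xi> \<le> B * 1"
          using B by (intro mult_mono) auto
        from mult_left_mono[OF this, of C0] show "cmod (\<phi> \<xi>) * (C0 * (norm \<xi> * heat \<nu> (t - \<tau>) \<xi>)) \<le> C0 * B"
          using C0 by (simp add: mult_ac)
      qed simp
      finally show ?thesis using True t by simp
    qed simp
    then have "(\<integral>\<^sup>+p. ennreal (norm (case p of (\<tau>, \<xi>) \<Rightarrow> ?K \<tau> \<xi>)) \<partial>(lborel \<Otimes>\<^sub>M lborel))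
      \<le> (\<integral>\<^sup>+p. ennreal (C0 * B) * (quad sol (fst p) (snd p) * indicator {0..T} (fst p)) \<partial>(lborel \<Otimes>\<^sub>M lborel))"
      by (intro nn_integral_mono) (simp add: case_prod_unfold)
    also have "\<dots> = ennreal (C0 * B) * (\<integral>\<^sup>+\<tau>. (\<integral>\<^sup>+\<xi>. quad sol \<tau> \<xi> * indicator {0..T} \<tau> \<partial>lborel) \<partial>lborel)"
    proof -
      have mq: "(\<lambda>p. quad sol (fst p) (snd p) * indicator {0..T} (fst p)) \<in> borel_measurable (lborel \<Otimes>\<^sub>M lborel)"
        unfolding indicator_def atLeastAtMost_iff by measurable
      show ?thesis
        using nn_integral_cmult[OF mq, of "ennreal (C0 * B)"] lborel.nn_integral_fst[OF mq] by simp
    qed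
    also have "\<dots> = ennreal (C0 * B) * Xnorm sol"
      by (simp add: nn_integral_multc nn_integral_quad[OF sol_joint_measurable] Xnorm_def)
    also have "\<dots> < \<infinity>" using finX by (simp add: ennreal_mult_less_top)
    finally show "(\<integral>\<^sup>+p. ennreal (norm (case p of (\<tau>, \<xi>) \<Rightarrow> ?K \<tau> \<xi>)) \<partial>(lborel \<Otimes>\<^sub>M lborel)) < \<infinity>" .
  qed
  have Ieq: "indicator {0..t} \<tau> *\<^sub>R I \<tau> = (LINT \<xi>|lborel. ?K \<tau> \<xi>)" for \<tau>
  proof -
    let ?\<chi> = "\<lambda>l j \<xi>. of_real ((semigroup_symbol \<nu> g \<Omega> N (t - \<tau>) \<xi> ** leray \<xi>) $ k $ l) * (\<i> * of_real (freq4 \<xi> $ j)) * \<phi> \<xi>"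
    have test: "test_off_0 (?\<chi> l j)" for l j
      by (intro test_off_0_mult \<phi> smooth_off_0_mult smooth_off_0_semigroup_leray smooth_off_0_const smooth_off_0_freq4)
    have ints: "integrable lborel (\<lambda>\<xi>. QF \<tau> j l \<xi> * ?\<chi> l j \<xi>)" for l j
      by (rule admissible_schwartz_mult[OF integrable_admissible[OF QF_integrable] test_off_0_schwartz[OF test]])
    have "I \<tau> = (\<Sum>l\<in>UNIV. \<Sum>j\<in>{1,2,3}. LINT \<xi>|lborel. QF \<tau> j l \<xi> * ?\<chi> l j \<xi>)"
      unfolding I_def by (intro sum.cong refl hat_pair_freq_dist[OF integrable_admissible[OF QF_integrable] test])
    also have "\<dots> = (LINT \<xi>|lborel. (\<Sum>l\<in>UNIV. \<Sum>j\<in>{1,2,3}. QF \<tau> j l \<xi> * ?\<chi> l j \<xi>))"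
      by (simp only: Bochner_Integration.integral_sum Bochner_Integration.integrable_sum ints)
    also have "\<dots> = (LINT \<xi>|lborel. indicator good \<tau> *\<^sub>R (duh_kernel sol k t \<xi> \<tau> * \<phi> \<xi>))"
    proof (rule integral_cong_AE)
      show "(\<lambda>\<xi>. \<Sum>l\<in>UNIV. \<Sum>j\<in>{1,2,3}. QF \<tau> j l \<xi> * ?\<chi> l j \<xi>) \<in> borel_measurable lborel"
        by (intro borel_measurable_sum borel_measurable_integrable[OF ints])
      show "AE \<xi> in lborel. (\<Sum>l\<in>UNIV. \<Sum>j\<in>{1,2,3}. QF \<tau> j l \<xi> * ?\<chi> l j \<xi>) = indicator good \<tau> *\<^sub>R (duh_kernel sol k t \<xi> \<tau> * \<phi> \<xi>)"
        using AE_nonzero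
      proof eventually_elim
        case (elim \<xi>)
        have sy: "(semigroup_symbol \<nu> g \<Omega> N (t - \<tau>) \<xi> ** leray \<xi>) $ k $ l = heat \<nu> (t - \<tau>) \<xi> * E (t - \<tau>) \<xi> k l" for l
          by (simp add: semigroup_symbol_eq[OF elim] scaleR_matrix_mult heat_def E_eq duhamel_symbol_def)
        show ?case unfolding sy QF_def duh_kernel_def
          by (cases "\<tau> \<in> good") (simp_all add: sum_distrib_left mult_ac del: sum.insert)
      qed
    qed measurable
    finally show ?thesis by simp
  qed
  show "set_integrable lborel {0..t} I"
    unfolding set_integrable_def Ieq using lborel_pair.integrable_fst[OF IK] by simp
  have "(LINT \<tau>:{0..t}|lborel. I \<tau>) = (LINT \<tau>|lborel. (LINT \<xi>|lborel. ?K \<tau> \<xi>))"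
    unfolding set_lebesgue_integral_def Ieq ..
  also have "\<dots> = (LINT \<xi>|lborel. (LINT \<tau>|lborel. ?K \<tau> \<xi>))"
    using lborel_pair.Fubini_integral[OF IK] by simp
  also have "\<dots> = (LINT \<xi>|lborel. duh sol k t \<xi> * \<phi> \<xi>)"
  proof (rule Bochner_Integration.integral_cong[OF refl])
    fix \<xi>
    have "(LINT \<tau>|lborel. ?K \<tau> \<xi>) = (LINT \<tau>|lborel. (indicator {0..t} \<tau> *\<^sub>R duh_kernel sol k t \<xi> \<tau>) * \<phi> \<xi>)"
    proof (rule integral_cong_AE)
      show "AE \<tau> in lborel. ?K \<tau> \<xi> = (indicator {0..t} \<tau> *\<^sub>R duh_kernel sol k t \<xi> \<tau>) * \<phi> \<xi>"
        using AE_good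
        by eventually_elim (use t in \<open>auto simp: indicator_def\<close>)
    qed measurable
    then show "(LINT \<tau>|lborel. ?K \<tau> \<xi>) = duh sol k t \<xi> * \<phi> \<xi>"
      unfolding duh_def by (simp only: integral_mult_left_zero)
  qed
  finally show "(LINT \<tau>:{0..t}|lborel. I \<tau>) = (LINT \<xi>|lborel. duh sol k t \<xi> * \<phi> \<xi>)" .
qed

lemma sol_mild: "mild_solution \<psi> \<nu> g \<Omega> N T (\<chi> k. freq_dist (d k)) (\<lambda>t. \<chi> k. freq_dist (sol k t))"
  unfolding mild_solution_def
proof (intro exI[of _ "\<lambda>\<tau>. \<chi> j l. freq_dist (QF \<tau> j l)"] conjI ballI allI impI)
  show "AE \<tau> in lborel. \<tau> \<in> {0<..<T} \<longrightarrow> (\<forall>j\<in>{1, 2, 3}. \<forall>l. is_product \<psi> ((\<chi> k. freq_dist (sol k \<tau>)) $ j) ((\<chi> k. freq_dist (sol k \<tau>)) $ l) ((\<chi> j l. freq_dist (QF \<tau> j l)) $ j $ l))"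
    using AE_good
  proof eventually_elim
    case (elim \<tau>)
    show ?case
    proof (intro impI ballI allI)
      fix j l assume "\<tau> \<in> {0<..<T}"
      then have g: "\<tau> \<in> good" using elim by auto
      then have "QF \<tau> j l = conv (sol j \<tau>) (sol l \<tau>)" by (simp add: QF_def fun_eq_iff)
      then show "is_product \<psi> ((\<chi> k. freq_dist (sol k \<tau>)) $ j) ((\<chi> k. freq_dist (sol k \<tau>)) $ l) ((\<chi> j l. freq_dist (QF \<tau> j l)) $ j $ l)"
        using is_product_conv[OF lp good_integrable[OF g] good_integrable[OF g], of j l] by simp
    qed
  qed
  fix t k \<phi> assume t: "t \<in> {0..T}" and \<phi>: "test_off_0 \<phi>"
  note s\<phi> = test_off_0_schwartz[OF \<phi>]
  have ad: "admissible (d l)" for l by (rule integrable_admissible[OF d_int])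
  have test: "test_off_0 (\<lambda>\<xi>. of_real (semigroup_symbol \<nu> g \<Omega> N t \<xi> $ k $ l) * \<phi> \<xi>)" for l
    by (intro test_off_0_mult \<phi> smooth_off_0_semigroup)
  have ints: "integrable lborel (\<lambda>\<xi>. d l \<xi> * (of_real (semigroup_symbol \<nu> g \<Omega> N t \<xi> $ k $ l) * \<phi> \<xi>))" for l
    by (rule admissible_schwartz_mult[OF ad test_off_0_schwartz[OF test]])
  have fr: "AE \<xi> in lborel. (\<Sum>l\<in>UNIV. d l \<xi> * (of_real (semigroup_symbol \<nu> g \<Omega> N t \<xi> $ k $ l) * \<phi> \<xi>)) = free k t \<xi> * \<phi> \<xi>"
    using AE_nonzero
  proof eventually_elim
    case (elim \<xi>)
    have "free k t \<xi> * \<phi> \<xi> = of_real (heat \<nu> t \<xi>) * (\<Sum>l\<in>UNIV. of_real (coriolis_symbol g \<Omega> N t \<xi> $ k $ l) * d l \<xi>) * \<phi> \<xi>"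
      by (simp only: free_def d_fixed[OF elim])
    also have "\<dots> = (\<Sum>l\<in>UNIV. d l \<xi> * (of_real (semigroup_symbol \<nu> g \<Omega> N t \<xi> $ k $ l) * \<phi> \<xi>))"
      by (simp add: semigroup_symbol_eq[OF elim] heat_def sum_distrib_left mult_ac)
    finally show ?case by simp
  qed
  have mfr: "(\<lambda>\<xi>. free k t \<xi> * \<phi> \<xi>) \<in> borel_measurable lborel"
  proof -
    note [measurable] = schwartz_measurable[OF s\<phi>]
    show ?thesis unfolding free_def by measurable
  qed
  have Isum: "integrable lborel (\<lambda>\<xi>. \<Sum>l\<in>UNIV. d l \<xi> * (of_real (semigroup_symbol \<nu> g \<Omega> N t \<xi> $ k $ l) * \<phi> \<xi>))"
    by (intro Bochner_Integration.integrable_sum ints)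
  have Ifr: "integrable lborel (\<lambda>\<xi>. free k t \<xi> * \<phi> \<xi>)"
    using integrable_cong_AE_imp[OF Isum mfr] fr by (simp add: eq_commute)
  have data: "(\<Sum>l\<in>UNIV. hat_pair ((\<chi> k. freq_dist (d k)) $ l) (\<lambda>\<xi>. of_real (semigroup_symbol \<nu> g \<Omega> N t \<xi> $ k $ l) * \<phi> \<xi>))
    = (LINT \<xi>|lborel. free k t \<xi> * \<phi> \<xi>)"
  proof -
    have "(\<Sum>l\<in>UNIV. hat_pair ((\<chi> k. freq_dist (d k)) $ l) (\<lambda>\<xi>. of_real (semigroup_symbol \<nu> g \<Omega> N t \<xi> $ k $ l) * \<phi> \<xi>))
      = (\<Sum>l\<in>UNIV. LINT \<xi>|lborel. d l \<xi> * (of_real (semigroup_symbol \<nu> g \<Omega> N t \<xi> $ k $ l) * \<phi> \<xi>))"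
      by (intro sum.cong refl) (simp add: hat_pair_freq_dist[OF ad test])
    also have "\<dots> = (LINT \<xi>|lborel. (\<Sum>l\<in>UNIV. d l \<xi> * (of_real (semigroup_symbol \<nu> g \<Omega> N t \<xi> $ k $ l) * \<phi> \<xi>)))"
      by (rule Bochner_Integration.integral_sum[symmetric]) (rule ints)
    also have "\<dots> = (LINT \<xi>|lborel. free k t \<xi> * \<phi> \<xi>)"
      by (rule integral_cong_AE[OF borel_measurable_integrable[OF Isum] mfr fr])
    finally show ?thesis .
  qed
  have as: "admissible (sol k t)" by (rule sol_admissible[OF finX t])
  have Is: "integrable lborel (\<lambda>\<xi>. sol k t \<xi> * \<phi> \<xi>)" by (rule admissible_schwartz_mult[OF as s\<phi>])
  have duh_eq: "duh sol k t \<xi> * \<phi> \<xi> = free k t \<xi> * \<phi> \<xi> - sol k t \<xi> * \<phi> \<xi>" for \<xi>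
    by (subst sol_fixed_point) (simp add: step_def algebra_simps)
  have "(LINT \<xi>|lborel. duh sol k t \<xi> * \<phi> \<xi>) = (LINT \<xi>|lborel. free k t \<xi> * \<phi> \<xi>) - (LINT \<xi>|lborel. sol k t \<xi> * \<phi> \<xi>)"
    unfolding duh_eq by (rule Bochner_Integration.integral_diff[OF Ifr Is])
  then have main: "hat_pair ((\<chi> k. freq_dist (sol k t)) $ k) \<phi>
     = (LINT \<xi>|lborel. free k t \<xi> * \<phi> \<xi>) - (LINT \<xi>|lborel. duh sol k t \<xi> * \<phi> \<xi>)"
    by (simp add: hat_pair_freq_dist[OF as \<phi>])
  show "let I = (\<lambda>\<tau>. \<Sum>l\<in>UNIV. \<Sum>j\<in>{1, 2, 3}. hat_pair ((\<chi> j l. freq_dist (QF \<tau> j l)) $ j $ l)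
                   (\<lambda>\<xi>. of_real ((semigroup_symbol \<nu> g \<Omega> N (t - \<tau>) \<xi> ** leray \<xi>) $ k $ l)
                         * (\<i> * of_real (freq4 \<xi> $ j)) * \<phi> \<xi>))
         in set_integrable lborel {0..t} I \<and>
            hat_pair ((\<chi> k. freq_dist (sol k t)) $ k) \<phi> =
              (\<Sum>l\<in>UNIV. hat_pair ((\<chi> k. freq_dist (d k)) $ l)
                 (\<lambda>\<xi>. of_real (semigroup_symbol \<nu> g \<Omega> N t \<xi> $ k $ l) * \<phi> \<xi>))
              - (LINT \<tau>:{0..t}|lborel. I \<tau>)"
    unfolding Let_def vec_lambda_beta data[unfolded vec_lambda_beta]
    using duhamel_pairing[OF t \<phi>, of k] main[unfolded vec_lambda_beta] by simp
qed

end

end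

section \<open>Geostrophic data\<close>

definition cube :: "(3 \<Rightarrow> real) \<Rightarrow> real \<Rightarrow> (real^3) set" where
  "cube c h = cbox (\<chi> i. c i - h) (\<chi> i. c i + h)"

lemma mem_cube: "\<xi> \<in> cube c h \<longleftrightarrow> (\<forall>i. \<bar>\<xi> $ i - c i\<bar> \<le> h)"
proof -
  have "(c i - h \<le> x \<and> x \<le> c i + h) \<longleftrightarrow> \<bar>x - c i\<bar> \<le> h" for x i
    by auto
  then show ?thesis unfolding cube_def mem_box_cart by simp
qed

lemma cube_sets [measurable]: "cube c h \<in> sets borel"
  by (simp add: cube_def)

lemma emeasure_cube:
  assumes "h \<ge> 0" shows "emeasure lborel (cube c h) = ennreal ((2 * h) ^ 3)"
proof -
  have "cube c h \<noteq> {}"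
    using assms by (auto simp: mem_cube intro: exI[of _ "\<chi> i. c i"] simp: set_eq_iff)
  then have "measure lborel (cube c h) = (2 * h) ^ 3"
    unfolding cube_def by (subst content_cbox_cart) auto
  moreover have "emeasure lborel (cube c h) \<noteq> \<top>"
    unfolding cube_def using emeasure_lborel_cbox_finite by (simp only: infinity_ennreal_def less_top)
  ultimately show ?thesis by (simp add: emeasure_eq_ennreal_measure)
qed

text \<open>The boxes have the same size at every scale, and both signs of \<open>\<xi>\<^sub>1\<close> occur, so that two
  frequencies of size \<open>2\<^sup>j\<close> interact to one of size \<open>1\<close>.\<close>

definition freq_box :: "nat \<Rightarrow> (real^3) set" where
  "freq_box j = {\<xi>. \<bar>\<bar>\<xi> $ 1\<bar> - 2 ^ j\<bar> \<le> 1/8 \<and> 1 \<le> \<xi> $ 2 \<and> \<xi> $ 2 \<le> 5/4 \<and> 1 \<le> \<xi> $ 3 \<and> \<xi> $ 3 \<le> 5/4}"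

definition freq_boxes :: "nat \<Rightarrow> nat \<Rightarrow> (real^3) set" where
  "freq_boxes a n = (\<Union>j\<in>{a + 1..a + n}. freq_box j)"

text \<open>Geostrophic balance: a vector in the kernel of the generator, so that the semigroup acts on it by the
  heat factor alone.\<close>

definition geo :: "real \<Rightarrow> real \<Rightarrow> 4 \<Rightarrow> real^3 \<Rightarrow> real" where
  "geo g \<Omega> k \<xi> = (vector [\<xi> $ 2, - \<xi> $ 1, 0, - (\<Omega> * \<xi> $ 3 / g)] :: real^4) $ k"

lemma geo_simps [simp]: "geo g \<Omega> 1 \<xi> = \<xi> $ 2" "geo g \<Omega> 2 \<xi> = - \<xi> $ 1" "geo g \<Omega> 3 \<xi> = 0" "geo g \<Omega> 4 \<xi> = - (\<Omega> * \<xi> $ 3 / g)"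
  by (simp_all add: geo_def vector_4)

lemma geo_measurable [measurable]: "geo g \<Omega> k \<in> borel_measurable borel"
proof -
  have "geo g \<Omega> k \<in> {geo g \<Omega> 1, geo g \<Omega> 2, geo g \<Omega> 3, geo g \<Omega> 4}" using exhaust_4[of k] by auto
  moreover have "geo g \<Omega> 1 \<in> borel_measurable borel" "geo g \<Omega> 2 \<in> borel_measurable borel"
    "geo g \<Omega> 3 \<in> borel_measurable borel" "geo g \<Omega> 4 \<in> borel_measurable borel"
    unfolding geo_simps[abs_def] by auto
  ultimately show ?thesis by (elim insertE emptyE) simp_all
qed

definition data :: "real \<Rightarrow> nat \<Rightarrow> nat \<Rightarrow> real \<Rightarrow> real \<Rightarrow> 4 \<Rightarrow> real^3 \<Rightarrow> complex" where
  "data lam a n g \<Omega> k \<xi> = complex_of_real (lam * indicator (freq_boxes a n) \<xi> * geo g \<Omega> k \<xi>)"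

lemma freq_box_sets [measurable]: "freq_box j \<in> sets borel"
  unfolding freq_box_def by measurable

lemma freq_boxes_sets [measurable]: "freq_boxes a n \<in> sets borel"
  unfolding freq_boxes_def by measurable

lemma data_measurable [measurable]: "data lam a n g \<Omega> k \<in> borel_measurable borel"
  unfolding data_def by measurable

lemma freq_box_norm:
  assumes "\<xi> \<in> freq_box j" "2 \<le> j"
  shows "2 ^ j / 2 \<le> norm \<xi>" "norm \<xi> \<le> 2 * 2 ^ j" "2 ^ j / 2 \<le> \<bar>\<xi> $ 1\<bar>"
proof -
  have "(2::real) ^ 2 \<le> 2 ^ j" using assms(2) by (intro power_increasing) auto
  then have 4: "4 \<le> (2::real) ^ j" by simp
  have x: "\<bar>\<bar>\<xi> $ 1\<bar> - 2 ^ j\<bar> \<le> 1/8" "1 \<le> \<xi> $ 2" "\<xi> $ 2 \<le> 5/4" "1 \<le> \<xi> $ 3" "\<xi> $ 3 \<le> 5/4"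
    using assms(1) by (auto simp: freq_box_def)
  show 1: "2 ^ j / 2 \<le> \<bar>\<xi> $ 1\<bar>" using x 4 by linarith
  then show "2 ^ j / 2 \<le> norm \<xi>" using component_le_norm_cart[of \<xi> 1] by linarith
  have "norm \<xi> \<le> \<bar>\<xi> $ 1\<bar> + \<bar>\<xi> $ 2\<bar> + \<bar>\<xi> $ 3\<bar>" using norm_le_l1_cart[of \<xi>] by (simp add: sum_3)
  then show "norm \<xi> \<le> 2 * 2 ^ j" using x 4 by linarith
qed

lemma geo_bound:
  assumes "\<xi> \<in> freq_box j" "2 \<le> j" "g > 0"
  shows "\<bar>geo g \<Omega> k \<xi>\<bar> \<le> (2 + 2 * \<bar>\<Omega>\<bar> / g) * 2 ^ j"
proof -
  have p: "1 \<le> (2::real) ^ j" by simp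
  have x: "\<bar>\<bar>\<xi> $ 1\<bar> - 2 ^ j\<bar> \<le> 1/8" "1 \<le> \<xi> $ 2" "\<xi> $ 2 \<le> 5/4" "1 \<le> \<xi> $ 3" "\<xi> $ 3 \<le> 5/4"
    using assms(1) by (auto simp: freq_box_def)
  have V: "0 \<le> \<bar>\<Omega>\<bar> / g" using assms(3) by simp
  have b1: "2 * 2 ^ j \<le> (2 + 2 * \<bar>\<Omega>\<bar> / g) * 2 ^ j" using V by (intro mult_right_mono) auto
  have b2: "2 * \<bar>\<Omega>\<bar> / g \<le> (2 + 2 * \<bar>\<Omega>\<bar> / g) * 2 ^ j"
  proof -
    have "(2 + 2 * \<bar>\<Omega>\<bar> / g) * 1 \<le> (2 + 2 * \<bar>\<Omega>\<bar> / g) * 2 ^ j" using V p by (intro mult_left_mono) auto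
    then show ?thesis by simp
  qed
  have "\<bar>\<Omega> * \<xi> $ 3 / g\<bar> = (\<bar>\<Omega>\<bar> / g) * \<bar>\<xi> $ 3\<bar>" using assms(3) by (simp add: abs_mult)
  also have "\<dots> \<le> (\<bar>\<Omega>\<bar> / g) * 2" using V x by (intro mult_left_mono) auto
  also have "(\<bar>\<Omega>\<bar> / g) * 2 = 2 * \<bar>\<Omega>\<bar> / g" by simp
  finally have b3: "\<bar>\<Omega> * \<xi> $ 3 / g\<bar> \<le> 2 * \<bar>\<Omega>\<bar> / g" .
  consider "k = 1" | "k = 2" | "k = 3" | "k = 4" using exhaust_4[of k] by blast
  then show ?thesis
  proof cases
    case 1
    have "\<bar>\<xi> $ 2\<bar> \<le> 2 * 2 ^ j" using x p by linarith
    then show ?thesis unfolding 1 geo_simps using b1 by linarith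
  next
    case 2
    have "\<bar>- \<xi> $ 1\<bar> \<le> 2 * 2 ^ j" using x p by linarith
    then show ?thesis unfolding 2 geo_simps using b1 by linarith
  next
    case 3 then show ?thesis using V by simp
  next
    case 4 then show ?thesis using b2 b3 by simp
  qed
qed

lemma emeasure_freq_box: "emeasure lborel (freq_box j) \<le> 1"
proof -
  let ?c = "\<lambda>s i. if i = 1 then s * 2 ^ j else 9/8 :: real"
  have "freq_box j \<subseteq> cube (?c 1) (1/8) \<union> cube (?c (-1)) (1/8)"
    by (auto simp: freq_box_def mem_cube forall_3 abs_le_iff abs_if split: if_splits)
  then have "emeasure lborel (freq_box j) \<le> emeasure lborel (cube (?c 1) (1/8) \<union> cube (?c (-1)) (1/8))"
    by (intro emeasure_mono) auto
  also have "\<dots> \<le> emeasure lborel (cube (?c 1) (1/8)) + emeasure lborel (cube (?c (-1)) (1/8))"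
    by (rule emeasure_subadditive) auto
  also have "\<dots> \<le> 1"
    by (simp add: emeasure_cube ennreal_plus[symmetric] power_divide del: ennreal_plus)
  finally show ?thesis .
qed

lemma freq_boxesE:
  assumes "\<xi> \<in> freq_boxes a n" "1 \<le> a" obtains j where "j \<in> {a + 1..a + n}" "2 \<le> j" "\<xi> \<in> freq_box j"
proof -
  obtain j where "j \<in> {a + 1..a + n}" "\<xi> \<in> freq_box j" using assms(1) by (auto simp: freq_boxes_def)
  then show ?thesis using that[of j] assms(2) by auto
qed

lemma freq_boxes_half_space: "\<xi> \<in> freq_boxes a n \<Longrightarrow> 1 \<le> \<xi> $ 2 \<and> \<xi> $ 2 \<le> 5/4"
  by (auto simp: freq_boxes_def freq_box_def)

lemma data_integrable:
  assumes "1 \<le> a" "g > 0"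
  shows "integrable lborel (data lam a n g \<Omega> k)"
proof -
  let ?V = "2 + 2 * \<bar>\<Omega>\<bar> / g"
  have fin: "emeasure lborel (freq_boxes a n) < \<infinity>"
  proof -
    have "emeasure lborel (freq_boxes a n) \<le> (\<Sum>j\<in>{a + 1..a + n}. emeasure lborel (freq_box j))"
      unfolding freq_boxes_def by (rule emeasure_subadditive_finite) auto
    also have "\<dots> \<le> (\<Sum>j\<in>{a + 1..a + n}. 1)" by (intro sum_mono emeasure_freq_box)
    also have "\<dots> < \<infinity>" by (simp add: of_nat_less_top)
    finally show ?thesis .
  qed
  have I: "integrable lborel (\<lambda>\<xi>::real^3. \<bar>lam\<bar> * (?V * 2 ^ (a + n)) * indicator (freq_boxes a n) \<xi>)"
    using fin by (intro integrable_mult_right integrable_real_indicator) auto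
  show ?thesis
  proof (rule Bochner_Integration.integrable_bound[OF I])
    show "AE \<xi> in lborel. norm (data lam a n g \<Omega> k \<xi>) \<le> norm (\<bar>lam\<bar> * (?V * 2 ^ (a + n)) * indicator (freq_boxes a n) \<xi> :: real)"
    proof (rule AE_I2)
      fix \<xi> :: "real^3"
      show "norm (data lam a n g \<Omega> k \<xi>) \<le> norm (\<bar>lam\<bar> * (?V * 2 ^ (a + n)) * indicator (freq_boxes a n) \<xi> :: real)"
      proof (cases "\<xi> \<in> freq_boxes a n")
        case True
        then obtain j where j: "j \<in> {a + 1..a + n}" "2 \<le> j" "\<xi> \<in> freq_box j" using freq_boxesE assms(1) by blast
        have "\<bar>geo g \<Omega> k \<xi>\<bar> \<le> ?V * 2 ^ j" by (rule geo_bound[OF j(3,2) assms(2)])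
        also have "\<dots> \<le> ?V * 2 ^ (a + n)"
          using j(1) assms(2) by (intro mult_left_mono power_increasing) auto
        finally have "\<bar>lam\<bar> * \<bar>geo g \<Omega> k \<xi>\<bar> \<le> \<bar>lam\<bar> * (?V * 2 ^ (a + n))" by (rule mult_left_mono) simp
        also have "\<dots> \<le> \<bar>\<bar>lam\<bar> * (?V * 2 ^ (a + n))\<bar>" by (rule abs_ge_self)
        finally show ?thesis using True by (simp add: data_def norm_mult abs_mult)
      qed (simp add: data_def)
    qed
  qed measurable
qed

lemma data_block_bound:
  fixes \<Omega> :: real
  assumes lp: "littlewood_paley \<psi>" and a: "1 \<le> a" and g: "g > 0" and l: "lam \<ge> 0"
  defines "M \<equiv> 22 * (lam * (2 + 2 * \<bar>\<Omega>\<bar> / g) * psi_bound \<psi>)"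
  shows "(\<integral>\<^sup>+\<xi>. ennreal (2 powi (- j) * cmod (data lam a n g \<Omega> k \<xi> * lp_hat \<psi> j \<xi>)) \<partial>lborel) \<le> ennreal M"
    and "j \<notin> {int a - 1..int (a + n) + 1} \<Longrightarrow> data lam a n g \<Omega> k \<xi> * lp_hat \<psi> j \<xi> = 0"
proof -
  let ?V = "2 + 2 * \<bar>\<Omega>\<bar> / g"
  have V0: "0 \<le> ?V" using g by simp
  note p0 = psi_bound_nonneg[OF lp]
  have near: "int i \<in> {j - 1..j + 2}" if "\<xi> \<in> freq_box i" "2 \<le> i" "lp_hat \<psi> j \<xi> \<noteq> 0" for \<xi> i
  proof -
    have s: "3/4 * 2 powi j \<le> norm \<xi>" "norm \<xi> \<le> 8/3 * 2 powi j" using lp_hat_supp[OF lp that(3)] by auto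
    have b: "2 powi int i / 2 \<le> norm \<xi>" "norm \<xi> \<le> 2 * 2 powi int i" using freq_box_norm[OF that(1,2)] by simp_all
    have pos: "0 < (2::real) powi j" "0 < (2::real) powi int i" by simp_all
    have "\<not> j + 3 \<le> int i"
    proof
      assume "j + 3 \<le> int i"
      then have "(2::real) powi (j + 3) \<le> 2 powi int i" by (intro power_int_increasing) auto
      then have "8 * (2::real) powi j \<le> 2 powi int i" by (simp add: power_int_add)
      then show False using s b pos by linarith
    qed
    moreover have "\<not> int i + 2 \<le> j"
    proof
      assume "int i + 2 \<le> j"
      then have "(2::real) powi (int i + 2) \<le> 2 powi j" by (intro power_int_increasing) auto
      then have "4 * (2::real) powi int i \<le> 2 powi j" by (simp add: power_int_add)
      then show False using s b pos by linarith
    qed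
    ultimately show ?thesis by simp
  qed
  show "data lam a n g \<Omega> k \<xi> * lp_hat \<psi> j \<xi> = 0" if "j \<notin> {int a - 1..int (a + n) + 1}" for \<xi>
  proof (rule ccontr)
    assume "data lam a n g \<Omega> k \<xi> * lp_hat \<psi> j \<xi> \<noteq> 0"
    then have "\<xi> \<in> freq_boxes a n" "lp_hat \<psi> j \<xi> \<noteq> 0" by (auto simp: data_def indicator_def split: if_splits)
    then obtain i where "i \<in> {a + 1..a + n}" "2 \<le> i" "\<xi> \<in> freq_box i" using freq_boxesE a by blast
    with near[of \<xi> i] \<open>lp_hat \<psi> j \<xi> \<noteq> 0\<close> have "int i \<in> {j - 1..j + 2}" by blast
    with \<open>i \<in> _\<close> that show False by auto
  qed
  let ?S = "\<Union>i\<in>{i. 2 \<le> i \<and> int i \<in> {j - 1..j + 2}}. freq_box i"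
  let ?I = "{i. 2 \<le> i \<and> int i \<in> {j - 1..j + 2}}"
  have I: "finite ?I" "card ?I \<le> 4"
  proof -
    have "?I \<subseteq> nat ` {j - 1..j + 2}" by force
    moreover have "card (nat ` {j - 1..j + 2}) \<le> 4" using card_image_le[of "{j - 1..j + 2}" nat] by simp
    ultimately show "finite ?I" "card ?I \<le> 4"
      using finite_subset card_mono[of "nat ` {j - 1..j + 2}" ?I] by auto
  qed
  have mS: "?S \<in> sets lborel" using I(1) by (intro sets.finite_UN) auto
  have "emeasure lborel ?S \<le> (\<Sum>i\<in>?I. emeasure lborel (freq_box i))"
    using I(1) by (intro emeasure_subadditive_finite) auto
  also have "\<dots> \<le> (\<Sum>i\<in>?I. 1)" by (intro sum_mono emeasure_freq_box)
  also have "\<dots> \<le> 4" using I(2) by simp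
  finally have eS: "emeasure lborel ?S \<le> 4" .
  have pt: "2 powi (- j) * cmod (data lam a n g \<Omega> k \<xi> * lp_hat \<psi> j \<xi>) \<le> 16/3 * (lam * ?V * psi_bound \<psi>) * indicator ?S \<xi>" for \<xi>
  proof (cases "data lam a n g \<Omega> k \<xi> * lp_hat \<psi> j \<xi> = 0")
    case True
    show ?thesis unfolding True using l V0 p0 by simp
  next
    case False
    then have x: "\<xi> \<in> freq_boxes a n" "lp_hat \<psi> j \<xi> \<noteq> 0" by (auto simp: data_def indicator_def split: if_splits)
    then obtain i where i: "i \<in> {a + 1..a + n}" "2 \<le> i" "\<xi> \<in> freq_box i" using freq_boxesE a by blast
    have S: "\<xi> \<in> ?S" using near[OF i(3,2) x(2)] i by blast
    have "2 ^ i \<le> 2 * norm \<xi>" using freq_box_norm(1)[OF i(3,2)] by simp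
    also have "\<dots> \<le> 16/3 * 2 powi j" using lp_hat_supp[OF lp x(2)] by simp
    finally have "?V * 2 ^ i \<le> ?V * (16/3 * 2 powi j)" using V0 by (rule mult_left_mono)
    then have "\<bar>geo g \<Omega> k \<xi>\<bar> \<le> ?V * (16/3 * 2 powi j)" using geo_bound[OF i(3,2) g, of \<Omega> k] by linarith
    then have "lam * \<bar>geo g \<Omega> k \<xi>\<bar> * cmod (lp_hat \<psi> j \<xi>) \<le> lam * (?V * (16/3 * 2 powi j)) * psi_bound \<psi>"
      using l V0 by (intro mult_mono lp_hat_le[OF lp] mult_left_mono) auto
    from mult_left_mono[OF this, of "2 powi (- j)"]
    have "2 powi (- j) * (lam * \<bar>geo g \<Omega> k \<xi>\<bar> * cmod (lp_hat \<psi> j \<xi>)) \<le> 2 powi (- j) * (lam * (?V * (16/3 * 2 powi j)) * psi_bound \<psi>)" by simp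
    also have "\<dots> = 16/3 * (lam * ?V * psi_bound \<psi>)" by (simp add: power_int_minus field_simps)
    finally show ?thesis using S x(1) l by (simp add: data_def norm_mult abs_mult)
  qed
  have "(\<integral>\<^sup>+\<xi>. ennreal (2 powi (- j) * cmod (data lam a n g \<Omega> k \<xi> * lp_hat \<psi> j \<xi>)) \<partial>lborel)
    \<le> (\<integral>\<^sup>+\<xi>. ennreal (16/3 * (lam * ?V * psi_bound \<psi>)) * indicator ?S \<xi> \<partial>lborel)"
  proof (rule nn_integral_mono)
    fix \<xi>
    show "ennreal (2 powi (- j) * cmod (data lam a n g \<Omega> k \<xi> * lp_hat \<psi> j \<xi>)) \<le> ennreal (16/3 * (lam * ?V * psi_bound \<psi>)) * indicator ?S \<xi>"
    proof -
      have "ennreal c * indicator A \<xi> = ennreal (c * indicator A \<xi>)" for c and A :: "(real^3) set"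
        by (simp add: indicator_def)
      then show ?thesis using ennreal_leI[OF pt[of \<xi>]] by (simp only:)
    qed
  qed
  also have "\<dots> = ennreal (16/3 * (lam * ?V * psi_bound \<psi>)) * emeasure lborel ?S"
    by (rule nn_integral_cmult_indicator[OF mS])
  also have "\<dots> \<le> ennreal (16/3 * (lam * ?V * psi_bound \<psi>)) * 4"
    by (rule mult_left_mono[OF eS]) simp
  also have "\<dots> = ennreal (64/3 * (lam * ?V * psi_bound \<psi>))"
  proof -
    have e: "ennreal c * 4 = ennreal (c * 4)" if "0 \<le> c" for c
      using that by (subst ennreal_mult) auto
    have "0 \<le> 16/3 * (lam * ?V * psi_bound \<psi>)"
      using l V0 p0 by (intro mult_nonneg_nonneg) auto
    then show ?thesis by (simp only: e) (simp add: mult.commute)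
  qed
  also have "\<dots> \<le> ennreal M"
    unfolding M_def using l V0 p0 by (intro ennreal_leI mult_right_mono) auto
  finally show "(\<integral>\<^sup>+\<xi>. ennreal (2 powi (- j) * cmod (data lam a n g \<Omega> k \<xi> * lp_hat \<psi> j \<xi>)) \<partial>lborel) \<le> ennreal M" .
qed

lemma data_fb_norm:
  assumes lp: "littlewood_paley \<psi>" and a: "1 \<le> a" and g: "g > 0" and l: "lam \<ge> 0" and r: "0 < r"
  shows "fb_norm \<psi> (-1) 1 r (freq_dist (data lam a n g \<Omega> k))
    \<le> ennreal (22 * (lam * (2 + 2 * \<bar>\<Omega>\<bar> / g) * psi_bound \<psi>) * (if r = \<infinity> then 1 else real (n + 3) powr (1 / enn2real r)))"
proof -
  note F = integrable_admissible[OF data_integrable[OF a g, of lam n \<Omega> k]]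
  let ?d = "\<lambda>j. dist_Lp_norm 1 (lp_block_hat \<psi> j (freq_dist (data lam a n g \<Omega> k)))"
  let ?M = "22 * (lam * (2 + 2 * \<bar>\<Omega>\<bar> / g) * psi_bound \<psi>)"
  note [measurable] = lp_hat_measurable[OF lp]
  have le: "ennreal (2 powi (- j)) * ?d j \<le> (\<integral>\<^sup>+\<xi>. ennreal (2 powi (- j) * cmod (data lam a n g \<Omega> k \<xi> * lp_hat \<psi> j \<xi>)) \<partial>lborel)" for j
  proof -
    have "ennreal (2 powi (- j)) * ?d j \<le> ennreal (2 powi (- j)) * (\<integral>\<^sup>+\<xi>. ennreal (cmod (data lam a n g \<Omega> k \<xi> * lp_hat \<psi> j \<xi>)) \<partial>lborel)"
      by (rule mult_left_mono[OF block_norm_le[OF lp F]]) simp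
    also have "\<dots> = (\<integral>\<^sup>+\<xi>. ennreal (2 powi (- j)) * ennreal (cmod (data lam a n g \<Omega> k \<xi> * lp_hat \<psi> j \<xi>)) \<partial>lborel)"
      by (rule nn_integral_cmult[symmetric]) measurable
    finally show ?thesis by (simp add: ennreal_mult)
  qed
  have card: "card {int a - 1..int (a + n) + 1} = n + 3" by simp
  have "Lp_norm (count_space UNIV) r (\<lambda>j. ennreal (2 powi (- j)) * ?d j)
    \<le> ennreal (?M * (if r = \<infinity> then 1 else real (card {int a - 1..int (a + n) + 1}) powr (1 / enn2real r)))"
  proof (rule Lp_norm_count_le_finite[OF r])
    show "ennreal (2 powi (- j)) * ?d j \<le> ennreal ?M" for j
      using order_trans[OF le data_block_bound(1)[OF lp a g l]] .
    show "0 \<le> ?M" using l g psi_bound_nonneg[OF lp] by simp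
    show "ennreal (2 powi (- j)) * ?d j = 0" if "j \<notin> {int a - 1..int (a + n) + 1}" for j
      using le[of j] data_block_bound(2)[OF lp a g l that] by simp
  qed simp
  then show ?thesis unfolding fb_norm_def powr_minus_1_int card .
qed

lemma data_divergence_free:
  assumes a: "1 \<le> a" and g: "g > 0"
  shows "divergence_free (\<chi> k. freq_dist (data lam a n g \<Omega> k))"
  unfolding divergence_free_def
proof (intro allI impI)
  fix \<phi> assume \<phi>: "test_off_0 \<phi>"
  have ad: "admissible (data lam a n g \<Omega> k)" for k by (rule integrable_admissible[OF data_integrable[OF a g]])
  have test: "test_off_0 (\<lambda>\<xi>. \<i> * of_real (freq4 \<xi> $ j) * \<phi> \<xi>)" for j
    by (intro test_off_0_mult \<phi> smooth_off_0_mult smooth_off_0_const smooth_off_0_freq4)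
  have i: "integrable lborel (\<lambda>\<xi>. data lam a n g \<Omega> j \<xi> * (\<i> * of_real (freq4 \<xi> $ j) * \<phi> \<xi>))" for j
    by (rule admissible_schwartz_mult[OF ad test_off_0_schwartz[OF test]])
  have "(\<Sum>j\<in>{1, 2, 3}. hat_pair ((\<chi> k. freq_dist (data lam a n g \<Omega> k)) $ j) (\<lambda>\<xi>. \<i> * of_real (freq4 \<xi> $ j) * \<phi> \<xi>))
    = (\<Sum>j\<in>{1, 2, 3}. LINT \<xi>|lborel. data lam a n g \<Omega> j \<xi> * (\<i> * of_real (freq4 \<xi> $ j) * \<phi> \<xi>))"
    by (intro sum.cong refl) (simp only: vec_lambda_beta hat_pair_freq_dist[OF ad test])
  also have "\<dots> = (LINT \<xi>|lborel. (\<Sum>j\<in>{1, 2, 3}. data lam a n g \<Omega> j \<xi> * (\<i> * of_real (freq4 \<xi> $ j) * \<phi> \<xi>)))"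
    by (rule Bochner_Integration.integral_sum[symmetric]) (rule i)
  also have "\<dots> = (LINT \<xi>|(lborel :: (real^3) measure). 0)"
    by (intro Bochner_Integration.integral_cong refl) (simp add: data_def algebra_simps)
  finally show "(\<Sum>j\<in>{1, 2, 3}. hat_pair ((\<chi> k. freq_dist (data lam a n g \<Omega> k)) $ j) (\<lambda>\<xi>. \<i> * of_real (freq4 \<xi> $ j) * \<phi> \<xi>)) = 0"
    by simp
qed

lemma coriolis_symbol_geo:
  assumes g: "g \<noteq> 0" and xi: "\<xi> \<noteq> 0"
  shows "(\<Sum>l\<in>UNIV. coriolis_symbol g \<Omega> N t \<xi> $ k $ l * geo g \<Omega> l \<xi>) = geo g \<Omega> k \<xi>"
proof -
  let ?v = "vector [\<xi> $ 2, - \<xi> $ 1, 0, - (\<Omega> * \<xi> $ 3 / g)] :: real^4"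
  let ?A = "generator g \<Omega> N \<xi>"
  have A: "?A *v ?v = 0" by (rule generator_geostrophic[OF g xi])
  have A2: "(?A ** ?A) *v ?v = 0" by (simp only: matrix_vector_mul_assoc[symmetric] A) simp
  have "(\<Sum>l\<in>UNIV. coriolis_symbol g \<Omega> N t \<xi> $ k $ l * geo g \<Omega> l \<xi>) = (coriolis_symbol g \<Omega> N t \<xi> *v ?v) $ k"
    by (simp add: matrix_vector_mult_def geo_def)
  also have "coriolis_symbol g \<Omega> N t \<xi> *v ?v = ?v"
  proof -
    have lin: "(X - b *\<^sub>R Y + c *\<^sub>R Z) *v u = X *v u - b *\<^sub>R (Y *v u) + c *\<^sub>R (Z *v u)" for X Y Z :: "real^4^4" and u b c
      by (simp add: vec_eq_iff matrix_vector_mult_def sum_4 algebra_simps)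
    show ?thesis unfolding coriolis_symbol_def lin A A2 by simp
  qed
  finally show ?thesis by (simp add: geo_def)
qed

lemma data_fixed:
  assumes g: "g \<noteq> 0" and xi: "\<xi> \<noteq> 0"
  shows "(\<Sum>l\<in>UNIV. of_real (coriolis_symbol g \<Omega> N t \<xi> $ k $ l) * data lam a n g \<Omega> l \<xi>) = data lam a n g \<Omega> k \<xi>"
proof -
  have "(\<Sum>l\<in>UNIV. of_real (coriolis_symbol g \<Omega> N t \<xi> $ k $ l) * data lam a n g \<Omega> l \<xi>)
    = complex_of_real (lam * indicator (freq_boxes a n) \<xi> * (\<Sum>l\<in>UNIV. coriolis_symbol g \<Omega> N t \<xi> $ k $ l * geo g \<Omega> l \<xi>))"
    by (simp add: data_def sum_distrib_left mult_ac)
  then show ?thesis unfolding coriolis_symbol_geo[OF g xi] by (simp add: data_def)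
qed

section \<open>Norm inflation in the second layer\<close>

lemma square_sum_dyadic:
  fixes x :: "nat \<Rightarrow> real"
  assumes x: "\<And>j. 0 \<le> x j" "\<And>j. x j \<le> 2 ^ j"
  shows "(\<Sum>j\<in>{a + 1..a + n}. x j)\<^sup>2 \<le> 4 * (\<Sum>j\<in>{a + 1..a + n}. 2 ^ j * x j)"
proof -
  have S: "(\<Sum>j\<in>{a + 1..a + n}. x j) \<le> 2 * 2 ^ (a + n)" for n
  proof (induction n)
    case (Suc n)
    then show ?case using x(2)[of "Suc (a + n)"] by simp
  qed simp
  show ?thesis
  proof (induction n)
    case (Suc n)
    let ?s = "\<Sum>j\<in>{a + 1..a + n}. x j" and ?y = "x (a + Suc n)"
    have "(?s + ?y)\<^sup>2 = ?s\<^sup>2 + ?y * (2 * ?s + ?y)" by (simp add: power2_eq_square algebra_simps)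
    also have "\<dots> \<le> ?s\<^sup>2 + ?y * (4 * 2 ^ (a + Suc n))"
    proof (intro add_left_mono mult_left_mono x)
      show "2 * ?s + ?y \<le> 4 * 2 ^ (a + Suc n)" using S[of "Suc n"] x(1)[of "a + Suc n"] by simp
    qed
    also have "\<dots> \<le> 4 * (\<Sum>j\<in>{a + 1..a + n}. 2 ^ j * x j) + ?y * (4 * 2 ^ (a + Suc n))"
      using Suc by simp
    finally show ?case by (simp add: algebra_simps)
  qed simp
qed

locale inflation = picard \<nu> T C0 "\<lambda>s \<xi> k l. duhamel_symbol g \<Omega> N s \<xi> $ k $ l" "data lam a n g \<Omega>"
  for \<nu> T C0 g \<Omega> N lam a n +
  assumes g: "g > 0" and lam: "lam \<ge> 0" and a: "1 \<le> a"
begin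

abbreviation V :: real where "V \<equiv> 2 + 2 * \<bar>\<Omega>\<bar> / g"

lemma Xnorm_free: "Xnorm free \<le> ennreal (256 * lam\<^sup>2 * V\<^sup>2 * real n / \<nu>)"
proof -
  let ?J = "{a + 1..a + n}"
  define x where "x t j = 2 ^ j * exp (- \<nu> * (4 ^ j / 4) * t)" for t and j :: nat
  have V0: "0 \<le> V" using g by simp
  have x0: "0 \<le> x t j" for t j by (simp add: x_def)
  have x1: "x t j \<le> 2 ^ j" if "0 \<le> t" for t j using that nu by (simp add: x_def)
  have pt: "mag free t \<xi> \<le> (\<Sum>j\<in>?J. ennreal (4 * lam * V * x t j) * indicator (freq_box j) \<xi>)" if t: "0 \<le> t" for t \<xi>
  proof (cases "\<xi> \<in> freq_boxes a n")
    case False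
    then have "mag free t \<xi> = 0" by (simp add: mag_def free_def data_def)
    then show ?thesis by simp
  next
    case True
    then obtain j where j: "j \<in> ?J" "2 \<le> j" "\<xi> \<in> freq_box j" using freq_boxesE a by blast
    have "(2 ^ j / 2)\<^sup>2 \<le> (norm \<xi>)\<^sup>2" using freq_box_norm(1)[OF j(3,2)] by (rule power_mono) simp
    moreover have "((2::real) ^ j / 2)\<^sup>2 = 4 ^ j / 4" by (simp add: power_divide power_mult[symmetric] mult.commute[of j] power_mult)
    ultimately have h: "heat \<nu> t \<xi> \<le> exp (- \<nu> * (4 ^ j / 4) * t)"
    proof -
      have "\<nu> * (4 ^ j / 4 * t) \<le> \<nu> * ((norm \<xi>)\<^sup>2 * t)"
        using nu t \<open>(2 ^ j / 2)\<^sup>2 \<le> (norm \<xi>)\<^sup>2\<close> \<open>((2::real) ^ j / 2)\<^sup>2 = 4 ^ j / 4\<close>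
        by (intro mult_left_mono mult_right_mono) auto
      then show ?thesis unfolding heat_def by (simp add: mult.assoc)
    qed
    have "ennreal (cmod (free k t \<xi>)) \<le> ennreal (lam * V * x t j)" for k
    proof (rule ennreal_leI)
      have "cmod (free k t \<xi>) = heat \<nu> t \<xi> * (lam * \<bar>geo g \<Omega> k \<xi>\<bar>)"
        using True lam by (simp add: free_def data_def norm_mult abs_mult)
      also have "\<dots> \<le> exp (- \<nu> * (4 ^ j / 4) * t) * (lam * (V * 2 ^ j))"
        using lam by (intro mult_mono h mult_left_mono geo_bound[OF j(3,2) g]) auto
      finally show "cmod (free k t \<xi>) \<le> lam * V * x t j" by (simp add: x_def mult_ac)
    qed
    then have "mag free t \<xi> \<le> (\<Sum>k\<in>(UNIV :: 4 set). ennreal (lam * V * x t j))"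
      unfolding mag_def by (intro sum_mono)
    also have "\<dots> = ennreal (4 * lam * V * x t j)"
    proof -
      have e: "(\<Sum>k\<in>(UNIV :: 4 set). ennreal y) = ennreal (4 * y)" if "0 \<le> y" for y
        using that by (simp add: ennreal_mult)
      show ?thesis using lam V0 x0[of t j] by (simp only: e mult_nonneg_nonneg) (simp only: mult.assoc)
    qed
    also have "\<dots> = ennreal (4 * lam * V * x t j) * indicator (freq_box j) \<xi>" using j(3) by simp
    also have "\<dots> \<le> (\<Sum>j\<in>?J. ennreal (4 * lam * V * x t j) * indicator (freq_box j) \<xi>)"
      using j(1) by (intro member_le_sum[where f = "\<lambda>j. ennreal (4 * lam * V * x t j) * indicator (freq_box j) \<xi>"]) auto
    finally show ?thesis .
  qed
  have int: "(\<integral>\<^sup>+\<xi>. mag free t \<xi> \<partial>lborel)\<^sup>2 \<le> ennreal (64 * lam\<^sup>2 * V\<^sup>2 * (\<Sum>j\<in>?J. 2 ^ j * x t j))" if t: "0 \<le> t" for t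
  proof -
    have "(\<integral>\<^sup>+\<xi>. mag free t \<xi> \<partial>lborel) \<le> (\<integral>\<^sup>+\<xi>. (\<Sum>j\<in>?J. ennreal (4 * lam * V * x t j) * indicator (freq_box j) \<xi>) \<partial>lborel)"
      by (intro nn_integral_mono pt t)
    also have "\<dots> = (\<Sum>j\<in>?J. ennreal (4 * lam * V * x t j) * emeasure lborel (freq_box j))"
      by (subst nn_integral_sum) (auto simp: nn_integral_cmult_indicator)
    also have "\<dots> \<le> (\<Sum>j\<in>?J. ennreal (4 * lam * V * x t j) * 1)"
      by (intro sum_mono mult_left_mono emeasure_freq_box) simp
    also have "\<dots> = ennreal (\<Sum>j\<in>?J. 4 * lam * V * x t j)"
      using lam V0 x0 by (simp add: sum_ennreal)
    also have "(\<Sum>j\<in>?J. 4 * lam * V * x t j) = 4 * lam * V * (\<Sum>j\<in>?J. x t j)"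
      by (rule sum_distrib_left[symmetric])
    finally have "(\<integral>\<^sup>+\<xi>. mag free t \<xi> \<partial>lborel)\<^sup>2 \<le> (ennreal (4 * lam * V * (\<Sum>j\<in>?J. x t j)))\<^sup>2"
      by (rule power_mono) simp
    also have "\<dots> = ennreal ((4 * lam * V)\<^sup>2 * (\<Sum>j\<in>?J. x t j)\<^sup>2)"
      using lam V0 x0 by (simp add: ennreal_power sum_nonneg power_mult_distrib)
    also have "\<dots> \<le> ennreal ((4 * lam * V)\<^sup>2 * (4 * (\<Sum>j\<in>?J. 2 ^ j * x t j)))"
      by (intro ennreal_leI mult_left_mono square_sum_dyadic x0 x1 t) simp
    also have "(4 * lam * V)\<^sup>2 * (4 * (\<Sum>j\<in>?J. 2 ^ j * x t j)) = 64 * lam\<^sup>2 * V\<^sup>2 * (\<Sum>j\<in>?J. 2 ^ j * x t j)"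
      by (simp only: power_mult_distrib) simp
    finally show ?thesis .
  qed
  have mx [measurable]: "(\<lambda>t. x t j) \<in> borel_measurable borel" for j
    unfolding x_def by measurable
  let ?c = "64 * lam\<^sup>2 * V\<^sup>2"
  have c0: "0 \<le> ?c" by simp
  have "Xnorm free \<le> (\<integral>\<^sup>+t. (\<Sum>j\<in>?J. ennreal ?c * (ennreal (2 ^ j * x t j) * indicator {0..} t)) \<partial>lborel)"
    unfolding Xnorm_def
  proof (rule nn_integral_mono)
    fix t
    show "(\<integral>\<^sup>+\<xi>. mag free t \<xi> \<partial>lborel)\<^sup>2 * indicator {0..T} t \<le> (\<Sum>j\<in>?J. ennreal ?c * (ennreal (2 ^ j * x t j) * indicator {0..} t))"
    proof (cases "t \<in> {0..T}")
      case True
      have "(\<integral>\<^sup>+\<xi>. mag free t \<xi> \<partial>lborel)\<^sup>2 \<le> ennreal (?c * (\<Sum>j\<in>?J. 2 ^ j * x t j))" using int True by simp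
      also have "\<dots> = ennreal ?c * (\<Sum>j\<in>?J. ennreal (2 ^ j * x t j))"
        using x0 c0 by (subst sum_ennreal) (auto intro!: ennreal_mult sum_nonneg)
      finally show ?thesis using True by (simp add: sum_distrib_left)
    qed simp
  qed
  also have "\<dots> = (\<Sum>j\<in>?J. ennreal ?c * (\<integral>\<^sup>+t. ennreal (2 ^ j * x t j) * indicator {0..} t \<partial>lborel))"
    by (subst nn_integral_sum) (auto simp: nn_integral_cmult)
  also have "\<dots> \<le> (\<Sum>j\<in>?J. ennreal ?c * ennreal (4 / \<nu>))"
  proof (intro sum_mono mult_left_mono)
    fix j
    have e: "2 ^ j * x t j = (2 ^ j * exp (- (\<nu> / 8) * (2 ^ j)\<^sup>2 * (t - 0)))\<^sup>2" for t
      by (simp add: x_def power_mult_distrib exp_double[symmetric] power2_eq_square[of "2 ^ j"] power_mult_distrib[symmetric] mult_ac)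
    have "(\<integral>\<^sup>+t. ennreal (2 ^ j * x t j) * indicator {0..} t \<partial>lborel) \<le> ennreal (1 / (2 * (\<nu> / 8)))"
      unfolding e by (rule heat_kernel_L2) (use nu in simp)
    then show "(\<integral>\<^sup>+t. ennreal (2 ^ j * x t j) * indicator {0..} t \<partial>lborel) \<le> ennreal (4 / \<nu>)" by simp
  qed simp
  also have "\<dots> = of_nat n * (ennreal ?c * ennreal (4 / \<nu>))" by simp
  also have "\<dots> = ennreal (256 * lam\<^sup>2 * V\<^sup>2 * real n / \<nu>)"
    using c0 nu by (simp add: ennreal_of_nat_eq_real_of_nat ennreal_mult[symmetric] mult_ac)
  finally show ?thesis .
qed

lemma conv_free:
  "conv (free j \<tau>) (free l \<tau>) \<xi> = (LINT \<eta>|lborel. of_real (heat \<nu> \<tau> (\<xi> - \<eta>) * heat \<nu> \<tau> \<eta> * lam\<^sup>2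
      * (indicator (freq_boxes a n) (\<xi> - \<eta>) * indicator (freq_boxes a n) \<eta>) * geo g \<Omega> j (\<xi> - \<eta>) * geo g \<Omega> l \<eta>)) / of_real ((2 * pi) ^ 3)"
  unfolding conv_def free_def data_def
  by (intro arg_cong2[where f = "(/)"] Bochner_Integration.integral_cong refl) (simp add: power2_eq_square mult_ac)

text \<open>Up to constants and the heat factor at \<open>\<xi>\<close>, the integrand of \<open>- Im\<close> of the second component of the
  first Duhamel iterate.\<close>

definition weight :: "real \<Rightarrow> real^3 \<Rightarrow> real \<Rightarrow> real^3 \<Rightarrow> real" where
  "weight t \<xi> \<tau> \<eta> = heat \<nu> \<tau> (\<xi> - \<eta>) * heat \<nu> \<tau> \<eta> * (indicator (freq_boxes a n) (\<xi> - \<eta>) * indicator (freq_boxes a n) \<eta>)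
     * - ((\<xi> $ 2 * \<eta> $ 1 - \<xi> $ 1 * \<eta> $ 2)
     * (\<Sum>l\<in>UNIV. duhamel_symbol g \<Omega> N (t - \<tau>) \<xi> $ 2 $ l * geo g \<Omega> l \<eta>))"

lemma geo_bounded_on: "\<exists>B\<ge>0. \<forall>\<xi>\<in>freq_boxes a n. \<bar>geo g \<Omega> k \<xi>\<bar> \<le> B"
proof (intro exI[of _ "V * 2 ^ (a + n)"] conjI ballI)
  show "0 \<le> V * 2 ^ (a + n)" using g by simp
  fix \<xi> assume "\<xi> \<in> freq_boxes a n"
  then obtain j where j: "j \<in> {a + 1..a + n}" "2 \<le> j" "\<xi> \<in> freq_box j" using freq_boxesE a by blast
  have "\<bar>geo g \<Omega> k \<xi>\<bar> \<le> V * 2 ^ j" by (rule geo_bound[OF j(3,2) g])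
  also have "\<dots> \<le> V * 2 ^ (a + n)" using j(1) g by (intro mult_left_mono power_increasing) auto
  finally show "\<bar>geo g \<Omega> k \<xi>\<bar> \<le> V * 2 ^ (a + n)" .
qed

lemma duh_kernel_free:
  assumes \<tau>: "0 \<le> \<tau>"
  shows "duh_kernel free 2 t \<xi> \<tau> = - \<i> * of_real (heat \<nu> (t - \<tau>) \<xi> * (lam\<^sup>2 / (2 * pi) ^ 3) * (LINT \<eta>|lborel. weight t \<xi> \<tau> \<eta>))"
    and "integrable lborel (weight t \<xi> \<tau>)"
proof -
  let ?i = "\<lambda>\<eta>. indicator (freq_boxes a n) (\<xi> - \<eta>) * indicator (freq_boxes a n) \<eta> :: real"
  let ?p = "\<lambda>j l \<eta>. heat \<nu> \<tau> (\<xi> - \<eta>) * heat \<nu> \<tau> \<eta> * ?i \<eta> * geo g \<Omega> j (\<xi> - \<eta>) * geo g \<Omega> l \<eta>"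
  obtain B where B: "\<And>k. 0 \<le> B k" "\<And>k \<xi>. \<xi> \<in> freq_boxes a n \<Longrightarrow> \<bar>geo g \<Omega> k \<xi>\<bar> \<le> B k"
    using geo_bounded_on by metis
  have fin: "emeasure lborel (freq_boxes a n) < \<infinity>"
  proof -
    have "emeasure lborel (freq_boxes a n) \<le> (\<Sum>j\<in>{a + 1..a + n}. emeasure lborel (freq_box j))"
      unfolding freq_boxes_def by (rule emeasure_subadditive_finite) auto
    also have "\<dots> \<le> (\<Sum>j\<in>{a + 1..a + n}. 1)" by (intro sum_mono emeasure_freq_box)
    also have "\<dots> < \<infinity>" by (simp add: of_nat_less_top)
    finally show ?thesis .
  qed
  have Ip: "integrable lborel (?p j l)" for j l
  proof (rule Bochner_Integration.integrable_bound[where f = "\<lambda>\<eta>. (B j * B l) * indicator (freq_boxes a n) \<eta>"])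
    show "integrable lborel (\<lambda>\<eta>. (B j * B l) * indicator (freq_boxes a n) \<eta> :: real)"
      using fin by (intro integrable_mult_right integrable_real_indicator) auto
    show "AE \<eta> in lborel. norm (?p j l \<eta>) \<le> norm ((B j * B l) * indicator (freq_boxes a n) \<eta> :: real)"
    proof (rule AE_I2)
      fix \<eta>
      show "norm (?p j l \<eta>) \<le> norm ((B j * B l) * indicator (freq_boxes a n) \<eta> :: real)"
      proof (cases "\<xi> - \<eta> \<in> freq_boxes a n \<and> \<eta> \<in> freq_boxes a n")
        case True
        have "heat \<nu> \<tau> (\<xi> - \<eta>) * heat \<nu> \<tau> \<eta> \<le> 1 * 1"
          using heat_le_1[of \<nu> \<tau>] nu \<tau> by (intro mult_mono) auto
        moreover have "\<bar>geo g \<Omega> j (\<xi> - \<eta>)\<bar> * \<bar>geo g \<Omega> l \<eta>\<bar> \<le> B j * B l"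
          using True B by (intro mult_mono) auto
        ultimately have "(heat \<nu> \<tau> (\<xi> - \<eta>) * heat \<nu> \<tau> \<eta>) * (\<bar>geo g \<Omega> j (\<xi> - \<eta>)\<bar> * \<bar>geo g \<Omega> l \<eta>\<bar>) \<le> (1 * 1) * (B j * B l)"
          by (rule mult_mono) (use B in auto)
        then show ?thesis using True B by (simp add: abs_mult mult_ac)
      qed auto
    qed
  qed measurable
  have conv: "conv (free j \<tau>) (free l \<tau>) \<xi> = of_real (lam\<^sup>2 / (2 * pi) ^ 3 * (LINT \<eta>|lborel. ?p j l \<eta>))" for j l
  proof -
    have "(LINT \<eta>|lborel. complex_of_real (heat \<nu> \<tau> (\<xi> - \<eta>) * heat \<nu> \<tau> \<eta> * lam\<^sup>2 * ?i \<eta> * geo g \<Omega> j (\<xi> - \<eta>) * geo g \<Omega> l \<eta>))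
      = of_real (LINT \<eta>|lborel. lam\<^sup>2 * ?p j l \<eta>)"
      by (subst integral_complex_of_real) (simp only: mult_ac)
    then show ?thesis unfolding conv_free by simp
  qed
  let ?E = "\<lambda>l. duhamel_symbol g \<Omega> N (t - \<tau>) \<xi> $ 2 $ l"
  have W: "weight t \<xi> \<tau> = (\<lambda>\<eta>. - (\<Sum>l\<in>UNIV. \<Sum>j\<in>{1,2,3}. ?E l * freq4 \<xi> $ j * ?p j l \<eta>))"
  proof
    fix \<eta>
    have "(\<Sum>j\<in>{1,2,3}. freq4 \<xi> $ j * geo g \<Omega> j (\<xi> - \<eta>)) = \<xi> $ 2 * \<eta> $ 1 - \<xi> $ 1 * \<eta> $ 2"
      by (simp add: algebra_simps)
    then have "weight t \<xi> \<tau> \<eta> = heat \<nu> \<tau> (\<xi> - \<eta>) * heat \<nu> \<tau> \<eta> * ?i \<eta> * - ((\<Sum>j\<in>{1,2,3}. freq4 \<xi> $ j * geo g \<Omega> j (\<xi> - \<eta>))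
      * (\<Sum>l\<in>UNIV. ?E l * geo g \<Omega> l \<eta>))" by (simp only: weight_def)
    also have "\<dots> = - (\<Sum>l\<in>UNIV. \<Sum>j\<in>{1,2,3}. ?E l * freq4 \<xi> $ j * ?p j l \<eta>)"
      by (simp only: sum_distrib_left sum_distrib_right mult_minus_right mult_ac) (subst sum.swap, rule refl)
    finally show "weight t \<xi> \<tau> \<eta> = - (\<Sum>l\<in>UNIV. \<Sum>j\<in>{1,2,3}. ?E l * freq4 \<xi> $ j * ?p j l \<eta>)" .
  qed
  show "integrable lborel (weight t \<xi> \<tau>)"
    unfolding W by (intro Bochner_Integration.integrable_minus Bochner_Integration.integrable_sum integrable_mult_right Ip)
  have LW: "(LINT \<eta>|lborel. weight t \<xi> \<tau> \<eta>) = - (\<Sum>l\<in>UNIV. \<Sum>j\<in>{1,2,3}. ?E l * freq4 \<xi> $ j * (LINT \<eta>|lborel. ?p j l \<eta>))"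
    unfolding W
    by (simp only: Bochner_Integration.integral_minus Bochner_Integration.integral_sum Bochner_Integration.integrable_sum integrable_mult_right Ip integral_mult_right_zero)
  have "duh_kernel free 2 t \<xi> \<tau> = \<i> * of_real (heat \<nu> (t - \<tau>) \<xi> * (lam\<^sup>2 / (2 * pi) ^ 3) * (\<Sum>l\<in>UNIV. \<Sum>j\<in>{1,2,3}. ?E l * freq4 \<xi> $ j * (LINT \<eta>|lborel. ?p j l \<eta>)))"
    unfolding duh_kernel_def conv
    by (simp only: of_real_sum of_real_mult sum_distrib_left mult_ac)
  then show "duh_kernel free 2 t \<xi> \<tau> = - \<i> * of_real (heat \<nu> (t - \<tau>) \<xi> * (lam\<^sup>2 / (2 * pi) ^ 3) * (LINT \<eta>|lborel. weight t \<xi> \<tau> \<eta>))"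
    unfolding LW by simp
qed

lemma duh_integrable:
  assumes w: "joint_measurable w" and fin: "quad_total w \<xi> < \<infinity>" and t: "t \<le> T"
  shows "integrable lborel (\<lambda>\<tau>. indicator {0..t} \<tau> *\<^sub>R duh_kernel w k t \<xi> \<tau>)"
proof (rule integrableI_bounded)
  note [measurable] = duh_kernel_measurable[OF w] quad_measurable[OF w]
  show "(\<lambda>\<tau>. indicator {0..t} \<tau> *\<^sub>R duh_kernel w k t \<xi> \<tau>) \<in> borel_measurable lborel" by measurable
  have "(\<integral>\<^sup>+\<tau>. ennreal (norm (indicator {0..t} \<tau> *\<^sub>R duh_kernel w k t \<xi> \<tau>)) \<partial>lborel)
    \<le> (\<integral>\<^sup>+\<tau>. ennreal C0 * (ennreal (norm \<xi> * heat \<nu> (t - \<tau>) \<xi>) * quad w \<tau> \<xi> * indicator {0..t} \<tau>) \<partial>lborel)"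
    using duh_kernel_bound[OF w t] C0
    by (intro nn_integral_mono) (auto simp: indicator_def ennreal_mult[symmetric] mult.assoc[symmetric])
  also have "\<dots> = ennreal C0 * beta w t \<xi>"
    unfolding beta_def by (rule nn_integral_cmult) measurable
  also have "\<dots> \<le> ennreal C0 * (ennreal (norm \<xi>) * quad_total w \<xi>)"
    unfolding quad_total_def by (rule mult_left_mono[OF beta_le_quad_total[OF w t]]) simp
  also have "\<dots> < \<infinity>" using fin by (simp add: ennreal_mult_less_top)
  finally show "(\<integral>\<^sup>+\<tau>. ennreal (norm (indicator {0..t} \<tau> *\<^sub>R duh_kernel w k t \<xi> \<tau>)) \<partial>lborel) < \<infinity>" .
qed

text \<open>The output frequencies of the interaction of \<open>(2\<^sup>j, 9/8, 9/8)\<close> and \<open>(- 2\<^sup>j, 9/8, 9/8)\<close>.\<close>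

abbreviation target :: "(real^3) set" where
  "target \<equiv> cube (\<lambda>i. if i = 1 then 0 else 9/4) (1/16)"

lemma targetD:
  assumes "\<xi> \<in> target"
  shows "\<bar>\<xi> $ 1\<bar> \<le> 1/16" "35/16 \<le> \<xi> $ 2" "\<xi> $ 2 \<le> 37/16" "35/16 \<le> \<xi> $ 3" "\<xi> $ 3 \<le> 37/16"
proof -
  have "\<forall>i. \<bar>\<xi> $ i - (if i = 1 then 0 else 9/4)\<bar> \<le> 1/16" using assms by (simp add: mem_cube)
  from this[rule_format, of 1] this[rule_format, of 2] this[rule_format, of 3]
  have "\<bar>\<xi> $ 1\<bar> \<le> 1/16" "\<bar>\<xi> $ 2 - 9/4\<bar> \<le> 1/16" "\<bar>\<xi> $ 3 - 9/4\<bar> \<le> 1/16" by auto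
  then show "\<bar>\<xi> $ 1\<bar> \<le> 1/16" "35/16 \<le> \<xi> $ 2" "\<xi> $ 2 \<le> 37/16" "35/16 \<le> \<xi> $ 3" "\<xi> $ 3 \<le> 37/16"
    by linarith+
qed

lemma target_norm: "\<xi> \<in> target \<Longrightarrow> (norm \<xi>)\<^sup>2 \<le> 12" "\<xi> \<in> target \<Longrightarrow> 1/3 \<le> leray \<xi> $ 2 $ 2"
proof -
  assume x: "\<xi> \<in> target"
  note b = targetD[OF x]
  have 1: "(\<xi> $ 1)\<^sup>2 \<le> (1/16)\<^sup>2" using b(1) by (simp add: abs_le_square_iff[symmetric])
  have 2: "(\<xi> $ 2)\<^sup>2 \<le> (37/16)\<^sup>2" using b by (intro power_mono) auto
  have 3: "(\<xi> $ 3)\<^sup>2 \<le> (37/16)\<^sup>2" "(35/16)\<^sup>2 \<le> (\<xi> $ 3)\<^sup>2" using b by (intro power_mono; simp)+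
  show "(norm \<xi>)\<^sup>2 \<le> 12" unfolding norm_sq_3 using 1 2 3 by (simp add: power2_eq_square)
  have le: "3 * (\<xi> $ 2)\<^sup>2 \<le> 2 * (norm \<xi>)\<^sup>2"
  proof -
    have "(\<xi> $ 2)\<^sup>2 \<le> 1369/256" "1225/256 \<le> (\<xi> $ 3)\<^sup>2" using 2 3 by (simp_all add: power_divide)
    then show ?thesis unfolding norm_sq_3 distrib_left using zero_le_power2[of "\<xi> $ 1"] by linarith
  qed
  have "0 < (norm \<xi>)\<^sup>2" using b by auto
  then have "(\<xi> $ 2)\<^sup>2 / (norm \<xi>)\<^sup>2 \<le> 2/3" using le by (simp add: divide_le_eq)
  then show "1/3 \<le> leray \<xi> $ 2 $ 2" by (simp add: leray_def power2_eq_square)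
qed

context
  fixes t
  assumes t: "0 < t" "t \<le> T"
    and near: "\<And>s \<xi> i j. 0 \<le> s \<Longrightarrow> s \<le> t \<Longrightarrow> \<bar>duhamel_symbol g \<Omega> N s \<xi> $ i $ j - leray \<xi> $ i $ j\<bar> \<le> 1/12"
    and large: "30 * (1 + \<bar>\<Omega>\<bar> / g) \<le> 2 ^ a" and fast: "inverse (4 ^ a) \<le> t"
begin

lemma weight_lower:
  assumes x: "\<xi> \<in> target" and \<tau>: "\<tau> \<in> {0..t}"
  shows "heat \<nu> \<tau> (\<xi> - \<eta>) * heat \<nu> \<tau> \<eta> * (indicator (freq_boxes a n) (\<xi> - \<eta>) * indicator (freq_boxes a n) \<eta>) * ((\<eta> $ 1)\<^sup>2 / 8)
    \<le> weight t \<xi> \<tau> \<eta>"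
proof (cases "\<eta> \<in> freq_boxes a n")
  case False
  then show ?thesis by (simp add: weight_def)
next
  case True
  then obtain j where j: "j \<in> {a + 1..a + n}" "2 \<le> j" "\<eta> \<in> freq_box j" using freq_boxesE a by blast
  note b = targetD[OF x]
  have e: "0 \<le> \<eta> $ 2" "\<eta> $ 2 \<le> 5/4" "0 \<le> \<eta> $ 3" "\<eta> $ 3 \<le> 5/4" using j(3) by (auto simp: freq_box_def)
  have om: "0 \<le> \<bar>\<Omega>\<bar> / g" using g by simp
  have "2 * (2::real) ^ a = 2 ^ (a + 1)" by simp
  also have "\<dots> \<le> 2 ^ j" using j(1) by (intro power_increasing) auto
  finally have big: "30 * (1 + \<bar>\<Omega>\<bar> / g) \<le> \<bar>\<eta> $ 1\<bar>" using freq_box_norm(3)[OF j(3,2)] large by linarith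
  let ?E = "\<lambda>l. duhamel_symbol g \<Omega> N (t - \<tau>) \<xi> $ 2 $ l"
  have nr: "\<bar>?E l - leray \<xi> $ 2 $ l\<bar> \<le> 1/12" for l using near[of "t - \<tau>"] \<tau> by auto
  have E22: "1/4 \<le> ?E 2" using nr[of 2] target_norm(2)[OF x] by linarith
  have El: "\<bar>?E l\<bar> \<le> 3" for l using nr[of l] leray_entry_bound[of \<xi> 2 l] by linarith
  define A where "A = \<xi> $ 2 * \<eta> $ 1 - \<xi> $ 1 * \<eta> $ 2"
  define D where "D = (\<Sum>l\<in>UNIV. ?E l * geo g \<Omega> l \<eta>)"
  have D: "D = ?E 1 * \<eta> $ 2 - ?E 2 * \<eta> $ 1 - ?E 4 * (\<Omega> * \<eta> $ 3 / g)" by (simp add: D_def sum_4)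
  have s1: "\<bar>?E 1 * \<eta> $ 2\<bar> \<le> 3 * (5/4)" unfolding abs_mult using e by (intro mult_mono El) auto
  have s4: "\<bar>?E 4 * (\<Omega> * \<eta> $ 3 / g)\<bar> \<le> 3 * (5/4 * (\<bar>\<Omega>\<bar> / g))"
  proof -
    have "\<bar>\<Omega> * \<eta> $ 3 / g\<bar> = \<eta> $ 3 * (\<bar>\<Omega>\<bar> / g)" using g e by (simp add: abs_mult)
    also have "\<dots> \<le> 5/4 * (\<bar>\<Omega>\<bar> / g)" using e om by (intro mult_right_mono) auto
    finally show ?thesis unfolding abs_mult[of "?E 4"] by (intro mult_mono El) auto
  qed
  have small: "\<bar>?E 1 * \<eta> $ 2 - ?E 4 * (\<Omega> * \<eta> $ 3 / g)\<bar> \<le> \<bar>\<eta> $ 1\<bar> / 8"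
  proof -
    have "r \<le> z / 8" if "p \<le> 3 * (5/4)" "q \<le> 3 * (5/4 * w)" "30 * (1 + w) \<le> z" "r \<le> p + q" for p q r w z :: real
      using that by (simp add: algebra_simps)
    from this[OF s1 s4 big abs_triangle_ineq4] show ?thesis .
  qed
  have sx: "\<bar>\<xi> $ 1 * \<eta> $ 2\<bar> \<le> 1/16 * (5/4)" unfolding abs_mult using b e by (intro mult_mono) auto
  have big1: "30 \<le> \<bar>\<eta> $ 1\<bar>"
  proof -
    have "30 \<le> z" if "30 * (1 + w) \<le> z" "0 \<le> w" for w z :: real using that by (simp add: algebra_simps)
    from this[OF big om] show ?thesis .
  qed
  have "(\<eta> $ 1)\<^sup>2 / 8 \<le> - (A * D)"
  proof (cases "0 < \<eta> $ 1")
    case True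
    have "2 * \<eta> $ 1 \<le> \<xi> $ 2 * \<eta> $ 1" using True b by (intro mult_right_mono) auto
    then have A1: "\<eta> $ 1 \<le> A" unfolding A_def using sx big1 True by linarith
    have "1/4 * \<eta> $ 1 \<le> ?E 2 * \<eta> $ 1" using True E22 by (intro mult_right_mono) auto
    then have D1: "\<eta> $ 1 / 8 \<le> - D" unfolding D using small True by linarith
    have "\<eta> $ 1 * (\<eta> $ 1 / 8) \<le> A * (- D)" using A1 D1 True by (intro mult_mono) auto
    then show ?thesis by (simp add: power2_eq_square)
  next
    case False
    then have neg: "\<eta> $ 1 < 0" using big1 by linarith
    have "2 * (- \<eta> $ 1) \<le> \<xi> $ 2 * (- \<eta> $ 1)" using neg b by (intro mult_right_mono) auto
    then have A1: "- \<eta> $ 1 \<le> - A" unfolding A_def mult_minus_right using sx big1 neg by linarith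
    have "1/4 * (- \<eta> $ 1) \<le> ?E 2 * (- \<eta> $ 1)" using neg E22 by (intro mult_right_mono) auto
    then have D1: "- \<eta> $ 1 / 8 \<le> D" unfolding D mult_minus_right using small neg by linarith
    have "(- \<eta> $ 1) * (- \<eta> $ 1 / 8) \<le> (- A) * D" using A1 D1 neg by (intro mult_mono) auto
    then show ?thesis by (simp add: power2_eq_square)
  qed
  then show ?thesis
    unfolding weight_def A_def[symmetric] D_def[symmetric] by (intro mult_left_mono) auto
qed

lemma weight_integral_lower:
  assumes x: "\<xi> \<in> target" and \<tau>: "\<tau> \<in> {0..t}"
  shows "(\<Sum>i\<in>{a + 1..a + n}. exp (- 8 * \<nu>) * 4 ^ i / 16384 * indicator {0..inverse (4 ^ i :: real)} \<tau>) \<le> (LINT \<eta>|lborel. weight t \<xi> \<tau> \<eta>)"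
proof -
  let ?J = "{a + 1..a + n}"
  define Z where "Z i = cube (\<lambda>k. if k = 1 then 2 ^ i else 9/8) (1/16)" for i :: nat
  define c where "c i = exp (- 8 * \<nu>) * (4 ^ i / 32) * indicator {0..inverse (4 ^ i :: real)} \<tau>" for i :: nat
  have c0: "0 \<le> c i" for i by (simp add: c_def)
  have mZ [measurable]: "Z i \<in> sets borel" for i by (simp add: Z_def)
  have eZ: "emeasure lborel (Z i) = ennreal (1/512)" for i
    unfolding Z_def by (subst emeasure_cube) (simp_all add: power_divide)
  have IZ: "integrable lborel (\<lambda>\<eta>. c i * indicator (Z i) \<eta> :: real)" for i
    using eZ[of i] by (intro integrable_mult_right integrable_real_indicator) auto
  have ZD: "\<bar>\<eta> $ 1 - 2 ^ i\<bar> \<le> 1/16" "\<bar>\<eta> $ 2 - 9/8\<bar> \<le> 1/16" "\<bar>\<eta> $ 3 - 9/8\<bar> \<le> 1/16" if "\<eta> \<in> Z i" for \<eta> i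
  proof -
    have "\<forall>k. \<bar>\<eta> $ k - (if k = 1 then 2 ^ i else 9/8)\<bar> \<le> 1/16" using that by (simp add: Z_def mem_cube)
    from this[rule_format, of 1] this[rule_format, of 2] this[rule_format, of 3]
    show "\<bar>\<eta> $ 1 - 2 ^ i\<bar> \<le> 1/16" "\<bar>\<eta> $ 2 - 9/8\<bar> \<le> 1/16" "\<bar>\<eta> $ 3 - 9/8\<bar> \<le> 1/16" by auto
  qed
  have disj: "i = k" if "\<eta> \<in> Z i" "\<eta> \<in> Z k" for \<eta> i k
  proof -
    have ne: "\<not> i < k" if "\<eta> \<in> Z i" "\<eta> \<in> Z k" for i k
    proof
      assume "i < k"
      then have "(2::real) ^ (i + 1) \<le> 2 ^ k" by (intro power_increasing) auto
      moreover have "1 \<le> (2::real) ^ i" by simp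
      ultimately show False using ZD(1)[OF that(1)] ZD(1)[OF that(2)] power_Suc[of "2::real" i] by (simp only: Suc_eq_plus1)
    qed
    show ?thesis using ne[OF that] ne[OF that(2,1)] by simp
  qed
  have pt: "(\<Sum>i\<in>?J. c i * indicator (Z i) \<eta>) \<le> weight t \<xi> \<tau> \<eta>" for \<eta>
  proof -
    have w0: "0 \<le> weight t \<xi> \<tau> \<eta>"
      by (rule order_trans[OF _ weight_lower[OF x \<tau>]]) simp
    show ?thesis
    proof (cases "\<exists>i\<in>?J. \<eta> \<in> Z i")
      case False
      then have "(\<Sum>i\<in>?J. c i * indicator (Z i) \<eta>) = 0" by (intro sum.neutral) auto
      then show ?thesis using w0 by simp
    next
      case True
      then obtain i where i: "i \<in> ?J" "\<eta> \<in> Z i" by blast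
      have ind: "indicator (Z k) \<eta> = (if k = i then 1 else 0 :: real)" for k
      proof (cases "k = i")
        case False
        then have "\<eta> \<notin> Z k" using disj[OF _ i(2)] by blast
        then show ?thesis using False by simp
      qed (use i(2) in simp)
      have "(\<Sum>k\<in>?J. c k * indicator (Z k) \<eta>) = (\<Sum>k\<in>?J. if k = i then c k else 0)"
        by (intro sum.cong refl) (simp add: ind)
      also have "\<dots> = c i" using i(1) by (subst sum.delta) auto
      also have "\<dots> \<le> weight t \<xi> \<tau> \<eta>"
      proof (cases "\<tau> \<in> {0..inverse (4 ^ i)}")
        case False
        then show ?thesis using w0 by (simp add: c_def)
      next
        case tau: True
        note z = ZD[OF i(2)]
        note b = targetD[OF x]
        have i2: "2 \<le> i" using i(1) a by auto
        have "(2::real) ^ 2 \<le> 2 ^ i" using i2 by (intro power_increasing) auto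
        then have p: "4 \<le> (2::real) ^ i" by simp
        have bx: "\<eta> \<in> freq_box i" using z p unfolding freq_box_def mem_Collect_eq by (intro conjI; linarith)
        have by': "\<xi> - \<eta> \<in> freq_box i"
        proof -
          show ?thesis using z p b unfolding freq_box_def mem_Collect_eq vector_minus_component by (intro conjI; linarith)
        qed
        have h: "exp (- 4 * \<nu>) \<le> heat \<nu> \<tau> \<zeta>" if "\<zeta> \<in> freq_box i" for \<zeta>
        proof -
          have "(norm \<zeta>)\<^sup>2 \<le> (2 * 2 ^ i)\<^sup>2" using freq_box_norm(2)[OF that i2] by (intro power_mono) auto
          also have "\<dots> = 4 * 4 ^ i" by (simp add: power_mult_distrib power_mult[symmetric] mult.commute[of i] power_mult)
          finally have "(norm \<zeta>)\<^sup>2 * \<tau> \<le> (4 * 4 ^ i) * inverse (4 ^ i)" using tau by (intro mult_mono) auto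
          also have "\<dots> = 4" by simp
          finally have "\<nu> * ((norm \<zeta>)\<^sup>2 * \<tau>) \<le> \<nu> * 4" using nu by (intro mult_left_mono) auto
          then show ?thesis unfolding heat_def by (simp add: mult_ac)
        qed
        have hh: "exp (- 8 * \<nu>) \<le> heat \<nu> \<tau> (\<xi> - \<eta>) * heat \<nu> \<tau> \<eta>"
        proof -
          have "exp (- 8 * \<nu>) = exp (- 4 * \<nu>) * exp (- 4 * \<nu>)" by (simp add: exp_add[symmetric])
          also have "\<dots> \<le> heat \<nu> \<tau> (\<xi> - \<eta>) * heat \<nu> \<tau> \<eta>" by (intro mult_mono h bx by') auto
          finally show ?thesis .
        qed
        have "(2 ^ i / 2)\<^sup>2 \<le> \<bar>\<eta> $ 1\<bar>\<^sup>2" using freq_box_norm(3)[OF bx i2] by (intro power_mono) auto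
        moreover have "((2::real) ^ i / 2)\<^sup>2 = 4 ^ i / 4" by (simp add: power_divide power_mult[symmetric] mult.commute[of i] power_mult)
        ultimately have q: "4 ^ i / 32 \<le> (\<eta> $ 1)\<^sup>2 / 8" by simp
        have inb: "\<eta> \<in> freq_boxes a n" "\<xi> - \<eta> \<in> freq_boxes a n"
          using bx by' i(1) by (auto simp: freq_boxes_def)
        have "c i = exp (- 8 * \<nu>) * (4 ^ i / 32)" using tau by (simp add: c_def)
        also have "\<dots> \<le> (heat \<nu> \<tau> (\<xi> - \<eta>) * heat \<nu> \<tau> \<eta>) * ((\<eta> $ 1)\<^sup>2 / 8)"
          by (intro mult_mono hh q) auto
        also have "\<dots> \<le> weight t \<xi> \<tau> \<eta>"
          using weight_lower[OF x \<tau>, of \<eta>] inb by simp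
        finally show ?thesis .
      qed
      finally show ?thesis .
    qed
  qed
  have "(\<Sum>i\<in>?J. exp (- 8 * \<nu>) * 4 ^ i / 16384 * indicator {0..inverse (4 ^ i :: real)} \<tau>) = (\<Sum>i\<in>?J. LINT \<eta>|lborel. c i * indicator (Z i) \<eta>)"
  proof (rule sum.cong[OF refl])
    fix i
    have "measure lborel (Z i) = 1/512" using eZ[of i] by (simp add: measure_def)
    then show "exp (- 8 * \<nu>) * 4 ^ i / 16384 * indicator {0..inverse (4 ^ i :: real)} \<tau> = (LINT \<eta>|lborel. c i * indicator (Z i) \<eta>)"
      by (simp add: c_def)
  qed
  also have "\<dots> = (LINT \<eta>|lborel. (\<Sum>i\<in>?J. c i * indicator (Z i) \<eta>))"
    by (rule Bochner_Integration.integral_sum[symmetric]) (rule IZ)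
  also have "\<dots> \<le> (LINT \<eta>|lborel. weight t \<xi> \<tau> \<eta>)"
    using duh_kernel_free(2)[of \<tau> t \<xi>] \<tau>
    by (intro integral_mono Bochner_Integration.integrable_sum IZ pt) auto
  finally show ?thesis .
qed

lemma sol_lower:
  assumes x: "\<xi> \<in> target" and fin: "quad_total free \<xi> < \<infinity>"
  shows "exp (- (12 * t + 8) * \<nu>) / (16384 * (2 * pi) ^ 3) * (lam\<^sup>2 * real n) \<le> Im (sol 2 t \<xi>)"
proof -
  let ?J = "{a + 1..a + n}" and ?X = "\<lambda>\<tau>. indicator {0..t} \<tau> *\<^sub>R duh_kernel free 2 t \<xi> \<tau>"
  note b = targetD[OF x]
  have "free 2 t \<xi> = 0"
    using b freq_boxes_half_space[of \<xi> a n] by (auto simp: free_def data_def indicator_def)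
  then have "sol 2 t \<xi> = - duh free 2 t \<xi>"
    using sol_strip_3[of \<xi> 2 t] b by (simp add: step_def)
  moreover have I: "integrable lborel ?X" by (rule duh_integrable[OF free_joint_measurable fin t(2)])
  ultimately have S: "Im (sol 2 t \<xi>) = (LINT \<tau>|lborel. - Im (?X \<tau>))"
    unfolding duh_def by (simp only: uminus_complex.simps Bochner_Integration.integral_minus integral_Im[OF I])
  let ?k = "exp (- (12 * t) * \<nu>) * (lam\<^sup>2 / (2 * pi) ^ 3)"
  let ?f = "\<lambda>\<tau>. \<Sum>i\<in>?J. ?k * (exp (- 8 * \<nu>) * 4 ^ i / 16384) * indicator {0..inverse (4 ^ i :: real)} \<tau>"
  have pos: "0 \<le> lam\<^sup>2 / (2 * pi) ^ 3" by simp
  have le: "?f \<tau> \<le> - Im (?X \<tau>)" for \<tau>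
  proof (cases "\<tau> \<in> {0..t}")
    case True
    let ?s = "\<Sum>i\<in>?J. exp (- 8 * \<nu>) * 4 ^ i / 16384 * indicator {0..inverse (4 ^ i :: real)} \<tau>"
    have h: "exp (- (12 * t) * \<nu>) \<le> heat \<nu> (t - \<tau>) \<xi>"
    proof -
      have "(norm \<xi>)\<^sup>2 * (t - \<tau>) \<le> 12 * t" using target_norm(1)[OF x] True by (intro mult_mono) auto
      then have "\<nu> * ((norm \<xi>)\<^sup>2 * (t - \<tau>)) \<le> \<nu> * (12 * t)" using nu by (intro mult_left_mono) auto
      then show ?thesis unfolding heat_def by (simp add: mult_ac)
    qed
    have s0: "0 \<le> ?s" by (intro sum_nonneg) auto
    have "?f \<tau> = ?k * ?s" by (simp only: sum_distrib_left mult.assoc)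
    also have "\<dots> \<le> (heat \<nu> (t - \<tau>) \<xi> * (lam\<^sup>2 / (2 * pi) ^ 3)) * (LINT \<eta>|lborel. weight t \<xi> \<tau> \<eta>)"
      using weight_integral_lower[OF x True] h pos s0 by (intro mult_mono mult_right_mono) auto
    also have "\<dots> = - Im (?X \<tau>)"
      using duh_kernel_free(1)[of \<tau> t \<xi>] True by simp
    finally show ?thesis .
  next
    case False
    have "indicator {0..inverse (4 ^ i :: real)} \<tau> = (0::real)" if "i \<in> ?J" for i
    proof -
      have "inverse (4 ^ i) \<le> inverse ((4::real) ^ a)" using that by (intro le_imp_inverse_le power_increasing) auto
      then have "inverse (4 ^ i) \<le> t" using fast by linarith
      then show ?thesis using False by (auto simp: indicator_def)
    qed
    then have "?f \<tau> = 0" by (intro sum.neutral) auto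
    then show ?thesis using False by simp
  qed
  have Ii: "integrable lborel (\<lambda>\<tau>. ?k * (exp (- 8 * \<nu>) * 4 ^ i / 16384) * indicator {0..inverse (4 ^ i :: real)} \<tau> :: real)" for i :: nat
    by (intro integrable_mult_right integrable_real_indicator) auto
  have "exp (- (12 * t + 8) * \<nu>) / (16384 * (2 * pi) ^ 3) * (lam\<^sup>2 * real n) = (\<Sum>i\<in>?J. ?k * (exp (- 8 * \<nu>) / 16384))"
  proof -
    have "exp (- (12 * t + 8) * \<nu>) = exp (- (12 * t) * \<nu>) * exp (- 8 * \<nu>)" by (simp add: exp_add[symmetric] algebra_simps)
    then show ?thesis by simp
  qed
  also have "\<dots> = (\<Sum>i\<in>?J. LINT \<tau>|lborel. ?k * (exp (- 8 * \<nu>) * 4 ^ i / 16384) * indicator {0..inverse (4 ^ i :: real)} \<tau>)"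
    by (intro sum.cong refl) simp
  also have "\<dots> = (LINT \<tau>|lborel. ?f \<tau>)"
    by (rule Bochner_Integration.integral_sum[symmetric]) (rule Ii)
  also have "\<dots> \<le> (LINT \<tau>|lborel. - Im (?X \<tau>))"
    by (intro integral_mono Bochner_Integration.integrable_sum Ii le Bochner_Integration.integrable_minus integrable_Im I)
  finally show ?thesis unfolding S .
qed

end

end

lemma continuous_sinc: "continuous_on UNIV sinc" and continuous_cosc: "continuous_on UNIV cosc"
proof -
  have "isCont sinc y" "isCont cosc y" for y
    unfolding sinc_def[abs_def] cosc_def[abs_def]
    by (intro isCont_powser_converges_everywhere summable_norm_cancel[OF sinc_summable] summable_norm_cancel[OF cosc_summable])+
  then show "continuous_on UNIV sinc" "continuous_on UNIV cosc"
    by (simp_all add: continuous_on_eq_continuous_at)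
qed

lemma continuous_duhamel_symbol: "continuous_on UNIV (\<lambda>t. duhamel_symbol g \<Omega> N t \<xi> $ i $ j)"
proof -
  have c: "continuous_on UNIV (\<lambda>t. coriolis_symbol g \<Omega> N t \<xi> $ i $ k)" for k
    unfolding coriolis_symbol_def vector_add_component vector_minus_component vector_scaleR_component
    by (intro continuous_intros continuous_on_compose2[OF continuous_sinc] continuous_on_compose2[OF continuous_cosc]) auto
  then show ?thesis
    unfolding duhamel_symbol_def matrix_matrix_mult_def by (simp, intro continuous_on_sum continuous_on_mult_right c)
qed

lemma inflation_instance:
  assumes "\<nu> > 0" "T > 0" and g: "g > 0" and "lam \<ge> 0" and a: "1 \<le> a" and K: "K \<ge> 0"
    "\<And>t \<xi> i j. 0 \<le> t \<Longrightarrow> t \<le> T \<Longrightarrow> \<bar>duhamel_symbol g \<Omega> N t \<xi> $ i $ j - leray \<xi> $ i $ j\<bar> \<le> K * t"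
  shows "inflation \<nu> T (K * T + 3) g \<Omega> N lam a n"
proof unfold_locales
  show "0 < K * T + 3" using K(1) \<open>T > 0\<close> by (simp add: add_nonneg_pos)
  show "(\<lambda>p. duhamel_symbol g \<Omega> N (fst p) (snd p) $ k $ l) \<in> borel_measurable (borel \<Otimes>\<^sub>M borel)" for k l
    by measurable
  show "\<bar>duhamel_symbol g \<Omega> N s \<xi> $ k $ l\<bar> \<le> K * T + 3" if "0 \<le> s" "s \<le> T" for s \<xi> k l
    using K(2)[OF that, of \<xi> k l] leray_entry_bound[of \<xi> k l] mult_left_mono[OF that(2) K(1)] by linarith
  show "data lam a n g \<Omega> k \<xi> = 0" if "\<xi> $ 2 < 1" for k \<xi>
    using freq_boxes_half_space[of \<xi> a n] that by (auto simp: data_def indicator_def)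
qed (use assms data_integrable in \<open>auto intro: continuous_duhamel_symbol\<close>)

lemma bump:
  assumes lp: "littlewood_paley \<psi>"
  obtains f :: "real^3 \<Rightarrow> real" and B where "schwartz (\<lambda>\<xi>. of_real (f \<xi>))" "\<And>\<xi>. 0 \<le> f \<xi>" "\<And>\<xi>. f \<xi> \<le> B" "B > 0"
    "\<And>\<xi>. f \<xi> \<noteq> 0 \<Longrightarrow> \<xi> \<in> cube (\<lambda>i. if i = 1 then 0 else 9/4) (1/16)" "integrable lborel f" "0 < (LINT \<xi>|lborel. f \<xi>)"
proof -
  define p :: "real^3" where "p = (\<chi> i. if i = 1 then 0 else 9/4)"
  let ?h = "\<lambda>\<xi>. fourier \<psi> (48 *\<^sub>R \<xi> + (- 48 *\<^sub>R p))"
  define f where "f \<xi> = (cmod (?h \<xi>))\<^sup>2" for \<xi>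
  have f0: "0 \<le> f \<xi>" for \<xi> by (simp add: f_def)
  have S: "schwartz ?h" by (rule schwartz_affine[OF fourier_schwartz[OF psi_schwartz[OF lp]]]) simp
  have sup: "\<xi> \<in> cube (\<lambda>i. if i = 1 then 0 else 9/4) (1/16)" if "f \<xi> \<noteq> 0" for \<xi>
  proof -
    have "norm (48 *\<^sub>R (\<xi> - p)) \<le> 8/3"
      using psi_hat_supp[OF lp, of "48 *\<^sub>R \<xi> + (- 48 *\<^sub>R p)"] that by (simp add: f_def scaleR_diff_right)
    then have "norm (\<xi> - p) \<le> 1/16" by simp
    then have "\<bar>(\<xi> - p) $ i\<bar> \<le> 1/16" for i using component_le_norm_cart[of "\<xi> - p" i] by linarith
    then show ?thesis by (simp add: mem_cube p_def)
  qed
  have ff: "complex_of_real (f \<xi>) = ?h \<xi> * cnj (?h \<xi>)" for \<xi> 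
    using complex_norm_square[of "?h \<xi>"] by (simp only: f_def of_real_power)
  have sm: "smooth (\<lambda>\<xi>. complex_of_real (f \<xi>))"
    unfolding ff smooth_iff
    by (intro allI smooth_upto_mult smooth_upto_cnj open_UNIV) (use S in \<open>simp_all add: schwartz_def smooth_iff\<close>)
  have Sf: "schwartz (\<lambda>\<xi>. complex_of_real (f \<xi>))"
  proof (rule schwartz_compact_support[OF sm])
    show "norm \<xi> \<le> norm p + 1" if "complex_of_real (f \<xi>) \<noteq> 0" for \<xi>
    proof -
      have "norm (48 *\<^sub>R (\<xi> - p)) \<le> 8/3"
        using psi_hat_supp[OF lp, of "48 *\<^sub>R \<xi> + (- 48 *\<^sub>R p)"] that by (simp add: f_def scaleR_diff_right)
      then show ?thesis using norm_triangle_ineq2[of \<xi> p] by simp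
    qed
  qed
  have le: "f \<xi> \<le> (psi_bound \<psi>)\<^sup>2 + 1" for \<xi>
    using power_mono[OF lp_hat_le[OF lp, of 0 "48 *\<^sub>R \<xi> + (- 48 *\<^sub>R p)"], of 2] by (simp add: f_def lp_hat_def)
  have I: "integrable lborel f" using integrable_Re[OF schwartz_integrable[OF Sf]] by simp
  have c: "continuous_on UNIV f"
    using smooth_continuous[OF sm] continuous_on_Re by fastforce
  obtain \<zeta> where \<zeta>: "fourier \<psi> \<zeta> \<noteq> 0"
  proof (rule ccontr)
    assume "\<not> thesis"
    then have "fourier \<psi> \<zeta> = 0" for \<zeta> using that by blast
    then show False
      using lp_hat_has_sum[OF lp, of "axis 1 1"] has_sum_unique[OF has_sum_0, of UNIV "\<lambda>j. lp_hat \<psi> j (axis 1 1)" 1]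
      by (simp add: lp_hat_def axis_eq_0_iff)
  qed
  have "f ((1/48) *\<^sub>R \<zeta> + p) \<noteq> 0" using \<zeta> by (simp add: f_def scaleR_add_right)
  then have ne: "{\<xi>. f \<xi> \<noteq> 0} \<noteq> {}" by blast
  have op: "open {\<xi>. f \<xi> \<noteq> 0}"
    using open_vimage[OF _ c, of "- {0}"] by (simp add: vimage_def open_Compl)
  have "(LINT \<xi>|lborel. f \<xi>) \<noteq> 0"
  proof
    assume "(LINT \<xi>|lborel. f \<xi>) = 0"
    then have "AE \<xi> in lborel. f \<xi> = 0"
      using integral_nonneg_eq_0_iff_AE[OF I] f0 by simp
    then have "{\<xi>. f \<xi> \<noteq> 0} \<in> null_sets lborel"
      using AE_iff_null[of lborel "\<lambda>\<xi>. f \<xi> = 0"] borel_open[OF op] by simp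
    then show False
      using open_not_negligible[OF op ne] unfolding negligible_iff_null_sets by (blast dest: null_sets_completionI)
  qed
  moreover have "0 \<le> (LINT \<xi>|lborel. f \<xi>)" by (simp add: f_def)
  ultimately have "0 < (LINT \<xi>|lborel. f \<xi>)" by simp
  then show ?thesis using that[OF Sf _ le _ sup I] by (simp add: f_def add_nonneg_pos)
qed

lemma lp_hat_partition:
  assumes lp: "littlewood_paley \<psi>" and \<xi>: "1 \<le> norm \<xi>" "norm \<xi> \<le> 4"
  shows "(\<Sum>j\<in>{-2..3}. lp_hat \<psi> j \<xi>) = 1"
proof -
  have z: "lp_hat \<psi> j \<xi> = 0" if j: "j \<notin> {-2..3}" for j
  proof (rule ccontr)
    assume "lp_hat \<psi> j \<xi> \<noteq> 0"
    note b = lp_hat_supp[OF lp this]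
    consider "j \<le> -3" | "4 \<le> j" using j by fastforce
    then show False
    proof cases
      case 1
      then have "(2::real) powi j \<le> 2 powi (-3)" by (intro power_int_increasing) auto
      then show False using b \<xi> by (simp add: power_int_minus)
    next
      case 2
      then have "(2::real) powi 4 \<le> 2 powi j" by (intro power_int_increasing) auto
      then show False using b \<xi> by simp
    qed
  qed
  have "((\<lambda>j. lp_hat \<psi> j \<xi>) has_sum 1) {-2..3}"
    using lp_hat_has_sum[OF lp, of \<xi>] \<xi> z has_sum_cong_neutral[of "{-2..3}" UNIV "\<lambda>j. lp_hat \<psi> j \<xi>" "\<lambda>j. lp_hat \<psi> j \<xi>" 1] by fastforce
  then show ?thesis using has_sum_unique[OF has_sum_finite] by blast
qed

lemma fb_norm_pairing_annulus:
  assumes lp: "littlewood_paley \<psi>" and F: "admissible F" and f: "schwartz f"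
    and B: "\<And>x. cmod (f x) \<le> B" "B > 0" and r: "0 < r"
    and supp: "\<And>\<xi>. f \<xi> \<noteq> 0 \<Longrightarrow> 1 \<le> norm \<xi> \<and> norm \<xi> \<le> 4"
  shows "ennreal (cmod (LINT \<xi>|lborel. F \<xi> * f \<xi>)) \<le> ennreal (48 * B) * fb_norm \<psi> (-1) 1 r (freq_dist F)"
proof -
  let ?J = "{-2..3::int}" and ?I = "\<lambda>j. LINT \<xi>|lborel. F \<xi> * lp_hat \<psi> j \<xi> * f \<xi>" and ?n = "fb_norm \<psi> (-1) 1 r (freq_dist F)"
  have I: "integrable lborel (\<lambda>\<xi>. F \<xi> * lp_hat \<psi> j \<xi> * f \<xi>)" for j
    by (rule integrable_bounded_mult[OF admissible_schwartz_mult[OF F lp_hat_schwartz[OF lp]] _ B(1)])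
      (use schwartz_measurable[OF f] in simp)
  have "F \<xi> * f \<xi> = (\<Sum>j\<in>?J. F \<xi> * lp_hat \<psi> j \<xi> * f \<xi>)" for \<xi>
  proof (cases "f \<xi> = 0")
    case False
    then show ?thesis
      using lp_hat_partition[OF lp, of \<xi>] supp[of \<xi>] by (simp add: sum_distrib_left[symmetric] sum_distrib_right[symmetric])
  qed simp
  then have "(LINT \<xi>|lborel. F \<xi> * f \<xi>) = (LINT \<xi>|lborel. (\<Sum>j\<in>?J. F \<xi> * lp_hat \<psi> j \<xi> * f \<xi>))" by simp
  also have "\<dots> = (\<Sum>j\<in>?J. ?I j)" by (rule Bochner_Integration.integral_sum) (rule I)
  finally have L: "(LINT \<xi>|lborel. F \<xi> * f \<xi>) = (\<Sum>j\<in>?J. ?I j)" .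
  have "cmod (LINT \<xi>|lborel. F \<xi> * f \<xi>) \<le> (\<Sum>j\<in>?J. cmod (?I j))" unfolding L by (rule norm_sum)
  then have "ennreal (cmod (LINT \<xi>|lborel. F \<xi> * f \<xi>)) \<le> ennreal (\<Sum>j\<in>?J. cmod (?I j))" by (rule ennreal_leI)
  also have "\<dots> = (\<Sum>j\<in>?J. ennreal (cmod (?I j)))" by (rule sum_ennreal[symmetric]) simp
  also have "\<dots> \<le> (\<Sum>j\<in>?J. ennreal (B * 8) * ?n)"
  proof (rule sum_mono)
    fix j assume "j \<in> ?J"
    then have "(2::real) powi j \<le> 2 powi 3" by (intro power_int_increasing) auto
    then have "ennreal (B * 2 powi j) \<le> ennreal (B * 8)" using B(2) by (intro ennreal_leI mult_left_mono) auto
    then show "ennreal (cmod (?I j)) \<le> ennreal (B * 8) * ?n"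
      by (rule order_trans[OF fb_norm_pairing[OF lp F f B r, of j] mult_right_mono]) simp
  qed
  also have "\<dots> = of_nat 6 * (ennreal (B * 8) * ?n)" by (simp only: sum_constant) simp
  also have "\<dots> = ennreal (48 * B) * ?n"
  proof -
    have "of_nat 6 * ennreal (B * 8) = ennreal (48 * B)"
      using B(2) by (simp only: ennreal_of_nat_eq_real_of_nat) (subst ennreal_mult[symmetric], auto)
    then show ?thesis by (simp only: mult.assoc[symmetric])
  qed
  finally show ?thesis .
qed

context inflation
begin

lemma solution:
  assumes small: "16 * ((4 * C0)\<^sup>2 / (2 * \<nu>)) * (256 * lam\<^sup>2 * V\<^sup>2 * real n / \<nu>) \<le> 1"
    and lp: "littlewood_paley \<psi>" and r: "1 \<le> r"
  shows "Xnorm sol < \<infinity>" "cont_path \<psi> r T (\<lambda>t. \<chi> k. freq_dist (sol k t))"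
    "mild_solution \<psi> \<nu> g \<Omega> N T (\<chi> k. freq_dist (data lam a n g \<Omega> k)) (\<lambda>t. \<chi> k. freq_dist (sol k t))"
proof -
  have "Xnorm (iter m) \<le> ennreal (4 * (256 * lam\<^sup>2 * V\<^sup>2 * real n / \<nu>))" for m
    by (rule Xnorm_iter[OF Xnorm_free _ small]) (use nu in simp)
  then have "Xnorm sol \<le> ennreal (4 * (256 * lam\<^sup>2 * V\<^sup>2 * real n / \<nu>))" by (rule Xnorm_sol)
  then show fin: "Xnorm sol < \<infinity>" by (rule order_le_less_trans) simp
  show "cont_path \<psi> r T (\<lambda>t. \<chi> k. freq_dist (sol k t))" by (rule sol_cont_path[OF fin lp r])
  show "mild_solution \<psi> \<nu> g \<Omega> N T (\<chi> k. freq_dist (data lam a n g \<Omega> k)) (\<lambda>t. \<chi> k. freq_dist (sol k t))"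
    by (rule sol_mild[OF fin lp refl data_fixed]) (use g in auto)
qed

lemma sol_zero: assumes "lam = 0" shows "sol k t \<xi> = 0"
proof -
  have "iter m = (\<lambda>k t \<xi>. 0)" for m
  proof (induction m)
    case (Suc m)
    have "data lam a n g \<Omega> k \<xi> = 0" for k \<xi> by (simp add: data_def assms)
    then show ?case
      unfolding iter.simps Suc by (intro ext) (simp only: step_def free_def duh_def duh_kernel_def conv_def, simp)
  qed simp
  then show ?thesis by (simp add: sol_def)
qed

lemma solution_lower:
  assumes t: "0 < t" "t \<le> T"
    and near: "\<And>s \<xi> i j. 0 \<le> s \<Longrightarrow> s \<le> t \<Longrightarrow> \<bar>duhamel_symbol g \<Omega> N s \<xi> $ i $ j - leray \<xi> $ i $ j\<bar> \<le> 1/12"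
    and large: "30 * (1 + \<bar>\<Omega>\<bar> / g) \<le> 2 ^ a" and fast: "inverse (4 ^ a) \<le> t"
    and fin: "Xnorm sol < \<infinity>" and lp: "littlewood_paley \<psi>" and r: "0 < r"
    and f: "schwartz (\<lambda>\<xi>. of_real (f \<xi>))" "\<And>\<xi>. 0 \<le> f \<xi>" "\<And>\<xi>. f \<xi> \<le> B" "B > 0"
      "\<And>\<xi>. f \<xi> \<noteq> 0 \<Longrightarrow> \<xi> \<in> target" "integrable lborel f"
  shows "ennreal (exp (- (12 * t + 8) * \<nu>) / (16384 * (2 * pi) ^ 3) * (lam\<^sup>2 * real n) * (LINT \<xi>|lborel. f \<xi>))
    \<le> ennreal (48 * B) * fb_norm \<psi> (-1) 1 r (freq_dist (sol 2 t))"
proof -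
  let ?c = "exp (- (12 * t + 8) * \<nu>) / (16384 * (2 * pi) ^ 3) * (lam\<^sup>2 * real n)"
  have adm: "admissible (sol 2 t)" by (rule sol_admissible[OF fin]) (use t in auto)
  note [measurable] = quad_measurable[OF free_joint_measurable]
  have "quad_total free \<in> borel_measurable lborel" unfolding quad_total_def by measurable
  moreover have "(\<integral>\<^sup>+\<xi>. quad_total free \<xi> \<partial>lborel) \<noteq> \<infinity>"
    using Xnorm_free unfolding quad_total_integral[OF free_joint_measurable] by (auto simp: top_unique)
  ultimately have AE: "AE \<xi> in lborel. quad_total free \<xi> < \<infinity>"
    using nn_integral_PInf_AE[of "quad_total free" lborel] by (simp add: less_top)
  have I: "integrable lborel (\<lambda>\<xi>. sol 2 t \<xi> * of_real (f \<xi>))" by (rule admissible_schwartz_mult[OF adm f(1)])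
  have "?c * (LINT \<xi>|lborel. f \<xi>) = (LINT \<xi>|lborel. ?c * f \<xi>)" by simp
  also have "\<dots> \<le> (LINT \<xi>|lborel. Im (sol 2 t \<xi> * of_real (f \<xi>)))"
  proof (rule integral_mono_AE)
    show "integrable lborel (\<lambda>\<xi>. ?c * f \<xi>)" using f(6) by simp
    show "integrable lborel (\<lambda>\<xi>. Im (sol 2 t \<xi> * of_real (f \<xi>)))" by (rule integrable_Im[OF I])
    show "AE \<xi> in lborel. ?c * f \<xi> \<le> Im (sol 2 t \<xi> * of_real (f \<xi>))"
      using AE
    proof eventually_elim
      case (elim \<xi>)
      show ?case
      proof (cases "f \<xi> = 0")
        case False
        show ?thesis
          using mult_right_mono[OF sol_lower[OF t near large fast f(5)[OF False] elim] f(2)[of \<xi>]] by simp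
      qed simp
    qed
  qed
  also have "\<dots> = Im (LINT \<xi>|lborel. sol 2 t \<xi> * of_real (f \<xi>))" by (rule integral_Im[OF I])
  also have "\<dots> \<le> cmod (LINT \<xi>|lborel. sol 2 t \<xi> * of_real (f \<xi>))" by (rule abs_Im_le_cmod[THEN abs_le_D1])
  finally have "ennreal (?c * (LINT \<xi>|lborel. f \<xi>)) \<le> ennreal (cmod (LINT \<xi>|lborel. sol 2 t \<xi> * of_real (f \<xi>)))"
    by (rule ennreal_leI)
  also have "\<dots> \<le> ennreal (48 * B) * fb_norm \<psi> (-1) 1 r (freq_dist (sol 2 t))"
  proof (rule fb_norm_pairing_annulus[OF lp adm f(1) _ f(4) r])
    show "cmod (of_real (f \<xi>)) \<le> B" for \<xi> using f(2,3)[of \<xi>] by simp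
    show "1 \<le> norm \<xi> \<and> norm \<xi> \<le> 4" if "complex_of_real (f \<xi>) \<noteq> 0" for \<xi>
    proof
      have x: "\<xi> \<in> target" using that f(5) by simp
      show "1 \<le> norm \<xi>" using component_le_norm_cart[of \<xi> 2] targetD(2)[OF x] by linarith
      have "(norm \<xi>)\<^sup>2 \<le> 4\<^sup>2" using target_norm(1)[OF x] by simp
      then show "norm \<xi> \<le> 4" by (rule power2_le_imp_le) simp
    qed
  qed
  finally show ?thesis .
qed

end

lemma shifted_powr_over_sqrt_tendsto_0:
  fixes s :: real
  assumes "0 \<le> s" "s < 1/2"
  shows "(\<lambda>n. c * (real (n + 3) powr s / sqrt (real n))) \<longlonglongrightarrow> 0"
proof -
  have "(\<lambda>n. real (n + 3) powr s / sqrt (real n)) \<longlonglongrightarrow> 0"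
  proof (rule tendsto_sandwich[where f = "\<lambda>_. 0"])
    have "real (n + 3) powr s / sqrt (real n) \<le> 4 powr s * real n powr (s - 1/2)" if "1 \<le> n" for n
    proof -
      have "real (n + 3) powr s \<le> (4 * real n) powr s" using that assms by (intro powr_mono2) auto
      then have "real (n + 3) powr s / sqrt (real n) \<le> (4 * real n) powr s / sqrt (real n)" by (intro divide_right_mono) auto
      also have "\<dots> = 4 powr s * real n powr (s - 1/2)"
        using that by (simp add: powr_mult powr_diff powr_half_sqrt)
      finally show ?thesis .
    qed
    then show "\<forall>\<^sub>F n in sequentially. real (n + 3) powr s / sqrt (real n) \<le> 4 powr s * real n powr (s - 1/2)"
      by (rule eventually_sequentiallyI)
    have "(\<lambda>n. real n powr (s - 1/2)) \<longlonglongrightarrow> 0"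
      using assms by (intro tendsto_neg_powr filterlim_real_sequentially) auto
    from tendsto_mult_right_zero[OF this] show "(\<lambda>n. 4 powr s * real n powr (s - 1/2)) \<longlonglongrightarrow> 0" .
  qed auto
  from tendsto_mult_right_zero[OF this] show ?thesis .
qed

lemma fb_vec_norm_data:
  fixes r :: ennreal
  assumes lp: "littlewood_paley \<psi>" and a: "1 \<le> a" and g: "g > 0" and \<delta>: "\<delta> \<ge> 0" and r: "2 < r"
  shows "(\<lambda>n. fb_vec_norm \<psi> (-1) 1 r (\<chi> k. freq_dist (data (\<delta> / sqrt (real n)) a n g \<Omega> k))) \<longlonglongrightarrow> 0"
    and "(\<chi> k. freq_dist (data (\<delta> / sqrt (real n)) a n g \<Omega> k)) \<in> data_space \<psi> r"
proof -
  let ?W = "\<lambda>n. \<chi> k. freq_dist (data (\<delta> / sqrt (real n)) a n g \<Omega> k)"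
  define s where "s = (if r = \<infinity> then 0 else 1 / enn2real r)"
  define c where "c = 22 * (\<delta> * (2 + 2 * \<bar>\<Omega>\<bar> / g) * psi_bound \<psi>)"
  have s: "0 \<le> s \<and> s < 1/2"
  proof (cases "r = \<infinity>")
    case False
    then obtain p where p: "r = ennreal p" "0 \<le> p" by (cases r) auto
    have "ennreal 2 < ennreal p" using r p by simp
    then have "2 < p" by (simp add: ennreal_less_iff)
    then show ?thesis using p by (simp add: s_def divide_less_eq)
  qed (simp add: s_def)
  have r0: "0 < r" using r by (meson order_less_trans zero_less_numeral)
  have b: "fb_norm \<psi> (-1) 1 r (?W n $ k) \<le> ennreal (c * (real (n + 3) powr s / sqrt (real n)))" for n k
  proof -
    have eq: "22 * (\<delta> / sqrt (real n) * (2 + 2 * \<bar>\<Omega>\<bar> / g) * psi_bound \<psi>) * (if r = \<infinity> then 1 else real (n + 3) powr (1 / enn2real r))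
      = c * (real (n + 3) powr s / sqrt (real n))"
      by (simp add: c_def s_def)
    have "0 \<le> \<delta> / sqrt (real n)" using \<delta> by simp
    from data_fb_norm[OF lp a g this r0, of n \<Omega> k] show ?thesis unfolding eq vec_lambda_beta .
  qed
  let ?b = "\<lambda>n. ennreal (c * (real (n + 3) powr s / sqrt (real n)))"
  have "?b \<longlonglongrightarrow> ennreal 0"
    by (rule tendsto_ennrealI[OF shifted_powr_over_sqrt_tendsto_0]) (use s in auto)
  then have lim: "(\<lambda>n. \<Sum>k\<in>(UNIV::4 set). ?b n) \<longlonglongrightarrow> (\<Sum>k\<in>(UNIV::4 set). ennreal 0)"
    by (intro tendsto_sum)
  have le: "fb_vec_norm \<psi> (-1) 1 r (?W n) \<le> (\<Sum>k\<in>(UNIV::4 set). ?b n)" for n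
    unfolding fb_vec_norm_def by (rule sum_mono) (rule b)
  show "(\<lambda>n. fb_vec_norm \<psi> (-1) 1 r (?W n)) \<longlonglongrightarrow> 0"
    by (rule tendsto_sandwich[OF _ _ tendsto_const lim[unfolded ennreal_0 sum.neutral_const]]) (use le in \<open>simp_all only: eventually_True zero_le\<close>)
  have "fb_norm \<psi> (-1) 1 r (?W n $ k) < \<infinity>" for k
    using order_le_less_trans[OF b ennreal_less_top] by simp
  then show "?W n \<in> data_space \<psi> r"
    using data_divergence_free[OF a g] by (simp add: data_space_def fb_space_def)
qed

theorem theorem1p6:
  fixes \<psi> :: "real^3 \<Rightarrow> complex" and \<nu> g \<Omega> N T :: real and r :: ennreal
    and D :: "(tempered_h^4) set" and \<Phi> :: "tempered_h^4 \<Rightarrow> real \<Rightarrow> tempered_h^4"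
  assumes "littlewood_paley \<psi>"
    and "\<nu> > 0" and "g > 0" and "N \<ge> 0" and "T > 0" and "2 < r"
    and "D \<subseteq> data_space \<psi> r"
    and "\<exists>\<rho>>0. \<forall>W0\<in>data_space \<psi> r. fb_vec_norm \<psi> (-1) 1 r W0 < \<rho> \<longrightarrow> W0 \<in> D"
    and "is_solution_map \<psi> r \<nu> g \<Omega> N T D \<Phi>"
  shows "\<not> (\<forall>\<epsilon>>0. \<exists>\<delta>>0. \<forall>W0\<in>D. fb_vec_norm \<psi> (-1) 1 r W0 < \<delta> \<longrightarrow>
           (SUP t\<in>{0..T}. fb_vec_norm \<psi> (-1) 1 r (\<Phi> W0 t - \<Phi> 0 t)) < \<epsilon>)"
proof
  assume cont: "\<forall>\<epsilon>>0. \<exists>\<delta>>0. \<forall>W0\<in>D. fb_vec_norm \<psi> (-1) 1 r W0 < \<delta> \<longrightarrow>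
           (SUP t\<in>{0..T}. fb_vec_norm \<psi> (-1) 1 r (\<Phi> W0 t - \<Phi> 0 t)) < \<epsilon>"
  note lp = assms(1) and nu = assms(2) and g = assms(3) and T = assms(5)
  have r1: "1 \<le> r" and r0: "0 < r"
    using assms(6) by (meson order_less_imp_le order_less_trans one_less_numeral_iff semiring_norm(76) zero_less_numeral)+
  obtain \<rho> where \<rho>: "\<rho> > 0" "\<And>W0. W0 \<in> data_space \<psi> r \<Longrightarrow> fb_vec_norm \<psi> (-1) 1 r W0 < \<rho> \<Longrightarrow> W0 \<in> D"
    using assms(8) by blast
  have uniq: "V t = \<Phi> W0 t" if "W0 \<in> D" "cont_path \<psi> r T V" "mild_solution \<psi> \<nu> g \<Omega> N T W0 V" "t \<in> {0..T}" for V W0 t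
    using assms(9) that unfolding is_solution_map_def by blast
  obtain K where K: "K \<ge> 0" "\<And>t \<xi> i j. 0 \<le> t \<Longrightarrow> t \<le> T \<Longrightarrow> \<bar>duhamel_symbol g \<Omega> N t \<xi> $ i $ j - leray \<xi> $ i $ j\<bar> \<le> K * t"
    using coriolis_near_identity[of g T \<Omega> N] g by (metis less_imp_le)
  define C0 where "C0 = K * T + 3"
  define t0 where "t0 = min T (1 / (12 * (K + 1)))"
  have t0: "0 < t0" "t0 \<le> T" using T K(1) by (auto simp: t0_def)
  have near: "\<bar>duhamel_symbol g \<Omega> N s \<xi> $ i $ j - leray \<xi> $ i $ j\<bar> \<le> 1/12" if s: "0 \<le> s" "s \<le> t0" for s \<xi> i j
  proof -
    have "s * (12 * (K + 1)) \<le> 1" using s K(1) by (simp add: t0_def le_divide_eq)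
    then have "K * s \<le> 1/12" using s(1) by (simp add: algebra_simps)
    then show ?thesis using K(2)[of s \<xi> i j] s t0(2) by linarith
  qed
  obtain a :: nat where a: "1 \<le> a" "30 * (1 + \<bar>\<Omega>\<bar> / g) \<le> 2 ^ a" "inverse (4 ^ a) \<le> t0"
  proof -
    have "\<exists>m. max (30 * (1 + \<bar>\<Omega>\<bar> / g)) (1 / t0) < 2 ^ m" by (rule real_arch_pow) simp
    then obtain m where "max (30 * (1 + \<bar>\<Omega>\<bar> / g)) (1 / t0) < 2 ^ m" by blast
    then have m: "30 * (1 + \<bar>\<Omega>\<bar> / g) < 2 ^ m" "1 / t0 < 2 ^ m" by (simp_all only: max_less_iff_conj)
    have le: "(2::real) ^ m \<le> 2 ^ Suc m" "(2::real) ^ m \<le> 4 ^ Suc m"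
    proof -
      show "(2::real) ^ m \<le> 2 ^ Suc m" by simp
      have "(2::real) ^ m \<le> 4 ^ m" by (intro power_mono) auto
      also have "\<dots> \<le> 4 ^ Suc m" by (intro power_increasing) auto
      finally show "(2::real) ^ m \<le> 4 ^ Suc m" .
    qed
    have "1 / t0 \<le> 4 ^ Suc m" using m(2) le(2) by linarith
    then have "inverse (4 ^ Suc m) \<le> t0" using t0(1) by (simp add: field_simps)
    then show ?thesis using that[of "Suc m"] order_trans[OF less_imp_le[OF m(1)] le(1)] by simp
  qed
  define V where "V = 2 + 2 * \<bar>\<Omega>\<bar> / g"
  define M where "M = 16 * ((4 * C0)\<^sup>2 / (2 * \<nu>)) * (256 * V\<^sup>2 / \<nu>)"
  define \<delta>0 where "\<delta>0 = 1 / sqrt (M + 1)"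
  have M: "0 \<le> M" using nu by (simp add: M_def)
  have \<delta>0: "0 < \<delta>0" "M * \<delta>0\<^sup>2 \<le> 1" using M by (auto simp: \<delta>0_def power_divide divide_le_eq)
  let ?lam = "\<lambda>n. \<delta>0 / sqrt (real n)"
  let ?W = "\<lambda>n. \<chi> k. freq_dist (data (?lam n) a n g \<Omega> k)"
  have lam: "(?lam n)\<^sup>2 * real n = \<delta>0\<^sup>2" if "1 \<le> n" for n using that by (simp add: power_divide)
  have small: "16 * ((4 * C0)\<^sup>2 / (2 * \<nu>)) * (256 * (?lam n)\<^sup>2 * V\<^sup>2 * real n / \<nu>) \<le> 1" if "1 \<le> n" for n
  proof -
    have "16 * ((4 * C0)\<^sup>2 / (2 * \<nu>)) * (256 * (?lam n)\<^sup>2 * V\<^sup>2 * real n / \<nu>) = M * ((?lam n)\<^sup>2 * real n)"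
      by (simp add: M_def)
    then show ?thesis using \<delta>0(2) lam[OF that] by simp
  qed
  have inst: "inflation \<nu> T C0 g \<Omega> N l a n" if "0 \<le> l" for l n
    unfolding C0_def by (rule inflation_instance[OF nu T g that a(1) K])
  have zero: "\<Phi> 0 t = 0" if t: "t \<in> {0..T}" for t
  proof -
    interpret Z: inflation \<nu> T C0 g \<Omega> N 0 a 0 by (rule inst) simp
    have "data 0 a 0 g \<Omega> k = (\<lambda>_. 0)" for k by (rule ext) (simp add: data_def)
    then have d0: "(\<chi> k. freq_dist (data 0 a 0 g \<Omega> k)) = 0"
      by (simp add: vec_eq_iff freq_dist_zero)
    have "(0 :: tempered_h^4) \<in> data_space \<psi> r" using fb_vec_norm_data(2)[OF lp a(1) g order_refl assms(6), of 0 \<Omega>] d0 by simp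
    moreover have "fb_vec_norm \<psi> (-1) 1 r 0 < \<rho>" using \<rho>(1) by (simp add: fb_vec_norm_def fb_norm_zero[OF lp r1])
    ultimately have D: "0 \<in> D" by (rule \<rho>(2))
    have "(\<chi> k. freq_dist (Z.sol k t)) = \<Phi> 0 t"
      using Z.solution(2,3)[OF _ lp r1] d0 by (intro uniq[OF D _ _ t]) auto
    moreover have "Z.sol k t = (\<lambda>_. 0)" for k using Z.sol_zero by auto
    ultimately show ?thesis by (simp add: vec_eq_iff freq_dist_zero)
  qed
  obtain f B where f: "schwartz (\<lambda>\<xi>. of_real (f \<xi>))" "\<And>\<xi>. 0 \<le> f \<xi>" "\<And>\<xi>. f \<xi> \<le> B" "B > 0"
    "\<And>\<xi>. f \<xi> \<noteq> 0 \<Longrightarrow> \<xi> \<in> cube (\<lambda>i. if i = 1 then 0 else 9/4) (1/16)" "integrable lborel f" "0 < (LINT \<xi>|lborel. f \<xi>)"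
    using bump[OF lp] by blast
  define c where "c = exp (- (12 * t0 + 8) * \<nu>) / (16384 * (2 * pi) ^ 3) * \<delta>0\<^sup>2 * (LINT \<xi>|lborel. f \<xi>)"
  have c: "0 < c" using \<delta>0(1) f(7) by (simp add: c_def)
  define \<epsilon> where "\<epsilon> = ennreal (c / (48 * B))"
  have "0 < \<epsilon>" using c f(4) by (simp add: \<epsilon>_def)
  then obtain \<delta> where \<delta>: "\<delta> > 0" "\<And>W0. W0 \<in> D \<Longrightarrow> fb_vec_norm \<psi> (-1) 1 r W0 < \<delta> \<Longrightarrow>
           (SUP t\<in>{0..T}. fb_vec_norm \<psi> (-1) 1 r (\<Phi> W0 t - \<Phi> 0 t)) < \<epsilon>"
    using cont by blast
  have "0 < min \<delta> \<rho>" using \<delta>(1) \<rho>(1) by simp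
  from order_tendstoD(2)[OF fb_vec_norm_data(1)[OF lp a(1) g less_imp_le[OF \<delta>0(1)] assms(6), of \<Omega>] this]
  obtain n0 where "\<forall>n\<ge>n0. fb_vec_norm \<psi> (-1) 1 r (?W n) < min \<delta> \<rho>"
    unfolding eventually_sequentially by (elim exE)
  then have n: "1 \<le> max 1 n0" "fb_vec_norm \<psi> (-1) 1 r (?W (max 1 n0)) < min \<delta> \<rho>"
    by (simp, elim allE[of _ "max 1 n0"] impE) (rule max.cobounded2)
  define n where "n = max 1 n0"
  note n = n[folded n_def]
  interpret S: inflation \<nu> T C0 g \<Omega> N "?lam n" a n by (rule inst) (use \<delta>0(1) in simp)
  note sol = S.solution[OF small[OF n(1), unfolded V_def] lp r1]
  have D: "?W n \<in> D"
    using n(2) by (intro \<rho>(2) fb_vec_norm_data(2)[OF lp a(1) g less_imp_le[OF \<delta>0(1)] assms(6)]) simp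
  have E: "(\<chi> k. freq_dist (S.sol k t0)) = \<Phi> (?W n) t0"
    by (rule uniq[OF D sol(2,3)]) (use t0 in simp)
  have \<Phi>: "\<Phi> (?W n) t0 $ 2 = freq_dist (S.sol 2 t0)"
    unfolding E[symmetric] vec_lambda_beta by (rule refl)
  have "ennreal c \<le> ennreal (48 * B) * fb_norm \<psi> (-1) 1 r (freq_dist (S.sol 2 t0))"
    using S.solution_lower[OF t0 near a(2,3) sol(1) lp r0 f(1-6)] unfolding lam[OF n(1)] c_def .
  also have "\<dots> \<le> ennreal (48 * B) * fb_vec_norm \<psi> (-1) 1 r (\<Phi> (?W n) t0 - \<Phi> 0 t0)"
  proof (rule mult_left_mono)
    show "fb_norm \<psi> (-1) 1 r (freq_dist (S.sol 2 t0)) \<le> fb_vec_norm \<psi> (-1) 1 r (\<Phi> (?W n) t0 - \<Phi> 0 t0)"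
      using zero[of t0] t0 member_le_sum[of 2 "UNIV :: 4 set" "\<lambda>k. fb_norm \<psi> (-1) 1 r (\<Phi> (?W n) t0 $ k)"]
      by (simp add: fb_vec_norm_def \<Phi>)
  qed simp
  also have "\<dots> < ennreal (48 * B) * \<epsilon>"
  proof -
    have "fb_vec_norm \<psi> (-1) 1 r (\<Phi> (?W n) t0 - \<Phi> 0 t0) \<le> (SUP t\<in>{0..T}. fb_vec_norm \<psi> (-1) 1 r (\<Phi> (?W n) t - \<Phi> 0 t))"
      using t0 by (intro SUP_upper) auto
    also have "\<dots> < \<epsilon>" using \<delta>(2)[OF D] n(2) by simp
    finally show ?thesis using f(4) by (intro ennreal_mult_strict_left_mono) auto
  qed
  also have "ennreal (48 * B) * \<epsilon> = ennreal c"
    using f(4) c by (simp add: \<epsilon>_def ennreal_mult[symmetric])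
  finally show False by simp
qed

end
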